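(* For any strongly regular $X$ in $\widehat{\Delta}$ and $n\in\mathbb{N}$, $\dim X \leq n$ if, and only if, $\mathrm{IBD}_n$ holds in $\acute{\mathrm{E}} X$.
   Context: $\mathbb{N}$ includes $0$. $\Delta$ is the category of ordered sets $[n]=\{0<\dots<n\}$, $n\in\mathbb{N}$, and monotone maps; $\widehat{\Delta}$ is the topos of simplicial sets (presheaves on $\Delta$). For $X$ in $\widehat{\Delta}$, $\Delta/X$ denotes the category of elements of $X$: objects are pairs $(x,C)$ with $C$ in $\Delta$ and $x\in XC$, and maps $(x,C)\to (y,D)$ are maps $f:C\to D$ with $y\cdot f=x$. One has $\widehat{\Delta}/X \cong \widehat{\Delta/X}$. An object of a category is minimal if every map with that object as domain is monic. $X$ is strongly regular if, for every monic map in $\Delta/X$ with minimal codomain, the domain is also minimal. Dimension: for $n\in\mathbb{N}$, let $\Delta_n\to\Delta$ be the full subcategory of the objects $[m]$ with $m\le n$. The $n$-skeleton $\mathrm{Sk}_nX\to X$ is the subobject such that $(\mathrm{Sk}_nX)D$ consists of those $x\in XD$ of the form $x=y\cdot f$ for some $f:D\to E$ in $\Delta$ that factors through an object of $\Delta_n$ and some $y\in XE$. $\dim X\le n$ means that $\mathrm{Sk}_nX\to X$ is an isomorphism (this is the usual notion of $n$-skeletal simplicial set). Level é: A subtopos $l:\mathcal{L}\to\mathcal{E}$ is a level (essential) if the inverse image $l^*$ has a left adjoint $l_!$; levels are ordered by factorization of inclusions. A geometric morphism $f:\mathcal{F}\to\mathcal{S}$ is localic if every object of $\mathcal{F}$ is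 a subquotient of one of the form $f^*A$ with $A$ in $\mathcal{S}$. A geometric morphism $g:\mathcal{G}\to\mathcal{S}$ is an étendue if there is a well-supported object $G$ in $\mathcal{G}$ (i.e. $G\to 1$ is epi) such that the composite $\mathcal{G}/G\to\mathcal{G}\to\mathcal{S}$ is localic. A geometric morphism $f:\mathcal{F}\to\mathcal{S}$ has a level é if $\mathcal{F}$ has a largest level $\mathcal{L}\to\mathcal{F}$ such that $\mathcal{L}\to\mathcal{F}\to\mathcal{S}$ is an étendue; that largest level is then called level é. For $X$ in $\widehat{\Delta}$, $\acute{\mathrm{E}}X\to\widehat{\Delta}/X$ denotes level é of the composite $\widehat{\Delta}/X\to\widehat{\Delta}\to\mathbf{Set}$. (It exists for every $X$ and coincides with the level $\widehat{(\Delta/X)^{\ast}}\to\widehat{\Delta/X}\cong\widehat{\Delta}/X$ induced by the full subcategory $(\Delta/X)^{\ast}\to\Delta/X$ of minimal objects.) In the internal language of a topos with subobject classifier $\Omega$, define the closed formulas $\mathrm{IBD}_{-\infty} := \bot$, $\mathrm{IBD}_0 := (\forall x:\Omega)(x \vee (x\Rightarrow \mathrm{IBD}_{-\infty}))$, and $\mathrm{IBD}_{n+1} := (\forall x:\Omega)(x \vee (x \Rightarrow \mathrm{IBD}_n))$ for $n\in\mathbb{N}$. Each is interpreted as a subterminal object; $\mathrm{IBD}_n$ holds in the topos if this subterminal is the terminal object. *)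

theory Defs
  imports "HOL-Library.FuncSet"
begin

unbundle cardinal_syntax

text \<open>
  Categories are single-sorted records. Composition is written in applicative order:
  \<open>g \<cdot> f\<close> is \<open>f\<close> followed by \<open>g\<close>.
\<close>

record ('o, 'a) cat =
  Ob :: "'o set"
  Arr :: "'a set"
  Dom :: "'a \<Rightarrow> 'o"
  Cod :: "'a \<Rightarrow> 'o"
  Idt :: "'o \<Rightarrow> 'a"
  Comp :: "'a \<Rightarrow> 'a \<Rightarrow> 'a"  (infixl "\<cdot>\<index>" 70)

definition hom :: "('o, 'a) cat \<Rightarrow> 'o \<Rightarrow> 'o \<Rightarrow> 'a set" where
  "hom C A B = {f \<in> Arr C. Dom C f = A \<and> Cod C f = B}"

definition op_cat :: "('o, 'a) cat \<Rightarrow> ('o, 'a) cat" where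
  "op_cat C = C\<lparr>Dom := Cod C, Cod := Dom C, Comp := (\<lambda>g f. f \<cdot>\<^bsub>C\<^esub> g)\<rparr>"

definition full_subcat :: "('o, 'a) cat \<Rightarrow> 'o set \<Rightarrow> ('o, 'a) cat" where
  "full_subcat C L = C\<lparr>Ob := L, Arr := {f \<in> Arr C. Dom C f \<in> L \<and> Cod C f \<in> L}\<rparr>"

definition slice :: "('o, 'a) cat \<Rightarrow> 'o \<Rightarrow> ('a, 'a \<times> 'a \<times> 'a) cat" where
  "slice C X = \<lparr>
     Ob = {p \<in> Arr C. Cod C p = X},
     Arr = {(p, f, q). p \<in> Arr C \<and> q \<in> Arr C \<and> Cod C p = X \<and> Cod C q = X \<and>
                       f \<in> hom C (Dom C p) (Dom C q) \<and> q \<cdot>\<^bsub>C\<^esub> f = p},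
     Dom = (\<lambda>(p, f, q). p),
     Cod = (\<lambda>(p, f, q). q),
     Idt = (\<lambda>p. (p, Idt C (Dom C p), p)),
     Comp = (\<lambda>(q', g, s) (p, f, q). (p, g \<cdot>\<^bsub>C\<^esub> f, s))\<rparr>"

definition is_iso :: "('o, 'a) cat \<Rightarrow> 'a \<Rightarrow> bool" where
  "is_iso C f \<longleftrightarrow> f \<in> Arr C \<and> (\<exists>g \<in> hom C (Cod C f) (Dom C f).
     g \<cdot>\<^bsub>C\<^esub> f = Idt C (Dom C f) \<and> f \<cdot>\<^bsub>C\<^esub> g = Idt C (Cod C f))"

definition monic :: "('o, 'a) cat \<Rightarrow> 'a \<Rightarrow> bool" where
  "monic C m \<longleftrightarrow> m \<in> Arr C \<and> (\<forall>A \<in> Ob C. \<forall>f \<in> hom C A (Dom C m). \<forall>g \<in> hom C A (Dom C m).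
     m \<cdot>\<^bsub>C\<^esub> f = m \<cdot>\<^bsub>C\<^esub> g \<longrightarrow> f = g)"

definition epic :: "('o, 'a) cat \<Rightarrow> 'a \<Rightarrow> bool" where
  "epic C e \<longleftrightarrow> e \<in> Arr C \<and> (\<forall>A \<in> Ob C. \<forall>f \<in> hom C (Cod C e) A. \<forall>g \<in> hom C (Cod C e) A.
     f \<cdot>\<^bsub>C\<^esub> e = g \<cdot>\<^bsub>C\<^esub> e \<longrightarrow> f = g)"

definition terminal :: "('o, 'a) cat \<Rightarrow> 'o \<Rightarrow> bool" where
  "terminal C T \<longleftrightarrow> T \<in> Ob C \<and> (\<forall>A \<in> Ob C. \<exists>!f. f \<in> hom C A T)"

text \<open>\<open>is_pullback C f g p q\<close>: the square \<open>f \<cdot> p = g \<cdot> q\<close> is a pullback of the cospan \<open>f, g\<close>.\<close>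

definition is_pullback :: "('o, 'a) cat \<Rightarrow> 'a \<Rightarrow> 'a \<Rightarrow> 'a \<Rightarrow> 'a \<Rightarrow> bool" where
  "is_pullback C f g p q \<longleftrightarrow>
     f \<in> Arr C \<and> g \<in> Arr C \<and> Cod C f = Cod C g \<and>
     p \<in> hom C (Dom C p) (Dom C f) \<and> q \<in> hom C (Dom C p) (Dom C g) \<and>
     f \<cdot>\<^bsub>C\<^esub> p = g \<cdot>\<^bsub>C\<^esub> q \<and>
     (\<forall>A \<in> Ob C. \<forall>a \<in> hom C A (Dom C f). \<forall>b \<in> hom C A (Dom C g).
        f \<cdot>\<^bsub>C\<^esub> a = g \<cdot>\<^bsub>C\<^esub> b \<longrightarrow>
        (\<exists>!h. h \<in> hom C A (Dom C p) \<and> p \<cdot>\<^bsub>C\<^esub> h = a \<and> q \<cdot>\<^bsub>C\<^esub> h = b))"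


section \<open>Functors and adjunctions\<close>

record ('o, 'a, 'p, 'b) func =
  on_ob :: "'o \<Rightarrow> 'p"
  on_arr :: "'a \<Rightarrow> 'b"

definition is_functor ::
    "('o, 'a) cat \<Rightarrow> ('p, 'b) cat \<Rightarrow> ('o, 'a, 'p, 'b) func \<Rightarrow> bool" where
  "is_functor C D F \<longleftrightarrow>
     (\<forall>A \<in> Ob C. on_ob F A \<in> Ob D \<and> on_arr F (Idt C A) = Idt D (on_ob F A)) \<and>
     (\<forall>f \<in> Arr C. on_arr F f \<in> hom D (on_ob F (Dom C f)) (on_ob F (Cod C f))) \<and>
     (\<forall>f \<in> Arr C. \<forall>g \<in> Arr C. Dom C g = Cod C f \<longrightarrow>
        on_arr F (g \<cdot>\<^bsub>C\<^esub> f) = on_arr F g \<cdot>\<^bsub>D\<^esub> on_arr F f)"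

definition comp_func ::
    "('p, 'b, 'q, 'c) func \<Rightarrow> ('o, 'a, 'p, 'b) func \<Rightarrow> ('o, 'a, 'q, 'c) func" where
  "comp_func G F = \<lparr>on_ob = on_ob G \<circ> on_ob F, on_arr = on_arr G \<circ> on_arr F\<rparr>"

definition inclusion :: "('o, 'a, 'o, 'a) func" where
  "inclusion = \<lparr>on_ob = id, on_arr = id\<rparr>"

text \<open>\<open>adjoint C D F G\<close>: the functor \<open>F : C \<rightarrow> D\<close> is left adjoint to \<open>G : D \<rightarrow> C\<close>.\<close>

definition adjoint :: "('o, 'a) cat \<Rightarrow> ('p, 'b) cat \<Rightarrow>
    ('o, 'a, 'p, 'b) func \<Rightarrow> ('p, 'b, 'o, 'a) func \<Rightarrow> bool" where
  "adjoint C D F G \<longleftrightarrow> is_functor C D F \<and> is_functor D C G \<and>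
     (\<exists>\<eta>. (\<forall>A \<in> Ob C. \<eta> A \<in> hom C A (on_ob G (on_ob F A))) \<and>
          (\<forall>f \<in> Arr C. on_arr G (on_arr F f) \<cdot>\<^bsub>C\<^esub> \<eta> (Dom C f) = \<eta> (Cod C f) \<cdot>\<^bsub>C\<^esub> f) \<and>
          (\<forall>A \<in> Ob C. \<forall>B \<in> Ob D. \<forall>f \<in> hom C A (on_ob G B).
             \<exists>!g. g \<in> hom D (on_ob F A) B \<and> on_arr G g \<cdot>\<^bsub>C\<^esub> \<eta> A = f))"

text \<open>Preservation of terminal objects and pullbacks amounts to preservation of finite limits.\<close>

definition left_exact ::
    "('o, 'a) cat \<Rightarrow> ('p, 'b) cat \<Rightarrow> ('o, 'a, 'p, 'b) func \<Rightarrow> bool" where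
  "left_exact C D F \<longleftrightarrow> is_functor C D F \<and>
     (\<forall>T. terminal C T \<longrightarrow> terminal D (on_ob F T)) \<and>
     (\<forall>f g p q. is_pullback C f g p q \<longrightarrow>
        is_pullback D (on_arr F f) (on_arr F g) (on_arr F p) (on_arr F q))"

definition forget :: "('o, 'a) cat \<Rightarrow> ('a, 'a \<times> 'a \<times> 'a, 'o, 'a) func" where
  "forget C = \<lparr>on_ob = Dom C, on_arr = (\<lambda>(p, f, q). f)\<rparr>"

text \<open>The functor \<open>A \<mapsto> (A \<times> X \<rightarrow> X)\<close>, that is, the inverse image of the
  geometric morphism \<open>C/X \<rightarrow> C\<close>.\<close>

definition base_change :: "('o, 'a) cat \<Rightarrow> 'o \<Rightarrow> ('o, 'a, 'a, 'a \<times> 'a \<times> 'a) func" where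
  "base_change C X = (SOME k. adjoint (slice C X) C (forget C) k)"


section \<open>Levels and level e-acute\<close>

text \<open>\<open>geometric_morphism F S i d\<close>: a geometric morphism \<open>F \<rightarrow> S\<close> with inverse image
  \<open>i : S \<rightarrow> F\<close> and direct image \<open>d : F \<rightarrow> S\<close>.\<close>

definition geometric_morphism :: "('o, 'a) cat \<Rightarrow> ('p, 'b) cat \<Rightarrow>
    ('p, 'b, 'o, 'a) func \<Rightarrow> ('o, 'a, 'p, 'b) func \<Rightarrow> bool" where
  "geometric_morphism F S i d \<longleftrightarrow> left_exact S F i \<and> adjoint S F i d"

text \<open>
  Up to equivalence, a subtopos of \<open>E\<close> is a full replete subcategory whose inclusion is the
  direct image of a geometric morphism; for replete subcategories the factorization order is
  inclusion of the sets of objects.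
\<close>

definition replete :: "('o, 'a) cat \<Rightarrow> 'o set \<Rightarrow> bool" where
  "replete E L \<longleftrightarrow> L \<subseteq> Ob E \<and> (\<forall>f. is_iso E f \<and> Dom E f \<in> L \<longrightarrow> Cod E f \<in> L)"

definition subtopos :: "('o, 'a) cat \<Rightarrow> 'o set \<Rightarrow> bool" where
  "subtopos E L \<longleftrightarrow> replete E L \<and> (\<exists>a. geometric_morphism (full_subcat E L) E a inclusion)"

definition inverse_image :: "('o, 'a) cat \<Rightarrow> 'o set \<Rightarrow> ('o, 'a, 'o, 'a) func" where
  "inverse_image E L = (SOME a. geometric_morphism (full_subcat E L) E a inclusion)"

definition level :: "('o, 'a) cat \<Rightarrow> 'o set \<Rightarrow> bool" where
  "level E L \<longleftrightarrow> subtopos E L \<and> (\<exists>l. adjoint (full_subcat E L) E l (inverse_image E L))"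

text \<open>
  A geometric morphism to the base \<open>S\<close> enters the next notions only through its inverse
  image functor, which is the argument \<open>i\<close>.
\<close>

definition subquotient :: "('o, 'a) cat \<Rightarrow> 'o \<Rightarrow> 'o \<Rightarrow> bool" where
  "subquotient C B A \<longleftrightarrow>
     (\<exists>m e. monic C m \<and> Cod C m = A \<and> epic C e \<and> Dom C e = Dom C m \<and> Cod C e = B)"

definition localic :: "('o, 'a) cat \<Rightarrow> ('p, 'b) cat \<Rightarrow> ('p, 'b, 'o, 'a) func \<Rightarrow> bool" where
  "localic F S i \<longleftrightarrow> (\<forall>B \<in> Ob F. \<exists>A \<in> Ob S. subquotient F B (on_ob i A))"

definition well_supported :: "('o, 'a) cat \<Rightarrow> 'o \<Rightarrow> bool" where
  "well_supported C G \<longleftrightarrow> G \<in> Ob C \<and> (\<exists>e. epic C e \<and> Dom C e = G \<and> terminal C (Cod C e))"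

definition etendue :: "('o, 'a) cat \<Rightarrow> ('p, 'b) cat \<Rightarrow> ('p, 'b, 'o, 'a) func \<Rightarrow> bool" where
  "etendue F S i \<longleftrightarrow>
     (\<exists>G. well_supported F G \<and> localic (slice F G) S (comp_func (base_change F G) i))"

definition etendue_level ::
    "('o, 'a) cat \<Rightarrow> ('p, 'b) cat \<Rightarrow> ('p, 'b, 'o, 'a) func \<Rightarrow> 'o set \<Rightarrow> bool" where
  "etendue_level F S i L \<longleftrightarrow>
     level F L \<and> etendue (full_subcat F L) S (comp_func (inverse_image F L) i)"

definition level_e ::
    "('o, 'a) cat \<Rightarrow> ('p, 'b) cat \<Rightarrow> ('p, 'b, 'o, 'a) func \<Rightarrow> 'o set" where
  "level_e F S i =
     (THE L. etendue_level F S i L \<and> (\<forall>L'. etendue_level F S i L' \<longrightarrow> L' \<subseteq> L))"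


section \<open>The formulas IBD in the internal language\<close>

definition sub :: "('o, 'a) cat \<Rightarrow> 'o \<Rightarrow> 'a set" where
  "sub C A = {m. monic C m \<and> Cod C m = A}"

definition sub_le :: "('o, 'a) cat \<Rightarrow> 'a \<Rightarrow> 'a \<Rightarrow> bool" where
  "sub_le C m m' \<longleftrightarrow> (\<exists>k \<in> hom C (Dom C m) (Dom C m'). m' \<cdot>\<^bsub>C\<^esub> k = m)"

definition sub_bot :: "('o, 'a) cat \<Rightarrow> 'o \<Rightarrow> 'a \<Rightarrow> bool" where
  "sub_bot C A b \<longleftrightarrow> b \<in> sub C A \<and> (\<forall>m \<in> sub C A. sub_le C b m)"

definition sub_meet :: "('o, 'a) cat \<Rightarrow> 'o \<Rightarrow> 'a \<Rightarrow> 'a \<Rightarrow> 'a \<Rightarrow> bool" where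
  "sub_meet C A m m' k \<longleftrightarrow> k \<in> sub C A \<and>
     (\<forall>h \<in> sub C A. sub_le C h k \<longleftrightarrow> sub_le C h m \<and> sub_le C h m')"

definition sub_join :: "('o, 'a) cat \<Rightarrow> 'o \<Rightarrow> 'a \<Rightarrow> 'a \<Rightarrow> 'a \<Rightarrow> bool" where
  "sub_join C A m m' j \<longleftrightarrow> j \<in> sub C A \<and>
     (\<forall>h \<in> sub C A. sub_le C j h \<longleftrightarrow> sub_le C m h \<and> sub_le C m' h)"

definition sub_imp :: "('o, 'a) cat \<Rightarrow> 'o \<Rightarrow> 'a \<Rightarrow> 'a \<Rightarrow> 'a \<Rightarrow> bool" where
  "sub_imp C A m m' i \<longleftrightarrow> i \<in> sub C A \<and>
     (\<forall>h \<in> sub C A. sub_le C h i \<longleftrightarrow> (\<forall>k. sub_meet C A h m k \<longrightarrow> sub_le C k m'))"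

definition sub_pull :: "('o, 'a) cat \<Rightarrow> 'a \<Rightarrow> 'a \<Rightarrow> 'a \<Rightarrow> bool" where
  "sub_pull C f m p \<longleftrightarrow> (\<exists>q. is_pullback C f m p q)"

text \<open>\<open>v\<close> is the value at \<open>m\<close> of the right adjoint to pulling back subobjects along \<open>f\<close>.\<close>

definition sub_forall :: "('o, 'a) cat \<Rightarrow> 'a \<Rightarrow> 'a \<Rightarrow> 'a \<Rightarrow> bool" where
  "sub_forall C f m v \<longleftrightarrow> v \<in> sub C (Cod C f) \<and>
     (\<forall>h \<in> sub C (Cod C f). sub_le C h v \<longleftrightarrow> (\<forall>p. sub_pull C f h p \<longrightarrow> sub_le C p m))"

definition subobject_classifier :: "('o, 'a) cat \<Rightarrow> 'a \<Rightarrow> bool" where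
  "subobject_classifier C t \<longleftrightarrow> t \<in> Arr C \<and> terminal C (Dom C t) \<and>
     (\<forall>m. monic C m \<longrightarrow>
        (\<exists>!\<chi>. \<chi> \<in> hom C (Cod C m) (Cod C t) \<and> (\<exists>u. is_pullback C \<chi> t m u)))"

text \<open>
  Let \<open>t : 1 \<rightarrow> \<Omega>\<close> be a subobject classifier. The open formula \<open>x\<close> with \<open>x : \<Omega>\<close> is interpreted
  by the subobject \<open>t\<close> of \<open>\<Omega>\<close>, and a closed formula regarded as a formula in context \<open>x : \<Omega>\<close> by
  the pullback of its interpretation along \<open>\<Omega> \<rightarrow> 1\<close>. So, if \<open>\<phi>\<close> is a closed formula interpreted by
  the subterminal \<open>u\<close>, then \<open>ibd_step C t u v\<close> means that \<open>v\<close> is the interpretation of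
  \<open>(\<forall>x:\<Omega>)(x \<or> (x \<Rightarrow> \<phi>))\<close>.
\<close>

definition ibd_step :: "('o, 'a) cat \<Rightarrow> 'a \<Rightarrow> 'a \<Rightarrow> 'a \<Rightarrow> bool" where
  "ibd_step C t u v \<longleftrightarrow> (\<exists>b \<in> hom C (Cod C t) (Dom C t). \<exists>w i j.
     sub_pull C b u w \<and> sub_imp C (Cod C t) t w i \<and> sub_join C (Cod C t) t i j \<and>
     sub_forall C b j v)"

primrec ibd :: "('o, 'a) cat \<Rightarrow> 'a \<Rightarrow> nat \<Rightarrow> 'a \<Rightarrow> bool" where
  "ibd C t 0 v \<longleftrightarrow> (\<exists>u. sub_bot C (Dom C t) u \<and> ibd_step C t u v)"
| "ibd C t (Suc n) v \<longleftrightarrow> (\<exists>u. ibd C t n u \<and> ibd_step C t u v)"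

definition IBD_holds :: "('o, 'a) cat \<Rightarrow> nat \<Rightarrow> bool" where
  "IBD_holds C n \<longleftrightarrow> (\<exists>t v. subobject_classifier C t \<and> ibd C t n v \<and> is_iso C v)"


section \<open>Sets and presheaves\<close>

text \<open>
  The category of sets is represented by the sets of cardinality less than \<open>r\<close> over the carrier
  type of \<open>r\<close>, where \<open>r\<close> is a regular uncountable cardinal. For a strong limit \<open>r\<close> these are the
  small sets of a Grothendieck universe; this further condition is not demanded because nothing
  below relies on it and because HOL does not prove that any type carries such a cardinal.
\<close>

definition universe :: "'u rel \<Rightarrow> bool" where
  "universe r \<longleftrightarrow> Card_order r \<and> regularCard r \<and> natLeq <o r"

type_synonym 'u setmap = "'u set \<times> ('u \<Rightarrow> 'u) \<times> 'u set"

definition set_cat :: "'u rel \<Rightarrow> ('u set, 'u setmap) cat" where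
  "set_cat r = \<lparr>
     Ob = {A. |A| <o r},
     Arr = {(A, f, B). |A| <o r \<and> |B| <o r \<and> f \<in> A \<rightarrow>\<^sub>E B},
     Dom = (\<lambda>(A, f, B). A),
     Cod = (\<lambda>(A, f, B). B),
     Idt = (\<lambda>A. (A, \<lambda>x\<in>A. x, A)),
     Comp = (\<lambda>(B', g, D) (A, f, B). (A, compose A g f, D))\<rparr>"

definition app :: "'u setmap \<Rightarrow> 'u \<Rightarrow> 'u" where
  "app f x = fst (snd f) x"

type_synonym ('o, 'a, 'u) psh = "('o, 'a, 'u set, 'u setmap) func"
type_synonym ('o, 'a, 'u) pshmap =
  "('o, 'a, 'u) psh \<times> ('o \<Rightarrow> 'u setmap) \<times> ('o, 'a, 'u) psh"

definition functor_cat :: "('o, 'a) cat \<Rightarrow> ('p, 'b) cat \<Rightarrow>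
    (('o, 'a, 'p, 'b) func,
     ('o, 'a, 'p, 'b) func \<times> ('o \<Rightarrow> 'b) \<times> ('o, 'a, 'p, 'b) func) cat" where
  "functor_cat C D = (let
       Fun = {F. is_functor C D F \<and> on_ob F \<in> extensional (Ob C) \<and> on_arr F \<in> extensional (Arr C)}
     in \<lparr>
     Ob = Fun,
     Arr = {(F, \<alpha>, G). F \<in> Fun \<and> G \<in> Fun \<and> \<alpha> \<in> extensional (Ob C) \<and>
              (\<forall>A \<in> Ob C. \<alpha> A \<in> hom D (on_ob F A) (on_ob G A)) \<and>
              (\<forall>f \<in> Arr C. \<alpha> (Cod C f) \<cdot>\<^bsub>D\<^esub> on_arr F f = on_arr G f \<cdot>\<^bsub>D\<^esub> \<alpha> (Dom C f))},
     Dom = (\<lambda>(F, \<alpha>, G). F),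
     Cod = (\<lambda>(F, \<alpha>, G). G),
     Idt = (\<lambda>F. (F, \<lambda>A\<in>Ob C. Idt D (on_ob F A), F)),
     Comp = (\<lambda>(G', \<beta>, H) (F, \<alpha>, G). (F, \<lambda>A\<in>Ob C. \<beta> A \<cdot>\<^bsub>D\<^esub> \<alpha> A, H))\<rparr>)"

definition presheaves ::
    "'u rel \<Rightarrow> ('o, 'a) cat \<Rightarrow> (('o, 'a, 'u) psh, ('o, 'a, 'u) pshmap) cat" where
  "presheaves r C = functor_cat (op_cat C) (set_cat r)"

text \<open>The inverse image of the unique geometric morphism from \<open>presheaves r C\<close> to sets.\<close>

definition const_psh :: "'u rel \<Rightarrow> ('o, 'a) cat \<Rightarrow>
    ('u set, 'u setmap, ('o, 'a, 'u) psh, ('o, 'a, 'u) pshmap) func" where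
  "const_psh r C = (let
       K = (\<lambda>A. \<lparr>on_ob = (\<lambda>c\<in>Ob C. A), on_arr = (\<lambda>f\<in>Arr C. Idt (set_cat r) A)\<rparr>)
     in \<lparr>
     on_ob = K,
     on_arr = (\<lambda>f. (K (Dom (set_cat r) f), \<lambda>c\<in>Ob C. f, K (Cod (set_cat r) f)))\<rparr>)"

definition elements ::
    "('o, 'a) cat \<Rightarrow> ('o, 'a, 'u) psh \<Rightarrow> ('u \<times> 'o, ('u \<times> 'o) \<times> 'a \<times> ('u \<times> 'o)) cat" where
  "elements C X = \<lparr>
     Ob = {(x, c). c \<in> Ob C \<and> x \<in> on_ob X c},
     Arr = {((x, c), f, (y, d)). c \<in> Ob C \<and> x \<in> on_ob X c \<and> d \<in> Ob C \<and> y \<in> on_ob X d \<and>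
                                 f \<in> hom C c d \<and> app (on_arr X f) y = x},
     Dom = (\<lambda>(p, f, q). p),
     Cod = (\<lambda>(p, f, q). q),
     Idt = (\<lambda>(x, c). ((x, c), Idt C c, (x, c))),
     Comp = (\<lambda>(q', g, s) (p, f, q). (p, g \<cdot>\<^bsub>C\<^esub> f, s))\<rparr>"

definition minimal :: "('o, 'a) cat \<Rightarrow> 'o \<Rightarrow> bool" where
  "minimal C A \<longleftrightarrow> A \<in> Ob C \<and> (\<forall>f \<in> Arr C. Dom C f = A \<longrightarrow> monic C f)"


section \<open>Simplicial sets\<close>

text \<open>The number \<open>n\<close> stands for the ordinal \<open>[n] = {0 < \<dots> < n}\<close>.\<close>

type_synonym simp_op = "nat \<times> (nat \<Rightarrow> nat) \<times> nat"

definition Delta :: "(nat, simp_op) cat" where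
  "Delta = \<lparr>
     Ob = UNIV,
     Arr = {(m, f, n). f \<in> {..m} \<rightarrow>\<^sub>E {..n} \<and> mono_on {..m} f},
     Dom = (\<lambda>(m, f, n). m),
     Cod = (\<lambda>(m, f, n). n),
     Idt = (\<lambda>n. (n, \<lambda>i\<in>{..n}. i, n)),
     Comp = (\<lambda>(n', g, k) (m, f, n). (m, compose {..m} g f, k))\<rparr>"

type_synonym 'u simp_set = "(nat, simp_op, 'u) psh"
type_synonym 'u simp_map = "(nat, simp_op, 'u) pshmap"

definition simp_sets :: "'u rel \<Rightarrow> ('u simp_set, 'u simp_map) cat" where
  "simp_sets r = presheaves r Delta"

definition strongly_regular :: "'u simp_set \<Rightarrow> bool" where
  "strongly_regular X \<longleftrightarrow>
     (\<forall>m. monic (elements Delta X) m \<and> minimal (elements Delta X) (Cod (elements Delta X) m) \<longrightarrow>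
        minimal (elements Delta X) (Dom (elements Delta X) m))"

definition skel_set :: "nat \<Rightarrow> 'u simp_set \<Rightarrow> nat \<Rightarrow> 'u set" where
  "skel_set n X d = {x \<in> on_ob X d.
     \<exists>e. \<exists>f \<in> hom Delta d e. \<exists>y \<in> on_ob X e. x = app (on_arr X f) y \<and>
       (\<exists>k \<le> n. \<exists>g \<in> hom Delta d k. \<exists>h \<in> hom Delta k e. f = h \<cdot>\<^bsub>Delta\<^esub> g)}"

definition skeleton :: "nat \<Rightarrow> 'u simp_set \<Rightarrow> 'u simp_set" where
  "skeleton n X = \<lparr>
     on_ob = skel_set n X,
     on_arr = (\<lambda>f\<in>Arr Delta.
       (skel_set n X (Cod Delta f),
        restrict (app (on_arr X f)) (skel_set n X (Cod Delta f)),
        skel_set n X (Dom Delta f)))\<rparr>"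

definition skel_incl :: "nat \<Rightarrow> 'u simp_set \<Rightarrow> 'u simp_map" where
  "skel_incl n X = (skeleton n X, \<lambda>d. (skel_set n X d, \<lambda>x\<in>skel_set n X d. x, on_ob X d), X)"

definition dim_le :: "'u rel \<Rightarrow> 'u simp_set \<Rightarrow> nat \<Rightarrow> bool" where
  "dim_le r X n \<longleftrightarrow> is_iso (simp_sets r) (skel_incl n X)"

text \<open>The topos which is level e-acute of \<open>simp_sets/X \<rightarrow> simp_sets \<rightarrow> Set\<close>.\<close>

definition E_topos :: "'u rel \<Rightarrow> 'u simp_set \<Rightarrow>
    ('u simp_map, 'u simp_map \<times> 'u simp_map \<times> 'u simp_map) cat" where
  "E_topos r X = full_subcat (slice (simp_sets r) X)
     (level_e (slice (simp_sets r) X) (set_cat r)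
        (comp_func (base_change (simp_sets r) X) (const_psh r Delta)))"

end

theory Submission
  imports Defs
begin

text \<open>
  The minimal objects of the category of elements of \<open>X\<close> are the nondegenerate simplices, and for
  strongly regular \<open>X\<close> a map between them is an injective face operator. Level e-acute is the
  subtopos \<open>L0\<close> of the presheaves that are right Kan extended from the nondegenerate simplices. It is a
  level since, by Eilenberg-Zilber and strong regularity, the left Kan extension of a presheaf on the
  nondegenerate simplices is the part of the right one that these simplices generate; it is an etendue because
  injective maps into the natural numbers rigidify faces.

  Conversely, a level amounts to an idempotent ideal of maps. The ideals of the category of elements are
  generated by their identities, since a factorization chain into a fixed simplex has stabilizing images. If
  the level is an etendue, these identities belong to nondegenerate simplices: a degenerate \<open>x = y \<cdot> e\<close> with
  a section \<open>s\<close> of \<open>e\<close> has the endomorphism \<open>s \<cdot> e\<close>, which acts trivially on constant presheaves and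
  on every \<open>G\<close> with an element over \<open>y\<close>, hence on all their subquotients. So every such level lies below \<open>L0\<close>.

  In \<open>L0\<close> a subobject is a family of nondegenerate elements closed under faces. By induction, \<open>IBD\<close> of index
  \<open>n\<close> is the subterminal object of the nondegenerate simplices of dimension at most \<open>n\<close>: the sieve of proper
  faces of a simplex is the truth value that detects its dimension.
\<close>

section \<open>Categories and adjunctions\<close>

text \<open>Two features of the setting shape the argument. Reflectors, inverse images and base
  changes are Hilbert choices, known only by their universal properties; so each is compared with a
  concrete construction or described by the elements of the objects involved. For \<open>L0\<close>
  the outcome is that the unit of any reflector is bijective on nondegenerate elements, and little
  else about the reflector is ever used.

  Secondly, all presheaves must consist of elements of \<open>'u\<close> in sets below
  \<open>r\<close>, and \<open>r\<close> is regular but comes with no bound on power sets. This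
  suffices because an injective operator into \<open>[k]\<close> starts in dimension at most
  \<open>k\<close>: at one simplex the limit defining a right Kan extension, a sieve and a function
  on vertices all have a finite index set.

  Strong regularity serves to make the nondegenerate elements of an object a presheaf of their own,
  closed under faces, so that families indexed by them can be restricted and compared. The bounds in
  \<open>IBD\<close> then count dimensions: a \<open>k\<close>-simplex has faces in each of the
  \<open>k + 1\<close> dimensions up to \<open>k\<close>, and each step of the formula accounts for
  one of them.\<close>

locale category =
  fixes C :: "('o, 'a) cat" (structure)
  assumes dom_ob: "f \<in> hom C A B \<Longrightarrow> A \<in> Ob C"
    and cod_ob: "f \<in> hom C A B \<Longrightarrow> B \<in> Ob C"
    and id_in: "A \<in> Ob C \<Longrightarrow> Idt C A \<in> hom C A A"
    and comp_in: "\<lbrakk>g \<in> hom C B D; f \<in> hom C A B\<rbrakk> \<Longrightarrow> g \<cdot> f \<in> hom C A D"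
    and assoc: "\<lbrakk>h \<in> hom C D D'; g \<in> hom C B D; f \<in> hom C A B\<rbrakk> \<Longrightarrow> h \<cdot> (g \<cdot> f) = (h \<cdot> g) \<cdot> f"
    and idl: "f \<in> hom C A B \<Longrightarrow> Idt C B \<cdot> f = f"
    and idr: "f \<in> hom C A B \<Longrightarrow> f \<cdot> Idt C A = f"

lemma homD: "f \<in> hom C A B \<Longrightarrow> f \<in> Arr C \<and> Dom C f = A \<and> Cod C f = B"
  by (simp add: hom_def)

lemma homI: "f \<in> Arr C \<Longrightarrow> f \<in> hom C (Dom C f) (Cod C f)"
  by (simp add: hom_def)

lemma category_op: "category C \<Longrightarrow> category (op_cat C)"
  unfolding category_def op_cat_def hom_def by simp

lemma hom_full_iff:
  "f \<in> hom (full_subcat C L) A B \<longleftrightarrow> f \<in> hom C A B \<and> A \<in> L \<and> B \<in> L"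
  by (auto simp: hom_def full_subcat_def)

lemma full_simps [simp]:
  "Ob (full_subcat C L) = L" "Dom (full_subcat C L) = Dom C" "Cod (full_subcat C L) = Cod C"
  "Idt (full_subcat C L) = Idt C" "Comp (full_subcat C L) = Comp C"
  by (simp_all add: full_subcat_def)

lemma category_full: assumes "category C" "L \<subseteq> Ob C" shows "category (full_subcat C L)"
proof -
  interpret category C by fact
  show ?thesis
    by unfold_locales (use assms(2) in \<open>auto simp: hom_full_iff idl idr comp_in assoc intro: id_in\<close>)
qed

lemma slice_simps [simp]:
  "Dom (slice C X) = fst" "Cod (slice C X) = (\<lambda>h. snd (snd h))"
  "Idt (slice C X) p = (p, Idt C (Dom C p), p)"
  "Comp (slice C X) g f = (fst f, fst (snd g) \<cdot>\<^bsub>C\<^esub> fst (snd f), snd (snd g))"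
  by (auto simp: slice_def fun_eq_iff split: prod.splits)

lemma slice_Ob: "p \<in> Ob (slice C X) \<longleftrightarrow> p \<in> hom C (Dom C p) X"
  by (auto simp: slice_def hom_def)

lemma slice_hom:
  "h \<in> hom (slice C X) p q \<longleftrightarrow> p \<in> Ob (slice C X) \<and> q \<in> Ob (slice C X) \<and>
     (\<exists>f. h = (p, f, q) \<and> f \<in> hom C (Dom C p) (Dom C q) \<and> q \<cdot>\<^bsub>C\<^esub> f = p)"
  by (auto simp: slice_def hom_def)

lemma category_slice: assumes "category C" shows "category (slice C X)"
proof -
  interpret category C by fact
  have *: "p \<in> hom C (Dom C p) X" if "p \<in> Ob (slice C X)" for p using that by (simp add: slice_Ob)
  show ?thesis
  proof
    fix p assume p: "p \<in> Ob (slice C X)"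
    show "Idt (slice C X) p \<in> hom (slice C X) p p"
      using p *[OF p] by (auto simp: slice_hom idr intro: id_in dom_ob)
  next
    fix g f p q s
    assume "g \<in> hom (slice C X) q s" "f \<in> hom (slice C X) p q"
    then show "g \<cdot>\<^bsub>slice C X\<^esub> f \<in> hom (slice C X) p s"
      using * by (auto simp: slice_hom intro!: comp_in) (metis assoc)
  next
    fix h g f p q s t
    assume "h \<in> hom (slice C X) s t" "g \<in> hom (slice C X) q s" "f \<in> hom (slice C X) p q"
    then show "h \<cdot>\<^bsub>slice C X\<^esub> (g \<cdot>\<^bsub>slice C X\<^esub> f) = h \<cdot>\<^bsub>slice C X\<^esub> g \<cdot>\<^bsub>slice C X\<^esub> f"
      by (auto simp: slice_hom intro: assoc)
  qed (auto simp: slice_hom idl idr)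
qed

lemma hom_op [simp]: "hom (op_cat C) A B = hom C B A"
  by (auto simp: hom_def op_cat_def)

lemma op_simps [simp]:
  "Ob (op_cat C) = Ob C" "Arr (op_cat C) = Arr C" "Dom (op_cat C) = Cod C" "Cod (op_cat C) = Dom C"
  "Idt (op_cat C) = Idt C" "Comp (op_cat C) g f = Comp C f g"
  by (simp_all add: op_cat_def)

lemma functorD:
  assumes "is_functor C D F"
  shows "A \<in> Ob C \<Longrightarrow> on_ob F A \<in> Ob D"
    and "A \<in> Ob C \<Longrightarrow> on_arr F (Idt C A) = Idt D (on_ob F A)"
    and "f \<in> hom C A B \<Longrightarrow> on_arr F f \<in> hom D (on_ob F A) (on_ob F B)"
    and "g \<in> hom C B B' \<Longrightarrow> f \<in> hom C A B \<Longrightarrow>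
           on_arr F (g \<cdot>\<^bsub>C\<^esub> f) = on_arr F g \<cdot>\<^bsub>D\<^esub> on_arr F f"
  using assms by (auto simp: is_functor_def hom_def)

lemma functor_inclusion: "category C \<Longrightarrow> L \<subseteq> Ob C \<Longrightarrow> is_functor (full_subcat C L) C inclusion"
  by (auto simp: is_functor_def inclusion_def full_subcat_def hom_def)

lemma functor_forget: assumes "category C" shows "is_functor (slice C X) C (forget C)"
  using category.dom_ob[OF assms]
  by (auto simp: is_functor_def forget_def slice_def hom_def)

lemma adjointD:
  assumes "adjoint C D F G"
  shows "is_functor C D F" "is_functor D C G"
  using assms by (auto simp: adjoint_def)

lemma adjoint_unit:
  assumes "adjoint C D F G"
  obtains \<eta> where "\<And>A. A \<in> Ob C \<Longrightarrow> \<eta> A \<in> hom C A (on_ob G (on_ob F A))"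
    and "\<And>f A B. f \<in> hom C A B \<Longrightarrow> on_arr G (on_arr F f) \<cdot>\<^bsub>C\<^esub> \<eta> A = \<eta> B \<cdot>\<^bsub>C\<^esub> f"
    and "\<And>A B f. A \<in> Ob C \<Longrightarrow> B \<in> Ob D \<Longrightarrow> f \<in> hom C A (on_ob G B) \<Longrightarrow>
           \<exists>!g. g \<in> hom D (on_ob F A) B \<and> on_arr G g \<cdot>\<^bsub>C\<^esub> \<eta> A = f"
proof -
  from assms obtain \<eta> where e: "(\<forall>A \<in> Ob C. \<eta> A \<in> hom C A (on_ob G (on_ob F A)))"
    "(\<forall>f \<in> Arr C. on_arr G (on_arr F f) \<cdot>\<^bsub>C\<^esub> \<eta> (Dom C f) = \<eta> (Cod C f) \<cdot>\<^bsub>C\<^esub> f)"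
    "(\<forall>A \<in> Ob C. \<forall>B \<in> Ob D. \<forall>f \<in> hom C A (on_ob G B).
             \<exists>!g. g \<in> hom D (on_ob F A) B \<and> on_arr G g \<cdot>\<^bsub>C\<^esub> \<eta> A = f)"
    unfolding adjoint_def by blast
  show thesis
  proof (rule that)
    show "on_arr G (on_arr F f) \<cdot>\<^bsub>C\<^esub> \<eta> A = \<eta> B \<cdot>\<^bsub>C\<^esub> f" if "f \<in> hom C A B" for f A B
      using e(2) homD[OF that] by blast
  qed (use e in blast)+
qed

text \<open>A choice of universal arrows is a left adjoint: on arrows it is given by unique
  factorization, and each functor law holds because both sides factor the same arrow through a
  universal one. The reflector onto \<open>L0\<close> and its further left adjoint arise in this
  way.\<close>

lemma adjoint_from_universal:
  assumes C: "category C" and D: "category D" and G: "is_functor D C G"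
    and ex: "\<And>A. A \<in> Ob C \<Longrightarrow> \<exists>B \<in> Ob D. \<exists>u \<in> hom C A (on_ob G B).
      \<forall>B' \<in> Ob D. \<forall>f \<in> hom C A (on_ob G B'). \<exists>!g. g \<in> hom D B B' \<and> on_arr G g \<cdot>\<^bsub>C\<^esub> u = f"
  shows "\<exists>F. adjoint C D F G"
proof -
  interpret C: category C by fact
  interpret D: category D by fact
  note G1 = functorD[OF G]
  define P where "P A b \<longleftrightarrow> fst b \<in> Ob D \<and> snd b \<in> hom C A (on_ob G (fst b)) \<and>
      (\<forall>B' \<in> Ob D. \<forall>f \<in> hom C A (on_ob G B').
         \<exists>!g. g \<in> hom D (fst b) B' \<and> on_arr G g \<cdot>\<^bsub>C\<^esub> snd b = f)" for A b
  have "\<exists>b. P A b" if "A \<in> Ob C" for A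
    using ex[OF that] unfolding P_def by (metis fst_conv snd_conv)
  then obtain s where s: "\<And>A. A \<in> Ob C \<Longrightarrow> P A (s A)" by metis
  define F0 where "F0 A = fst (s A)" for A
  define \<eta> where "\<eta> A = snd (s A)" for A
  have F0: "F0 A \<in> Ob D" and \<eta>: "\<eta> A \<in> hom C A (on_ob G (F0 A))"
    and univ: "\<And>B' f. B' \<in> Ob D \<Longrightarrow> f \<in> hom C A (on_ob G B') \<Longrightarrow>
        \<exists>!g. g \<in> hom D (F0 A) B' \<and> on_arr G g \<cdot>\<^bsub>C\<^esub> \<eta> A = f" if "A \<in> Ob C" for A
    using s[OF that] unfolding P_def F0_def \<eta>_def by blast+
  define F1 where "F1 f = (THE g. g \<in> hom D (F0 (Dom C f)) (F0 (Cod C f)) \<and>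
      on_arr G g \<cdot>\<^bsub>C\<^esub> \<eta> (Dom C f) = \<eta> (Cod C f) \<cdot>\<^bsub>C\<^esub> f)" for f
  have F1: "F1 f \<in> hom D (F0 A) (F0 B)" "on_arr G (F1 f) \<cdot>\<^bsub>C\<^esub> \<eta> A = \<eta> B \<cdot>\<^bsub>C\<^esub> f"
    if "f \<in> hom C A B" for f A B
  proof -
    have ob: "A \<in> Ob C" "B \<in> Ob C" using that C.dom_ob C.cod_ob by auto
    have "\<exists>!g. g \<in> hom D (F0 A) (F0 B) \<and> on_arr G g \<cdot>\<^bsub>C\<^esub> \<eta> A = \<eta> B \<cdot>\<^bsub>C\<^esub> f"
      using univ[OF ob(1) F0[OF ob(2)]] C.comp_in[OF \<eta>[OF ob(2)] that] by blast
    from theI'[OF this] show "F1 f \<in> hom D (F0 A) (F0 B)" "on_arr G (F1 f) \<cdot>\<^bsub>C\<^esub> \<eta> A = \<eta> B \<cdot>\<^bsub>C\<^esub> f"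
      using homD[OF that] by (auto simp: F1_def)
  qed
  have uq: "g = g'" if "A \<in> Ob C" "g \<in> hom D (F0 A) B" "g' \<in> hom D (F0 A) B"
    "on_arr G g \<cdot>\<^bsub>C\<^esub> \<eta> A = on_arr G g' \<cdot>\<^bsub>C\<^esub> \<eta> A" for g g' A B
  proof -
    have "B \<in> Ob D" using that(2) D.cod_ob by auto
    moreover have "on_arr G g \<cdot>\<^bsub>C\<^esub> \<eta> A \<in> hom C A (on_ob G B)"
      using C.comp_in[OF G1(3)[OF that(2)] \<eta>[OF that(1)]] .
    ultimately show ?thesis using univ[OF that(1)] that by (metis (no_types, lifting))
  qed
  define F where "F = \<lparr>on_ob = F0, on_arr = F1\<rparr>"
  have "is_functor C D F"
    unfolding is_functor_def
  proof (intro conjI ballI impI)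
    fix A assume A: "A \<in> Ob C"
    show "on_ob F A \<in> Ob D" using F0 A by (simp add: F_def)
    have i: "Idt C A \<in> hom C A A" using A by (rule C.id_in)
    show "on_arr F (Idt C A) = Idt D (on_ob F A)"
      unfolding F_def func.simps
      by (rule uq[OF A F1(1)[OF i] D.id_in[OF F0[OF A]]])
        (simp add: F1(2)[OF i] G1(2)[OF F0[OF A]] C.idl[OF \<eta>[OF A]] C.idr[OF \<eta>[OF A]])
  next
    fix f assume "f \<in> Arr C"
    then show "on_arr F f \<in> hom D (on_ob F (Dom C f)) (on_ob F (Cod C f))"
      using F1(1)[OF homI] by (simp add: F_def)
  next
    fix f g assume "f \<in> Arr C" "g \<in> Arr C" "Dom C g = Cod C f"
    then obtain A B E where fg: "f \<in> hom C A B" "g \<in> hom C B E" by (auto simp: hom_def)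
    have A: "A \<in> Ob C" and B: "B \<in> Ob C" and E: "E \<in> Ob C" using fg C.dom_ob C.cod_ob by blast+
    have gf: "g \<cdot>\<^bsub>C\<^esub> f \<in> hom C A E" using fg C.comp_in by blast
    have "on_arr G (F1 g \<cdot>\<^bsub>D\<^esub> F1 f) \<cdot>\<^bsub>C\<^esub> \<eta> A = on_arr G (F1 g) \<cdot>\<^bsub>C\<^esub> on_arr G (F1 f) \<cdot>\<^bsub>C\<^esub> \<eta> A"
      using G1(4)[OF F1(1)[OF fg(2)] F1(1)[OF fg(1)]] by simp
    also have "\<dots> = on_arr G (F1 g) \<cdot>\<^bsub>C\<^esub> (\<eta> B \<cdot>\<^bsub>C\<^esub> f)"
      using C.assoc[OF G1(3)[OF F1(1)[OF fg(2)]] G1(3)[OF F1(1)[OF fg(1)]] \<eta>[OF A]] F1(2)[OF fg(1)] by simp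
    also have "\<dots> = \<eta> E \<cdot>\<^bsub>C\<^esub> g \<cdot>\<^bsub>C\<^esub> f"
      using C.assoc[OF G1(3)[OF F1(1)[OF fg(2)]] \<eta>[OF B] fg(1)] F1(2)[OF fg(2)] by simp
    also have "\<dots> = \<eta> E \<cdot>\<^bsub>C\<^esub> (g \<cdot>\<^bsub>C\<^esub> f)" using C.assoc[OF \<eta>[OF E] fg(2) fg(1)] by simp
    finally show "on_arr F (g \<cdot>\<^bsub>C\<^esub> f) = on_arr F g \<cdot>\<^bsub>D\<^esub> on_arr F f"
      unfolding F_def func.simps
      using uq[OF A F1(1)[OF gf] D.comp_in[OF F1(1)[OF fg(2)] F1(1)[OF fg(1)]]] F1(2)[OF gf] by simp
  qed
  moreover have "on_arr G (F1 f) \<cdot>\<^bsub>C\<^esub> \<eta> (Dom C f) = \<eta> (Cod C f) \<cdot>\<^bsub>C\<^esub> f" if "f \<in> Arr C" for f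
    using F1(2)[OF homI[OF that]] .
  ultimately have "adjoint C D F G"
    unfolding adjoint_def using G \<eta> univ
    by (intro conjI exI[of _ \<eta>] ballI) (simp_all add: F_def)
  then show ?thesis by blast
qed

text \<open>\<open>adjoint\<close> records a unit, whereas base change is a right adjoint and is
  used through its counit. The counit is the transpose of the identity, and transposition is
  inverted by \<open>key\<close>.\<close>

lemma adjoint_counit:
  assumes C: "category C" and D: "category D" and adj: "adjoint C D F G" and B: "B \<in> Ob D"
  shows "\<exists>\<epsilon> \<in> hom D (on_ob F (on_ob G B)) B. \<forall>A \<in> Ob C. \<forall>f \<in> hom D (on_ob F A) B.
     \<exists>!g. g \<in> hom C A (on_ob G B) \<and> \<epsilon> \<cdot>\<^bsub>D\<^esub> on_arr F g = f"
proof -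
  interpret C: category C by fact
  interpret D: category D by fact
  note F1 = functorD[OF adjointD(1)[OF adj]] and G1 = functorD[OF adjointD(2)[OF adj]]
  obtain \<eta> where \<eta>: "\<And>A. A \<in> Ob C \<Longrightarrow> \<eta> A \<in> hom C A (on_ob G (on_ob F A))"
    and nat: "\<And>f A B. f \<in> hom C A B \<Longrightarrow> on_arr G (on_arr F f) \<cdot>\<^bsub>C\<^esub> \<eta> A = \<eta> B \<cdot>\<^bsub>C\<^esub> f"
    and univ: "\<And>A B f. A \<in> Ob C \<Longrightarrow> B \<in> Ob D \<Longrightarrow> f \<in> hom C A (on_ob G B) \<Longrightarrow>
           \<exists>!g. g \<in> hom D (on_ob F A) B \<and> on_arr G g \<cdot>\<^bsub>C\<^esub> \<eta> A = f"
    by (rule adjoint_unit[OF adj]) (rule that)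
  have GB: "on_ob G B \<in> Ob C" using G1(1)[OF B] .
  obtain \<epsilon> where e: "\<epsilon> \<in> hom D (on_ob F (on_ob G B)) B"
      "on_arr G \<epsilon> \<cdot>\<^bsub>C\<^esub> \<eta> (on_ob G B) = Idt C (on_ob G B)"
    using univ[OF GB B C.id_in[OF GB]] by blast
  have key: "on_arr G (\<epsilon> \<cdot>\<^bsub>D\<^esub> on_arr F g) \<cdot>\<^bsub>C\<^esub> \<eta> A = g" if "A \<in> Ob C" "g \<in> hom C A (on_ob G B)" for A g
  proof -
    have "on_arr G (\<epsilon> \<cdot>\<^bsub>D\<^esub> on_arr F g) \<cdot>\<^bsub>C\<^esub> \<eta> A = on_arr G \<epsilon> \<cdot>\<^bsub>C\<^esub> (on_arr G (on_arr F g) \<cdot>\<^bsub>C\<^esub> \<eta> A)"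
      using G1(4)[OF e(1) F1(3)[OF that(2)]] C.assoc[OF G1(3)[OF e(1)] G1(3)[OF F1(3)[OF that(2)]] \<eta>[OF that(1)]]
      by simp
    also have "\<dots> = on_arr G \<epsilon> \<cdot>\<^bsub>C\<^esub> \<eta> (on_ob G B) \<cdot>\<^bsub>C\<^esub> g"
      using nat[OF that(2)] C.assoc[OF G1(3)[OF e(1)] \<eta>[OF GB] that(2)] by simp
    finally show ?thesis using e(2) C.idl[OF that(2)] by simp
  qed
  show ?thesis
  proof (intro bexI[OF _ e(1)] ballI)
    fix A f assume A: "A \<in> Ob C" and f: "f \<in> hom D (on_ob F A) B"
    let ?g = "on_arr G f \<cdot>\<^bsub>C\<^esub> \<eta> A"
    have g: "?g \<in> hom C A (on_ob G B)" using C.comp_in[OF G1(3)[OF f] \<eta>[OF A]] .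
    have 1: "\<epsilon> \<cdot>\<^bsub>D\<^esub> on_arr F ?g = f"
      using univ[OF A B g] key[OF A g] D.comp_in[OF e(1) F1(3)[OF g]] f by metis
    show "\<exists>!g. g \<in> hom C A (on_ob G B) \<and> \<epsilon> \<cdot>\<^bsub>D\<^esub> on_arr F g = f"
      by (rule ex1I[of _ ?g]) (use g 1 key[OF A] in auto)
  qed
qed

text \<open>The dual construction, needed for base change: there the functor at hand is the
  forgetful one, and the couniversal arrows are product projections.\<close>

lemma adjoint_from_couniversal:
  assumes C: "category C" and D: "category D" and F: "is_functor C D F"
    and ex: "\<And>B. B \<in> Ob D \<Longrightarrow> \<exists>A \<in> Ob C. \<exists>u \<in> hom D (on_ob F A) B.
      \<forall>A' \<in> Ob C. \<forall>f \<in> hom D (on_ob F A') B. \<exists>!g. g \<in> hom C A' A \<and> u \<cdot>\<^bsub>D\<^esub> on_arr F g = f"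
  shows "\<exists>G. adjoint C D F G"
proof -
  interpret C: category C by fact
  interpret D: category D by fact
  note F1 = functorD[OF F]
  define P where "P B b \<longleftrightarrow> fst b \<in> Ob C \<and> snd b \<in> hom D (on_ob F (fst b)) B \<and>
      (\<forall>A' \<in> Ob C. \<forall>f \<in> hom D (on_ob F A') B.
         \<exists>!g. g \<in> hom C A' (fst b) \<and> snd b \<cdot>\<^bsub>D\<^esub> on_arr F g = f)" for B b
  have "\<exists>b. P B b" if "B \<in> Ob D" for B
    using ex[OF that] unfolding P_def by (metis fst_conv snd_conv)
  then obtain s where s: "\<And>B. B \<in> Ob D \<Longrightarrow> P B (s B)" by metis
  define G0 where "G0 A = fst (s A)" for A
  define \<epsilon> where "\<epsilon> A = snd (s A)" for A
  have G0: "G0 B \<in> Ob C" and \<epsilon>: "\<epsilon> B \<in> hom D (on_ob F (G0 B)) B"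
    and univ: "\<And>A' f. A' \<in> Ob C \<Longrightarrow> f \<in> hom D (on_ob F A') B \<Longrightarrow>
        \<exists>!g. g \<in> hom C A' (G0 B) \<and> \<epsilon> B \<cdot>\<^bsub>D\<^esub> on_arr F g = f" if "B \<in> Ob D" for B
    using s[OF that] unfolding P_def G0_def \<epsilon>_def by blast+
  have uq: "g = g'" if "B \<in> Ob D" "g \<in> hom C A (G0 B)" "g' \<in> hom C A (G0 B)"
    "\<epsilon> B \<cdot>\<^bsub>D\<^esub> on_arr F g = \<epsilon> B \<cdot>\<^bsub>D\<^esub> on_arr F g'" for g g' A B
    using univ[OF that(1) C.dom_ob[OF that(2)] D.comp_in[OF \<epsilon>[OF that(1)] F1(3)[OF that(2)]]] that
    by (metis (no_types, lifting))
  define tr where "tr A B f = (THE g. g \<in> hom C A (G0 B) \<and> \<epsilon> B \<cdot>\<^bsub>D\<^esub> on_arr F g = f)" for A B f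
  have tr: "tr A B f \<in> hom C A (G0 B)" "\<epsilon> B \<cdot>\<^bsub>D\<^esub> on_arr F (tr A B f) = f"
    if "A \<in> Ob C" "f \<in> hom D (on_ob F A) B" for A B f
    using theI'[OF univ[OF D.cod_ob[OF that(2)] that]] unfolding tr_def by auto
  define G1 where "G1 f = tr (G0 (Dom D f)) (Cod D f) (f \<cdot>\<^bsub>D\<^esub> \<epsilon> (Dom D f))" for f
  have G1: "G1 f \<in> hom C (G0 A) (G0 B)" "\<epsilon> B \<cdot>\<^bsub>D\<^esub> on_arr F (G1 f) = f \<cdot>\<^bsub>D\<^esub> \<epsilon> A"
    if f: "f \<in> hom D A B" for f A B
    using tr[OF G0[OF D.dom_ob[OF f]] D.comp_in[OF f \<epsilon>[OF D.dom_ob[OF f]]]] homD[OF f]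
    by (auto simp: G1_def)
  have comp: "\<epsilon> B \<cdot>\<^bsub>D\<^esub> on_arr F (G1 f \<cdot>\<^bsub>C\<^esub> g) = f \<cdot>\<^bsub>D\<^esub> (\<epsilon> A \<cdot>\<^bsub>D\<^esub> on_arr F g)"
    if f: "f \<in> hom D A B" and g: "g \<in> hom C Z (G0 A)" for f A B g Z
  proof -
    have A: "A \<in> Ob D" and B: "B \<in> Ob D" using f D.dom_ob D.cod_ob by auto
    have "\<epsilon> B \<cdot>\<^bsub>D\<^esub> on_arr F (G1 f \<cdot>\<^bsub>C\<^esub> g) = \<epsilon> B \<cdot>\<^bsub>D\<^esub> on_arr F (G1 f) \<cdot>\<^bsub>D\<^esub> on_arr F g"
      using F1(4)[OF G1(1)[OF f] g] D.assoc[OF \<epsilon>[OF B] F1(3)[OF G1(1)[OF f]] F1(3)[OF g]] by simp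
    then show ?thesis using G1(2)[OF f] D.assoc[OF f \<epsilon>[OF A] F1(3)[OF g]] by simp
  qed
  define G where "G = \<lparr>on_ob = G0, on_arr = G1\<rparr>"
  have fG: "is_functor D C G"
    unfolding is_functor_def
  proof (intro conjI ballI impI)
    fix B assume B: "B \<in> Ob D"
    show "on_ob G B \<in> Ob C" using G0 B by (simp add: G_def)
    have i: "Idt D B \<in> hom D B B" using B by (rule D.id_in)
    show "on_arr G (Idt D B) = Idt C (on_ob G B)"
      unfolding G_def func.simps
      by (rule uq[OF B G1(1)[OF i] C.id_in[OF G0[OF B]]])
        (simp add: G1(2)[OF i] F1(2)[OF G0[OF B]] D.idl[OF \<epsilon>[OF B]] D.idr[OF \<epsilon>[OF B]])
  next
    fix f assume "f \<in> Arr D"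
    then show "on_arr G f \<in> hom C (on_ob G (Dom D f)) (on_ob G (Cod D f))"
      using G1(1)[OF homI] by (simp add: G_def)
  next
    fix f g assume "f \<in> Arr D" "g \<in> Arr D" "Dom D g = Cod D f"
    then obtain A B E where fg: "f \<in> hom D A B" "g \<in> hom D B E" by (auto simp: hom_def)
    have A: "A \<in> Ob D" and E: "E \<in> Ob D" using fg D.dom_ob D.cod_ob by blast+
    have gf: "g \<cdot>\<^bsub>D\<^esub> f \<in> hom D A E" using fg D.comp_in by blast
    have "\<epsilon> E \<cdot>\<^bsub>D\<^esub> on_arr F (G1 g \<cdot>\<^bsub>C\<^esub> G1 f) = \<epsilon> E \<cdot>\<^bsub>D\<^esub> on_arr F (G1 (g \<cdot>\<^bsub>D\<^esub> f))"
      using comp[OF fg(2) G1(1)[OF fg(1)]] G1(2)[OF fg(1)] G1(2)[OF gf] D.assoc[OF fg(2,1) \<epsilon>[OF A]] by simp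
    then show "on_arr G (g \<cdot>\<^bsub>D\<^esub> f) = on_arr G g \<cdot>\<^bsub>C\<^esub> on_arr G f"
      unfolding G_def func.simps
      using uq[OF E C.comp_in[OF G1(1)[OF fg(2)] G1(1)[OF fg(1)]] G1(1)[OF gf]] by simp
  qed
  define \<eta> where "\<eta> A = tr A (on_ob F A) (Idt D (on_ob F A))" for A
  have \<eta>: "\<eta> A \<in> hom C A (G0 (on_ob F A))" "\<epsilon> (on_ob F A) \<cdot>\<^bsub>D\<^esub> on_arr F (\<eta> A) = Idt D (on_ob F A)"
    if A: "A \<in> Ob C" for A
    using tr[OF A D.id_in[OF F1(1)[OF A]]] by (auto simp: \<eta>_def)
  have u: "\<epsilon> B \<cdot>\<^bsub>D\<^esub> on_arr F (G1 g \<cdot>\<^bsub>C\<^esub> \<eta> A) = g" if "A \<in> Ob C" "g \<in> hom D (on_ob F A) B" for A B g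
    using comp[OF that(2) \<eta>(1)[OF that(1)]] \<eta>(2)[OF that(1)] D.idr[OF that(2)] by simp
  have "on_arr G (on_arr F f) \<cdot>\<^bsub>C\<^esub> \<eta> (Dom C f) = \<eta> (Cod C f) \<cdot>\<^bsub>C\<^esub> f" if fA: "f \<in> Arr C" for f
  proof -
    obtain A B where f: "f \<in> hom C A B" using homI[OF fA] by blast
    have A: "A \<in> Ob C" and B: "B \<in> Ob C" using f C.dom_ob C.cod_ob by auto
    note Ff = F1(3)[OF f]
    have "\<epsilon> (on_ob F B) \<cdot>\<^bsub>D\<^esub> on_arr F (\<eta> B \<cdot>\<^bsub>C\<^esub> f) = on_arr F f"
      using F1(4)[OF \<eta>(1)[OF B] f] D.assoc[OF \<epsilon>[OF F1(1)[OF B]] F1(3)[OF \<eta>(1)[OF B]] Ff] \<eta>(2)[OF B] D.idl[OF Ff]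
      by simp
    then have "G1 (on_arr F f) \<cdot>\<^bsub>C\<^esub> \<eta> A = \<eta> B \<cdot>\<^bsub>C\<^esub> f"
      using uq[OF F1(1)[OF B] C.comp_in[OF G1(1)[OF Ff] \<eta>(1)[OF A]] C.comp_in[OF \<eta>(1)[OF B] f]] u[OF A Ff] by simp
    then show ?thesis using homD[OF f] by (simp add: G_def)
  qed
  moreover have "\<exists>!g. g \<in> hom D (on_ob F A) B \<and> on_arr G g \<cdot>\<^bsub>C\<^esub> \<eta> A = f"
    if "A \<in> Ob C" "B \<in> Ob D" "f \<in> hom C A (on_ob G B)" for A B f
  proof (rule ex1I)
    have f: "f \<in> hom C A (G0 B)" using that(3) by (simp add: G_def)
    let ?g = "\<epsilon> B \<cdot>\<^bsub>D\<^esub> on_arr F f"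
    have g: "?g \<in> hom D (on_ob F A) B" using D.comp_in[OF \<epsilon>[OF that(2)] F1(3)[OF f]] .
    show "?g \<in> hom D (on_ob F A) B \<and> on_arr G ?g \<cdot>\<^bsub>C\<^esub> \<eta> A = f"
      using g uq[OF that(2) C.comp_in[OF G1(1)[OF g] \<eta>(1)[OF that(1)]] f u[OF that(1) g]] by (simp add: G_def)
    show "h = ?g" if "h \<in> hom D (on_ob F A) B \<and> on_arr G h \<cdot>\<^bsub>C\<^esub> \<eta> A = f" for h
      using u[OF \<open>A \<in> Ob C\<close>, of h B] that by (auto simp: G_def)
  qed
  ultimately have "adjoint C D F G"
    unfolding adjoint_def using F fG \<eta>(1)
    by (intro conjI exI[of _ \<eta>] ballI) (simp_all add: G_def)
  then show ?thesis by blast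
qed

text \<open>This will supply the left exactness in \<open>geometric_morphism\<close>: a reflector
  with a further left adjoint is itself a right adjoint, so its preservation of finite limits
  follows by transposing cones.\<close>

lemma right_adjoint_left_exact:
  assumes C: "category C" and D: "category D" and adj: "adjoint C D F G"
  shows "left_exact D C G"
proof -
  interpret C: category C by fact
  interpret D: category D by fact
  note F1 = functorD[OF adjointD(1)[OF adj]] and G1 = functorD[OF adjointD(2)[OF adj]]
  obtain \<eta> where \<eta>: "\<And>A. A \<in> Ob C \<Longrightarrow> \<eta> A \<in> hom C A (on_ob G (on_ob F A))"
    and nat: "\<And>f A B. f \<in> hom C A B \<Longrightarrow> on_arr G (on_arr F f) \<cdot>\<^bsub>C\<^esub> \<eta> A = \<eta> B \<cdot>\<^bsub>C\<^esub> f"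
    and univ: "\<And>A B f. A \<in> Ob C \<Longrightarrow> B \<in> Ob D \<Longrightarrow> f \<in> hom C A (on_ob G B) \<Longrightarrow>
           \<exists>!g. g \<in> hom D (on_ob F A) B \<and> on_arr G g \<cdot>\<^bsub>C\<^esub> \<eta> A = f"
    by (rule adjoint_unit[OF adj]) (rule that)
  have Gc: "on_arr G (g \<cdot>\<^bsub>D\<^esub> h) \<cdot>\<^bsub>C\<^esub> \<eta> A = on_arr G g \<cdot>\<^bsub>C\<^esub> (on_arr G h \<cdot>\<^bsub>C\<^esub> \<eta> A)"
    if "A \<in> Ob C" "h \<in> hom D (on_ob F A) B" "g \<in> hom D B B'" for A B B' g h
    using G1(4)[OF that(3,2)] C.assoc[OF G1(3)[OF that(3)] G1(3)[OF that(2)] \<eta>[OF that(1)]] by simp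
  have uq: "g = g'" if "A \<in> Ob C" "g \<in> hom D (on_ob F A) B" "g' \<in> hom D (on_ob F A) B"
    "on_arr G g \<cdot>\<^bsub>C\<^esub> \<eta> A = on_arr G g' \<cdot>\<^bsub>C\<^esub> \<eta> A" for g g' A B
    using univ[OF that(1) D.cod_ob[OF that(2)] C.comp_in[OF G1(3)[OF that(2)] \<eta>[OF that(1)]]] that
    by (metis (no_types, lifting))
  show ?thesis
    unfolding left_exact_def
  proof (intro conjI allI impI)
    show "is_functor D C G" by (rule adjointD(2)[OF adj])
  next
    fix T assume T: "terminal D T"
    then have TO: "T \<in> Ob D" by (simp add: terminal_def)
    have "\<exists>!f. f \<in> hom C A (on_ob G T)" if A: "A \<in> Ob C" for A
    proof -
      obtain t where t: "\<And>h. h \<in> hom D (on_ob F A) T \<longleftrightarrow> h = t"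
        using T F1(1)[OF A] unfolding terminal_def by metis
      have "on_arr G t \<cdot>\<^bsub>C\<^esub> \<eta> A \<in> hom C A (on_ob G T)"
        using C.comp_in[OF G1(3) \<eta>[OF A]] t by blast
      moreover have "f = on_arr G t \<cdot>\<^bsub>C\<^esub> \<eta> A" if "f \<in> hom C A (on_ob G T)" for f
        using univ[OF A TO that] t by metis
      ultimately show ?thesis by blast
    qed
    then show "terminal C (on_ob G T)" using G1(1)[OF TO] by (simp add: terminal_def)
  next
    fix f g p q assume pb: "is_pullback D f g p q"
    define a b d e where "a = Dom D f" and "b = Dom D g" and "d = Cod D f" and "e = Dom D p"
    have f: "f \<in> hom D a d" and g: "g \<in> hom D b d" and p: "p \<in> hom D e a" and q: "q \<in> hom D e b"
      and fpgq: "f \<cdot>\<^bsub>D\<^esub> p = g \<cdot>\<^bsub>D\<^esub> q"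
      using pb by (auto simp: is_pullback_def hom_def a_def b_def d_def e_def)
    have U: "\<exists>!h. h \<in> hom D A e \<and> p \<cdot>\<^bsub>D\<^esub> h = \<alpha> \<and> q \<cdot>\<^bsub>D\<^esub> h = \<beta>"
      if "A \<in> Ob D" "\<alpha> \<in> hom D A a" "\<beta> \<in> hom D A b" "f \<cdot>\<^bsub>D\<^esub> \<alpha> = g \<cdot>\<^bsub>D\<^esub> \<beta>" for A \<alpha> \<beta>
      using pb that unfolding is_pullback_def a_def b_def e_def by blast
    note Gf = G1(3)[OF f] and Gg = G1(3)[OF g] and Gp = G1(3)[OF p] and Gq = G1(3)[OF q]
    have "\<exists>!h. h \<in> hom C A (on_ob G e) \<and> on_arr G p \<cdot>\<^bsub>C\<^esub> h = \<alpha> \<and> on_arr G q \<cdot>\<^bsub>C\<^esub> h = \<beta>"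
      if A: "A \<in> Ob C" and al: "\<alpha> \<in> hom C A (on_ob G a)" and be: "\<beta> \<in> hom C A (on_ob G b)"
        and eq: "on_arr G f \<cdot>\<^bsub>C\<^esub> \<alpha> = on_arr G g \<cdot>\<^bsub>C\<^esub> \<beta>" for A \<alpha> \<beta>
    proof -
      obtain \<alpha>' where a': "\<alpha>' \<in> hom D (on_ob F A) a" "on_arr G \<alpha>' \<cdot>\<^bsub>C\<^esub> \<eta> A = \<alpha>"
        using univ[OF A D.dom_ob[OF f] al] by blast
      obtain \<beta>' where b': "\<beta>' \<in> hom D (on_ob F A) b" "on_arr G \<beta>' \<cdot>\<^bsub>C\<^esub> \<eta> A = \<beta>"
        using univ[OF A D.dom_ob[OF g] be] by blast
      have "f \<cdot>\<^bsub>D\<^esub> \<alpha>' = g \<cdot>\<^bsub>D\<^esub> \<beta>'"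
        by (rule uq[OF A D.comp_in[OF f a'(1)] D.comp_in[OF g b'(1)]])
          (simp add: Gc[OF A a'(1) f] Gc[OF A b'(1) g] a' b' eq)
      with U[OF F1(1)[OF A] a'(1) b'(1)] obtain h' where
        h': "h' \<in> hom D (on_ob F A) e" "p \<cdot>\<^bsub>D\<^esub> h' = \<alpha>'" "q \<cdot>\<^bsub>D\<^esub> h' = \<beta>'"
        and h'u: "\<And>k. k \<in> hom D (on_ob F A) e \<Longrightarrow> p \<cdot>\<^bsub>D\<^esub> k = \<alpha>' \<Longrightarrow> q \<cdot>\<^bsub>D\<^esub> k = \<beta>' \<Longrightarrow> k = h'" by metis
      let ?h = "on_arr G h' \<cdot>\<^bsub>C\<^esub> \<eta> A"
      show ?thesis
      proof (rule ex1I[of _ ?h])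
        show "?h \<in> hom C A (on_ob G e) \<and> on_arr G p \<cdot>\<^bsub>C\<^esub> ?h = \<alpha> \<and> on_arr G q \<cdot>\<^bsub>C\<^esub> ?h = \<beta>"
          using C.comp_in[OF G1(3)[OF h'(1)] \<eta>[OF A]] Gc[OF A h'(1) p] Gc[OF A h'(1) q] h' a' b' by simp
      next
        fix k assume k: "k \<in> hom C A (on_ob G e) \<and> on_arr G p \<cdot>\<^bsub>C\<^esub> k = \<alpha> \<and> on_arr G q \<cdot>\<^bsub>C\<^esub> k = \<beta>"
        obtain k' where k': "k' \<in> hom D (on_ob F A) e" "on_arr G k' \<cdot>\<^bsub>C\<^esub> \<eta> A = k"
          using univ[OF A D.dom_ob[OF p]] k by blast
        have "p \<cdot>\<^bsub>D\<^esub> k' = \<alpha>'"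
          by (rule uq[OF A D.comp_in[OF p k'(1)] a'(1)]) (simp add: Gc[OF A k'(1) p] k' k a')
        moreover have "q \<cdot>\<^bsub>D\<^esub> k' = \<beta>'"
          by (rule uq[OF A D.comp_in[OF q k'(1)] b'(1)]) (simp add: Gc[OF A k'(1) q] k' k b')
        ultimately show "k = ?h" using h'u k' by blast
      qed
    qed
    then show "is_pullback C (on_arr G f) (on_arr G g) (on_arr G p) (on_arr G q)"
      unfolding is_pullback_def
      using homD[OF Gf] homD[OF Gg] homD[OF Gp] homD[OF Gq] Gp Gq
        G1(4)[OF f p] G1(4)[OF g q] fpgq by (simp)
  qed
qed

section \<open>Simplicial sets over a simplicial set\<close>

declare split_paired_All [simp del] split_paired_Ex [simp del]

section \<open>The simplex category\<close>

definition ev :: "simp_op \<Rightarrow> nat \<Rightarrow> nat" where "ev f = fst (snd f)"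

definition mkD :: "nat \<Rightarrow> (nat \<Rightarrow> nat) \<Rightarrow> nat \<Rightarrow> simp_op" where
  "mkD m h n = (m, restrict h {..m}, n)"

lemma Delta_hom:
  "f \<in> hom Delta m n \<longleftrightarrow> (\<exists>h. f = (m, h, n) \<and> h \<in> {..m} \<rightarrow>\<^sub>E {..n} \<and> mono_on {..m} h)"
  by (auto simp: hom_def Delta_def)

lemma Delta_simps:
  "Comp Delta g f = (fst f, compose {..fst f} (fst (snd g)) (fst (snd f)), snd (snd g))"
  "Idt Delta n = (n, \<lambda>i\<in>{..n}. i, n)"
  by (auto simp: Delta_def split: prod.splits)

lemma Delta_Ob [simp]: "Ob Delta = UNIV" by (simp add: Delta_def)

lemma ev_le: "f \<in> hom Delta m n \<Longrightarrow> i \<le> m \<Longrightarrow> ev f i \<le> n"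
  by (auto simp: Delta_hom ev_def)

lemma ev_mono: "f \<in> hom Delta m n \<Longrightarrow> i \<le> j \<Longrightarrow> j \<le> m \<Longrightarrow> ev f i \<le> ev f j"
  by (auto simp: Delta_hom ev_def mono_on_def)

lemma Delta_eqI:
  assumes "f \<in> hom Delta m n" "g \<in> hom Delta m n" "\<And>i. i \<le> m \<Longrightarrow> ev f i = ev g i"
  shows "f = g"
proof -
  obtain h h' where *: "f = (m, h, n)" "h \<in> {..m} \<rightarrow>\<^sub>E {..n}" "g = (m, h', n)" "h' \<in> {..m} \<rightarrow>\<^sub>E {..n}"
    using assms(1,2) by (auto simp: Delta_hom)
  then have "h = h'" using assms(3) by (intro PiE_ext[OF *(2,4)]) (auto simp: ev_def)
  then show ?thesis using * by simp
qed

lemma mkD_in: "mono_on {..m} h \<Longrightarrow> (\<And>i. i \<le> m \<Longrightarrow> h i \<le> n) \<Longrightarrow> mkD m h n \<in> hom Delta m n"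
  by (auto simp: Delta_hom mkD_def mono_on_def)

lemma ev_mkD [simp]: "i \<le> m \<Longrightarrow> ev (mkD m h n) i = h i"
  by (simp add: ev_def mkD_def)

lemma Delta_comp_in: "g \<in> hom Delta n k \<Longrightarrow> f \<in> hom Delta m n \<Longrightarrow> g \<cdot>\<^bsub>Delta\<^esub> f \<in> hom Delta m k"
proof -
  assume "g \<in> hom Delta n k" "f \<in> hom Delta m n"
  then obtain h h' where *: "g = (n, h, k)" "h \<in> {..n} \<rightarrow>\<^sub>E {..k}" "mono_on {..n} h"
    "f = (m, h', n)" "h' \<in> {..m} \<rightarrow>\<^sub>E {..n}" "mono_on {..m} h'" by (auto simp: Delta_hom)
  have "mono_on {..m} (compose {..m} h h')"
    using * by (auto simp: mono_on_def compose_def PiE_def Pi_def)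
  moreover have "compose {..m} h h' \<in> {..m} \<rightarrow>\<^sub>E {..k}" using * by (auto simp: compose_def PiE_def Pi_def)
  ultimately show ?thesis using * by (simp add: Delta_hom Delta_simps)
qed

lemma ev_comp:
  "g \<in> hom Delta n k \<Longrightarrow> f \<in> hom Delta m n \<Longrightarrow> i \<le> m \<Longrightarrow> ev (g \<cdot>\<^bsub>Delta\<^esub> f) i = ev g (ev f i)"
  by (auto simp: Delta_hom Delta_simps compose_def ev_def)

lemma Delta_id_in: "Idt Delta n \<in> hom Delta n n"
  by (auto simp: Delta_hom Delta_simps mono_on_def)

lemma ev_id [simp]: "i \<le> n \<Longrightarrow> ev (Idt Delta n) i = i"
  by (simp add: Delta_simps ev_def)

lemma category_Delta: "category Delta"
proof
  fix h g f A B D D' assume h: "h \<in> hom Delta D D'" and g: "g \<in> hom Delta B D" and f: "f \<in> hom Delta A B"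
  show "h \<cdot>\<^bsub>Delta\<^esub> (g \<cdot>\<^bsub>Delta\<^esub> f) = (h \<cdot>\<^bsub>Delta\<^esub> g) \<cdot>\<^bsub>Delta\<^esub> f"
    using Delta_comp_in[OF h g] Delta_comp_in[OF g f] h g f
    by (intro Delta_eqI[of _ A D']) (auto intro: Delta_comp_in simp: ev_comp ev_le)
next
  fix f A B assume f: "f \<in> hom Delta A B"
  show "Idt Delta B \<cdot>\<^bsub>Delta\<^esub> f = f"
    by (rule Delta_eqI[OF Delta_comp_in[OF Delta_id_in f] f])
      (simp add: ev_comp[OF Delta_id_in f] ev_le[OF f])
  show "f \<cdot>\<^bsub>Delta\<^esub> Idt Delta A = f"
    by (rule Delta_eqI[OF Delta_comp_in[OF f Delta_id_in] f]) (simp add: ev_comp[OF f Delta_id_in])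
qed (auto simp: Delta_id_in Delta_comp_in)

interpretation Delta: category Delta by (rule category_Delta)

section \<open>The base category of sets\<close>

lemma set_hom: "f \<in> hom (set_cat r) A B \<longleftrightarrow>
    (\<exists>h. f = (A, h, B) \<and> |A| <o r \<and> |B| <o r \<and> h \<in> A \<rightarrow>\<^sub>E B)"
  by (auto simp: hom_def set_cat_def)

lemma set_simps:
  "Comp (set_cat r) g f = (fst f, compose (fst f) (fst (snd g)) (fst (snd f)), snd (snd g))"
  "Idt (set_cat r) A = (A, \<lambda>x\<in>A. x, A)"
  by (auto simp: set_cat_def split: prod.splits)

lemma set_Ob: "A \<in> Ob (set_cat r) \<longleftrightarrow> |A| <o r" by (simp add: set_cat_def)

lemma set_hom_card: "f \<in> hom (set_cat r) A B \<Longrightarrow> |A| <o r \<and> |B| <o r"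
  by (auto simp: set_hom)

lemma app_in: "f \<in> hom (set_cat r) A B \<Longrightarrow> a \<in> A \<Longrightarrow> app f a \<in> B"
  by (auto simp: set_hom app_def)

lemma set_comp_in: "g \<in> hom (set_cat r) B D \<Longrightarrow> f \<in> hom (set_cat r) A B \<Longrightarrow>
    g \<cdot>\<^bsub>set_cat r\<^esub> f \<in> hom (set_cat r) A D"
  by (auto simp: set_hom set_simps compose_def PiE_def Pi_def)

lemma app_comp: "g \<in> hom (set_cat r) B D \<Longrightarrow> f \<in> hom (set_cat r) A B \<Longrightarrow> a \<in> A \<Longrightarrow>
    app (g \<cdot>\<^bsub>set_cat r\<^esub> f) a = app g (app f a)"
  by (auto simp: set_hom set_simps compose_def app_def)

lemma set_id_in: "|A| <o r \<Longrightarrow> Idt (set_cat r) A \<in> hom (set_cat r) A A"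
  by (auto simp: set_hom set_simps)

lemma app_id [simp]: "a \<in> A \<Longrightarrow> app (Idt (set_cat r) A) a = a"
  by (simp add: set_simps app_def)

lemma set_eqI:
  assumes "f \<in> hom (set_cat r) A B" "g \<in> hom (set_cat r) A B" "\<And>a. a \<in> A \<Longrightarrow> app f a = app g a"
  shows "f = g"
proof -
  obtain h h' where *: "f = (A, h, B)" "h \<in> A \<rightarrow>\<^sub>E B" "g = (A, h', B)" "h' \<in> A \<rightarrow>\<^sub>E B"
    using assms(1,2) by (auto simp: set_hom)
  then have "h = h'" using assms(3) by (intro PiE_ext[OF *(2,4)]) (auto simp: app_def)
  then show ?thesis using * by simp
qed

lemma category_set: "category (set_cat r)"
proof
  show "h \<cdot>\<^bsub>set_cat r\<^esub> (g \<cdot>\<^bsub>set_cat r\<^esub> f) = (h \<cdot>\<^bsub>set_cat r\<^esub> g) \<cdot>\<^bsub>set_cat r\<^esub> f"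
    if "h \<in> hom (set_cat r) D D'" "g \<in> hom (set_cat r) B D" "f \<in> hom (set_cat r) A B" for h g f A B D D'
  proof (rule set_eqI[of _ r A D'])
    fix a assume "a \<in> A"
    then show "app (h \<cdot>\<^bsub>set_cat r\<^esub> (g \<cdot>\<^bsub>set_cat r\<^esub> f)) a = app ((h \<cdot>\<^bsub>set_cat r\<^esub> g) \<cdot>\<^bsub>set_cat r\<^esub> f) a"
      using app_comp[OF that(1) set_comp_in[OF that(2,3)]] app_comp[OF set_comp_in[OF that(1,2)] that(3)]
        app_comp[OF that(2,3)] app_comp[OF that(1,2)] app_in[OF that(3)] by simp
  qed (use that in \<open>auto intro!: set_comp_in\<close>)
  show "Idt (set_cat r) B \<cdot>\<^bsub>set_cat r\<^esub> f = f" if "f \<in> hom (set_cat r) A B" for f A B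
  proof (rule set_eqI[of _ r A B])
    have i: "Idt (set_cat r) B \<in> hom (set_cat r) B B" using set_hom_card[OF that] by (blast intro: set_id_in)
    show "Idt (set_cat r) B \<cdot>\<^bsub>set_cat r\<^esub> f \<in> hom (set_cat r) A B" by (rule set_comp_in[OF i that])
    show "app (Idt (set_cat r) B \<cdot>\<^bsub>set_cat r\<^esub> f) a = app f a" if "a \<in> A" for a
      using app_comp[OF i \<open>f \<in> _\<close> that] app_in[OF \<open>f \<in> _\<close> that] by simp
  qed fact
  show "f \<cdot>\<^bsub>set_cat r\<^esub> Idt (set_cat r) A = f" if "f \<in> hom (set_cat r) A B" for f A B
  proof (rule set_eqI[of _ r A B])
    have i: "Idt (set_cat r) A \<in> hom (set_cat r) A A" using set_hom_card[OF that] by (blast intro: set_id_in)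
    show "f \<cdot>\<^bsub>set_cat r\<^esub> Idt (set_cat r) A \<in> hom (set_cat r) A B" by (rule set_comp_in[OF that i])
    show "app (f \<cdot>\<^bsub>set_cat r\<^esub> Idt (set_cat r) A) a = app f a" if "a \<in> A" for a
      using app_comp[OF \<open>f \<in> _\<close> i that] that by simp
  qed fact
qed (auto simp: set_Ob intro: set_id_in set_comp_in dest: set_hom_card)

section \<open>Functor categories\<close>

lemma functor_cat_simps:
  "Ob (functor_cat C D) =
     {F. is_functor C D F \<and> on_ob F \<in> extensional (Ob C) \<and> on_arr F \<in> extensional (Arr C)}"
  "Idt (functor_cat C D) F = (F, \<lambda>A\<in>Ob C. Idt D (on_ob F A), F)"
  "Comp (functor_cat C D) m' m = (fst m, \<lambda>A\<in>Ob C. fst (snd m') A \<cdot>\<^bsub>D\<^esub> fst (snd m) A, snd (snd m'))"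
  "Dom (functor_cat C D) = fst" "Cod (functor_cat C D) = (\<lambda>m. snd (snd m))"
  by (auto simp: functor_cat_def Let_def fun_eq_iff split: prod.splits)

lemma functor_cat_hom:
  "m \<in> hom (functor_cat C D) F G \<longleftrightarrow> (\<exists>\<alpha>. m = (F, \<alpha>, G) \<and> F \<in> Ob (functor_cat C D) \<and>
     G \<in> Ob (functor_cat C D) \<and> \<alpha> \<in> extensional (Ob C) \<and>
     (\<forall>A \<in> Ob C. \<alpha> A \<in> hom D (on_ob F A) (on_ob G A)) \<and>
     (\<forall>f \<in> Arr C. \<alpha> (Cod C f) \<cdot>\<^bsub>D\<^esub> on_arr F f = on_arr G f \<cdot>\<^bsub>D\<^esub> \<alpha> (Dom C f)))"
  by (auto simp: functor_cat_def Let_def hom_def)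

lemma category_functor_cat:
  assumes C: "category C" and D: "category D"
  shows "category (functor_cat C D)"
proof -
  interpret C: category C by fact
  interpret D: category D by fact
  let ?P = "functor_cat C D"
  have isf: "\<And>F. F \<in> Ob ?P \<Longrightarrow> is_functor C D F" by (simp add: functor_cat_simps)
  have comp: "g \<cdot>\<^bsub>?P\<^esub> f \<in> hom ?P F H" if "g \<in> hom ?P G H" "f \<in> hom ?P F G" for f g F G H
  proof -
    from that obtain \<alpha> \<beta> where f: "f = (F, \<alpha>, G)" and g: "g = (G, \<beta>, H)"
      and F: "F \<in> Ob ?P" and G: "G \<in> Ob ?P" and H: "H \<in> Ob ?P"
      and a: "\<And>A. A \<in> Ob C \<Longrightarrow> \<alpha> A \<in> hom D (on_ob F A) (on_ob G A)"
      and b: "\<And>A. A \<in> Ob C \<Longrightarrow> \<beta> A \<in> hom D (on_ob G A) (on_ob H A)"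
      and na: "\<And>f. f \<in> Arr C \<Longrightarrow> \<alpha> (Cod C f) \<cdot>\<^bsub>D\<^esub> on_arr F f = on_arr G f \<cdot>\<^bsub>D\<^esub> \<alpha> (Dom C f)"
      and nb: "\<And>f. f \<in> Arr C \<Longrightarrow> \<beta> (Cod C f) \<cdot>\<^bsub>D\<^esub> on_arr G f = on_arr H f \<cdot>\<^bsub>D\<^esub> \<beta> (Dom C f)"
      by (auto simp: functor_cat_hom)
    have "(\<beta> (Cod C h) \<cdot>\<^bsub>D\<^esub> \<alpha> (Cod C h)) \<cdot>\<^bsub>D\<^esub> on_arr F h = on_arr H h \<cdot>\<^bsub>D\<^esub> (\<beta> (Dom C h) \<cdot>\<^bsub>D\<^esub> \<alpha> (Dom C h))"
      if h: "h \<in> Arr C" for h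
    proof -
      have ob: "Dom C h \<in> Ob C" "Cod C h \<in> Ob C" using C.dom_ob C.cod_ob homI[OF h] by auto
      note Fh = functorD(3)[OF isf[OF F] homI[OF h]] and Gh = functorD(3)[OF isf[OF G] homI[OF h]]
        and Hh = functorD(3)[OF isf[OF H] homI[OF h]]
      show ?thesis
        using D.assoc[OF b[OF ob(2)] a[OF ob(2)] Fh] D.assoc[OF b[OF ob(2)] Gh a[OF ob(1)]]
          D.assoc[OF Hh b[OF ob(1)] a[OF ob(1)]] na[OF h] nb[OF h] by simp
    qed
    moreover have "Dom C h \<in> Ob C" "Cod C h \<in> Ob C" if "h \<in> Arr C" for h
      using C.dom_ob C.cod_ob homI[OF that] by auto
    ultimately show ?thesis
      using F H D.comp_in[OF b a] by (auto simp: functor_cat_hom f g functor_cat_simps(2-))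
  qed
  show ?thesis
  proof
    fix F assume F: "F \<in> Ob ?P"
    note F1 = functorD[OF isf[OF F]]
    have "Dom C h \<in> Ob C" "Cod C h \<in> Ob C" if "h \<in> Arr C" for h
      using C.dom_ob C.cod_ob homI[OF that] by auto
    then show "Idt ?P F \<in> hom ?P F F"
      using F D.id_in[OF F1(1)] D.idl[OF F1(3)[OF homI]] D.idr[OF F1(3)[OF homI]]
      by (auto simp: functor_cat_hom functor_cat_simps(2-))
  next
    fix f F G assume f: "f \<in> hom ?P F G"
    show "Idt ?P G \<cdot>\<^bsub>?P\<^esub> f = f" "f \<cdot>\<^bsub>?P\<^esub> Idt ?P F = f"
      using f by (auto simp: functor_cat_hom functor_cat_simps(2-) fun_eq_iff restrict_def extensional_def)
        (metis D.idl, metis D.idr)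
  next
    fix h g f F G H K assume "h \<in> hom ?P H K" "g \<in> hom ?P G H" "f \<in> hom ?P F G"
    then show "h \<cdot>\<^bsub>?P\<^esub> (g \<cdot>\<^bsub>?P\<^esub> f) = (h \<cdot>\<^bsub>?P\<^esub> g) \<cdot>\<^bsub>?P\<^esub> f"
      by (auto simp: functor_cat_hom functor_cat_simps(2-) fun_eq_iff restrict_def) (metis D.assoc)
  qed ((erule comp, assumption) | (auto simp: functor_cat_hom)[1])+
qed

lemma category_simp: "category (simp_sets r)"
  unfolding simp_sets_def presheaves_def
  by (intro category_functor_cat category_op category_Delta category_set)

section \<open>Simplicial sets by elements and actions\<close>

definition act :: "'u simp_set \<Rightarrow> simp_op \<Rightarrow> 'u \<Rightarrow> 'u" where "act F f a = app (on_arr F f) a"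

definition ap :: "'u simp_map \<Rightarrow> nat \<Rightarrow> 'u \<Rightarrow> 'u" where "ap \<mu> k a = app (fst (snd \<mu>) k) a"

lemma simp_Ob: "F \<in> Ob (simp_sets r) \<longleftrightarrow>
    is_functor (op_cat Delta) (set_cat r) F \<and> on_arr F \<in> extensional (Arr Delta)"
  by (auto simp: simp_sets_def presheaves_def functor_cat_simps(1))

lemma
  assumes F: "F \<in> Ob (simp_sets r)"
  shows simp_card: "|on_ob F k| <o r"
    and act_hom: "f \<in> hom Delta m k \<Longrightarrow> on_arr F f \<in> hom (set_cat r) (on_ob F k) (on_ob F m)"
    and act_in: "f \<in> hom Delta m k \<Longrightarrow> a \<in> on_ob F k \<Longrightarrow> act F f a \<in> on_ob F m"
    and act_id: "a \<in> on_ob F k \<Longrightarrow> act F (Idt Delta k) a = a"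
    and act_comp: "f \<in> hom Delta m k \<Longrightarrow> g \<in> hom Delta l m \<Longrightarrow> a \<in> on_ob F k \<Longrightarrow>
        act F g (act F f a) = act F (f \<cdot>\<^bsub>Delta\<^esub> g) a"
proof -
  note F1 = functorD[OF conjunct1[OF F[unfolded simp_Ob]]]
  show "|on_ob F k| <o r" using F1(1)[of k] by (simp add: set_Ob)
  show h: "on_arr F f \<in> hom (set_cat r) (on_ob F k) (on_ob F m)" if "f \<in> hom Delta m k" for f m k
    using F1(3)[of f k m] that by simp
  show "act F f a \<in> on_ob F m" if "f \<in> hom Delta m k" "a \<in> on_ob F k"
    using app_in[OF h[OF that(1)] that(2)] by (simp add: act_def)
  show "act F (Idt Delta k) a = a" if "a \<in> on_ob F k"
    using F1(2)[of k] that by (simp add: act_def)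
  show "act F g (act F f a) = act F (f \<cdot>\<^bsub>Delta\<^esub> g) a"
    if "f \<in> hom Delta m k" "g \<in> hom Delta l m" "a \<in> on_ob F k"
    using app_comp[OF h[OF that(2)] h[OF that(1)] that(3)] F1(4)[of g m l f k] that by (simp add: act_def)
qed

text \<open>The prescribed action is reproduced on well-typed arguments only: elsewhere the arrow
  part has to be \<open>undefined\<close>, as objects of \<open>simp_sets\<close> are required to be
  extensional.\<close>

lemma simp_ex:
  assumes "\<And>k. |B k| <o r"
    and "\<And>f m k a. f \<in> hom Delta m k \<Longrightarrow> a \<in> B k \<Longrightarrow> ac f a \<in> B m"
    and "\<And>k a. a \<in> B k \<Longrightarrow> ac (Idt Delta k) a = a"
    and "\<And>f g m k l a. f \<in> hom Delta m k \<Longrightarrow> g \<in> hom Delta l m \<Longrightarrow> a \<in> B k \<Longrightarrow>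
        ac g (ac f a) = ac (f \<cdot>\<^bsub>Delta\<^esub> g) a"
  shows "\<exists>F \<in> Ob (simp_sets r). on_ob F = B \<and>
     (\<forall>f m k a. f \<in> hom Delta m k \<longrightarrow> a \<in> B k \<longrightarrow> act F f a = ac f a)"
proof -
  define F where "F = \<lparr>on_ob = B, on_arr = (\<lambda>f\<in>Arr Delta.
     (B (Cod Delta f), restrict (ac f) (B (Cod Delta f)), B (Dom Delta f)))\<rparr>"
  have arr: "on_arr F f = (B k, restrict (ac f) (B k), B m)" if "f \<in> hom Delta m k" for f m k
    using homD[OF that] by (auto simp: F_def)
  have hom: "on_arr F f \<in> hom (set_cat r) (B k) (B m)" if "f \<in> hom Delta m k" for f m k
    unfolding arr[OF that] using assms(1) assms(2)[OF that] by (auto simp: set_hom)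
  have app: "app (on_arr F f) a = ac f a" if "f \<in> hom Delta m k" "a \<in> B k" for f m k a
    using arr[OF that(1)] that(2) by (simp add: app_def)
  have "is_functor (op_cat Delta) (set_cat r) F"
    unfolding is_functor_def op_simps
  proof (intro conjI ballI impI)
    fix k show "on_ob F k \<in> Ob (set_cat r)" using assms(1) by (simp add: F_def set_Ob)
    have ob: "on_ob F k = B k" by (simp add: F_def)
    show "on_arr F (Idt Delta k) = Idt (set_cat r) (on_ob F k)"
      unfolding ob
      by (rule set_eqI[OF hom[OF Delta_id_in] set_id_in[OF assms(1)]]) (simp add: assms(3) app[OF Delta_id_in])
  next
    fix f assume "f \<in> Arr Delta"
    from hom[OF homI[OF this]]
    show "on_arr F f \<in> hom (set_cat r) (on_ob F (Cod Delta f)) (on_ob F (Dom Delta f))" by (simp add: F_def)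
  next
    fix f g assume "f \<in> Arr Delta" "g \<in> Arr Delta" "Cod Delta g = Dom Delta f"
    then obtain l m k where f: "f \<in> hom Delta m k" and g: "g \<in> hom Delta l m" by (auto simp: hom_def)
    show "on_arr F (f \<cdot>\<^bsub>Delta\<^esub> g) = on_arr F g \<cdot>\<^bsub>set_cat r\<^esub> on_arr F f"
      by (rule set_eqI[OF hom[OF Delta_comp_in[OF f g]] set_comp_in[OF hom[OF g] hom[OF f]]])
        (simp add: app_comp[OF hom[OF g] hom[OF f]] app[OF Delta_comp_in[OF f g]] app[OF f] app[OF g]
          assms(4)[OF f g] assms(2)[OF f])
  qed
  then have "F \<in> Ob (simp_sets r)" by (simp add: simp_Ob F_def)
  moreover have "on_ob F = B" by (simp add: F_def)
  moreover have "act F f a = ac f a" if "f \<in> hom Delta m k" "a \<in> B k" for f m k a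
    using app[OF that] by (simp add: act_def)
  ultimately show ?thesis by blast
qed

lemma simp_hom: "\<mu> \<in> hom (simp_sets r) F G \<longleftrightarrow> (\<exists>\<alpha>. \<mu> = (F, \<alpha>, G) \<and> F \<in> Ob (simp_sets r) \<and>
     G \<in> Ob (simp_sets r) \<and> (\<forall>k. \<alpha> k \<in> hom (set_cat r) (on_ob F k) (on_ob G k)) \<and>
     (\<forall>f \<in> Arr Delta. \<alpha> (Dom Delta f) \<cdot>\<^bsub>set_cat r\<^esub> on_arr F f = on_arr G f \<cdot>\<^bsub>set_cat r\<^esub> \<alpha> (Cod Delta f)))"
  by (simp add: simp_sets_def presheaves_def functor_cat_hom)

lemma simp_simps: "Dom (simp_sets r) = fst" "Cod (simp_sets r) = (\<lambda>m. snd (snd m))"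
  by (simp_all add: simp_sets_def presheaves_def functor_cat_simps)

lemma
  assumes "\<mu> \<in> hom (simp_sets r) F G"
  shows ap_in: "a \<in> on_ob F k \<Longrightarrow> ap \<mu> k a \<in> on_ob G k"
    and ap_act: "f \<in> hom Delta m k \<Longrightarrow> a \<in> on_ob F k \<Longrightarrow> ap \<mu> m (act F f a) = act G f (ap \<mu> k a)"
    and ap_hom: "fst (snd \<mu>) k \<in> hom (set_cat r) (on_ob F k) (on_ob G k)"
proof -
  from assms obtain \<alpha> where mu: "\<mu> = (F, \<alpha>, G)" and FG: "F \<in> Ob (simp_sets r)" "G \<in> Ob (simp_sets r)"
    and h: "\<And>k. \<alpha> k \<in> hom (set_cat r) (on_ob F k) (on_ob G k)"
    and n: "\<And>f. f \<in> Arr Delta \<Longrightarrow>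
      \<alpha> (Dom Delta f) \<cdot>\<^bsub>set_cat r\<^esub> on_arr F f = on_arr G f \<cdot>\<^bsub>set_cat r\<^esub> \<alpha> (Cod Delta f)"
    by (auto simp: simp_hom)
  show "a \<in> on_ob F k \<Longrightarrow> ap \<mu> k a \<in> on_ob G k" using app_in[OF h] by (simp add: ap_def mu)
  show "fst (snd \<mu>) k \<in> hom (set_cat r) (on_ob F k) (on_ob G k)" using h by (simp add: mu)
  assume f: "f \<in> hom Delta m k" and a: "a \<in> on_ob F k"
  show "ap \<mu> m (act F f a) = act G f (ap \<mu> k a)"
    using app_comp[OF h act_hom[OF FG(1) f] a] app_comp[OF act_hom[OF FG(2) f] h a] n[of f] homD[OF f]
    by (simp add: ap_def act_def mu)
qed

lemma simp_hom_eqI: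
  assumes "\<mu> \<in> hom (simp_sets r) F G" "\<nu> \<in> hom (simp_sets r) F G"
    and "\<And>k a. a \<in> on_ob F k \<Longrightarrow> ap \<mu> k a = ap \<nu> k a"
  shows "\<mu> = \<nu>"
proof -
  have "fst (snd \<mu>) k = fst (snd \<nu>) k" for k
    by (rule set_eqI[OF ap_hom[OF assms(1)] ap_hom[OF assms(2)]]) (use assms(3) in \<open>simp add: ap_def\<close>)
  then show ?thesis using assms(1,2) by (auto simp: simp_hom fun_eq_iff)
qed

lemma simp_hom_ex:
  assumes F: "F \<in> Ob (simp_sets r)" and G: "G \<in> Ob (simp_sets r)"
    and i: "\<And>k a. a \<in> on_ob F k \<Longrightarrow> \<phi> k a \<in> on_ob G k"
    and n: "\<And>f m k a. f \<in> hom Delta m k \<Longrightarrow> a \<in> on_ob F k \<Longrightarrow> \<phi> m (act F f a) = act G f (\<phi> k a)"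
  shows "\<exists>\<mu> \<in> hom (simp_sets r) F G. \<forall>k. \<forall>a \<in> on_ob F k. ap \<mu> k a = \<phi> k a"
proof -
  define \<alpha> where "\<alpha> k = (on_ob F k, restrict (\<phi> k) (on_ob F k), on_ob G k)" for k
  have h: "\<alpha> k \<in> hom (set_cat r) (on_ob F k) (on_ob G k)" for k
    using simp_card[OF F] simp_card[OF G] i by (auto simp: set_hom \<alpha>_def)
  have app: "app (\<alpha> k) a = \<phi> k a" if "a \<in> on_ob F k" for k a using that by (simp add: app_def \<alpha>_def)
  have "\<alpha> (Dom Delta f) \<cdot>\<^bsub>set_cat r\<^esub> on_arr F f = on_arr G f \<cdot>\<^bsub>set_cat r\<^esub> \<alpha> (Cod Delta f)" if "f \<in> Arr Delta" for f
  proof -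
    note f = homI[OF that]
    note Ff = act_hom[OF F f] and Gf = act_hom[OF G f]
    show ?thesis
    proof (rule set_eqI[OF set_comp_in[OF h Ff] set_comp_in[OF Gf h]])
      fix a assume a: "a \<in> on_ob F (Cod Delta f)"
      show "app (\<alpha> (Dom Delta f) \<cdot>\<^bsub>set_cat r\<^esub> on_arr F f) a = app (on_arr G f \<cdot>\<^bsub>set_cat r\<^esub> \<alpha> (Cod Delta f)) a"
        using app_comp[OF h Ff a] app_comp[OF Gf h a] app[OF a] app[OF act_in[OF F f a]] n[OF f a]
        by (simp add: act_def)
    qed
  qed
  then have "(F, \<alpha>, G) \<in> hom (simp_sets r) F G" using F G h by (auto simp: simp_hom)
  then show ?thesis using app by (auto simp: ap_def intro!: bexI[of _ "(F, \<alpha>, G)"])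
qed

lemma ap_comp:
  assumes "\<nu> \<in> hom (simp_sets r) G H" "\<mu> \<in> hom (simp_sets r) F G" "a \<in> on_ob F k"
  shows "ap (\<nu> \<cdot>\<^bsub>simp_sets r\<^esub> \<mu>) k a = ap \<nu> k (ap \<mu> k a)"
proof -
  have "fst (snd (\<nu> \<cdot>\<^bsub>simp_sets r\<^esub> \<mu>)) k = fst (snd \<nu>) k \<cdot>\<^bsub>set_cat r\<^esub> fst (snd \<mu>) k"
    by (simp add: simp_sets_def presheaves_def functor_cat_simps)
  then show ?thesis using app_comp[OF ap_hom[OF assms(1)] ap_hom[OF assms(2)] assms(3)] by (simp add: ap_def)
qed

lemma ap_id: "a \<in> on_ob F k \<Longrightarrow> ap (Idt (simp_sets r) F) k a = a"
  by (simp add: ap_def simp_sets_def presheaves_def functor_cat_simps)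


section \<open>The slice over a fixed simplicial set\<close>

locale simp_over =
  fixes r :: "'u rel" and X :: "'u simp_set"
  assumes univ: "universe r" and X: "X \<in> Ob (simp_sets r)"
begin

definition E :: "('u simp_map, 'u simp_map \<times> 'u simp_map \<times> 'u simp_map) cat" where
  "E = slice (simp_sets r) X"

sublocale E: category E
  unfolding E_def by (intro category_slice category_simp)

text \<open>An object \<open>p\<close> of the slice is handled as a presheaf on the category of elements of \<open>X\<close>: an element
  \<open>a\<close> of \<open>el p k\<close> lies over the object \<open>(lb p k a, k)\<close>.\<close>

definition el :: "'u simp_map \<Rightarrow> nat \<Rightarrow> 'u set" where "el p = on_ob (fst p)"
definition res :: "'u simp_map \<Rightarrow> simp_op \<Rightarrow> 'u \<Rightarrow> 'u" where "res p = act (fst p)"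
definition lb :: "'u simp_map \<Rightarrow> nat \<Rightarrow> 'u \<Rightarrow> 'u" where "lb p = ap p"
definition eap :: "'u simp_map \<times> 'u simp_map \<times> 'u simp_map \<Rightarrow> nat \<Rightarrow> 'u \<Rightarrow> 'u" where
  "eap h = ap (fst (snd h))"

lemma E_Ob: "p \<in> Ob E \<longleftrightarrow> p \<in> hom (simp_sets r) (fst p) X"
  by (simp add: E_def slice_Ob simp_simps)

lemma E_Ob_simp: "p \<in> Ob E \<Longrightarrow> fst p \<in> Ob (simp_sets r)"
  using category.dom_ob[OF category_simp] E_Ob by blast

lemma E_hom: "h \<in> hom E p q \<longleftrightarrow> p \<in> Ob E \<and> q \<in> Ob E \<and>
     (\<exists>f. h = (p, f, q) \<and> f \<in> hom (simp_sets r) (fst p) (fst q) \<and> q \<cdot>\<^bsub>simp_sets r\<^esub> f = p)"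
  by (simp add: E_def slice_hom simp_simps)

lemma
  assumes p: "p \<in> Ob E"
  shows el_card: "|el p k| <o r"
    and res_in: "f \<in> hom Delta m k \<Longrightarrow> a \<in> el p k \<Longrightarrow> res p f a \<in> el p m"
    and res_id: "a \<in> el p k \<Longrightarrow> res p (Idt Delta k) a = a"
    and res_comp: "f \<in> hom Delta m k \<Longrightarrow> g \<in> hom Delta l m \<Longrightarrow> a \<in> el p k \<Longrightarrow>
        res p g (res p f a) = res p (f \<cdot>\<^bsub>Delta\<^esub> g) a"
    and lb_in: "a \<in> el p k \<Longrightarrow> lb p k a \<in> on_ob X k"
    and lb_res: "f \<in> hom Delta m k \<Longrightarrow> a \<in> el p k \<Longrightarrow> lb p m (res p f a) = act X f (lb p k a)"
  using simp_card[OF E_Ob_simp[OF p]] act_in[OF E_Ob_simp[OF p]] act_id[OF E_Ob_simp[OF p]]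
    act_comp[OF E_Ob_simp[OF p]] ap_in[OF p[unfolded E_Ob]] ap_act[OF p[unfolded E_Ob]]
  by (simp_all add: el_def res_def lb_def)

lemma
  assumes h: "h \<in> hom E p q"
  shows eap_in: "a \<in> el p k \<Longrightarrow> eap h k a \<in> el q k"
    and eap_lb: "a \<in> el p k \<Longrightarrow> lb q k (eap h k a) = lb p k a"
    and eap_res: "f \<in> hom Delta m k \<Longrightarrow> a \<in> el p k \<Longrightarrow> eap h m (res p f a) = res q f (eap h k a)"
proof -
  obtain f where f: "h = (p, f, q)" "f \<in> hom (simp_sets r) (fst p) (fst q)" "q \<cdot>\<^bsub>simp_sets r\<^esub> f = p"
    "q \<in> Ob E" using h by (auto simp: E_hom)
  show "a \<in> el p k \<Longrightarrow> eap h k a \<in> el q k" using ap_in[OF f(2)] by (simp add: el_def eap_def f(1))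
  show "a \<in> el p k \<Longrightarrow> lb q k (eap h k a) = lb p k a"
    using ap_comp[OF f(4)[unfolded E_Ob] f(2), of a k] f(3) by (simp add: el_def eap_def lb_def f(1))
  show "f \<in> hom Delta m k \<Longrightarrow> a \<in> el p k \<Longrightarrow> eap h m (res p f a) = res q f (eap h k a)" for f
    using ap_act[OF f(2)] by (simp add: el_def eap_def res_def f(1))
qed

lemma eap_comp:
  assumes "g \<in> hom E q s" "h \<in> hom E p q" "a \<in> el p k"
  shows "eap (g \<cdot>\<^bsub>E\<^esub> h) k a = eap g k (eap h k a)"
proof -
  have "fst (snd (g \<cdot>\<^bsub>E\<^esub> h)) = fst (snd g) \<cdot>\<^bsub>simp_sets r\<^esub> fst (snd h)" by (simp add: E_def)
  moreover have "fst (snd g) \<in> hom (simp_sets r) (fst q) (fst s)" "fst (snd h) \<in> hom (simp_sets r) (fst p) (fst q)"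
    using assms by (auto simp: E_hom)
  ultimately show ?thesis
    using ap_comp[of "fst (snd g)" r "fst q" "fst s" "fst (snd h)" "fst p" a k] assms(3) by (simp add: eap_def el_def)
qed

lemma eap_id: "a \<in> el p k \<Longrightarrow> eap (Idt E p) k a = a"
  by (simp add: E_def eap_def el_def ap_id simp_simps)

lemma hom_eqI:
  assumes "h \<in> hom E p q" "h' \<in> hom E p q" "\<And>k a. a \<in> el p k \<Longrightarrow> eap h k a = eap h' k a"
  shows "h = h'"
  using assms simp_hom_eqI[of "fst (snd h)" r "fst p" "fst q" "fst (snd h')"]
  by (auto simp: E_hom el_def eap_def)

lemma hom_ex:
  assumes p: "p \<in> Ob E" and q: "q \<in> Ob E"
    and i: "\<And>k a. a \<in> el p k \<Longrightarrow> \<phi> k a \<in> el q k"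
    and l: "\<And>k a. a \<in> el p k \<Longrightarrow> lb q k (\<phi> k a) = lb p k a"
    and n: "\<And>f m k a. f \<in> hom Delta m k \<Longrightarrow> a \<in> el p k \<Longrightarrow> \<phi> m (res p f a) = res q f (\<phi> k a)"
  shows "\<exists>h \<in> hom E p q. \<forall>k. \<forall>a \<in> el p k. eap h k a = \<phi> k a"
proof -
  obtain \<mu> where mu: "\<mu> \<in> hom (simp_sets r) (fst p) (fst q)" "\<And>k a. a \<in> el p k \<Longrightarrow> ap \<mu> k a = \<phi> k a"
    using simp_hom_ex[OF E_Ob_simp[OF p] E_Ob_simp[OF q], of \<phi>] i n unfolding el_def res_def by blast
  interpret S: category "simp_sets r" by (rule category_simp)
  have "q \<cdot>\<^bsub>simp_sets r\<^esub> \<mu> = p"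
    by (rule simp_hom_eqI[OF S.comp_in[OF q[unfolded E_Ob] mu(1)] p[unfolded E_Ob]])
      (use ap_comp[OF q[unfolded E_Ob] mu(1)] mu(2) l in \<open>auto simp: el_def lb_def\<close>)
  then have "(p, \<mu>, q) \<in> hom E p q" using p q mu by (auto simp: E_hom)
  then show ?thesis using mu(2) by (intro bexI[of _ "(p, \<mu>, q)"]) (auto simp: eap_def)
qed

text \<open>Presheaves with values in an arbitrary type \<open>'b\<close> are encoded in \<open>'u\<close> by a family \<open>e\<close> of bijections.\<close>

definition presents :: "(nat \<Rightarrow> 'b set) \<Rightarrow> (simp_op \<Rightarrow> 'b \<Rightarrow> 'b) \<Rightarrow> (nat \<Rightarrow> 'b \<Rightarrow> 'u) \<Rightarrow>
    (nat \<Rightarrow> 'b \<Rightarrow> 'u) \<Rightarrow> 'u simp_map \<Rightarrow> bool" where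
  "presents B ac l e p \<longleftrightarrow> p \<in> Ob E \<and> (\<forall>k. bij_betw (e k) (B k) (el p k)) \<and>
     (\<forall>k. \<forall>a \<in> B k. lb p k (e k a) = l k a) \<and>
     (\<forall>f m k. \<forall>a \<in> B k. f \<in> hom Delta m k \<longrightarrow> ac f a \<in> B m \<and> res p f (e k a) = e m (ac f a))"

text \<open>A cardinal \<open>r\<close> has the size of its own field, which is a subset of
  \<open>'u\<close>; a set below \<open>r\<close> therefore embeds in \<open>'u\<close>.\<close>

lemma card_inj:
  assumes "|B| <o r"
  shows "\<exists>e :: 'b \<Rightarrow> 'u. inj_on e B"
proof -
  have "Card_order r" using univ by (simp add: universe_def)
  then have "|B| \<le>o |Field r|"
    using assms card_of_Field_ordIso ordIso_symmetric ordLess_ordIso_trans ordLess_imp_ordLeq by blast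
  then show ?thesis using card_of_ordLeq[of B "Field r"] by blast
qed

text \<open>Transport of structure along injections into \<open>'u\<close>, chosen separately in
  each dimension. Pairs, families and sieves may thus be used as elements as soon as they form small
  sets.\<close>

lemma presents_ex:
  fixes B :: "nat \<Rightarrow> 'b set" and l :: "nat \<Rightarrow> 'b \<Rightarrow> 'u"
  assumes c: "\<And>k. |B k| <o r"
    and i: "\<And>f m k a. f \<in> hom Delta m k \<Longrightarrow> a \<in> B k \<Longrightarrow> ac f a \<in> B m"
    and id: "\<And>k a. a \<in> B k \<Longrightarrow> ac (Idt Delta k) a = a"
    and co: "\<And>f g m k j a. f \<in> hom Delta m k \<Longrightarrow> g \<in> hom Delta j m \<Longrightarrow> a \<in> B k \<Longrightarrow>
        ac g (ac f a) = ac (f \<cdot>\<^bsub>Delta\<^esub> g) a"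
    and li: "\<And>k a. a \<in> B k \<Longrightarrow> l k a \<in> on_ob X k"
    and ln: "\<And>f m k a. f \<in> hom Delta m k \<Longrightarrow> a \<in> B k \<Longrightarrow> l m (ac f a) = act X f (l k a)"
  shows "\<exists>p e. presents B ac l e p"
proof -
  obtain e :: "nat \<Rightarrow> 'b \<Rightarrow> 'u" where e: "\<And>k. inj_on (e k) (B k)" using card_inj[OF c] by metis
  define d where "d k = the_inv_into (B k) (e k)" for k
  have d: "d k (e k a) = a" if "a \<in> B k" for k a using the_inv_into_f_f[OF e that] by (simp add: d_def)
  define ac' where "ac' f b = e (Dom Delta f) (ac f (d (Cod Delta f) b))" for f b
  have ac': "ac' f (e k a) = e m (ac f a)" if "f \<in> hom Delta m k" "a \<in> B k" for f m k a
    using d[OF that(2)] homD[OF that(1)] by (simp add: ac'_def)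
  have "\<exists>F \<in> Ob (simp_sets r). on_ob F = (\<lambda>k. e k ` B k) \<and>
     (\<forall>f m k a. f \<in> hom Delta m k \<longrightarrow> a \<in> e k ` B k \<longrightarrow> act F f a = ac' f a)"
  proof (rule simp_ex)
    show "|e k ` B k| <o r" for k using card_of_image c ordLeq_ordLess_trans by blast
  qed (auto simp: ac' i id ac'[OF Delta_id_in] ac'[OF Delta_comp_in] co simp del: split_paired_All)
  then obtain F where F: "F \<in> Ob (simp_sets r)" "on_ob F = (\<lambda>k. e k ` B k)"
    and aF: "\<And>f m k a. f \<in> hom Delta m k \<Longrightarrow> a \<in> B k \<Longrightarrow> act F f (e k a) = e m (ac f a)"
    using ac' by fastforce
  obtain p where p: "p \<in> hom (simp_sets r) F X" "\<And>k a. a \<in> B k \<Longrightarrow> ap p k (e k a) = l k a"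
  proof -
    have "\<exists>p \<in> hom (simp_sets r) F X. \<forall>k. \<forall>a \<in> on_ob F k. ap p k a = l k (d k a)"
    proof (rule simp_hom_ex[OF F(1) X])
      fix f :: simp_op and m k a assume f: "f \<in> hom Delta m k" and a: "a \<in> on_ob F k"
      then obtain b where b: "a = e k b" "b \<in> B k" using F(2) by auto
      show "l m (d m (act F f a)) = act X f (l k (d k a))"
        using aF[OF f b(2)] d[OF b(2)] d[OF i[OF f b(2)]] ln[OF f b(2)] b(1) by simp
    qed (use F d li in auto)
    then show thesis using that d F(2) by auto
  qed
  have "fst p = F" using p(1) by (auto simp: simp_hom)
  then have "presents B ac l e p"
    unfolding presents_def using p F aF e i by (auto simp: E_Ob el_def lb_def res_def bij_betw_def)
  then show ?thesis by blast
qed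

lemma
  assumes "presents B ac l e p"
  shows presents_Ob: "p \<in> Ob E"
    and presents_in: "a \<in> B k \<Longrightarrow> e k a \<in> el p k"
    and presents_inj: "a \<in> B k \<Longrightarrow> b \<in> B k \<Longrightarrow> e k a = e k b \<Longrightarrow> a = b"
    and presents_surj: "c \<in> el p k \<Longrightarrow> \<exists>a \<in> B k. c = e k a"
    and presents_lb: "a \<in> B k \<Longrightarrow> lb p k (e k a) = l k a"
    and presents_ac: "a \<in> B k \<Longrightarrow> f \<in> hom Delta m k \<Longrightarrow> ac f a \<in> B m"
    and presents_res: "a \<in> B k \<Longrightarrow> f \<in> hom Delta m k \<Longrightarrow> res p f (e k a) = e m (ac f a)"
  using assms unfolding presents_def bij_betw_def inj_on_def by blast+

lemma presents_hom:
  assumes P: "presents B ac l e p" and q: "q \<in> Ob E"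
    and i: "\<And>k a. a \<in> B k \<Longrightarrow> \<phi> k a \<in> el q k"
    and l: "\<And>k a. a \<in> B k \<Longrightarrow> lb q k (\<phi> k a) = l k a"
    and n: "\<And>f m k a. f \<in> hom Delta m k \<Longrightarrow> a \<in> B k \<Longrightarrow> \<phi> m (ac f a) = res q f (\<phi> k a)"
  shows "\<exists>h \<in> hom E p q. \<forall>k. \<forall>a \<in> B k. eap h k (e k a) = \<phi> k a"
proof -
  define d where "d k = the_inv_into (B k) (e k)" for k
  have inj: "inj_on (e k) (B k)" for k using presents_inj[OF P] by (auto simp: inj_on_def)
  have d: "d k (e k a) = a" if "a \<in> B k" for k a using the_inv_into_f_f[OF inj that] by (simp add: d_def)
  have "\<exists>h \<in> hom E p q. \<forall>k. \<forall>a \<in> el p k. eap h k a = \<phi> k (d k a)"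
  proof (rule hom_ex[OF presents_Ob[OF P] q])
    fix f :: simp_op and m k a assume f: "f \<in> hom Delta m k" and "a \<in> el p k"
    then obtain b where b: "a = e k b" "b \<in> B k" using presents_surj[OF P] by blast
    show "\<phi> m (d m (res p f a)) = res q f (\<phi> k (d k a))"
      using presents_res[OF P b(2) f] d[OF b(2)] d[OF presents_ac[OF P b(2) f]] n[OF f b(2)] b(1) by simp
  next
    fix k a assume "a \<in> el p k"
    then obtain b where b: "a = e k b" "b \<in> B k" using presents_surj[OF P] by blast
    then show "\<phi> k (d k a) \<in> el q k" "lb q k (\<phi> k (d k a)) = lb p k a"
      using i l d presents_lb[OF P] by auto
  qed
  then show ?thesis using d presents_in[OF P] by (metis (no_types, lifting))
qed

end

section \<open>Nondegenerate simplices\<close>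

lemma inj_strict:
  assumes "f \<in> hom Delta m n" "inj_on (ev f) {..m}" "i < j" "j \<le> m"
  shows "ev f i < ev f j"
  using ev_mono[OF assms(1), of i j] assms inj_onD[OF assms(2), of i j] by fastforce

lemma inj_dim: "f \<in> hom Delta m n \<Longrightarrow> inj_on (ev f) {..m} \<Longrightarrow> m \<le> n"
  using card_inj_on_le[of "ev f" "{..m}" "{..n}"] ev_le[of f m n] by auto

text \<open>A strictly increasing self-map of a finite chain lies above the identity by induction
  from the bottom and below it by induction from the top; the second induction runs over
  \<open>m - i\<close>.\<close>

lemma inj_endo:
  assumes f: "f \<in> hom Delta m m" and inj: "inj_on (ev f) {..m}"
  shows "f = Idt Delta m"
proof (rule Delta_eqI[OF f Delta_id_in])
  have 1: "i \<le> ev f i" if "i \<le> m" for i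
    using that
  proof (induction i)
    case (Suc i)
    then show ?case using inj_strict[OF f inj, of i "Suc i"] by simp
  qed simp
  have 2: "ev f (m - i) \<le> m - i" if "i \<le> m" for i
    using that
  proof (induction i)
    case 0
    then show ?case using ev_le[OF f, of m] by simp
  next
    case (Suc i)
    have "ev f (m - Suc i) < ev f (m - i)" using inj_strict[OF f inj, of "m - Suc i" "m - i"] Suc.prems by simp
    then show ?case using Suc by simp
  qed
  fix i assume "i \<le> m"
  then show "ev f i = ev (Idt Delta m) i" using 1[of i] 2[of "m - i"] by simp
qed

lemma inj_comp:
  assumes "f \<in> hom Delta m n" "g \<in> hom Delta n k" "inj_on (ev f) {..m}" "inj_on (ev g) {..n}"
  shows "inj_on (ev (g \<cdot>\<^bsub>Delta\<^esub> f)) {..m}"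
  using assms ev_le[OF assms(1)] by (auto simp: inj_on_def ev_comp)

lemma inj_comp_right:
  assumes "f \<in> hom Delta m n" "g \<in> hom Delta n k" "inj_on (ev (g \<cdot>\<^bsub>Delta\<^esub> f)) {..m}"
  shows "inj_on (ev f) {..m}"
  using assms by (auto simp: inj_on_def ev_comp)

text \<open>\<open>d\<close> lists the image in increasing order and \<open>e\<close> sends a vertex
  to the position of its value. The alternative of injectivity and \<open>j < m\<close> drives
  inductions on dimension; the equality of images is what later makes maximal images
  comparable.\<close>

lemma epi_mono:
  assumes f: "f \<in> hom Delta m n"
  obtains j e d where "e \<in> hom Delta m j" "d \<in> hom Delta j n" "f = d \<cdot>\<^bsub>Delta\<^esub> e"
    "ev e ` {..m} = {..j}" "inj_on (ev d) {..j}" "inj_on (ev f) {..m} \<or> j < m"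
    "ev d ` {..j} = ev f ` {..m}"
proof -
  define S where "S = ev f ` {..m}"
  have S: "finite S" "S \<noteq> {}" by (auto simp: S_def)
  define xs where "xs = sorted_list_of_set S"
  have xs: "sorted_wrt (<) xs" "set xs = S" "length xs = card S"
    using S by (auto simp: xs_def)
  \<comment> \<open>\<open>[j]\<close> has \<open>j + 1\<close> vertices, hence the predecessor of
    the cardinality.\<close>
  define j where "j = card S - 1"
  have j: "card S = Suc j" using S by (simp add: j_def card_gt_0_iff)
  have lt: "xs ! a < xs ! b" if "a < b" "b \<le> j" for a b
    using sorted_wrt_nth_less[OF xs(1)] that xs(3) j by simp
  have nth_in: "xs ! a \<in> S" if "a \<le> j" for a using that xs j by (metis less_Suc_eq_le nth_mem)
  define idx where "idx y = (SOME t. t \<le> j \<and> xs ! t = y)" for y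
  have idx: "idx y \<le> j" "xs ! idx y = y" if "y \<in> S" for y
  proof -
    have "\<exists>t. t \<le> j \<and> xs ! t = y" using that xs j by (metis in_set_conv_nth less_Suc_eq_le)
    from someI_ex[OF this] show "idx y \<le> j" "xs ! idx y = y" by (auto simp: idx_def)
  qed
  have idx_mono: "idx y \<le> idx y'" if "y \<in> S" "y' \<in> S" "y \<le> y'" for y y'
    using idx[OF that(1)] idx[OF that(2)] lt[of "idx y'" "idx y"] that(3) by fastforce
  have nth_inj: "inj_on ((!) xs) {..j}" 
  proof (rule inj_onI)
    fix a b assume "a \<in> {..j}" "b \<in> {..j}" "xs ! a = xs ! b"
    then show "a = b" using lt[of a b] lt[of b a] by (cases a b rule: linorder_cases) auto
  qed
  have idx_nth: "idx (xs ! a) = a" if "a \<le> j" for a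
    using idx[OF nth_in[OF that]] inj_onD[OF nth_inj] that by simp
  have Sle: "y \<le> n" if "y \<in> S" for y using that ev_le[OF f] by (auto simp: S_def)
  define e where "e = mkD m (\<lambda>i. idx (ev f i)) j"
  define d where "d = mkD j ((!) xs) n"
  have fS: "ev f i \<in> S" if "i \<le> m" for i using that by (simp add: S_def)
  have e: "e \<in> hom Delta m j" unfolding e_def
    by (rule mkD_in) (use fS idx ev_mono[OF f] idx_mono in \<open>auto simp: mono_on_def\<close>)
  have mono: "mono_on {..j} ((!) xs)"
    unfolding mono_on_def
  proof (intro allI impI)
    fix a b assume "a \<in> {..j} \<and> b \<in> {..j} \<and> a \<le> b"
    then show "xs ! a \<le> xs ! b" using lt[of a b] by (cases "a = b") auto
  qed
  have d: "d \<in> hom Delta j n" unfolding d_def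
    by (rule mkD_in[OF mono]) (use nth_in Sle in auto)
  have fe: "f = d \<cdot>\<^bsub>Delta\<^esub> e"
  proof (rule Delta_eqI[OF f Delta_comp_in[OF d e]])
    fix i assume i: "i \<le> m"
    show "ev f i = ev (d \<cdot>\<^bsub>Delta\<^esub> e) i"
      using ev_comp[OF d e i] i idx[OF fS[OF i]] by (simp add: d_def e_def)
  qed
  have "ev e ` {..m} = {..j}"
  proof
    show "ev e ` {..m} \<subseteq> {..j}" using ev_le[OF e] by auto
    show "{..j} \<subseteq> ev e ` {..m}"
    proof
      fix a assume "a \<in> {..j}"
      then have a: "a \<le> j" by simp
      then obtain i where i: "i \<le> m" "xs ! a = ev f i" using nth_in[OF a] by (auto simp: S_def)
      then have "ev e i = a" using idx_nth[OF a] by (simp add: e_def)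
      then show "a \<in> ev e ` {..m}" using i by auto
    qed
  qed
  moreover have "inj_on (ev d) {..j}"
    using nth_inj by (simp add: d_def inj_on_def)
  moreover have "inj_on (ev f) {..m} \<or> j < m"
  proof (cases "inj_on (ev f) {..m}")
    case False
    have "card S \<noteq> Suc m" using False eq_card_imp_inj_on[of "{..m}" "ev f"] by (auto simp: S_def)
    moreover have "card S \<le> Suc m" using card_image_le[of "{..m}" "ev f"] by (simp add: S_def)
    ultimately show ?thesis using j by simp
  qed simp
  moreover have "ev d ` {..j} = ev f ` {..m}"
  proof -
    have "ev d ` {..j} = (!) xs ` {..j}" by (auto simp: d_def)
    also have "\<dots> = set xs" using xs(3) j by (auto simp: set_conv_nth image_def less_Suc_eq_le)
    finally show ?thesis using xs(2) by (simp add: S_def)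
  qed
  ultimately show thesis using that[OF e d fe] by blast
qed

text \<open>Any choice of preimages along a monotone surjection is monotone, because the surjection
  reflects strict inequalities. One value can therefore be prescribed; letting \<open>i0\<close>
  vary, the sections determine the surjection.\<close>

lemma section_ex:
  assumes e: "e \<in> hom Delta m j" and surj: "ev e ` {..m} = {..j}" and i0: "i0 \<le> m"
  obtains s where "s \<in> hom Delta j m" "e \<cdot>\<^bsub>Delta\<^esub> s = Idt Delta j" "ev s (ev e i0) = i0"
proof -
  define s0 where "s0 t = (if t = ev e i0 then i0 else SOME i. i \<le> m \<and> ev e i = t)" for t
  have s0: "s0 t \<le> m \<and> ev e (s0 t) = t" if "t \<le> j" for t
  proof (cases "t = ev e i0")
    case False
    have "t \<in> ev e ` {..m}" using that surj by simp
    then have "\<exists>i. i \<le> m \<and> ev e i = t" by auto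
    from someI_ex[OF this] False show ?thesis by (simp add: s0_def)
  qed (use i0 in \<open>simp add: s0_def\<close>)
  have mono: "mono_on {..j} s0"
    unfolding mono_on_def
  proof (intro allI impI)
    fix a b assume ab: "a \<in> {..j} \<and> b \<in> {..j} \<and> a \<le> b"
    show "s0 a \<le> s0 b"
    proof (rule ccontr)
      assume "\<not> s0 a \<le> s0 b"
      then have "b \<le> a" using ev_mono[OF e, of "s0 b" "s0 a"] s0[of a] s0[of b] ab by auto
      then show False using \<open>\<not> _\<close> ab by simp
    qed
  qed
  define s where "s = mkD j s0 m"
  have s: "s \<in> hom Delta j m" unfolding s_def by (rule mkD_in[OF mono]) (use s0 in auto)
  have evs: "ev s t = s0 t" if "t \<le> j" for t using that by (simp add: s_def)
  have "e \<cdot>\<^bsub>Delta\<^esub> s = Idt Delta j"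
    by (rule Delta_eqI[OF Delta_comp_in[OF e s] Delta_id_in])
      (simp add: ev_comp[OF e s] s0 evs)
  moreover have "ev s (ev e i0) = i0" using ev_le[OF e i0] by (simp add: s_def s0_def)
  ultimately show thesis using that s by blast
qed

section \<open>Eilenberg-Zilber decompositions\<close>

context simp_over
begin

text \<open>Minimality in the category of elements, with injective operators in place of monic maps;
  \<open>minimal_iff\<close> proves the agreement. By the epi-mono factorization it is also the
  usual condition of not being degenerate.\<close>

definition nd :: "nat \<Rightarrow> 'u \<Rightarrow> bool" where
  "nd k x \<longleftrightarrow> x \<in> on_ob X k \<and> (\<forall>m. \<forall>y \<in> on_ob X m. \<forall>f \<in> hom Delta k m.
     x = act X f y \<longrightarrow> inj_on (ev f) {..k})"

lemma nd_in: "nd k x \<Longrightarrow> x \<in> on_ob X k" by (simp add: nd_def)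

lemma nd_inj: "nd m (act X f x) \<Longrightarrow> x \<in> on_ob X k \<Longrightarrow> f \<in> hom Delta m k \<Longrightarrow> inj_on (ev f) {..m}"
  by (auto simp: nd_def)

text \<open>A non-injective operator through which \<open>x\<close> arises factors by a surjection
  onto a simplex of smaller dimension, to which the induction hypothesis applies.\<close>

lemma EZ_ex:
  assumes "x \<in> on_ob X k"
  shows "\<exists>j e y. e \<in> hom Delta k j \<and> ev e ` {..k} = {..j} \<and> nd j y \<and> x = act X e y"
  using assms
proof (induction k arbitrary: x rule: less_induct)
  case (less k)
  show ?case
  proof (cases "nd k x")
    case True
    then show ?thesis using Delta_id_in[of k] act_id[OF X less.prems]
      by (intro exI[of _ k] exI[of _ "Idt Delta k"] exI[of _ x]) (auto simp: image_def)
  next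
    case False
    then obtain m y f where f: "f \<in> hom Delta k m" "y \<in> on_ob X m" "x = act X f y" "\<not> inj_on (ev f) {..k}"
      using less.prems by (auto simp: nd_def)
    obtain j e d where e: "e \<in> hom Delta k j" "d \<in> hom Delta j m" "f = d \<cdot>\<^bsub>Delta\<^esub> e"
      "ev e ` {..k} = {..j}" "j < k" using epi_mono[OF f(1)] f(4) by metis
    have y': "act X d y \<in> on_ob X j" using act_in[OF X e(2) f(2)] .
    from less.IH[OF e(5) y'] obtain i e' z where z: "e' \<in> hom Delta j i" "ev e' ` {..j} = {..i}"
      "nd i z" "act X d y = act X e' z" by blast
    have "x = act X (e' \<cdot>\<^bsub>Delta\<^esub> e) z"
      using act_comp[OF X e(2,1) f(2)] act_comp[OF X z(1) e(1) nd_in[OF z(3)]] f(3) e(3) z(4) by simp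
    moreover have "ev (e' \<cdot>\<^bsub>Delta\<^esub> e) ` {..k} = {..i}"
    proof -
      have "ev (e' \<cdot>\<^bsub>Delta\<^esub> e) ` {..k} = ev e' ` ev e ` {..k}"
        by (auto simp: image_image ev_comp[OF z(1) e(1)])
      then show ?thesis using e(4) z(2) by simp
    qed
    ultimately show ?thesis using z(3) Delta_comp_in[OF z(1) e(1)] by blast
  qed
qed

text \<open>Restricting the equation along a section of \<open>e\<close> writes \<open>y\<close> as
  a restriction of \<open>y'\<close>; the operator so obtained is injective because \<open>y\<close>
  is nondegenerate.\<close>

lemma EZ_aux:
  assumes e: "e \<in> hom Delta k j" "ev e ` {..k} = {..j}" and e': "e' \<in> hom Delta k j'"
    and y: "nd j y" and y': "y' \<in> on_ob X j'" and eq: "act X e y = act X e' y'"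
    and s: "s \<in> hom Delta j k" "e \<cdot>\<^bsub>Delta\<^esub> s = Idt Delta j"
  shows "y = act X (e' \<cdot>\<^bsub>Delta\<^esub> s) y' \<and> inj_on (ev (e' \<cdot>\<^bsub>Delta\<^esub> s)) {..j}"
proof -
  have "act X s (act X e y) = y" using act_comp[OF X e(1) s(1) nd_in[OF y]] s(2) act_id[OF X nd_in[OF y]] by simp
  then have *: "y = act X (e' \<cdot>\<^bsub>Delta\<^esub> s) y'" using act_comp[OF X e' s(1) y'] eq by simp
  then show ?thesis using nd_inj[OF _ y' Delta_comp_in[OF e' s(1)]] y by simp
qed

text \<open>\<open>EZ_aux\<close> in both directions gives equal dimensions. Then \<open>e'\<close>
  composed with any section of \<open>e\<close> is an injective endomorphism, hence an identity, and
  choosing for each vertex a section through it forces \<open>e = e'\<close>.\<close>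

lemma EZ_unique:
  assumes e: "e \<in> hom Delta k j" "ev e ` {..k} = {..j}"
    and e': "e' \<in> hom Delta k j'" "ev e' ` {..k} = {..j'}"
    and y: "nd j y" and y': "nd j' y'" and eq: "act X e y = act X e' y'"
  shows "j = j' \<and> e = e' \<and> y = y'"
proof -
  obtain s where s: "s \<in> hom Delta j k" "e \<cdot>\<^bsub>Delta\<^esub> s = Idt Delta j" using section_ex[OF e, of 0] by blast
  obtain s' where s': "s' \<in> hom Delta j' k" "e' \<cdot>\<^bsub>Delta\<^esub> s' = Idt Delta j'" using section_ex[OF e', of 0] by blast
  have "j \<le> j'" using inj_dim[OF Delta_comp_in[OF e'(1) s(1)]] EZ_aux[OF e e'(1) y nd_in[OF y'] eq s] by simp
  moreover have "j' \<le> j"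
    using inj_dim[OF Delta_comp_in[OF e(1) s'(1)]] EZ_aux[OF e' e(1) y' nd_in[OF y] eq[symmetric] s'] by simp
  ultimately have jj: "j' = j" by simp
  have E: "e' \<cdot>\<^bsub>Delta\<^esub> t = Idt Delta j" if "t \<in> hom Delta j k" "e \<cdot>\<^bsub>Delta\<^esub> t = Idt Delta j" for t
    using inj_endo[OF Delta_comp_in[OF e'(1)[unfolded jj] that(1)]]
      EZ_aux[OF e e'(1) y nd_in[OF y'] eq that] jj by simp
  have "e = e'"
  proof (rule Delta_eqI[OF e(1) e'(1)[unfolded jj]])
    fix i assume i: "i \<le> k"
    obtain t where t: "t \<in> hom Delta j k" "e \<cdot>\<^bsub>Delta\<^esub> t = Idt Delta j" "ev t (ev e i) = i"
      using section_ex[OF e i] by blast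
    show "ev e i = ev e' i"
      using ev_comp[OF e'(1) t(1) ev_le[OF e(1) i]] E[OF t(1,2)] t(3) ev_le[OF e(1) i] by simp
  qed
  moreover have "y = y'"
    using EZ_aux[OF e e'(1) y nd_in[OF y'] eq s] E[OF s] act_id[OF X] nd_in[OF y'] jj by simp
  ultimately show ?thesis using jj by simp
qed

section \<open>Monic maps and minimal objects in the category of elements\<close>

lemma elements_simps:
  "Dom (elements C F) = fst" "Cod (elements C F) = (\<lambda>h. snd (snd h))"
  "Comp (elements C F) g f = (fst f, fst (snd g) \<cdot>\<^bsub>C\<^esub> fst (snd f), snd (snd g))"
  by (auto simp: elements_def split: prod.splits)

lemma elements_hom: "h \<in> hom (elements Delta X) (x, c) (y, d) \<longleftrightarrow>
    (\<exists>f \<in> hom Delta c d. h = ((x, c), f, (y, d)) \<and> x \<in> on_ob X c \<and> y \<in> on_ob X d \<and> act X f y = x)"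
  by (auto simp: elements_def hom_def act_def)

lemma elements_Arr: "h \<in> Arr (elements Delta X) \<longleftrightarrow> (\<exists>x c y d. h \<in> hom (elements Delta X) (x, c) (y, d))"
  by (auto simp: elements_def hom_def)

lemma elements_monic:
  assumes h: "((x, c), f, (y, d)) \<in> hom (elements Delta X) (x, c) (y, d)"
  shows "monic (elements Delta X) ((x, c), f, (y, d)) \<longleftrightarrow> inj_on (ev f) {..c}"
proof
  have f: "f \<in> hom Delta c d" "x \<in> on_ob X c" "y \<in> on_ob X d" "act X f y = x"
    using h by (auto simp: elements_hom)
  { assume m: "monic (elements Delta X) ((x, c), f, (y, d))"
    show "inj_on (ev f) {..c}"
    proof (rule inj_onI)
      fix i i' assume i: "i \<in> {..c}" "i' \<in> {..c}" "ev f i = ev f i'"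
      \<comment> \<open>Two vertices identified by \<open>f\<close> become parallel arrows from
        \<open>[0]\<close>. They start at the same element since \<open>x\<close> is itself a
        restriction along \<open>f\<close>, so monicity can be applied to them.\<close>
      define g where "g = mkD 0 (\<lambda>_. i) c"
      define g' where "g' = mkD 0 (\<lambda>_. i') c"
      have g: "g \<in> hom Delta 0 c" "g' \<in> hom Delta 0 c"
        using i unfolding g_def g'_def by (auto intro!: mkD_in simp: mono_on_def)
      have fg: "f \<cdot>\<^bsub>Delta\<^esub> g = f \<cdot>\<^bsub>Delta\<^esub> g'"
        by (rule Delta_eqI[OF Delta_comp_in[OF f(1) g(1)] Delta_comp_in[OF f(1) g(2)]])
          (simp add: ev_comp[OF f(1) g(1)] ev_comp[OF f(1) g(2)], simp add: g_def g'_def i(3))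
      have xx: "act X g x = act X g' x"
        using act_comp[OF X f(1) g(1) f(3)] act_comp[OF X f(1) g(2) f(3)] f(4) fg by simp
      let ?z = "(act X g x, 0)"
      have "(?z, g, (x, c)) \<in> hom (elements Delta X) ?z (x, c)" "(?z, g', (x, c)) \<in> hom (elements Delta X) ?z (x, c)"
        using g act_in[OF X g(1) f(2)] f xx by (auto simp: elements_hom)
      moreover have "?z \<in> Ob (elements Delta X)" using act_in[OF X g(1) f(2)] by (simp add: elements_def)
      ultimately have "g = g'"
        using m[unfolded monic_def, THEN conjunct2, rule_format, of ?z "(?z, g, (x, c))" "(?z, g', (x, c))"] fg
        by (simp add: elements_simps)
      then have "ev g 0 = ev g' 0" by simp
      then show "i = i'" by (simp add: g_def g'_def)
    qed }
  assume inj: "inj_on (ev f) {..c}"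
  show "monic (elements Delta X) ((x, c), f, (y, d))"
    unfolding monic_def
  proof (intro conjI ballI impI)
    show "((x, c), f, (y, d)) \<in> Arr (elements Delta X)" using h by (simp add: hom_def)
    fix A g g' assume g: "g \<in> hom (elements Delta X) A (Dom (elements Delta X) ((x, c), f, (y, d)))"
      "g' \<in> hom (elements Delta X) A (Dom (elements Delta X) ((x, c), f, (y, d)))"
      "((x, c), f, (y, d)) \<cdot>\<^bsub>elements Delta X\<^esub> g = ((x, c), f, (y, d)) \<cdot>\<^bsub>elements Delta X\<^esub> g'"
    obtain z b where A: "A = (z, b)" by (cases A)
    from g obtain u u' where u: "u \<in> hom Delta b c" "g = ((z, b), u, (x, c))"
      and u': "u' \<in> hom Delta b c" "g' = ((z, b), u', (x, c))"
      by (auto simp: A elements_hom elements_simps)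
    have fu: "f \<cdot>\<^bsub>Delta\<^esub> u = f \<cdot>\<^bsub>Delta\<^esub> u'" using g(3) by (simp add: u(2) u'(2) elements_simps)
    have "u = u'"
    proof (rule Delta_eqI[OF u(1) u'(1)])
      fix i assume i: "i \<le> b"
      have "ev f (ev u i) = ev f (ev u' i)" using ev_comp[OF f(1) u(1) i] ev_comp[OF f(1) u'(1) i] fu by simp
      then show "ev u i = ev u' i" using inj ev_le[OF u(1) i] ev_le[OF u'(1) i] by (auto simp: inj_on_def)
    qed
    then show "g = g'" using u u' by simp
  qed
qed

lemma minimal_iff: "minimal (elements Delta X) (x, k) \<longleftrightarrow> nd k x"
proof
  assume m: "minimal (elements Delta X) (x, k)"
  show "nd k x"
    unfolding nd_def
  proof (intro conjI allI ballI impI)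
    show x: "x \<in> on_ob X k" using m by (simp add: minimal_def elements_def)
    fix d y f assume f: "y \<in> on_ob X d" "f \<in> hom Delta k d" "x = act X f y"
    have h: "((x, k), f, (y, d)) \<in> hom (elements Delta X) (x, k) (y, d)" using f x by (auto simp: elements_hom)
    then have "monic (elements Delta X) ((x, k), f, (y, d))" using m by (auto simp: minimal_def hom_def)
    then show "inj_on (ev f) {..k}" using elements_monic[OF h] by simp
  qed
next
  assume n: "nd k x"
  show "minimal (elements Delta X) (x, k)"
    unfolding minimal_def
  proof (intro conjI ballI impI)
    show "(x, k) \<in> Ob (elements Delta X)" using nd_in[OF n] by (simp add: elements_def)
    fix h assume "h \<in> Arr (elements Delta X)" "Dom (elements Delta X) h = (x, k)"
    then obtain x' k' y d where hh0: "h \<in> hom (elements Delta X) (x', k') (y, d)" and "fst h = (x, k)"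
      unfolding elements_Arr elements_simps by blast
    then obtain f where f: "f \<in> hom Delta k d" "y \<in> on_ob X d" "act X f y = x" and h: "h = ((x, k), f, (y, d))"
      by (auto simp: elements_hom)
    have hh: "((x, k), f, (y, d)) \<in> hom (elements Delta X) (x, k) (y, d)"
      using f nd_in[OF n] by (simp add: elements_hom)
    have "inj_on (ev f) {..k}" using nd_inj[OF _ f(2,1)] n f(3) by simp
    then show "monic (elements Delta X) h" using elements_monic[OF hh] by (simp add: h)
  qed
qed

text \<open>If the skeleton is everything, the operator producing a nondegenerate simplex passes
  through some \<open>[j]\<close> with \<open>j\<close> at most \<open>n\<close>; being injective,
  it bounds the dimension by \<open>j\<close>. Conversely the surjection of an Eilenberg-Zilber
  decomposition itself passes through the dimension of a nondegenerate simplex.\<close>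

lemma dim_le_iff: "dim_le r X n \<longleftrightarrow> (\<forall>k x. nd k x \<longrightarrow> k \<le> n)"
proof
  have skel_hom: "app (fst (snd (skel_incl n X)) k) x = x" if "x \<in> skel_set n X k" for k x
    using that by (simp add: skel_incl_def app_def)
  { assume "dim_le r X n"
    then have iso: "is_iso (simp_sets r) (skel_incl n X)" by (simp add: dim_le_def)
    then obtain g where g: "g \<in> hom (simp_sets r) X (skeleton n X)"
      "skel_incl n X \<cdot>\<^bsub>simp_sets r\<^esub> g = Idt (simp_sets r) X"
      and s: "skel_incl n X \<in> hom (simp_sets r) (skeleton n X) X"
      unfolding is_iso_def by (auto simp: simp_simps skel_incl_def hom_def)
    have all: "x \<in> skel_set n X k" if "x \<in> on_ob X k" for x k
    proof -
      have "ap (skel_incl n X) k (ap g k x) = x" using ap_comp[OF s g(1) that] g(2) ap_id[OF that] by simp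
      moreover have "ap g k x \<in> skel_set n X k" using ap_in[OF g(1) that] by (simp add: skeleton_def)
      ultimately show ?thesis using skel_hom by (simp add: ap_def)
    qed
    show "\<forall>k x. nd k x \<longrightarrow> k \<le> n"
    proof (intro allI impI)
      fix k x assume nd: "nd k x"
      from all[OF nd_in[OF nd]] obtain e f y j g h where f: "f \<in> hom Delta k e" "y \<in> on_ob X e" "x = act X f y"
        "j \<le> n" "g \<in> hom Delta k j" "h \<in> hom Delta j e" "f = h \<cdot>\<^bsub>Delta\<^esub> g"
        by (auto simp: skel_set_def act_def)
      have "inj_on (ev f) {..k}" using nd_inj[OF _ f(2,1)] nd f(3) by simp
      then have "inj_on (ev g) {..k}" using inj_comp_right[OF f(5,6)] f(7) by simp
      then show "k \<le> n" using inj_dim[OF f(5)] f(4) by simp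
    qed }
  assume le: "\<forall>k x. nd k x \<longrightarrow> k \<le> n"
  have sk: "skel_set n X k = on_ob X k" for k
  proof
    show "on_ob X k \<subseteq> skel_set n X k"
    proof
      fix x assume x: "x \<in> on_ob X k"
      obtain j e y where e: "e \<in> hom Delta k j" "nd j y" "x = act X e y" using EZ_ex[OF x] by blast
      have "\<exists>e'. \<exists>f \<in> hom Delta k e'. \<exists>y\<in>on_ob X e'. x = app (on_arr X f) y \<and>
         (\<exists>k'\<le>n. \<exists>g\<in>hom Delta k k'. \<exists>h\<in>hom Delta k' e'. f = h \<cdot>\<^bsub>Delta\<^esub> g)"
        using e le nd_in[OF e(2)] Delta_id_in[of j] Delta.idl[OF e(1)]
        by (intro exI[of _ j] conjI bexI[of _ y] bexI[of _ e] bexI[of _ "Idt Delta j"])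
          (auto simp: act_def)
      then show "x \<in> skel_set n X k" using x by (simp add: skel_set_def)
    qed
  qed (auto simp: skel_set_def)
  have ext: "on_arr X \<in> extensional (Arr Delta)" using X by (simp add: simp_Ob)
  have "on_arr X f = (on_ob X (Cod Delta f), restrict (app (on_arr X f)) (on_ob X (Cod Delta f)), on_ob X (Dom Delta f))"
    if "f \<in> Arr Delta" for f
    using act_hom[OF X homI[OF that]] by (auto simp: set_hom app_def fun_eq_iff PiE_def extensional_def)
  then have "on_arr (skeleton n X) = on_arr X"
    using ext by (auto simp: skeleton_def sk fun_eq_iff extensional_def)
  \<comment> \<open>Both arrow parts are extensional, so the skeleton is literally \<open>X\<close>
    and its inclusion the identity.\<close>
  then have "skeleton n X = X" by (simp add: skeleton_def sk[abs_def])
  then have "skel_incl n X = Idt (simp_sets r) X"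
    by (auto simp: skel_incl_def sk simp_sets_def presheaves_def functor_cat_simps set_simps)
  moreover have "is_iso (simp_sets r) (Idt (simp_sets r) X)"
  proof -
    interpret S: category "simp_sets r" by (rule category_simp)
    have i: "Idt (simp_sets r) X \<in> hom (simp_sets r) X X" using S.id_in[OF X] .
    show ?thesis unfolding is_iso_def using i S.idl[OF i] homD[OF i] by (auto intro!: bexI[OF _ i])
  qed
  ultimately show "dim_le r X n" by (simp add: dim_le_def)
qed

end

locale strongly_regular_over = simp_over r X for r :: "'u rel" and X :: "'u simp_set" +
  assumes sr: "strongly_regular X"
begin

text \<open>Strong regularity enters every later argument through this closure property; injective
  operators are exactly the monic maps to which its definition refers.\<close>

lemma nd_face:
  assumes n: "nd k x" and f: "f \<in> hom Delta m k" and inj: "inj_on (ev f) {..m}"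
  shows "nd m (act X f x)"
proof -
  let ?h = "((act X f x, m), f, (x, k))"
  have h: "?h \<in> hom (elements Delta X) (act X f x, m) (x, k)"
    using f nd_in[OF n] act_in[OF X f nd_in[OF n]] by (auto simp: elements_hom)
  have "monic (elements Delta X) ?h" using elements_monic[OF h] inj by simp
  moreover have "minimal (elements Delta X) (Cod (elements Delta X) ?h)"
    using n by (simp add: elements_simps minimal_iff)
  ultimately have "minimal (elements Delta X) (Dom (elements Delta X) ?h)"
    using sr unfolding strongly_regular_def by blast
  then show ?thesis by (simp add: elements_simps minimal_iff)
qed

end

section \<open>Presheaves determined by their nondegenerate elements\<close>

context simp_over
begin

section \<open>Smallness of the constructions to be encoded\<close>

lemma r_card: "Card_order r" "regularCard r" "Cinfinite r" "natLeq <o r"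
proof -
  show 1: "Card_order r" "regularCard r" "natLeq <o r" using univ by (auto simp: universe_def)
  have "\<not> finite (Field r)"
  proof
    assume "finite (Field r)"
    then have "|Field r| <o natLeq" by (simp add: finite_iff_ordLess_natLeq)
    moreover have "r =o |Field r|" using card_of_Field_ordIso[OF 1(1)] by (rule ordIso_symmetric)
    ultimately have "r <o natLeq" using ordIso_ordLess_trans by blast
    then show False using 1(3) by (metis ordLess_transitive ordLess_irreflexive)
  qed
  then show "Cinfinite r" using 1 by (simp add: cinfinite_def)
qed

lemma small_finite: "finite A \<Longrightarrow> |A| <o r"
  using finite_iff_ordLess_natLeq ordLess_transitive r_card(4) by blast

lemma small_nat: "|A :: nat set| <o r"
  using card_of_mono1[of A UNIV] card_of_nat r_card(4)
  by (meson ordIso_ordLess_trans ordLeq_ordLess_trans subset_UNIV)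

lemma small_subset: "A \<subseteq> B \<Longrightarrow> |B| <o r \<Longrightarrow> |A| <o r"
  using card_of_mono1 ordLeq_ordLess_trans by blast

lemma small_image: "|A| <o r \<Longrightarrow> |f ` A| <o r"
  using card_of_image ordLeq_ordLess_trans by blast

lemma small_UN: "|I| <o r \<Longrightarrow> (\<And>i. i \<in> I \<Longrightarrow> |A i| <o r) \<Longrightarrow> |\<Union>i\<in>I. A i| <o r"
  using card_of_UNION_ordLess_infinite_Field_regularCard[OF r_card(2,3)] by blast

lemma small_Sigma:
  assumes "|A| <o r" "\<And>a. a \<in> A \<Longrightarrow> |B a| <o r"
  shows "|Sigma A B| <o r"
proof -
  have "Sigma A B = (\<Union>a\<in>A. Pair a ` B a)" by auto
  moreover have "|\<Union>a\<in>A. Pair a ` B a| <o r" by (rule small_UN[OF assms(1)]) (rule small_image[OF assms(2)])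
  ultimately show ?thesis by simp
qed

lemma small_insert: "|A| <o r \<Longrightarrow> |insert a A| <o r"
  using card_of_Un_ordLess_infinite_Field[of r "{a}" A] r_card(1,3) small_finite[of "{a}"]
  by (simp add: cinfinite_def)

text \<open>A finite power is an iterated product, so regularity is enough; infinite powers could
  exceed \<open>r\<close>.\<close>

lemma small_PiE:
  assumes "finite I" "|U| <o r"
  shows "|I \<rightarrow>\<^sub>E U| <o r"
  using assms(1)
proof (induction I)
  case empty
  then show ?case by (simp add: small_finite)
next
  case (insert i I)
  have "|U \<times> (I \<rightarrow>\<^sub>E U)| <o r" by (rule small_Sigma[OF assms(2) insert.IH])
  from small_image[OF this] show ?case unfolding PiE_insert_eq .
qed

text \<open>Infinitely many operators end in \<open>[k]\<close>, but those along which a simplex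
  restricts to a nondegenerate one are injective and so start in dimension at most \<open>k\<close>.
  This bounds the families and sieves recorded at one simplex.\<close>

lemma finite_Delta: "finite {f \<in> Arr Delta. Cod Delta f = k \<and> Dom Delta f \<le> k}" (is "finite ?D")
proof (rule finite_subset)
  show "?D \<subseteq> (\<Union>m\<in>{..k}. (\<lambda>h. (m, h, k)) ` ({..m} \<rightarrow>\<^sub>E {..k}))"
    by (auto simp: Delta_def)
  show "finite (\<Union>m\<in>{..k}. (\<lambda>h. (m, h, k)) ` ({..m} \<rightarrow>\<^sub>E {..k}))"
    by (auto intro!: finite_PiE)
qed

section \<open>Elements over nondegenerate simplices\<close>

definition Sel :: "'u simp_map \<Rightarrow> nat \<Rightarrow> 'u set" where
  "Sel p k = {a \<in> el p k. nd k (lb p k a)}"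

text \<open>A morphism between the restrictions of \<open>p\<close> and \<open>q\<close> to the
  minimal objects, as a function with arbitrary values off \<open>Sel\<close>. Naturality concerns
  injective operators only, these being the maps between minimal objects; preservation of labels
  puts the values in \<open>Sel q\<close>.\<close>

definition Nat :: "'u simp_map \<Rightarrow> 'u simp_map \<Rightarrow> (nat \<Rightarrow> 'u \<Rightarrow> 'u) \<Rightarrow> bool" where
  "Nat p q \<phi> \<longleftrightarrow> (\<forall>k. \<forall>a \<in> Sel p k. \<phi> k a \<in> el q k \<and> lb q k (\<phi> k a) = lb p k a) \<and>
     (\<forall>k m f. \<forall>a \<in> Sel p k. f \<in> hom Delta m k \<longrightarrow> inj_on (ev f) {..m} \<longrightarrow>
        \<phi> m (res p f a) = res q f (\<phi> k a))"

text \<open>These are the right Kan extensions of presheaves on the minimal objects: maps into them are the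
  same as natural families on nondegenerate elements.\<close>

definition L0 :: "'u simp_map set" where
  "L0 = {q \<in> Ob E. \<forall>p \<in> Ob E. \<forall>\<phi>. Nat p q \<phi> \<longrightarrow>
     (\<exists>!h. h \<in> hom E p q \<and> (\<forall>k. \<forall>a \<in> Sel p k. eap h k a = \<phi> k a))}"

text \<open>The arrows that become invertible when restricted to the minimal objects; objects of
  \<open>L0\<close> do not distinguish the two ends of such an arrow.\<close>

definition Sbij :: "'u simp_map \<times> 'u simp_map \<times> 'u simp_map \<Rightarrow> 'u simp_map \<Rightarrow> 'u simp_map \<Rightarrow> bool" where
  "Sbij h p q \<longleftrightarrow> h \<in> hom E p q \<and> (\<forall>k. bij_betw (eap h k) (Sel p k) (Sel q k))"

text \<open>These are the left Kan extensions of presheaves on the minimal objects.\<close>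

definition isCore :: "'u simp_map \<Rightarrow> bool" where
  "isCore p \<longleftrightarrow> p \<in> Ob E \<and> (\<forall>k. \<forall>a \<in> el p k. \<exists>j. \<exists>f \<in> hom Delta k j. \<exists>b \<in> Sel p j. a = res p f b)"

lemma Sel_el: "a \<in> Sel p k \<Longrightarrow> a \<in> el p k" by (simp add: Sel_def)

lemma Sel_eap: "h \<in> hom E p q \<Longrightarrow> a \<in> Sel p k \<Longrightarrow> eap h k a \<in> Sel q k"
  by (simp add: Sel_def eap_in eap_lb)

lemma Sel_eapD: "h \<in> hom E p q \<Longrightarrow> a \<in> el p k \<Longrightarrow> eap h k a \<in> Sel q k \<Longrightarrow> a \<in> Sel p k"
  by (simp add: Sel_def eap_lb)

lemma Sel_inj: "p \<in> Ob E \<Longrightarrow> a \<in> el p k \<Longrightarrow> f \<in> hom Delta m k \<Longrightarrow> res p f a \<in> Sel p m \<Longrightarrow> inj_on (ev f) {..m}"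
  using nd_inj[of m f "lb p k a" k] by (simp add: Sel_def lb_res lb_in)

lemma L0_Ob: "q \<in> L0 \<Longrightarrow> q \<in> Ob E" by (simp add: L0_def)

lemma L0_ext: "q \<in> L0 \<Longrightarrow> p \<in> Ob E \<Longrightarrow> Nat p q \<phi> \<Longrightarrow>
    \<exists>h \<in> hom E p q. \<forall>k. \<forall>a \<in> Sel p k. eap h k a = \<phi> k a"
  unfolding L0_def by blast

lemma Nat_eap: "h \<in> hom E p q \<Longrightarrow> Nat p q (eap h)"
  by (auto simp: Nat_def Sel_def eap_in eap_lb eap_res)

lemma Nat_Sel: "Nat p q \<phi> \<Longrightarrow> a \<in> Sel p k \<Longrightarrow> \<phi> k a \<in> Sel q k"
  by (auto simp: Nat_def Sel_def)

lemma Nat_lb: "Nat p q \<phi> \<Longrightarrow> a \<in> Sel p k \<Longrightarrow> lb q k (\<phi> k a) = lb p k a"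
  by (auto simp: Nat_def)

lemma Nat_res: "Nat p q \<phi> \<Longrightarrow> a \<in> Sel p k \<Longrightarrow> f \<in> hom Delta m k \<Longrightarrow> inj_on (ev f) {..m} \<Longrightarrow>
    \<phi> m (res p f a) = res q f (\<phi> k a)"
  by (auto simp: Nat_def)

lemma Nat_cong: "Nat p q \<phi> \<Longrightarrow> (\<And>k a. a \<in> Sel p k \<Longrightarrow> \<psi> k a = \<phi> k a) \<Longrightarrow>
   (\<And>k a m f. a \<in> Sel p k \<Longrightarrow> f \<in> hom Delta m k \<Longrightarrow> inj_on (ev f) {..m} \<Longrightarrow> res p f a \<in> Sel p m) \<Longrightarrow> Nat p q \<psi>"
  by (simp add: Nat_def)

text \<open>The extensionality principle for arrows into \<open>L0\<close>: the uniqueness clause of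
  its definition, for the natural family of \<open>h\<close> itself.\<close>

lemma L0_eq:
  assumes "q \<in> L0" "h \<in> hom E p q" "h' \<in> hom E p q"
    and "\<And>k a. a \<in> Sel p k \<Longrightarrow> eap h k a = eap h' k a"
  shows "h = h'"
proof -
  have "p \<in> Ob E" using E.dom_ob[OF assms(2)] .
  then have "\<exists>!g. g \<in> hom E p q \<and> (\<forall>k. \<forall>a \<in> Sel p k. eap g k a = eap h k a)"
    using assms(1) Nat_eap[OF assms(2)] unfolding L0_def by blast
  then show ?thesis using assms(2-4) by metis
qed

lemma Nat_comp:
  assumes "Nat p q \<phi>" "Nat q s \<psi>"
  shows "Nat p s (\<lambda>k a. \<psi> k (\<phi> k a))"
  unfolding Nat_def
proof (intro conjI allI ballI impI)
  fix k a assume a: "a \<in> Sel p k"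
  show "\<psi> k (\<phi> k a) \<in> el s k" using Nat_Sel[OF assms(2) Nat_Sel[OF assms(1) a]] Sel_el by blast
  show "lb s k (\<psi> k (\<phi> k a)) = lb p k a"
    using Nat_lb[OF assms(2) Nat_Sel[OF assms(1) a]] Nat_lb[OF assms(1) a] by simp
next
  fix k m f a assume a: "a \<in> Sel p k" and f: "f \<in> hom Delta m k" "inj_on (ev f) {..m}"
  show "\<psi> m (\<phi> m (res p f a)) = res s f (\<psi> k (\<phi> k a))"
    using Nat_res[OF assms(2) Nat_Sel[OF assms(1) a] f] Nat_res[OF assms(1) a f] by simp
qed

lemma Sbij_hom: "Sbij h p q \<Longrightarrow> h \<in> hom E p q" by (simp add: Sbij_def)

lemma Sbij_inj: "Sbij h p q \<Longrightarrow> a \<in> Sel p k \<Longrightarrow> b \<in> Sel p k \<Longrightarrow> eap h k a = eap h k b \<Longrightarrow> a = b"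
  by (auto simp: Sbij_def bij_betw_def inj_on_def)

lemma Sbij_surj: "Sbij h p q \<Longrightarrow> b \<in> Sel q k \<Longrightarrow> \<exists>a \<in> Sel p k. b = eap h k a"
  unfolding Sbij_def bij_betw_def by blast

end

context strongly_regular_over
begin

lemma Sel_res: "p \<in> Ob E \<Longrightarrow> a \<in> Sel p k \<Longrightarrow> f \<in> hom Delta m k \<Longrightarrow> inj_on (ev f) {..m} \<Longrightarrow> res p f a \<in> Sel p m"
  using nd_face[of k "lb p k a" f m] by (simp add: Sel_def res_in lb_res)

text \<open>The pointwise inverse is natural since faces of nondegenerate elements stay in
  \<open>Sel\<close>, where the bijection can be cancelled.\<close>

lemma Nat_inv:
  assumes "Sbij h p q"
  shows "\<exists>\<psi>. Nat q p \<psi> \<and> (\<forall>k. \<forall>a \<in> Sel p k. \<psi> k (eap h k a) = a) \<and>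
     (\<forall>k. \<forall>b \<in> Sel q k. eap h k (\<psi> k b) = b)"
proof -
  define \<psi> where "\<psi> k = the_inv_into (Sel p k) (eap h k)" for k
  have h: "h \<in> hom E p q" and inj: "inj_on (eap h k) (Sel p k)" and im: "eap h k ` Sel p k = Sel q k" for k
    using assms by (auto simp: Sbij_def bij_betw_def)
  note pq = E.dom_ob[OF h] E.cod_ob[OF h]
  have 1: "\<psi> k (eap h k a) = a" if "a \<in> Sel p k" for k a
    using the_inv_into_f_f[OF inj that] by (simp add: \<psi>_def)
  have 2: "eap h k (\<psi> k b) = b" "\<psi> k b \<in> Sel p k" if b: "b \<in> Sel q k" for k b
    using Sbij_surj[OF assms b] 1 by auto
  have "Nat q p \<psi>"
    unfolding Nat_def
  proof (intro conjI allI ballI impI)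
    fix k b assume b: "b \<in> Sel q k"
    show "\<psi> k b \<in> el p k" using Sel_el[OF 2(2)[OF b]] .
    show "lb p k (\<psi> k b) = lb q k b" using eap_lb[OF h Sel_el[OF 2(2)[OF b]]] 2(1)[OF b] by simp
  next
    fix k m f b assume b: "b \<in> Sel q k" and f: "f \<in> hom Delta m k" "inj_on (ev f) {..m}"
    show "\<psi> m (res q f b) = res p f (\<psi> k b)"
      using 1[OF Sel_res[OF pq(1) 2(2)[OF b] f]] eap_res[OF h f(1) Sel_el[OF 2(2)[OF b]]] 2(1)[OF b] by simp
  qed
  then show ?thesis using 1 2 by blast
qed

text \<open>The right Kan extension along the inclusion of the nondegenerate simplices.\<close>

lemma L0_reflection_ex:
  assumes p: "p \<in> Ob E"
  shows "\<exists>q \<in> L0. \<exists>h. Sbij h p q"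
proof -
  \<comment> \<open>The index set of the limit at \<open>x\<close>: all operators along which
    \<open>x\<close> restricts to a nondegenerate simplex.\<close>
  define dm where "dm k x = {f \<in> Arr Delta. Cod Delta f = k \<and> nd (Dom Delta f) (act X f x)}" for k x
  have dm: "f \<in> dm k x \<longleftrightarrow> nd m (act X f x)" if "f \<in> hom Delta m k" for f m k x
    using homD[OF that] by (auto simp: dm_def)
  have dm_ex: "\<exists>m. f \<in> hom Delta m k \<and> nd m (act X f x)" if "f \<in> dm k x" for f k x
    using that homI[of f Delta] by (auto simp: dm_def)
  \<comment> \<open>An element of the extension is a label with a compatible family of values in
    \<open>p\<close>, indexed by \<open>dm\<close>. Compatibility refers to injective
    \<open>g\<close> alone, and extensionality makes the family unique as a function.\<close>
  define B where "B k = {b. fst b \<in> on_ob X k \<and> snd b \<in> extensional (dm k (fst b)) \<and>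
     (\<forall>m. \<forall>f \<in> hom Delta m k. nd m (act X f (fst b)) \<longrightarrow>
        snd b f \<in> el p m \<and> lb p m (snd b f) = act X f (fst b) \<and>
        (\<forall>l. \<forall>g \<in> hom Delta l m. inj_on (ev g) {..l} \<longrightarrow> snd b (f \<cdot>\<^bsub>Delta\<^esub> g) = res p g (snd b f)))}" for k
  define ac :: "simp_op \<Rightarrow> 'u \<times> (simp_op \<Rightarrow> 'u) \<Rightarrow> 'u \<times> (simp_op \<Rightarrow> 'u)"
    where "ac h b = (act X h (fst b), restrict (\<lambda>f. snd b (h \<cdot>\<^bsub>Delta\<^esub> f)) (dm (Dom Delta h) (act X h (fst b))))" for h b
  have BD: "fst b \<in> on_ob X k" "snd b \<in> extensional (dm k (fst b))"
    "\<And>m f. f \<in> hom Delta m k \<Longrightarrow> nd m (act X f (fst b)) \<Longrightarrow> snd b f \<in> el p m \<and> lb p m (snd b f) = act X f (fst b)"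
    "\<And>m f l g. f \<in> hom Delta m k \<Longrightarrow> nd m (act X f (fst b)) \<Longrightarrow> g \<in> hom Delta l m \<Longrightarrow> inj_on (ev g) {..l} \<Longrightarrow>
       snd b (f \<cdot>\<^bsub>Delta\<^esub> g) = res p g (snd b f)"
    if "b \<in> B k" for b k using that by (auto simp: B_def)
  have Beq: "b = b'" if "b \<in> B k" "b' \<in> B k" "fst b = fst b'"
    and sn: "\<And>f m. f \<in> hom Delta m k \<Longrightarrow> nd m (act X f (fst b)) \<Longrightarrow> snd b f = snd b' f" for b b' k
  proof -
    have "snd b = snd b'"
    proof (rule extensionalityI[OF BD(2)[OF that(1)]])
      show "snd b' \<in> extensional (dm k (fst b))" using BD(2)[OF that(2)] that(3) by simp
      show "snd b f = snd b' f" if "f \<in> dm k (fst b)" for f using dm_ex[OF that] sn by blast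
    qed
    then show ?thesis using that(3) by (simp add: prod_eq_iff)
  qed
  have acs: "snd (ac h b) f = snd b (h \<cdot>\<^bsub>Delta\<^esub> f)"
    if "h \<in> hom Delta m k" "f \<in> hom Delta l m" "nd l (act X f (act X h (fst b)))" for h b f m k l
    using that dm[OF that(2)] homD[OF that(1)] by (simp add: ac_def)
  have aca: "act X f (act X h (fst b)) = act X (h \<cdot>\<^bsub>Delta\<^esub> f) (fst b)"
    if "h \<in> hom Delta m k" "f \<in> hom Delta l m" "b \<in> B k" for h b f m k l
    using act_comp[OF X that(1,2) BD(1)[OF that(3)]] .
  have acB: "ac h b \<in> B m" if h: "h \<in> hom Delta m k" and b: "b \<in> B k" for h b m k
  proof -
    have "snd (ac h b) f \<in> el p l \<and> lb p l (snd (ac h b) f) = act X f (fst (ac h b)) \<and>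
        (\<forall>j. \<forall>g \<in> hom Delta j l. inj_on (ev g) {..j} \<longrightarrow> snd (ac h b) (f \<cdot>\<^bsub>Delta\<^esub> g) = res p g (snd (ac h b) f))"
      if f: "f \<in> hom Delta l m" and n: "nd l (act X f (fst (ac h b)))" for l f
    proof -
      have n1: "nd l (act X f (act X h (fst b)))" using n by (simp add: ac_def)
      have n2: "nd l (act X (h \<cdot>\<^bsub>Delta\<^esub> f) (fst b))" using n1 aca[OF h f b] by simp
      have hf: "h \<cdot>\<^bsub>Delta\<^esub> f \<in> hom Delta l k" using Delta_comp_in[OF h f] .
      have "snd (ac h b) (f \<cdot>\<^bsub>Delta\<^esub> g) = res p g (snd (ac h b) f)"
        if g: "g \<in> hom Delta j l" and gi: "inj_on (ev g) {..j}" for j g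
      proof -
        have fg: "f \<cdot>\<^bsub>Delta\<^esub> g \<in> hom Delta j m" using Delta_comp_in[OF f g] .
        have "nd j (act X (f \<cdot>\<^bsub>Delta\<^esub> g) (act X h (fst b)))"
          using nd_face[OF n1 g gi] act_comp[OF X f g act_in[OF X h BD(1)[OF b]]] by simp
        then have "snd (ac h b) (f \<cdot>\<^bsub>Delta\<^esub> g) = snd b (h \<cdot>\<^bsub>Delta\<^esub> (f \<cdot>\<^bsub>Delta\<^esub> g))"
          using acs[OF h fg] by simp
        then show ?thesis using BD(4)[OF b hf n2 g gi] acs[OF h f n1] Delta.assoc[OF h f g] by simp
      qed
      then show ?thesis using BD(3)[OF b hf n2] acs[OF h f n1] aca[OF h f b] by (simp add: ac_def)
    qed
    moreover have "fst (ac h b) \<in> on_ob X m" using act_in[OF X h BD(1)[OF b]] by (simp add: ac_def)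
    moreover have "snd (ac h b) \<in> extensional (dm m (fst (ac h b)))"
      using homD[OF h] by (simp add: ac_def)
    ultimately show ?thesis unfolding B_def by blast
  qed
  have "\<exists>q e. presents B ac (\<lambda>k. fst) e q"
  proof (rule presents_ex)
    fix k
    define I where "I = {f \<in> Arr Delta. Cod Delta f = k \<and> Dom Delta f \<le> k}"
    define U where "U = (\<Union>m\<in>{..k}. el p m)"
    \<comment> \<open>A family may be undefined at operators of \<open>I\<close> outside
      \<open>dm\<close>, which accounts for the additional value \<open>undefined\<close>.\<close>
    have "B k \<subseteq> on_ob X k \<times> (I \<rightarrow>\<^sub>E insert undefined U)"
    proof
      fix b assume b: "b \<in> B k"
      have dI: "dm k (fst b) \<subseteq> I"
      proof
        fix f assume "f \<in> dm k (fst b)"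
        then obtain m where f: "f \<in> hom Delta m k" "nd m (act X f (fst b))" using dm_ex by blast
        then have "m \<le> k" using inj_dim nd_inj BD(1)[OF b] by blast
        then show "f \<in> I" using homD[OF f(1)] by (simp add: I_def)
      qed
      have "snd b f \<in> insert undefined U" if "f \<in> I" for f
      proof (cases "f \<in> dm k (fst b)")
        case True
        then obtain m where f: "f \<in> hom Delta m k" "nd m (act X f (fst b))" using dm_ex by blast
        then have "m \<le> k" using inj_dim nd_inj BD(1)[OF b] by blast
        then show ?thesis using BD(3)[OF b f] by (auto simp: U_def)
      next
        case False
        then show ?thesis using BD(2)[OF b] by (simp add: extensional_def)
      qed
      then have "snd b \<in> I \<rightarrow>\<^sub>E insert undefined U"
        using BD(2)[OF b] dI by (auto simp: PiE_def extensional_def)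
      then show "b \<in> on_ob X k \<times> (I \<rightarrow>\<^sub>E insert undefined U)" using BD(1)[OF b] by (simp add: mem_Times_iff)
    qed
    moreover have "|U| <o r" unfolding U_def by (intro small_UN small_finite el_card[OF p]) auto
    then have "|on_ob X k \<times> (I \<rightarrow>\<^sub>E insert undefined U)| <o r"
      using finite_Delta[of k] by (intro small_Sigma simp_card[OF X] small_PiE small_insert) (simp_all add: I_def)
    ultimately show "|B k| <o r" by (rule small_subset)
  next
    fix f m k b assume f: "f \<in> hom Delta m k" and b: "b \<in> B k"
    show "ac f b \<in> B m" using acB[OF f b] .
    show "fst (ac f b) = act X f (fst b)" by (simp add: ac_def)
  next
    fix k b assume b: "b \<in> B k"
    note i = Delta_id_in[of k]
    show "ac (Idt Delta k) b = b"
    proof (rule Beq[OF acB[OF i b] b])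
      show 1: "fst (ac (Idt Delta k) b) = fst b" using act_id[OF X BD(1)[OF b]] by (simp add: ac_def)
      show "snd (ac (Idt Delta k) b) f = snd b f"
        if "f \<in> hom Delta m k" "nd m (act X f (fst (ac (Idt Delta k) b)))" for f m
        using acs[OF i that(1), of b] that(2) 1 Delta.idl[OF that(1)] act_id[OF X BD(1)[OF b]] by simp
    qed
    show "fst b \<in> on_ob X k" using BD(1)[OF b] .
  next
    fix f g m k j b assume f: "f \<in> hom Delta m k" and g: "g \<in> hom Delta j m" and b: "b \<in> B k"
    have fg: "f \<cdot>\<^bsub>Delta\<^esub> g \<in> hom Delta j k" using Delta_comp_in[OF f g] .
    show "ac g (ac f b) = ac (f \<cdot>\<^bsub>Delta\<^esub> g) b"
    proof (rule Beq[OF acB[OF g acB[OF f b]] acB[OF fg b]])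
      show 1: "fst (ac g (ac f b)) = fst (ac (f \<cdot>\<^bsub>Delta\<^esub> g) b)"
        using aca[OF f g b] by (simp add: ac_def)
      fix h l assume h: "h \<in> hom Delta l j" and n: "nd l (act X h (fst (ac g (ac f b))))"
      have gh: "g \<cdot>\<^bsub>Delta\<^esub> h \<in> hom Delta l m" using Delta_comp_in[OF g h] .
      have n1: "nd l (act X h (act X g (fst (ac f b))))" using n by (simp add: ac_def)
      have n2: "nd l (act X (g \<cdot>\<^bsub>Delta\<^esub> h) (act X f (fst b)))"
        using n1 act_comp[OF X g h BD(1)[OF acB[OF f b]]] by (simp add: ac_def)
      have n3: "nd l (act X h (act X (f \<cdot>\<^bsub>Delta\<^esub> g) (fst b)))" using n 1 by (simp add: ac_def)
      show "snd (ac g (ac f b)) h = snd (ac (f \<cdot>\<^bsub>Delta\<^esub> g) b) h"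
        using acs[OF g h n1] acs[OF f gh n2] acs[OF fg h n3] Delta.assoc[OF f g h] by simp
    qed
  qed
  then obtain q e where P: "presents B ac (\<lambda>k. fst) e q" by blast
  note q = presents_Ob[OF P]
  \<comment> \<open>A natural family on nondegenerate elements extends by recording its values on all
    nondegenerate faces of an element.\<close>
  define tr where "tr s \<phi> k a = (lb s k a, restrict (\<lambda>f. \<phi> (Dom Delta f) (res s f a)) (dm k (lb s k a)))"
    for s and \<phi> :: "nat \<Rightarrow> 'u \<Rightarrow> 'u" and k a
  have tr_ev: "snd (tr s \<phi> k a) f = \<phi> m (res s f a)"
    if "f \<in> hom Delta m k" "nd m (act X f (lb s k a))" for s \<phi> k a f m
    using dm[OF that(1)] that(2) homD[OF that(1)] by (simp add: tr_def)
  have fSel: "res s f a \<in> Sel s m"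
    if "s \<in> Ob E" "a \<in> el s k" "f \<in> hom Delta m k" "nd m (act X f (lb s k a))" for s f a m k
    using that res_in lb_res by (simp add: Sel_def)
  have trB: "tr s \<phi> k a \<in> B k" if s: "s \<in> Ob E" and N: "Nat s p \<phi>" and a: "a \<in> el s k" for s \<phi> k a
  proof -
    have "snd (tr s \<phi> k a) f \<in> el p m \<and> lb p m (snd (tr s \<phi> k a) f) = act X f (lb s k a) \<and>
        (\<forall>j. \<forall>g \<in> hom Delta j m. inj_on (ev g) {..j} \<longrightarrow> snd (tr s \<phi> k a) (f \<cdot>\<^bsub>Delta\<^esub> g) = res p g (snd (tr s \<phi> k a) f))"
      if f: "f \<in> hom Delta m k" and n: "nd m (act X f (lb s k a))" for m f
    proof -
      note S = fSel[OF s a f n]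
      have "snd (tr s \<phi> k a) (f \<cdot>\<^bsub>Delta\<^esub> g) = res p g (snd (tr s \<phi> k a) f)"
        if g: "g \<in> hom Delta j m" "inj_on (ev g) {..j}" for j g
      proof -
        have fg: "f \<cdot>\<^bsub>Delta\<^esub> g \<in> hom Delta j k" using Delta_comp_in[OF f g(1)] .
        have n': "nd j (act X (f \<cdot>\<^bsub>Delta\<^esub> g) (lb s k a))"
          using nd_face[OF n g] act_comp[OF X f g(1) lb_in[OF s a]] by simp
        show ?thesis using tr_ev[OF fg n', of \<phi>] tr_ev[OF f n, of \<phi>] Nat_res[OF N S g] res_comp[OF s f g(1) a] by simp
      qed
      then show ?thesis using Nat_Sel[OF N S, THEN Sel_el] Nat_lb[OF N S] lb_res[OF s f a] tr_ev[OF f n, of \<phi>] by simp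
    qed
    then show ?thesis using lb_in[OF s a] by (simp add: B_def tr_def)
  qed
  have tr_ex: "\<exists>h \<in> hom E s q. \<forall>k. \<forall>a \<in> el s k. eap h k a = e k (tr s \<phi> k a)"
    if s: "s \<in> Ob E" and N: "Nat s p \<phi>" for s \<phi>
  proof (rule hom_ex[OF s q])
    fix k a assume a: "a \<in> el s k"
    show "e k (tr s \<phi> k a) \<in> el q k" using presents_in[OF P trB[OF s N a]] .
    show "lb q k (e k (tr s \<phi> k a)) = lb s k a" using presents_lb[OF P trB[OF s N a]] by (simp add: tr_def)
    fix f m assume f: "f \<in> hom Delta m k"
    have "tr s \<phi> m (res s f a) = ac f (tr s \<phi> k a)"
    proof (rule Beq[OF trB[OF s N res_in[OF s f a]] acB[OF f trB[OF s N a]]])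
      show "fst (tr s \<phi> m (res s f a)) = fst (ac f (tr s \<phi> k a))"
        using lb_res[OF s f a] by (simp add: tr_def ac_def)
      fix g l assume g: "g \<in> hom Delta l m" and n: "nd l (act X g (fst (tr s \<phi> m (res s f a))))"
      then have n1: "nd l (act X g (lb s m (res s f a)))" by (simp add: tr_def)
      have n2: "nd l (act X g (act X f (fst (tr s \<phi> k a))))" using n1 lb_res[OF s f a] by (simp add: tr_def)
      have n3: "nd l (act X (f \<cdot>\<^bsub>Delta\<^esub> g) (lb s k a))"
        using n2 act_comp[OF X f g lb_in[OF s a]] by (simp add: tr_def)
      show "snd (tr s \<phi> m (res s f a)) g = snd (ac f (tr s \<phi> k a)) g"
        using tr_ev[OF g n1, of \<phi>] acs[OF f g n2] tr_ev[OF Delta_comp_in[OF f g] n3, of \<phi>] res_comp[OF s f g a] by simp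
    qed
    then show "e m (tr s \<phi> m (res s f a)) = res q f (e k (tr s \<phi> k a))"
      using presents_res[OF P trB[OF s N a] f] by simp
  qed
  have idN: "Nat p p (\<lambda>k a. a)" by (auto simp: Nat_def Sel_def)
  obtain h where h: "h \<in> hom E p q" and hv: "\<And>k a. a \<in> el p k \<Longrightarrow> eap h k a = e k (tr p (\<lambda>k a. a) k a)"
    using tr_ex[OF p idN] by blast
  \<comment> \<open>Over a nondegenerate simplex the identity indexes a component of the family, and
    this component determines all others; evaluation there inverts the unit.\<close>
  define un where "un k b = snd (the_inv_into (B k) (e k) b) (Idt Delta k)" for k b
  have inj: "inj_on (e k) (B k)" for k using presents_inj[OF P] by (auto simp: inj_on_def)
  have un: "un k (e k b) = snd b (Idt Delta k)" if "b \<in> B k" for k b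
    using the_inv_into_f_f[OF inj that] by (simp add: un_def)
  have un_Sel: "un k c \<in> Sel p k \<and> eap h k (un k c) = c" if c: "c \<in> Sel q k" for k c
  proof -
    obtain b where b: "b \<in> B k" "c = e k b" using presents_surj[OF P Sel_el[OF c]] by blast
    have n: "nd k (fst b)" using c presents_lb[OF P b(1)] b(2) by (simp add: Sel_def)
    have n': "nd k (act X (Idt Delta k) (fst b))" using n act_id[OF X BD(1)[OF b(1)]] by simp
    have u: "un k c = snd b (Idt Delta k)" using un[OF b(1)] b(2) by simp
    have v: "un k c \<in> el p k" "lb p k (un k c) = fst b"
      using BD(3)[OF b(1) Delta_id_in n'] act_id[OF X BD(1)[OF b(1)]] u by auto
    have "tr p (\<lambda>k a. a) k (un k c) = b"
    proof (rule Beq[OF trB[OF p idN v(1)] b(1)])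
      show "fst (tr p (\<lambda>k a. a) k (un k c)) = fst b" using v(2) by (simp add: tr_def)
      fix f m assume f: "f \<in> hom Delta m k" and "nd m (act X f (fst (tr p (\<lambda>k a. a) k (un k c))))"
      then have n2: "nd m (act X f (lb p k (un k c)))" by (simp add: tr_def)
      have "inj_on (ev f) {..m}" using nd_inj[OF n2 lb_in[OF p v(1)] f] .
      from BD(4)[OF b(1) Delta_id_in n' f this]
      show "snd (tr p (\<lambda>k a. a) k (un k c)) f = snd b f"
        using tr_ev[OF f n2, of "\<lambda>k a. a"] Delta.idl[OF f] u by simp
    qed
    then show ?thesis using hv[OF v(1)] v n b(2) by (simp add: Sel_def)
  qed
  have "inj_on (eap h k) (Sel p k)" for k
  proof (rule inj_onI)
    fix a b assume ab: "a \<in> Sel p k" "b \<in> Sel p k" "eap h k a = eap h k b"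
    then have eq: "tr p (\<lambda>k a. a) k a = tr p (\<lambda>k a. a) k b"
      using hv presents_inj[OF P trB[OF p idN] trB[OF p idN]] Sel_el by metis
    have "nd k (act X (Idt Delta k) (lb p k a))" "nd k (act X (Idt Delta k) (lb p k b))"
      using ab act_id[OF X lb_in[OF p Sel_el]] by (auto simp: Sel_def)
    from this[THEN tr_ev[OF Delta_id_in, of _ _ _ "\<lambda>k a. a"]]
    have "res p (Idt Delta k) a = res p (Idt Delta k) b" using eq by metis
    then show "a = b" using res_id[OF p Sel_el[OF ab(1)]] res_id[OF p Sel_el[OF ab(2)]] by simp
  qed
  then have Sb: "Sbij h p q"
    using h un_Sel Sel_eap[OF h] unfolding Sbij_def bij_betw_def by (blast intro: sym)
  have un_h: "un k (eap h k a) = a" if "a \<in> Sel p k" for k a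
    using un_Sel[OF Sel_eap[OF h that]] Sbij_inj[OF Sb _ that] by blast
  have unN: "Nat q p un"
  proof -
    obtain \<psi> where psi: "Nat q p \<psi>" "\<And>k b. b \<in> Sel q k \<Longrightarrow> eap h k (\<psi> k b) = b" using Nat_inv[OF Sb] by blast
    have "un k b = \<psi> k b" if "b \<in> Sel q k" for k b
      using un_h[OF Nat_Sel[OF psi(1) that]] psi(2)[OF that] by simp
    then show ?thesis using Nat_cong[OF psi(1)] Sel_res[OF q] by blast
  qed
  have "q \<in> L0"
    unfolding L0_def
  proof (intro CollectI conjI ballI allI impI q)
    fix s \<phi> assume s: "s \<in> Ob E" and N: "Nat s q \<phi>"
    \<comment> \<open>The family with values in \<open>q\<close> is carried back to
      \<open>p\<close>, whose elements are what \<open>tr\<close> records as components.\<close>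
    define \<psi> where "\<psi> k a = un k (\<phi> k a)" for k a
    have N': "Nat s p \<psi>" unfolding \<psi>_def by (rule Nat_comp[OF N unN])
    obtain g where g: "g \<in> hom E s q" "\<And>k a. a \<in> el s k \<Longrightarrow> eap g k a = e k (tr s \<psi> k a)"
      using tr_ex[OF s N'] by blast
    have ev: "un k (e k b) = snd b (Idt Delta k)" if "b \<in> B k" for k b using un[OF that] .
    have gS: "eap g k a = \<phi> k a" if a: "a \<in> Sel s k" for k a
    proof -
      have n: "nd k (act X (Idt Delta k) (lb s k a))" using a act_id[OF X lb_in[OF s Sel_el[OF a]]] by (simp add: Sel_def)
      have "un k (eap g k a) = un k (\<phi> k a)"
        using g(2)[OF Sel_el[OF a]] ev[OF trB[OF s N' Sel_el[OF a]]] tr_ev[OF Delta_id_in n, of \<psi>] res_id[OF s Sel_el[OF a]]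
        unfolding \<psi>_def by metis
      then show ?thesis using un_Sel[OF Sel_eap[OF g(1) a]] un_Sel[OF Nat_Sel[OF N a]] by metis
    qed
    show "\<exists>!h. h \<in> hom E s q \<and> (\<forall>k. \<forall>a \<in> Sel s k. eap h k a = \<phi> k a)"
    proof (rule ex1I[of _ g])
      show "g \<in> hom E s q \<and> (\<forall>k. \<forall>a \<in> Sel s k. eap g k a = \<phi> k a)" using g gS by blast
      fix g' assume g': "g' \<in> hom E s q \<and> (\<forall>k. \<forall>a \<in> Sel s k. eap g' k a = \<phi> k a)"
      show "g' = g"
      proof (rule hom_eqI)
        show "g' \<in> hom E s q" "g \<in> hom E s q" using g' g by auto
        fix k a assume a: "a \<in> el s k"
        obtain b where b: "b \<in> B k" "eap g' k a = e k b" using presents_surj[OF P eap_in] g' a by blast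
        have lbb: "fst b = lb s k a" using eap_lb[of g' s q a k] g' a presents_lb[OF P b(1)] b(2) by simp
        have "b = tr s \<psi> k a"
        proof (rule Beq[OF b(1) trB[OF s N' a]])
          show "fst b = fst (tr s \<psi> k a)" using lbb by (simp add: tr_def)
          fix f m assume f: "f \<in> hom Delta m k" and n0: "nd m (act X f (fst b))"
          then have n: "nd m (act X f (lb s k a))" using lbb by simp
          have "eap g' m (res s f a) = \<phi> m (res s f a)" using g' fSel[OF s a f n] by blast
          moreover have "eap g' m (res s f a) = e m (ac f b)"
            using eap_res[of g' s q f m k a] g' f a presents_res[OF P b(1) f] b(2) by simp
          ultimately have "\<psi> m (res s f a) = snd (ac f b) (Idt Delta m)"
            using un[OF acB[OF f b(1)]] by (simp add: \<psi>_def)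
          \<comment> \<open>A component at \<open>f\<close> is the identity component of the
            restriction along \<open>f\<close>. Hence the values on nondegenerate faces determine an
            arrow into \<open>q\<close>.\<close>
          moreover have "snd (ac f b) (Idt Delta m) = snd b (f \<cdot>\<^bsub>Delta\<^esub> Idt Delta m)"
            by (rule acs[OF f Delta_id_in]) (use n0 act_id[OF X act_in[OF X f BD(1)[OF b(1)]]] in simp)
          ultimately show "snd b f = snd (tr s \<psi> k a) f"
            using Delta.idr[OF f] tr_ev[OF f n, of \<psi>] by simp
        qed
        then show "eap g' k a = eap g k a" using b(2) g(2)[OF a] by simp
      qed
    qed
  qed
  then show ?thesis using Sb by blast
qed

section \<open>Objects generated by their nondegenerate elements\<close>

lemma isCore_surj:
  assumes c: "isCore c" and a: "a \<in> el c k"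
  shows "\<exists>j e b. e \<in> hom Delta k j \<and> ev e ` {..k} = {..j} \<and> b \<in> Sel c j \<and> a = res c e b"
proof -
  have cO: "c \<in> Ob E" using c by (simp add: isCore_def)
  obtain j f b where f: "f \<in> hom Delta k j" "b \<in> Sel c j" "a = res c f b" using c a unfolding isCore_def by blast
  obtain i e d where e: "e \<in> hom Delta k i" "d \<in> hom Delta i j" "f = d \<cdot>\<^bsub>Delta\<^esub> e"
    "ev e ` {..k} = {..i}" "inj_on (ev d) {..i}" by (rule epi_mono[OF f(1)])
  have "a = res c e (res c d b)" using res_comp[OF cO e(2,1) Sel_el[OF f(2)]] f(3) e(3) by simp
  then show ?thesis using e Sel_res[OF cO f(2) e(2,5)] by blast
qed

lemma core_eq:
  assumes c: "isCore c" and h: "h \<in> hom E c q" "h' \<in> hom E c q"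
    and eq: "\<And>k a. a \<in> Sel c k \<Longrightarrow> eap h k a = eap h' k a"
  shows "h = h'"
proof (rule hom_eqI[OF h])
  fix k a assume "a \<in> el c k"
  then obtain j f b where f: "f \<in> hom Delta k j" "b \<in> Sel c j" "a = res c f b" using c unfolding isCore_def by blast
  then show "eap h k a = eap h' k a"
    using eap_res[OF h(1) f(1) Sel_el[OF f(2)]] eap_res[OF h(2) f(1) Sel_el[OF f(2)]] eq[OF f(2)] by simp
qed

text \<open>Elements are sent where a chosen decomposition dictates. Independence of the choice is
  the uniqueness of Eilenberg-Zilber decompositions: surjective parts are compared on labels,
  injective parts are absorbed by naturality.\<close>

lemma core_ext:
  assumes c: "isCore c" and q: "q \<in> Ob E" and N: "Nat c q \<phi>"
  shows "\<exists>h \<in> hom E c q. \<forall>k. \<forall>a \<in> Sel c k. eap h k a = \<phi> k a"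
proof -
  have cO: "c \<in> Ob E" using c by (simp add: isCore_def)
  define R where "R k a t \<longleftrightarrow> (case t of (j, e, b) \<Rightarrow> e \<in> hom Delta k j \<and> ev e ` {..k} = {..j} \<and>
    b \<in> Sel c j \<and> a = res c e b)" for k a t
  define \<phi>' where "\<phi>' k a = (case (SOME t. R k a t) of (j, e, b) \<Rightarrow> res q e (\<phi> j b))" for k a
  have key: "\<phi>' k (res c e b) = res q e (\<phi> j b)" if e: "e \<in> hom Delta k j" and b: "b \<in> Sel c j" for k j e b
  proof -
    have a: "res c e b \<in> el c k" using res_in[OF cO e Sel_el[OF b]] .
    have "\<exists>t. R k (res c e b) t" using isCore_surj[OF c a] unfolding R_def by auto
    from someI_ex[OF this] obtain j1 e1 b1 where t: "(SOME t. R k (res c e b) t) = (j1, e1, b1)"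
      and e1: "e1 \<in> hom Delta k j1" "ev e1 ` {..k} = {..j1}" "b1 \<in> Sel c j1" "res c e b = res c e1 b1"
      unfolding R_def by (cases "SOME t. R k (res c e b) t") (auto simp: R_def)
    obtain i e0 d where e0: "e0 \<in> hom Delta k i" "d \<in> hom Delta i j" "e = d \<cdot>\<^bsub>Delta\<^esub> e0"
      "ev e0 ` {..k} = {..i}" "inj_on (ev d) {..i}" by (rule epi_mono[OF e])
    have b0: "res c d b \<in> Sel c i" using Sel_res[OF cO b e0(2,5)] .
    have r0: "res c e b = res c e0 (res c d b)" using res_comp[OF cO e0(2,1) Sel_el[OF b]] e0(3) by simp
    \<comment> \<open>Uniqueness is available for simplices of \<open>X\<close>, so it is applied to
      the labels. Once the surjections agree, a section of the common surjection identifies the two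
      elements of \<open>c\<close>.\<close>
    have "act X e0 (lb c i (res c d b)) = act X e1 (lb c j1 b1)"
      using lb_res[OF cO e0(1) Sel_el[OF b0]] lb_res[OF cO e1(1) Sel_el[OF e1(3)]] r0 e1(4) by simp
    then have u: "i = j1 \<and> e0 = e1"
      using EZ_unique[OF e0(1,4) e1(1,2)] b0 e1(3) by (auto simp: Sel_def)
    obtain s where s: "s \<in> hom Delta i k" "e0 \<cdot>\<^bsub>Delta\<^esub> s = Idt Delta i" using section_ex[OF e0(1,4), of 0] by blast
    have "res c s (res c e0 z) = z" if "z \<in> Sel c i" for z
      using res_comp[OF cO e0(1) s(1) Sel_el[OF that]] s(2) res_id[OF cO Sel_el[OF that]] by simp
    then have "res c d b = b1" using r0 e1(3,4) u b0 by metis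
    then have "\<phi>' k (res c e b) = res q e0 (\<phi> i (res c d b))" using t u by (simp add: \<phi>'_def)
    also have "\<dots> = res q e0 (res q d (\<phi> j b))" using Nat_res[OF N b e0(2,5)] by simp
    also have "\<dots> = res q e (\<phi> j b)" using res_comp[OF q e0(2,1) Sel_el[OF Nat_Sel[OF N b]]] e0(3) by simp
    finally show ?thesis .
  qed
  have "\<exists>h \<in> hom E c q. \<forall>k. \<forall>a \<in> el c k. eap h k a = \<phi>' k a"
  proof (rule hom_ex[OF cO q])
    fix k a assume a: "a \<in> el c k"
    then obtain j e b where e: "e \<in> hom Delta k j" "b \<in> Sel c j" "a = res c e b" using isCore_surj[OF c a] by blast
    note fb = Sel_el[OF Nat_Sel[OF N e(2)]]
    have v: "\<phi>' k a = res q e (\<phi> j b)" using key[OF e(1,2)] e(3) by simp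
    show "\<phi>' k a \<in> el q k" using v res_in[OF q e(1) fb] by simp
    show "lb q k (\<phi>' k a) = lb c k a"
      using v lb_res[OF q e(1) fb] Nat_lb[OF N e(2)] lb_res[OF cO e(1) Sel_el[OF e(2)]] e(3) by simp
    fix f m assume f: "f \<in> hom Delta m k"
    have "res c f a = res c (e \<cdot>\<^bsub>Delta\<^esub> f) b" using res_comp[OF cO e(1) f Sel_el[OF e(2)]] e(3) by simp
    then show "\<phi>' m (res c f a) = res q f (\<phi>' k a)"
      using key[OF Delta_comp_in[OF e(1) f] e(2)] v res_comp[OF q e(1) f fb] by simp
  qed
  then obtain h where h: "h \<in> hom E c q" "\<And>k a. a \<in> el c k \<Longrightarrow> eap h k a = \<phi>' k a" by blast
  have "eap h k a = \<phi> k a" if a: "a \<in> Sel c k" for k a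
    using h(2)[OF Sel_el[OF a]] key[OF Delta_id_in a] res_id[OF cO Sel_el[OF a]] res_id[OF q Sel_el[OF Nat_Sel[OF N a]]] by simp
  then show ?thesis using h(1) by blast
qed

end

context simp_over
begin

text \<open>The encoding of presheaves may rename elements, so a subpresheaf is obtained up to a
  bijection onto \<open>B\<close> only.\<close>

lemma subobj_ex:
  assumes p: "p \<in> Ob E" and sub: "\<And>k. B k \<subseteq> el p k"
    and cl: "\<And>f m k a. f \<in> hom Delta m k \<Longrightarrow> a \<in> B k \<Longrightarrow> res p f a \<in> B m"
  shows "\<exists>c. \<exists>i \<in> hom E c p. \<forall>k. bij_betw (eap i k) (el c k) (B k)"
proof -
  have el: "a \<in> el p k" if "a \<in> B k" for a k using sub that by blast
  have "\<exists>c e. presents B (res p) (lb p) e c"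
    by (rule presents_ex)
      (simp_all add: small_subset[OF sub el_card[OF p]] cl el res_id[OF p] res_comp[OF p] lb_in[OF p] lb_res[OF p])
  then obtain c e where P: "presents B (res p) (lb p) e c" by blast
  have "\<exists>i \<in> hom E c p. \<forall>k. \<forall>a \<in> B k. eap i k (e k a) = a"
    using presents_hom[OF P p, of "\<lambda>k a. a"] sub by auto
  then obtain i where i: "i \<in> hom E c p" "\<And>k a. a \<in> B k \<Longrightarrow> eap i k (e k a) = a" by blast
  have "bij_betw (eap i k) (el c k) (B k)" for k
    unfolding bij_betw_def
  proof (intro conjI inj_onI equalityI subsetI)
    fix a b assume "a \<in> el c k" "b \<in> el c k" "eap i k a = eap i k b"
    then show "a = b" using presents_surj[OF P] i(2) by metis
  next
    fix a assume "a \<in> eap i k ` el c k"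
    then show "a \<in> B k" using presents_surj[OF P] i(2) by (metis imageE)
  next
    fix a assume "a \<in> B k"
    then show "a \<in> eap i k ` el c k" using presents_in[OF P] i(2) by (metis imageI)
  qed
  then show ?thesis using i(1) by blast
qed

end

context strongly_regular_over
begin

text \<open>The generated part contains every nondegenerate element, by the identity operator, and
  labels are kept by the inclusion; so the inclusion is bijective on nondegenerate elements.\<close>

lemma core_ex:
  assumes p: "p \<in> Ob E"
  shows "\<exists>c i. isCore c \<and> Sbij i c p \<and> (\<forall>k. inj_on (eap i k) (el c k))"
proof -
  define B where "B k = {a \<in> el p k. \<exists>j. \<exists>f \<in> hom Delta k j. \<exists>b \<in> Sel p j. a = res p f b}" for k
  have "\<exists>c. \<exists>i \<in> hom E c p. \<forall>k. bij_betw (eap i k) (el c k) (B k)"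
  proof (rule subobj_ex[OF p])
    show "B k \<subseteq> el p k" for k by (auto simp: B_def)
    fix f m k a assume f: "f \<in> hom Delta m k" and a: "a \<in> B k"
    then obtain j g b where g: "g \<in> hom Delta k j" "b \<in> Sel p j" "a = res p g b" by (auto simp: B_def)
    have "res p f a = res p (g \<cdot>\<^bsub>Delta\<^esub> f) b" using res_comp[OF p g(1) f Sel_el[OF g(2)]] g(3) by simp
    moreover have "a \<in> el p k" using a by (simp add: B_def)
    ultimately show "res p f a \<in> B m" using res_in[OF p f] g Delta_comp_in[OF g(1) f] unfolding B_def by blast
  qed
  then obtain c i where i: "i \<in> hom E c p" and bij: "\<And>k. bij_betw (eap i k) (el c k) (B k)" by blast
  have SB: "Sel p k \<subseteq> B k" for k
  proof
    fix a assume "a \<in> Sel p k"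
    then show "a \<in> B k" unfolding B_def
      using Sel_el res_id[OF p] Delta_id_in by (intro CollectI conjI exI[of _ k] bexI[of _ "Idt Delta k"] bexI[of _ a]) auto
  qed
  have inj: "inj_on (eap i k) (el c k)" for k using bij by (simp add: bij_betw_def)
  have lift: "\<exists>a' \<in> el c k. eap i k a' = a" if "a \<in> B k" for a k
    using that bij[of k] unfolding bij_betw_def by (metis imageE)
  have Slift: "\<exists>a' \<in> Sel c k. eap i k a' = a" if "a \<in> Sel p k" for a k
    using lift SB that Sel_eapD[OF i] by (metis subsetD)
  have "Sbij i c p"
    unfolding Sbij_def bij_betw_def
  proof (intro conjI allI i)
    show "inj_on (eap i k) (Sel c k)" for k using inj by (rule inj_on_subset) (auto simp: Sel_def)
    show "eap i k ` Sel c k = Sel p k" for k using Sel_eap[OF i] Slift by blast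
  qed
  moreover have "isCore c"
    unfolding isCore_def
  proof (intro conjI allI ballI)
    show c: "c \<in> Ob E" using E.dom_ob[OF i] .
    fix k a assume a: "a \<in> el c k"
    then have "eap i k a \<in> B k" using bij[of k] by (auto simp: bij_betw_def)
    then obtain j f b where f: "f \<in> hom Delta k j" "b \<in> Sel p j" "eap i k a = res p f b" by (auto simp: B_def)
    obtain b' where b': "b' \<in> Sel c j" "eap i j b' = b" using Slift[OF f(2)] by blast
    have "eap i k a = eap i k (res c f b')" using eap_res[OF i f(1) Sel_el[OF b'(1)]] f(3) b'(2) by simp
    then have "a = res c f b'" using inj_onD[OF inj] a res_in[OF c f(1) Sel_el[OF b'(1)]] by blast
    then show "\<exists>j. \<exists>f \<in> hom Delta k j. \<exists>b \<in> Sel c j. a = res c f b" using f(1) b'(1) by blast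
  qed
  ultimately show ?thesis using inj by blast
qed

end

section \<open>The level of the minimal objects\<close>

lemma inclusion_simps [simp]: "on_ob inclusion A = A" "on_arr inclusion f = f"
  by (simp_all add: inclusion_def)

lemma reflector:
  assumes C: "category C" and L: "L \<subseteq> Ob C" and adj: "adjoint C (full_subcat C L) a inclusion"
  obtains \<eta> where "\<And>p. p \<in> Ob C \<Longrightarrow> on_ob a p \<in> L"
    and "\<And>p. p \<in> Ob C \<Longrightarrow> \<eta> p \<in> hom C p (on_ob a p)"
    and "\<And>f p q. f \<in> hom C p q \<Longrightarrow> on_arr a f \<in> hom C (on_ob a p) (on_ob a q)"
    and "\<And>f p q. f \<in> hom C p q \<Longrightarrow> on_arr a f \<cdot>\<^bsub>C\<^esub> \<eta> p = \<eta> q \<cdot>\<^bsub>C\<^esub> f"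
    and "\<And>p q f. p \<in> Ob C \<Longrightarrow> q \<in> L \<Longrightarrow> f \<in> hom C p q \<Longrightarrow>
           \<exists>!g. g \<in> hom C (on_ob a p) q \<and> g \<cdot>\<^bsub>C\<^esub> \<eta> p = f"
proof -
  note a1 = functorD[OF adjointD(1)[OF adj]]
  show thesis
  proof (rule adjoint_unit[OF adj])
    fix \<eta>
    assume 1: "\<And>A. A \<in> Ob C \<Longrightarrow> \<eta> A \<in> hom C A (on_ob inclusion (on_ob a A))"
      and 2: "\<And>f A B. f \<in> hom C A B \<Longrightarrow> on_arr inclusion (on_arr a f) \<cdot>\<^bsub>C\<^esub> \<eta> A = \<eta> B \<cdot>\<^bsub>C\<^esub> f"
      and 3: "\<And>A B f. A \<in> Ob C \<Longrightarrow> B \<in> Ob (full_subcat C L) \<Longrightarrow> f \<in> hom C A (on_ob inclusion B) \<Longrightarrow>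
           \<exists>!g. g \<in> hom (full_subcat C L) (on_ob a A) B \<and> on_arr inclusion g \<cdot>\<^bsub>C\<^esub> \<eta> A = f"
    show thesis
    proof (rule that)
      show aL: "on_ob a p \<in> L" if "p \<in> Ob C" for p using a1(1)[OF that] by simp
      show "\<eta> p \<in> hom C p (on_ob a p)" if "p \<in> Ob C" for p using 1[OF that] by simp
      show "on_arr a f \<in> hom C (on_ob a p) (on_ob a q)" if "f \<in> hom C p q" for f p q
        using a1(3)[OF that] by (simp add: hom_full_iff)
      show "on_arr a f \<cdot>\<^bsub>C\<^esub> \<eta> p = \<eta> q \<cdot>\<^bsub>C\<^esub> f" if "f \<in> hom C p q" for f p q using 2[OF that] by simp
      show "\<exists>!g. g \<in> hom C (on_ob a p) q \<and> g \<cdot>\<^bsub>C\<^esub> \<eta> p = f" if "p \<in> Ob C" "q \<in> L" "f \<in> hom C p q" for p q f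
        using 3[OF that(1), of q f] that by (simp add: hom_full_iff aL)
    qed
  qed
qed

lemma terminal_hom:
  assumes "terminal C T" "A \<in> Ob C" "f \<in> hom C A T" "g \<in> hom C A T"
  shows "f = g"
  using assms unfolding terminal_def by blast

context strongly_regular_over
begin

lemma L0_sub: "L0 \<subseteq> Ob E" using L0_Ob by blast

lemma category_L0: "category (full_subcat E L0)"
  by (rule category_full[OF E.category_axioms L0_sub])

text \<open>Inverting \<open>h\<close> on nondegenerate elements turns \<open>f\<close> into a
  natural family on \<open>q\<close>, and \<open>q'\<close> extends such families uniquely.\<close>

lemma L0_refl_universal:
  assumes q: "q \<in> L0" and h: "Sbij h p q" and q': "q' \<in> L0" and f: "f \<in> hom E p q'"
  shows "\<exists>!g. g \<in> hom E q q' \<and> g \<cdot>\<^bsub>E\<^esub> h = f"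
proof -
  note hh = Sbij_hom[OF h]
  note p = E.dom_ob[OF hh] and qO = L0_Ob[OF q]
  obtain \<psi> where psi: "Nat q p \<psi>" "\<And>k a. a \<in> Sel p k \<Longrightarrow> \<psi> k (eap h k a) = a" using Nat_inv[OF h] by blast
  obtain g where g: "g \<in> hom E q q'" "\<And>k a. a \<in> Sel q k \<Longrightarrow> eap g k a = eap f k (\<psi> k a)"
    using L0_ext[OF q' qO Nat_comp[OF psi(1) Nat_eap[OF f]]] by blast
  show ?thesis
  proof (rule ex1I[of _ g])
    have "g \<cdot>\<^bsub>E\<^esub> h = f"
      by (rule L0_eq[OF q' E.comp_in[OF g(1) hh] f])
        (simp add: eap_comp[OF g(1) hh] Sel_el g(2) Sel_eap[OF hh] psi(2))
    then show "g \<in> hom E q q' \<and> g \<cdot>\<^bsub>E\<^esub> h = f" using g(1) by blast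
  next
    fix g' assume g': "g' \<in> hom E q q' \<and> g' \<cdot>\<^bsub>E\<^esub> h = f"
    show "g' = g"
    proof (rule L0_eq[OF q' _ g(1)])
      show "g' \<in> hom E q q'" using g' by blast
      fix k b assume "b \<in> Sel q k"
      then obtain a where a: "a \<in> Sel p k" "b = eap h k a" using Sbij_surj[OF h] by blast
      have "eap g' k b = eap f k a" using g' eap_comp[of g' q q' h p a k] hh Sel_el[OF a(1)] a(2) by auto
      then show "eap g' k b = eap g k b" using g(2)[OF Sel_eap[OF hh a(1)]] psi(2)[OF a(1)] a(2) by simp
    qed
  qed
qed

lemma L0_reflective: "\<exists>a. adjoint E (full_subcat E L0) a inclusion"
proof (rule adjoint_from_universal[OF E.category_axioms category_L0 functor_inclusion[OF E.category_axioms L0_sub]])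
  fix p assume "p \<in> Ob E"
  then obtain q h where q: "q \<in> L0" "Sbij h p q" using L0_reflection_ex by blast
  show "\<exists>B\<in>Ob (full_subcat E L0). \<exists>u\<in>hom E p (on_ob inclusion B).
     \<forall>B'\<in>Ob (full_subcat E L0). \<forall>f\<in>hom E p (on_ob inclusion B').
        \<exists>!g. g \<in> hom (full_subcat E L0) B B' \<and> on_arr inclusion g \<cdot>\<^bsub>E\<^esub> u = f"
    using q Sbij_hom[OF q(2)] L0_refl_universal[OF q]
    by (intro bexI[of _ q] bexI[of _ h] ballI) (simp_all add: hom_full_iff)
qed

text \<open>A chosen reflector need not be the constructed one, but two universal arrows from
  \<open>p\<close> differ by an isomorphism, and \<open>Sbij\<close> passes along it.\<close>

lemma unit_Sbij:
  assumes p: "p \<in> Ob E" and q0: "q0 \<in> L0" and e: "e \<in> hom E p q0"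
    and univ: "\<And>q f. q \<in> L0 \<Longrightarrow> f \<in> hom E p q \<Longrightarrow> \<exists>!g. g \<in> hom E q0 q \<and> g \<cdot>\<^bsub>E\<^esub> e = f"
  shows "Sbij e p q0"
proof -
  obtain q h where q: "q \<in> L0" and h: "Sbij h p q" using L0_reflection_ex[OF p] by blast
  note hh = Sbij_hom[OF h]
  obtain g where g: "g \<in> hom E q0 q" "g \<cdot>\<^bsub>E\<^esub> e = h" using univ[OF q hh] by blast
  obtain g' where g': "g' \<in> hom E q q0" "g' \<cdot>\<^bsub>E\<^esub> h = e" using L0_refl_universal[OF q h q0 e] by blast
  have "(g' \<cdot>\<^bsub>E\<^esub> g) \<cdot>\<^bsub>E\<^esub> e = e" using E.assoc[OF g'(1) g(1) e] g g' by simp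
  moreover have "Idt E q0 \<cdot>\<^bsub>E\<^esub> e = e" using E.idl[OF e] .
  ultimately have gg: "g' \<cdot>\<^bsub>E\<^esub> g = Idt E q0"
    using univ[OF q0 e] E.comp_in[OF g'(1) g(1)] E.id_in[OF L0_Ob[OF q0]] by blast
  show ?thesis
    unfolding Sbij_def bij_betw_def
  proof (intro conjI allI e inj_onI equalityI subsetI)
    fix k a b assume ab: "a \<in> Sel p k" "b \<in> Sel p k" "eap e k a = eap e k b"
    then have "eap h k a = eap h k b" using eap_comp[OF g(1) e Sel_el] g(2) by metis
    then show "a = b" using Sbij_inj[OF h] ab by blast
  next
    fix k b assume "b \<in> eap e k ` Sel p k"
    then show "b \<in> Sel q0 k" using Sel_eap[OF e] by blast
  next
    fix k b assume b: "b \<in> Sel q0 k"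
    obtain a where a: "a \<in> Sel p k" "eap g k b = eap h k a" using Sbij_surj[OF h Sel_eap[OF g(1) b]] by blast
    have "b = eap g' k (eap g k b)"
      using eap_comp[OF g'(1) g(1) Sel_el[OF b]] gg eap_id[OF Sel_el[OF b]] by simp
    also have "\<dots> = eap e k a" using eap_comp[OF g'(1) hh Sel_el[OF a(1)]] g'(2) a(2) by simp
    finally show "b \<in> eap e k ` Sel p k" using a(1) by blast
  qed
qed

text \<open>The left adjoint sends \<open>q\<close> to its generated part \<open>c\<close>. Arrows
  out of \<open>c\<close> and arrows into objects of \<open>L0\<close> are both given by natural
  families on nondegenerate elements, and there \<open>c\<close>, \<open>q\<close> and the
  reflection of \<open>c\<close> agree.\<close>

lemma L0_essential:
  assumes adj: "adjoint E (full_subcat E L0) a inclusion"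
  shows "\<exists>l. adjoint (full_subcat E L0) E l a"
proof (rule adjoint_from_universal[OF category_L0 E.category_axioms adjointD(1)[OF adj]])
  obtain \<eta> where aL: "\<And>p. p \<in> Ob E \<Longrightarrow> on_ob a p \<in> L0"
    and eta: "\<And>p. p \<in> Ob E \<Longrightarrow> \<eta> p \<in> hom E p (on_ob a p)"
    and ah: "\<And>f p q. f \<in> hom E p q \<Longrightarrow> on_arr a f \<in> hom E (on_ob a p) (on_ob a q)"
    and nat: "\<And>f p q. f \<in> hom E p q \<Longrightarrow> on_arr a f \<cdot>\<^bsub>E\<^esub> \<eta> p = \<eta> q \<cdot>\<^bsub>E\<^esub> f"
    and univ: "\<And>p q f. p \<in> Ob E \<Longrightarrow> q \<in> L0 \<Longrightarrow> f \<in> hom E p q \<Longrightarrow>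
           \<exists>!g. g \<in> hom E (on_ob a p) q \<and> g \<cdot>\<^bsub>E\<^esub> \<eta> p = f"
    by (rule reflector[OF E.category_axioms L0_sub adj]) (rule that)
  have etaS: "Sbij (\<eta> p) p (on_ob a p)" if "p \<in> Ob E" for p
    by (rule unit_Sbij[OF that aL[OF that] eta[OF that] univ[OF that]])
  have aev: "eap (on_arr a f) k (eap (\<eta> p) k z) = eap (\<eta> q) k (eap f k z)"
    if "f \<in> hom E p q" "z \<in> el p k" for f p q k z
    using eap_comp[OF ah[OF that(1)] eta[OF E.dom_ob[OF that(1)]] that(2)]
      eap_comp[OF eta[OF E.cod_ob[OF that(1)]] that] nat[OF that(1)] by simp
  fix q assume "q \<in> Ob (full_subcat E L0)"
  then have q: "q \<in> L0" by simp
  obtain c i where c: "isCore c" and i: "Sbij i c q" using core_ex[OF L0_Ob[OF q]] by blast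
  have cO: "c \<in> Ob E" using c by (simp add: isCore_def)
  note ih = Sbij_hom[OF i]
  obtain \<psi> where psi: "Nat q c \<psi>" "\<And>k z. z \<in> Sel c k \<Longrightarrow> \<psi> k (eap i k z) = z" using Nat_inv[OF i] by blast
  \<comment> \<open>The unit of the new adjunction: back from \<open>q\<close> to \<open>c\<close>
    on nondegenerate elements, then into the reflection of \<open>c\<close>.\<close>
  obtain u where u: "u \<in> hom E q (on_ob a c)" "\<And>k b. b \<in> Sel q k \<Longrightarrow> eap u k b = eap (\<eta> c) k (\<psi> k b)"
    using L0_ext[OF aL[OF cO] L0_Ob[OF q] Nat_comp[OF psi(1) Nat_eap[OF eta[OF cO]]]] by blast
  have ui: "eap u k (eap i k z) = eap (\<eta> c) k z" if "z \<in> Sel c k" for k z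
    using u(2)[OF Sel_eap[OF ih that]] psi(2)[OF that] by simp
  have "\<exists>!g. g \<in> hom E c s \<and> on_arr a g \<cdot>\<^bsub>E\<^esub> u = f"
    if s: "s \<in> Ob E" and f: "f \<in> hom E q (on_ob a s)" for s f
  proof -
    obtain \<chi> where chi: "Nat (on_ob a s) s \<chi>" "\<And>k b. b \<in> Sel (on_ob a s) k \<Longrightarrow> eap (\<eta> s) k (\<chi> k b) = b"
      using Nat_inv[OF etaS[OF s]] by blast
    obtain g where g: "g \<in> hom E c s" "\<And>k z. z \<in> Sel c k \<Longrightarrow> eap g k z = \<chi> k (eap f k (eap i k z))"
      using core_ext[OF c s Nat_comp[OF Nat_comp[OF Nat_eap[OF ih] Nat_eap[OF f]] chi(1)]] by blast
    show ?thesis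
    proof (rule ex1I[of _ g])
      have "on_arr a g \<cdot>\<^bsub>E\<^esub> u = f"
      proof (rule L0_eq[OF aL[OF s] E.comp_in[OF ah[OF g(1)] u(1)] f])
        fix k b assume b: "b \<in> Sel q k"
        then obtain z where z: "z \<in> Sel c k" "b = eap i k z" using Sbij_surj[OF i] by blast
        show "eap (on_arr a g \<cdot>\<^bsub>E\<^esub> u) k b = eap f k b"
          using eap_comp[OF ah[OF g(1)] u(1) Sel_el[OF b]] ui[OF z(1)] z(2) aev[OF g(1) Sel_el[OF z(1)]]
            g(2)[OF z(1)] chi(2)[OF Sel_eap[OF f b]] by simp
      qed
      then show "g \<in> hom E c s \<and> on_arr a g \<cdot>\<^bsub>E\<^esub> u = f" using g(1) by blast
      fix g' assume "g' \<in> hom E c s \<and> on_arr a g' \<cdot>\<^bsub>E\<^esub> u = f"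
      then have g': "g' \<in> hom E c s" "on_arr a g' \<cdot>\<^bsub>E\<^esub> u = f" by auto
      show "g' = g"
      proof (rule core_eq[OF c g'(1) g(1)])
        fix k z assume z: "z \<in> Sel c k"
        have b: "eap i k z \<in> Sel q k" using Sel_eap[OF ih z] .
        have "eap (\<eta> s) k (eap g' k z) = eap f k (eap i k z)"
          using eap_comp[OF ah[OF g'(1)] u(1) Sel_el[OF b]] ui[OF z] aev[OF g'(1) Sel_el[OF z]] g'(2) by simp
        also have "\<dots> = eap (\<eta> s) k (eap g k z)" using g(2)[OF z] chi(2)[OF Sel_eap[OF f b]] by simp
        finally show "eap g' k z = eap g k z"
          using Sbij_inj[OF etaS[OF s]] Sel_eap[OF g'(1) z] Sel_eap[OF g(1) z] by blast
      qed
    qed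
  qed
  then show "\<exists>B\<in>Ob E. \<exists>u\<in>hom (full_subcat E L0) q (on_ob a B).
     \<forall>B'\<in>Ob E. \<forall>f\<in>hom (full_subcat E L0) q (on_ob a B').
        \<exists>!g. g \<in> hom E B B' \<and> on_arr a g \<cdot>\<^bsub>full_subcat E L0\<^esub> u = f"
    using cO u(1) q aL by (intro bexI[of _ c] bexI[of _ u] ballI) (simp_all add: hom_full_iff)
qed

lemma L0_geometric:
  assumes adj: "adjoint E (full_subcat E L0) a inclusion"
  shows "geometric_morphism (full_subcat E L0) E a inclusion"
  using L0_essential[OF adj] right_adjoint_left_exact[OF category_L0 E.category_axioms] adj
  unfolding geometric_morphism_def by blast

lemma L0_replete: "replete E L0"
  unfolding replete_def
proof (intro conjI L0_sub allI impI)
  fix f assume A: "is_iso E f \<and> Dom E f \<in> L0"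
  then obtain g where g: "g \<in> hom E (Cod E f) (Dom E f)" "g \<cdot>\<^bsub>E\<^esub> f = Idt E (Dom E f)" "f \<cdot>\<^bsub>E\<^esub> g = Idt E (Cod E f)"
    and f: "f \<in> hom E (Dom E f) (Cod E f)" using homI[of f E] unfolding is_iso_def by blast
  define p q where "p = Dom E f" and "q = Cod E f"
  note g = g[folded p_def q_def] and f = f[folded p_def q_def]
  have p: "p \<in> L0" using A by (simp add: p_def)
  have q: "q \<in> Ob E" using E.cod_ob[OF f] .
  have fg: "eap f k (eap g k a) = a" if "a \<in> el q k" for k a
    using eap_comp[OF f g(1) that] g(3) eap_id[OF that] by simp
  show "Cod E f \<in> L0" unfolding q_def[symmetric]
    unfolding L0_def
  proof (intro CollectI conjI q ballI allI impI)
    fix s \<phi> assume s: "s \<in> Ob E" and N: "Nat s q \<phi>"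
    obtain h where h: "h \<in> hom E s p" "\<And>k a. a \<in> Sel s k \<Longrightarrow> eap h k a = eap g k (\<phi> k a)"
      using L0_ext[OF p s Nat_comp[OF N Nat_eap[OF g(1)]]] by blast
    show "\<exists>!h. h \<in> hom E s q \<and> (\<forall>k. \<forall>a\<in>Sel s k. eap h k a = \<phi> k a)"
    proof (rule ex1I[of _ "f \<cdot>\<^bsub>E\<^esub> h"])
      show "f \<cdot>\<^bsub>E\<^esub> h \<in> hom E s q \<and> (\<forall>k. \<forall>a\<in>Sel s k. eap (f \<cdot>\<^bsub>E\<^esub> h) k a = \<phi> k a)"
        using E.comp_in[OF f h(1)] eap_comp[OF f h(1) Sel_el] h(2) fg Sel_el[OF Nat_Sel[OF N]] by simp
      fix h' assume h': "h' \<in> hom E s q \<and> (\<forall>k. \<forall>a\<in>Sel s k. eap h' k a = \<phi> k a)"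
      then have h'h: "h' \<in> hom E s q" by blast
      have "g \<cdot>\<^bsub>E\<^esub> h' = h"
        by (rule L0_eq[OF p E.comp_in[OF g(1) h'h] h(1)]) (use eap_comp[OF g(1) h'h Sel_el] h' h(2) in simp)
      then show "h' = f \<cdot>\<^bsub>E\<^esub> h" using E.assoc[OF f g(1) h'h] g(3) E.idl[OF h'h] by simp
    qed
  qed
qed

lemma L0_level: "level E L0" and L0_inverse_image: "adjoint E (full_subcat E L0) (inverse_image E L0) inclusion"
proof -
  have "\<exists>a. geometric_morphism (full_subcat E L0) E a inclusion"
    using L0_reflective L0_geometric by blast
  from someI_ex[OF this] have g: "geometric_morphism (full_subcat E L0) E (inverse_image E L0) inclusion"
    unfolding inverse_image_def .
  then show adj: "adjoint E (full_subcat E L0) (inverse_image E L0) inclusion"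
    by (simp add: geometric_morphism_def)
  show "level E L0"
    unfolding level_def subtopos_def using L0_replete g L0_essential[OF adj] by blast
qed

end

section \<open>Products and base change\<close>

context simp_over
begin

text \<open>Products in the slice are fibre products over \<open>X\<close>, hence pairs of elements
  with a common label.\<close>

lemma prod_ex:
  assumes p: "p \<in> Ob E" and q: "q \<in> Ob E"
  shows "\<exists>w \<in> Ob E. \<exists>\<pi>1 \<in> hom E w p. \<exists>\<pi>2 \<in> hom E w q. \<forall>s. \<forall>f \<in> hom E s p. \<forall>g \<in> hom E s q.
     \<exists>!h. h \<in> hom E s w \<and> \<pi>1 \<cdot>\<^bsub>E\<^esub> h = f \<and> \<pi>2 \<cdot>\<^bsub>E\<^esub> h = g"
proof -
  define B where "B k = {b. fst b \<in> el p k \<and> snd b \<in> el q k \<and> lb p k (fst b) = lb q k (snd b)}" for k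
  define ac where "ac f b = (res p f (fst b), res q f (snd b))" for f b
  have "\<exists>w e. presents B ac (\<lambda>k b. lb p k (fst b)) e w"
  proof (rule presents_ex)
    show "|B k| <o r" for k
      by (rule small_subset[OF _ small_Sigma[OF el_card[OF p, of k] el_card[OF q, of k]]]) (auto simp: B_def)
    show "ac f a \<in> B m" if "f \<in> hom Delta m k" "a \<in> B k" for f m k a
      using that res_in[OF p] res_in[OF q] lb_res[OF p] lb_res[OF q] by (simp add: B_def ac_def)
    show "ac (Idt Delta k) a = a" if "a \<in> B k" for k a
      using that res_id[OF p] res_id[OF q] by (simp add: B_def ac_def)
    show "ac g (ac f a) = ac (f \<cdot>\<^bsub>Delta\<^esub> g) a" if "f \<in> hom Delta m k" "g \<in> hom Delta j m" "a \<in> B k" for f g m k j a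
      using that res_comp[OF p] res_comp[OF q] by (simp add: B_def ac_def)
    show "lb p k (fst a) \<in> on_ob X k" if "a \<in> B k" for k a
      using that lb_in[OF q, of "snd a" k] by (simp add: B_def)
    show "lb p m (fst (ac f a)) = act X f (lb p k (fst a))" if "f \<in> hom Delta m k" "a \<in> B k" for f m k a
      using that lb_res[OF p] by (simp add: B_def ac_def)
  qed
  then obtain w e where P: "presents B ac (\<lambda>k b. lb p k (fst b)) e w" by blast
  note w = presents_Ob[OF P]
  have "\<exists>h \<in> hom E w p. \<forall>k. \<forall>a \<in> B k. eap h k (e k a) = fst a"
    by (rule presents_hom[OF P p]) (auto simp: B_def ac_def)
  then obtain \<pi>1 where p1: "\<pi>1 \<in> hom E w p" "\<And>k a. a \<in> B k \<Longrightarrow> eap \<pi>1 k (e k a) = fst a" by blast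
  have "\<exists>h \<in> hom E w q. \<forall>k. \<forall>a \<in> B k. eap h k (e k a) = snd a"
    by (rule presents_hom[OF P q]) (auto simp: B_def ac_def)
  then obtain \<pi>2 where p2: "\<pi>2 \<in> hom E w q" "\<And>k a. a \<in> B k \<Longrightarrow> eap \<pi>2 k (e k a) = snd a" by blast
  have "\<exists>!h. h \<in> hom E s w \<and> \<pi>1 \<cdot>\<^bsub>E\<^esub> h = f \<and> \<pi>2 \<cdot>\<^bsub>E\<^esub> h = g" if f: "f \<in> hom E s p" and g: "g \<in> hom E s q" for s f g
  proof -
    note s = E.dom_ob[OF f]
    have B: "(eap f k a, eap g k a) \<in> B k" if "a \<in> el s k" for k a
      using that eap_in[OF f] eap_in[OF g] eap_lb[OF f] eap_lb[OF g] by (simp add: B_def)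
    have "\<exists>h \<in> hom E s w. \<forall>k. \<forall>a \<in> el s k. eap h k a = e k (eap f k a, eap g k a)"
    proof (rule hom_ex[OF s w])
      fix k a assume a: "a \<in> el s k"
      show "e k (eap f k a, eap g k a) \<in> el w k" using presents_in[OF P B[OF a]] .
      show "lb w k (e k (eap f k a, eap g k a)) = lb s k a" using presents_lb[OF P B[OF a]] eap_lb[OF f a] by simp
      fix d m assume d: "d \<in> hom Delta m k"
      show "e m (eap f m (res s d a), eap g m (res s d a)) = res w d (e k (eap f k a, eap g k a))"
        using presents_res[OF P B[OF a] d] eap_res[OF f d a] eap_res[OF g d a] by (simp add: ac_def)
    qed
    then obtain h where h: "h \<in> hom E s w" "\<And>k a. a \<in> el s k \<Longrightarrow> eap h k a = e k (eap f k a, eap g k a)" by blast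
    show ?thesis
    proof (rule ex1I[of _ h])
      have "\<pi>1 \<cdot>\<^bsub>E\<^esub> h = f"
        by (rule hom_eqI[OF E.comp_in[OF p1(1) h(1)] f]) (simp add: eap_comp[OF p1(1) h(1)] h(2) p1(2) B)
      moreover have "\<pi>2 \<cdot>\<^bsub>E\<^esub> h = g"
        by (rule hom_eqI[OF E.comp_in[OF p2(1) h(1)] g]) (simp add: eap_comp[OF p2(1) h(1)] h(2) p2(2) B)
      ultimately show "h \<in> hom E s w \<and> \<pi>1 \<cdot>\<^bsub>E\<^esub> h = f \<and> \<pi>2 \<cdot>\<^bsub>E\<^esub> h = g" using h(1) by blast
      fix h' assume "h' \<in> hom E s w \<and> \<pi>1 \<cdot>\<^bsub>E\<^esub> h' = f \<and> \<pi>2 \<cdot>\<^bsub>E\<^esub> h' = g"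
      then have h': "h' \<in> hom E s w" "\<pi>1 \<cdot>\<^bsub>E\<^esub> h' = f" "\<pi>2 \<cdot>\<^bsub>E\<^esub> h' = g" by auto
      show "h' = h"
      proof (rule hom_eqI[OF h'(1) h(1)])
        fix k a assume a: "a \<in> el s k"
        obtain b where b: "b \<in> B k" "eap h' k a = e k b" using presents_surj[OF P eap_in[OF h'(1) a]] by blast
        have "fst b = eap f k a" using p1(2)[OF b(1)] eap_comp[OF p1(1) h'(1) a] h'(2) b(2) by simp
        moreover have "snd b = eap g k a" using p2(2)[OF b(1)] eap_comp[OF p2(1) h'(1) a] h'(3) b(2) by simp
        ultimately show "eap h' k a = eap h k a" using b(2) h(2)[OF a] by (metis prod.collapse)
      qed
    qed
  qed
  then show ?thesis using w p1(1) p2(1) by blast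
qed

text \<open>A product of objects of a reflective subcategory belongs to it up to isomorphism. Its
  reflection is therefore used as the product: \<open>\<rho>\<close> comes from the factored
  projections \<open>r1\<close> and \<open>r2\<close>, and it is inverse to the unit.\<close>

lemma base_change_L:
  assumes L: "L \<subseteq> Ob E" and adj: "adjoint E (full_subcat E L) a inclusion" and G: "G \<in> L"
  shows "adjoint (slice (full_subcat E L) G) (full_subcat E L) (forget (full_subcat E L))
    (base_change (full_subcat E L) G)"
proof -
  let ?L = "full_subcat E L"
  have cL: "category ?L" by (rule category_full[OF E.category_axioms L])
  interpret L: category ?L by (rule cL)
  obtain \<eta> where aL: "\<And>p. p \<in> Ob E \<Longrightarrow> on_ob a p \<in> L"
    and eta: "\<And>p. p \<in> Ob E \<Longrightarrow> \<eta> p \<in> hom E p (on_ob a p)"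
    and univ: "\<And>p q f. p \<in> Ob E \<Longrightarrow> q \<in> L \<Longrightarrow> f \<in> hom E p q \<Longrightarrow>
           \<exists>!g. g \<in> hom E (on_ob a p) q \<and> g \<cdot>\<^bsub>E\<^esub> \<eta> p = f"
    by (rule reflector[OF E.category_axioms L adj]) (rule that)
  have "\<exists>k. adjoint (slice ?L G) ?L (forget ?L) k"
  proof (rule adjoint_from_couniversal[OF category_slice[OF cL] cL functor_forget[OF cL]])
    fix q assume "q \<in> Ob ?L"
    then have q: "q \<in> L" by simp
    obtain w \<pi>1 \<pi>2 where w: "w \<in> Ob E" and p1: "\<pi>1 \<in> hom E w q" and p2: "\<pi>2 \<in> hom E w G"
      and pr0: "\<forall>s. \<forall>f \<in> hom E s q. \<forall>g \<in> hom E s G.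
        \<exists>!h. h \<in> hom E s w \<and> \<pi>1 \<cdot>\<^bsub>E\<^esub> h = f \<and> \<pi>2 \<cdot>\<^bsub>E\<^esub> h = g"
      using prod_ex[OF subsetD[OF L q] subsetD[OF L G]] by blast
    note pr = pr0[rule_format]
    let ?w = "on_ob a w"
    obtain r1 where r1: "r1 \<in> hom E ?w q" "r1 \<cdot>\<^bsub>E\<^esub> \<eta> w = \<pi>1" using univ[OF w q p1] by blast
    obtain r2 where r2: "r2 \<in> hom E ?w G" "r2 \<cdot>\<^bsub>E\<^esub> \<eta> w = \<pi>2" using univ[OF w G p2] by blast
    obtain \<rho> where rho: "\<rho> \<in> hom E ?w w" "\<pi>1 \<cdot>\<^bsub>E\<^esub> \<rho> = r1" "\<pi>2 \<cdot>\<^bsub>E\<^esub> \<rho> = r2" using pr[OF r1(1) r2(1)] by blast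
    have re: "\<rho> \<cdot>\<^bsub>E\<^esub> \<eta> w = Idt E w"
    proof -
      have "\<pi>1 \<cdot>\<^bsub>E\<^esub> (\<rho> \<cdot>\<^bsub>E\<^esub> \<eta> w) = \<pi>1" "\<pi>2 \<cdot>\<^bsub>E\<^esub> (\<rho> \<cdot>\<^bsub>E\<^esub> \<eta> w) = \<pi>2"
        using E.assoc[OF p1 rho(1) eta[OF w]] E.assoc[OF p2 rho(1) eta[OF w]] rho r1 r2 by simp_all
      moreover have "\<pi>1 \<cdot>\<^bsub>E\<^esub> Idt E w = \<pi>1" "\<pi>2 \<cdot>\<^bsub>E\<^esub> Idt E w = \<pi>2" using E.idr p1 p2 by auto
      ultimately show ?thesis using pr[OF p1 p2] E.comp_in[OF rho(1) eta[OF w]] E.id_in[OF w] by blast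
    qed
    have er: "\<eta> w \<cdot>\<^bsub>E\<^esub> \<rho> = Idt E ?w"
    proof -
      have 1: "\<eta> w \<cdot>\<^bsub>E\<^esub> \<rho> \<in> hom E ?w ?w" using E.comp_in[OF eta[OF w] rho(1)] .
      have "(\<eta> w \<cdot>\<^bsub>E\<^esub> \<rho>) \<cdot>\<^bsub>E\<^esub> \<eta> w = \<eta> w"
        using E.assoc[OF eta[OF w] rho(1) eta[OF w]] re E.idr[OF eta[OF w]] by simp
      moreover have "Idt E ?w \<cdot>\<^bsub>E\<^esub> \<eta> w = \<eta> w" using E.idl[OF eta[OF w]] .
      ultimately show ?thesis
        using univ[OF w aL[OF w] eta[OF w]] 1 E.id_in[OF subsetD[OF L aL[OF w]]] by blast
    qed
    have pr': "\<exists>!h. h \<in> hom E s ?w \<and> r1 \<cdot>\<^bsub>E\<^esub> h = f \<and> r2 \<cdot>\<^bsub>E\<^esub> h = g"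
      if f: "f \<in> hom E s q" and g: "g \<in> hom E s G" for s f g
    proof -
      obtain h where h: "h \<in> hom E s w" "\<pi>1 \<cdot>\<^bsub>E\<^esub> h = f" "\<pi>2 \<cdot>\<^bsub>E\<^esub> h = g"
        and hu: "\<And>h'. h' \<in> hom E s w \<Longrightarrow> \<pi>1 \<cdot>\<^bsub>E\<^esub> h' = f \<Longrightarrow> \<pi>2 \<cdot>\<^bsub>E\<^esub> h' = g \<Longrightarrow> h' = h"
        using pr[OF f g] by blast
      show ?thesis
      proof (rule ex1I[of _ "\<eta> w \<cdot>\<^bsub>E\<^esub> h"])
        show "\<eta> w \<cdot>\<^bsub>E\<^esub> h \<in> hom E s ?w \<and> r1 \<cdot>\<^bsub>E\<^esub> (\<eta> w \<cdot>\<^bsub>E\<^esub> h) = f \<and> r2 \<cdot>\<^bsub>E\<^esub> (\<eta> w \<cdot>\<^bsub>E\<^esub> h) = g"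
          using E.comp_in[OF eta[OF w] h(1)] E.assoc[OF r1(1) eta[OF w] h(1)] E.assoc[OF r2(1) eta[OF w] h(1)]
            r1 r2 h by simp
        fix h' assume "h' \<in> hom E s ?w \<and> r1 \<cdot>\<^bsub>E\<^esub> h' = f \<and> r2 \<cdot>\<^bsub>E\<^esub> h' = g"
        then have h': "h' \<in> hom E s ?w" "r1 \<cdot>\<^bsub>E\<^esub> h' = f" "r2 \<cdot>\<^bsub>E\<^esub> h' = g" by auto
        have "\<rho> \<cdot>\<^bsub>E\<^esub> h' = h"
          using hu[OF E.comp_in[OF rho(1) h'(1)]] E.assoc[OF p1 rho(1) h'(1)] E.assoc[OF p2 rho(1) h'(1)] rho h' by simp
        then show "h' = \<eta> w \<cdot>\<^bsub>E\<^esub> h" using E.assoc[OF eta[OF w] rho(1) h'(1)] er E.idl[OF h'(1)] by simp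
      qed
    qed
    have r2ob: "r2 \<in> Ob (slice ?L G)" using r2(1) aL[OF w] G homD[OF r2(1)] by (simp add: slice_Ob hom_full_iff)
    show "\<exists>A\<in>Ob (slice ?L G). \<exists>u\<in>hom ?L (on_ob (forget ?L) A) q.
       \<forall>A'\<in>Ob (slice ?L G). \<forall>f\<in>hom ?L (on_ob (forget ?L) A') q.
          \<exists>!g. g \<in> hom (slice ?L G) A' A \<and> u \<cdot>\<^bsub>?L\<^esub> on_arr (forget ?L) g = f"
    proof (intro bexI[OF _ r2ob] bexI[of _ r1] ballI)
      show "r1 \<in> hom ?L (on_ob (forget ?L) r2) q"
        using r1(1) aL[OF w] q homD[OF r2(1)] by (simp add: forget_def hom_full_iff)
      fix A' f assume A': "A' \<in> Ob (slice ?L G)" and f: "f \<in> hom ?L (on_ob (forget ?L) A') q"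
      define s where "s = Dom E A'"
      have A'h: "A' \<in> hom E s G" "s \<in> L" using A' by (auto simp: slice_Ob hom_full_iff s_def)
      have fh: "f \<in> hom E s q" using f by (simp add: forget_def hom_full_iff s_def)
      obtain h where h: "h \<in> hom E s ?w" "r1 \<cdot>\<^bsub>E\<^esub> h = f" "r2 \<cdot>\<^bsub>E\<^esub> h = A'"
        and hu: "\<And>h'. h' \<in> hom E s ?w \<Longrightarrow> r1 \<cdot>\<^bsub>E\<^esub> h' = f \<Longrightarrow> r2 \<cdot>\<^bsub>E\<^esub> h' = A' \<Longrightarrow> h' = h"
        using pr'[OF fh A'h(1)] by blast
      have D: "Dom E r2 = ?w" using homD[OF r2(1)] by simp
      show "\<exists>!g. g \<in> hom (slice ?L G) A' r2 \<and> r1 \<cdot>\<^bsub>?L\<^esub> on_arr (forget ?L) g = f"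
      proof (rule ex1I[of _ "(A', h, r2)"])
        show "(A', h, r2) \<in> hom (slice ?L G) A' r2 \<and> r1 \<cdot>\<^bsub>?L\<^esub> on_arr (forget ?L) (A', h, r2) = f"
          using h A' r2ob A'h(2) aL[OF w] D by (simp add: slice_hom hom_full_iff forget_def s_def)
        fix g assume "g \<in> hom (slice ?L G) A' r2 \<and> r1 \<cdot>\<^bsub>?L\<^esub> on_arr (forget ?L) g = f"
        then show "g = (A', h, r2)"
          using hu D by (auto simp: slice_hom hom_full_iff forget_def s_def)
      qed
    qed
  qed
  from someI_ex[OF this] show ?thesis unfolding base_change_def .
qed

text \<open>Over \<open>X\<close> the couniversal object is the product of \<open>X\<close> with
  \<open>K\<close>, labelled by the first factor: the label of an element of the source is forced,
  which leaves a simplicial map into \<open>K\<close>.\<close>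

lemma base_change_X: "adjoint E (simp_sets r) (forget (simp_sets r)) (base_change (simp_sets r) X)"
proof -
  have "\<exists>k. adjoint E (simp_sets r) (forget (simp_sets r)) k"
  proof (rule adjoint_from_couniversal[OF E.category_axioms category_simp])
    show "is_functor E (simp_sets r) (forget (simp_sets r))"
      unfolding E_def by (rule functor_forget[OF category_simp])
    fix K assume K: "K \<in> Ob (simp_sets r)"
    define B where "B k = on_ob X k \<times> on_ob K k" for k
    define ac where "ac f b = (act X f (fst b), act K f (snd b))" for f b
    have "\<exists>w e. presents B ac (\<lambda>k. fst) e w"
    proof (rule presents_ex)
      show "|B k| <o r" for k unfolding B_def by (intro small_Sigma simp_card[OF X] simp_card[OF K])
      show "ac f a \<in> B m" if "f \<in> hom Delta m k" "a \<in> B k" for f m k a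
        using that act_in[OF X] act_in[OF K] by (simp add: B_def ac_def mem_Times_iff)
      show "ac (Idt Delta k) a = a" if "a \<in> B k" for k a
        using that act_id[OF X] act_id[OF K] by (simp add: B_def ac_def mem_Times_iff)
      show "ac g (ac f a) = ac (f \<cdot>\<^bsub>Delta\<^esub> g) a" if "f \<in> hom Delta m k" "g \<in> hom Delta j m" "a \<in> B k" for f g m k j a
        using that act_comp[OF X] act_comp[OF K] by (simp add: B_def ac_def mem_Times_iff)
      show "fst a \<in> on_ob X k" if "a \<in> B k" for k a using that by (simp add: B_def mem_Times_iff)
      show "fst (ac f a) = act X f (fst a)" for f a by (simp add: ac_def)
    qed
    then obtain w e where P: "presents B ac (\<lambda>k. fst) e w" by blast
    note w = presents_Ob[OF P] and wF = E_Ob_simp[OF presents_Ob[OF P]]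
    define un where "un k c = the_inv_into (B k) (e k) c" for k c
    have inj: "inj_on (e k) (B k)" for k using presents_inj[OF P] by (auto simp: inj_on_def)
    have un: "un k (e k b) = b" if "b \<in> B k" for k b using the_inv_into_f_f[OF inj that] by (simp add: un_def)
    have "\<exists>\<epsilon> \<in> hom (simp_sets r) (fst w) K. \<forall>k. \<forall>c \<in> on_ob (fst w) k. ap \<epsilon> k c = snd (un k c)"
    proof (rule simp_hom_ex[OF wF K])
      fix k c assume "c \<in> on_ob (fst w) k"
      then obtain b where b: "b \<in> B k" "c = e k b" using presents_surj[OF P, of c k] unfolding el_def by blast
      show "snd (un k c) \<in> on_ob K k" using un b by (simp add: B_def mem_Times_iff)
      fix f m assume f: "f \<in> hom Delta m k"
      show "snd (un m (act (fst w) f c)) = act K f (snd (un k c))"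
        using presents_res[OF P b(1) f] un[OF presents_ac[OF P b(1) f]] un[OF b(1)] b(2) by (simp add: res_def ac_def)
    qed
    then obtain \<epsilon> where eps: "\<epsilon> \<in> hom (simp_sets r) (fst w) K"
      and eps_e: "\<And>k b. b \<in> B k \<Longrightarrow> ap \<epsilon> k (e k b) = snd b"
      using un presents_in[OF P] by (auto simp: el_def)
    have "\<exists>!g. g \<in> hom E s w \<and> \<epsilon> \<cdot>\<^bsub>simp_sets r\<^esub> fst (snd g) = f"
      if s: "s \<in> Ob E" and f: "f \<in> hom (simp_sets r) (fst s) K" for s f
    proof -
      have Bs: "(lb s k a, ap f k a) \<in> B k" if "a \<in> el s k" for k a
        using that lb_in[OF s] ap_in[OF f] by (simp add: B_def el_def)
      have "\<exists>h \<in> hom E s w. \<forall>k. \<forall>a \<in> el s k. eap h k a = e k (lb s k a, ap f k a)"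
      proof (rule hom_ex[OF s w])
        fix k a assume a: "a \<in> el s k"
        show "e k (lb s k a, ap f k a) \<in> el w k" using presents_in[OF P Bs[OF a]] .
        show "lb w k (e k (lb s k a, ap f k a)) = lb s k a" using presents_lb[OF P Bs[OF a]] by simp
        fix d m assume d: "d \<in> hom Delta m k"
        show "e m (lb s m (res s d a), ap f m (res s d a)) = res w d (e k (lb s k a, ap f k a))"
          using presents_res[OF P Bs[OF a] d] lb_res[OF s d a] ap_act[OF f d, of a] a by (simp add: ac_def res_def el_def)
      qed
      then obtain h where h: "h \<in> hom E s w" "\<And>k a. a \<in> el s k \<Longrightarrow> eap h k a = e k (lb s k a, ap f k a)" by blast
      have hs: "fst (snd h) \<in> hom (simp_sets r) (fst s) (fst w)" if "h \<in> hom E s w" for h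
        using that by (auto simp: E_hom)
      interpret S: category "simp_sets r" by (rule category_simp)
      show ?thesis
      proof (rule ex1I[of _ h])
        have "\<epsilon> \<cdot>\<^bsub>simp_sets r\<^esub> fst (snd h) = f"
          by (rule simp_hom_eqI[OF S.comp_in[OF eps hs[OF h(1)]] f])
            (use ap_comp[OF eps hs[OF h(1)]] h(2) eps_e Bs in \<open>simp add: eap_def el_def\<close>)
        then show "h \<in> hom E s w \<and> \<epsilon> \<cdot>\<^bsub>simp_sets r\<^esub> fst (snd h) = f" using h(1) by blast
        fix h' assume "h' \<in> hom E s w \<and> \<epsilon> \<cdot>\<^bsub>simp_sets r\<^esub> fst (snd h') = f"
        then have h': "h' \<in> hom E s w" "\<epsilon> \<cdot>\<^bsub>simp_sets r\<^esub> fst (snd h') = f" by auto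
        show "h' = h"
        proof (rule hom_eqI[OF h'(1) h(1)])
          fix k a assume a: "a \<in> el s k"
          obtain b where b: "b \<in> B k" "eap h' k a = e k b" using presents_surj[OF P eap_in[OF h'(1) a]] by blast
          have "fst b = lb s k a" using presents_lb[OF P b(1)] eap_lb[OF h'(1) a] b(2) by simp
          moreover have "snd b = ap f k a"
            using eps_e[OF b(1)] ap_comp[OF eps hs[OF h'(1)], of a k] h'(2) a b(2) by (simp add: eap_def el_def)
          ultimately show "eap h' k a = eap h k a" using b(2) h(2)[OF a] by (metis prod.collapse)
        qed
      qed
    qed
    then show "\<exists>A\<in>Ob E. \<exists>u\<in>hom (simp_sets r) (on_ob (forget (simp_sets r)) A) K.
       \<forall>A'\<in>Ob E. \<forall>f\<in>hom (simp_sets r) (on_ob (forget (simp_sets r)) A') K.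
          \<exists>!g. g \<in> hom E A' A \<and> u \<cdot>\<^bsub>simp_sets r\<^esub> on_arr (forget (simp_sets r)) g = f"
      using w eps by (intro bexI[of _ w] bexI[of _ \<epsilon>] ballI) (simp_all add: forget_def simp_simps case_prod_beta)
  qed
  from someI_ex[OF this] show ?thesis unfolding base_change_def E_def .
qed

end

section \<open>Essential levels and their ideals\<close>

context simp_over
begin

text \<open>\<open>Y k x\<close> is the representable presheaf of the element \<open>x\<close>, and \<open>gen k x\<close> its generic element.\<close>

definition Ypres :: "nat \<Rightarrow> 'u \<Rightarrow> 'u simp_map \<times> (nat \<Rightarrow> simp_op \<Rightarrow> 'u) \<Rightarrow> bool" where
  "Ypres k x y \<longleftrightarrow> presents (\<lambda>m. hom Delta m k) (\<lambda>g f. f \<cdot>\<^bsub>Delta\<^esub> g) (\<lambda>m f. act X f x) (snd y) (fst y)"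

definition Y :: "nat \<Rightarrow> 'u \<Rightarrow> 'u simp_map" where
  "Y k x = fst (SOME y. Ypres k x y)"

definition gen :: "nat \<Rightarrow> 'u \<Rightarrow> 'u" where
  "gen k x = snd (SOME y. Ypres k x y) k (Idt Delta k)"

lemma finite_hom_Delta: "finite (hom Delta m k)"
proof (rule finite_subset)
  show "hom Delta m k \<subseteq> (\<lambda>h. (m, h, k)) ` ({..m} \<rightarrow>\<^sub>E {..k})" by (auto simp: Delta_hom)
qed (auto intro: finite_PiE)

lemma
  assumes x: "x \<in> on_ob X k"
  shows Y_Ob: "Y k x \<in> Ob E"
    and gen_in: "gen k x \<in> el (Y k x) k"
    and gen_lb: "lb (Y k x) k (gen k x) = x"
    and Y_surj: "z \<in> el (Y k x) m \<Longrightarrow> \<exists>f \<in> hom Delta m k. z = res (Y k x) f (gen k x)"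
    and Y_inj: "f \<in> hom Delta m k \<Longrightarrow> g \<in> hom Delta m k \<Longrightarrow>
      res (Y k x) f (gen k x) = res (Y k x) g (gen k x) \<Longrightarrow> f = g"
    and Y_hom: "p \<in> Ob E \<Longrightarrow> b \<in> el p k \<Longrightarrow> lb p k b = x \<Longrightarrow>
      \<exists>h \<in> hom E (Y k x) p. eap h k (gen k x) = b"
proof -
  have "\<exists>p e. presents (\<lambda>m. hom Delta m k) (\<lambda>g f. f \<cdot>\<^bsub>Delta\<^esub> g) (\<lambda>m f. act X f x) e p"
    by (rule presents_ex)
      (simp_all add: small_finite[OF finite_hom_Delta] Delta_comp_in Delta.idr Delta.assoc act_in[OF X _ x] act_comp[OF X _ _ x])
  then have "\<exists>y. Ypres k x y" unfolding Ypres_def by (metis fst_conv snd_conv)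
  from someI_ex[OF this] obtain e where P0: "Ypres k x (Y k x, e)" and g: "gen k x = e k (Idt Delta k)"
    unfolding Y_def gen_def by (metis prod.collapse)
  have P: "presents (\<lambda>m. hom Delta m k) (\<lambda>g f. f \<cdot>\<^bsub>Delta\<^esub> g) (\<lambda>m f. act X f x) e (Y k x)"
    using P0 by (simp add: Ypres_def)
  have r: "res (Y k x) f (gen k x) = e m f" if "f \<in> hom Delta m k" for f m
    using presents_res[OF P Delta_id_in that] Delta.idl[OF that] g by simp
  show "Y k x \<in> Ob E" using presents_Ob[OF P] .
  show "gen k x \<in> el (Y k x) k" using presents_in[OF P Delta_id_in] g by simp
  show "lb (Y k x) k (gen k x) = x" using presents_lb[OF P Delta_id_in] g act_id[OF X x] by simp
  show "\<exists>f \<in> hom Delta m k. z = res (Y k x) f (gen k x)" if "z \<in> el (Y k x) m"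
    using presents_surj[OF P that] r by metis
  show "f = g" if "f \<in> hom Delta m k" "g \<in> hom Delta m k" "res (Y k x) f (gen k x) = res (Y k x) g (gen k x)"
    using presents_inj[OF P that(1,2)] that(3) r[OF that(1)] r[OF that(2)] by simp
  show "\<exists>h \<in> hom E (Y k x) p. eap h k (gen k x) = b" if p: "p \<in> Ob E" and b: "b \<in> el p k" and l: "lb p k b = x"
  proof -
    have "\<exists>h \<in> hom E (Y k x) p. \<forall>m. \<forall>f \<in> hom Delta m k. eap h m (e m f) = res p f b"
      by (rule presents_hom[OF P p]) (use res_in[OF p _ b] lb_res[OF p _ b] l res_comp[OF p _ _ b] in simp_all)
    then show ?thesis using g Delta_id_in res_id[OF p b] by metis
  qed
qed

lemma Y_eq:
  assumes x: "x \<in> on_ob X k" and h: "h \<in> hom E (Y k x) p" "h' \<in> hom E (Y k x) p"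
    and eq: "eap h k (gen k x) = eap h' k (gen k x)"
  shows "h = h'"
proof (rule hom_eqI[OF h])
  fix m z assume "z \<in> el (Y k x) m"
  then obtain f where f: "f \<in> hom Delta m k" "z = res (Y k x) f (gen k x)" using Y_surj[OF x] by blast
  show "eap h m z = eap h' m z"
    using eap_res[OF h(1) f(1) gen_in[OF x]] eap_res[OF h(2) f(1) gen_in[OF x]] f(2) eq by simp
qed

end

text \<open>The adjoint string of an essential subtopos, expressed by universal properties in
  \<open>E\<close> so that homs of the full subcategory do not appear: \<open>\<eta>\<close> is the
  unit of the reflection, \<open>u\<close> that of the adjunction between \<open>l\<close> and
  \<open>a\<close>.\<close>

locale essential_level = simp_over r X for r :: "'u rel" and X :: "'u simp_set" +
  fixes L :: "'u simp_map set"
    and a l :: "('u simp_map, 'u simp_map \<times> 'u simp_map \<times> 'u simp_map,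
      'u simp_map, 'u simp_map \<times> 'u simp_map \<times> 'u simp_map) func"
    and \<eta> u :: "'u simp_map \<Rightarrow> 'u simp_map \<times> 'u simp_map \<times> 'u simp_map"
  assumes LE: "L \<subseteq> Ob E"
    and aL: "p \<in> Ob E \<Longrightarrow> on_ob a p \<in> L"
    and eta: "p \<in> Ob E \<Longrightarrow> \<eta> p \<in> hom E p (on_ob a p)"
    and a_hom: "f \<in> hom E p q \<Longrightarrow> on_arr a f \<in> hom E (on_ob a p) (on_ob a q)"
    and a_comp: "g \<in> hom E q s \<Longrightarrow> f \<in> hom E p q \<Longrightarrow> on_arr a (g \<cdot>\<^bsub>E\<^esub> f) = on_arr a g \<cdot>\<^bsub>E\<^esub> on_arr a f"
    and a_id: "p \<in> Ob E \<Longrightarrow> on_arr a (Idt E p) = Idt E (on_ob a p)"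
    and a_nat: "f \<in> hom E p q \<Longrightarrow> on_arr a f \<cdot>\<^bsub>E\<^esub> \<eta> p = \<eta> q \<cdot>\<^bsub>E\<^esub> f"
    and a_univ: "p \<in> Ob E \<Longrightarrow> q \<in> L \<Longrightarrow> f \<in> hom E p q \<Longrightarrow>
           \<exists>!g. g \<in> hom E (on_ob a p) q \<and> g \<cdot>\<^bsub>E\<^esub> \<eta> p = f"
    and l_ob: "q \<in> L \<Longrightarrow> on_ob l q \<in> Ob E"
    and u: "q \<in> L \<Longrightarrow> u q \<in> hom E q (on_ob a (on_ob l q))"
    and l_univ: "q \<in> L \<Longrightarrow> s \<in> Ob E \<Longrightarrow> f \<in> hom E q (on_ob a s) \<Longrightarrow>
           \<exists>!g. g \<in> hom E (on_ob l q) s \<and> on_arr a g \<cdot>\<^bsub>E\<^esub> u q = f"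

text \<open>The reflector has to be the choice made by \<open>inverse_image\<close>, since
  \<open>etendue_level\<close> refers to it; for \<open>l\<close> any left adjoint of this choice
  will do.\<close>

lemma (in simp_over) level_essential_level:
  assumes essential_level: "level E L"
  shows "\<exists>l \<eta> u. essential_level r X L (inverse_image E L) l \<eta> u"
    and "adjoint E (full_subcat E L) (inverse_image E L) inclusion" and "L \<subseteq> Ob E"
proof -
  show L: "L \<subseteq> Ob E" using essential_level by (auto simp: level_def subtopos_def replete_def)
  have "\<exists>a. geometric_morphism (full_subcat E L) E a inclusion" using essential_level by (auto simp: level_def subtopos_def)
  from someI_ex[OF this] have "geometric_morphism (full_subcat E L) E (inverse_image E L) inclusion"
    unfolding inverse_image_def .
  then show adj: "adjoint E (full_subcat E L) (inverse_image E L) inclusion" by (simp add: geometric_morphism_def)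
  obtain l where l: "adjoint (full_subcat E L) E l (inverse_image E L)" using essential_level by (auto simp: level_def)
  note a1 = functorD[OF adjointD(1)[OF adj]] and l1 = functorD[OF adjointD(1)[OF l]]
  let ?a = "inverse_image E L"
  show "\<exists>l \<eta> u. essential_level r X L ?a l \<eta> u"
  proof (rule reflector[OF E.category_axioms L adj])
    fix \<eta>
    assume R: "\<And>p. p \<in> Ob E \<Longrightarrow> on_ob ?a p \<in> L"
      "\<And>p. p \<in> Ob E \<Longrightarrow> \<eta> p \<in> hom E p (on_ob ?a p)"
      "\<And>f p q. f \<in> hom E p q \<Longrightarrow> on_arr ?a f \<in> hom E (on_ob ?a p) (on_ob ?a q)"
      "\<And>f p q. f \<in> hom E p q \<Longrightarrow> on_arr ?a f \<cdot>\<^bsub>E\<^esub> \<eta> p = \<eta> q \<cdot>\<^bsub>E\<^esub> f"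
      "\<And>p q f. p \<in> Ob E \<Longrightarrow> q \<in> L \<Longrightarrow> f \<in> hom E p q \<Longrightarrow>
           \<exists>!g. g \<in> hom E (on_ob ?a p) q \<and> g \<cdot>\<^bsub>E\<^esub> \<eta> p = f"
    show "\<exists>l \<eta> u. essential_level r X L ?a l \<eta> u"
    proof (rule adjoint_unit[OF l])
      fix u
      assume U: "\<And>A. A \<in> Ob (full_subcat E L) \<Longrightarrow> u A \<in> hom (full_subcat E L) A (on_ob ?a (on_ob l A))"
        "\<And>A B f. A \<in> Ob (full_subcat E L) \<Longrightarrow> B \<in> Ob E \<Longrightarrow> f \<in> hom (full_subcat E L) A (on_ob ?a B) \<Longrightarrow>
           \<exists>!g. g \<in> hom E (on_ob l A) B \<and> on_arr ?a g \<cdot>\<^bsub>full_subcat E L\<^esub> u A = f"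
      have "essential_level r X L ?a l \<eta> u"
      proof (intro essential_level.intro simp_over_axioms essential_level_axioms.intro)
        show "on_arr ?a (Idt E p) = Idt E (on_ob ?a p)" if "p \<in> Ob E" for p using a1(2)[OF that] by simp
        show "on_arr ?a (g \<cdot>\<^bsub>E\<^esub> f) = on_arr ?a g \<cdot>\<^bsub>E\<^esub> on_arr ?a f" if "g \<in> hom E q s" "f \<in> hom E p q" for g f p q s
          using a1(4)[OF that] by simp
        show "on_ob l q \<in> Ob E" if "q \<in> L" for q using l1(1) that by simp
        show "u q \<in> hom E q (on_ob ?a (on_ob l q))" if "q \<in> L" for q using U(1) that by (simp add: hom_full_iff)
        show "\<exists>!g. g \<in> hom E (on_ob l q) s \<and> on_arr ?a g \<cdot>\<^bsub>E\<^esub> u q = f"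
          if "q \<in> L" "s \<in> Ob E" "f \<in> hom E q (on_ob ?a s)" for q s f
          using U(2)[of q s f] that R(1) by (simp add: hom_full_iff)
      qed (rule L, (rule R; assumption)+)
      then show ?thesis by blast
    qed
  qed
qed

context essential_level
begin

lemma a_eq:
  assumes "p \<in> Ob E" "q \<in> L" "g \<in> hom E (on_ob a p) q" "g' \<in> hom E (on_ob a p) q" "g \<cdot>\<^bsub>E\<^esub> \<eta> p = g' \<cdot>\<^bsub>E\<^esub> \<eta> p"
  shows "g = g'"
  using a_univ[OF assms(1,2) E.comp_in[OF assms(3) eta[OF assms(1)]]] assms(3-5) by metis

lemma l_eq:
  assumes "q \<in> L" "g \<in> hom E (on_ob l q) s" "g' \<in> hom E (on_ob l q) s"
    "on_arr a g \<cdot>\<^bsub>E\<^esub> u q = on_arr a g' \<cdot>\<^bsub>E\<^esub> u q"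
  shows "g = g'"
  using l_univ[OF assms(1) E.cod_ob[OF assms(2)] E.comp_in[OF a_hom[OF assms(2)] u[OF assms(1)]]] assms(2-4) by metis

text \<open>The comonad of the level, whose counit \<open>eps\<close> is the transpose of an
  identity. Its values are the objects in which the level is generated.\<close>

definition T :: "'u simp_map \<Rightarrow> 'u simp_map" where "T p = on_ob l (on_ob a p)"

definition eps where
  "eps p = (THE g. g \<in> hom E (T p) p \<and> on_arr a g \<cdot>\<^bsub>E\<^esub> u (on_ob a p) = Idt E (on_ob a p))"

lemma T_Ob: "p \<in> Ob E \<Longrightarrow> T p \<in> Ob E" unfolding T_def by (rule l_ob[OF aL])

lemma aE: "p \<in> Ob E \<Longrightarrow> on_ob a p \<in> Ob E" using aL LE by blast

lemma
  assumes p: "p \<in> Ob E"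
  shows eps: "eps p \<in> hom E (T p) p" and eps_u: "on_arr a (eps p) \<cdot>\<^bsub>E\<^esub> u (on_ob a p) = Idt E (on_ob a p)"
proof -
  have "\<exists>!g. g \<in> hom E (T p) p \<and> on_arr a g \<cdot>\<^bsub>E\<^esub> u (on_ob a p) = Idt E (on_ob a p)"
    unfolding T_def by (rule l_univ[OF aL[OF p] p E.id_in[OF aE[OF p]]])
  from theI'[OF this] show "eps p \<in> hom E (T p) p" "on_arr a (eps p) \<cdot>\<^bsub>E\<^esub> u (on_ob a p) = Idt E (on_ob a p)"
    unfolding eps_def by auto
qed

lemma uT: "p \<in> Ob E \<Longrightarrow> u (on_ob a p) \<in> hom E (on_ob a p) (on_ob a (T p))"
  unfolding T_def by (rule u[OF aL])

lemma a_eps: "p \<in> Ob E \<Longrightarrow> h \<in> hom E p s \<Longrightarrow> on_arr a (h \<cdot>\<^bsub>E\<^esub> eps p) \<cdot>\<^bsub>E\<^esub> u (on_ob a p) = on_arr a h"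
  using a_comp[OF _ eps, of h p s] E.assoc[OF a_hom a_hom[OF eps] uT, of h p s] eps_u E.idr[OF a_hom, of h p s] by simp

lemma eta_iso:
  assumes q: "q \<in> L"
  obtains \<rho> where "\<rho> \<in> hom E (on_ob a q) q" "\<rho> \<cdot>\<^bsub>E\<^esub> \<eta> q = Idt E q" "\<eta> q \<cdot>\<^bsub>E\<^esub> \<rho> = Idt E (on_ob a q)"
proof -
  have qO: "q \<in> Ob E" using q LE by blast
  obtain \<rho> where r: "\<rho> \<in> hom E (on_ob a q) q" "\<rho> \<cdot>\<^bsub>E\<^esub> \<eta> q = Idt E q"
    using a_univ[OF qO q E.id_in[OF qO]] by blast
  have "\<eta> q \<cdot>\<^bsub>E\<^esub> \<rho> = Idt E (on_ob a q)"
    by (rule a_eq[OF qO aL[OF qO] E.comp_in[OF eta[OF qO] r(1)] E.id_in[OF aE[OF qO]]])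
      (simp add: E.assoc[OF eta[OF qO] r(1) eta[OF qO], symmetric] r(2) E.idr[OF eta[OF qO]] E.idl[OF eta[OF qO]])
  then show thesis using that r by blast
qed

text \<open>The unit is invertible at objects of the level, so an arrow into such an object can be
  recovered from its reflection.\<close>

lemma a_faithful:
  assumes q: "q \<in> L" and h: "h \<in> hom E p q" "h' \<in> hom E p q" and eq: "on_arr a h = on_arr a h'"
  shows "h = h'"
proof -
  have qO: "q \<in> Ob E" using q LE by blast
  obtain \<rho> where r: "\<rho> \<in> hom E (on_ob a q) q" "\<rho> \<cdot>\<^bsub>E\<^esub> \<eta> q = Idt E q" by (rule eta_iso[OF q])
  have "\<rho> \<cdot>\<^bsub>E\<^esub> (\<eta> q \<cdot>\<^bsub>E\<^esub> h) = \<rho> \<cdot>\<^bsub>E\<^esub> (\<eta> q \<cdot>\<^bsub>E\<^esub> h')" using a_nat[OF h(1)] a_nat[OF h(2)] eq by simp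
  then show ?thesis
    using E.assoc[OF r(1) eta[OF qO] h(1)] E.assoc[OF r(1) eta[OF qO] h(2)] r(2) E.idl[OF h(1)] E.idl[OF h(2)] by simp
qed

lemma a_full:
  assumes p: "p \<in> Ob E" and q: "q \<in> L" and b: "\<beta> \<in> hom E (on_ob a p) (on_ob a q)"
  shows "\<exists>h \<in> hom E p q. on_arr a h = \<beta>"
proof -
  have qO: "q \<in> Ob E" using q LE by blast
  obtain \<rho> where r: "\<rho> \<in> hom E (on_ob a q) q" "\<eta> q \<cdot>\<^bsub>E\<^esub> \<rho> = Idt E (on_ob a q)" by (rule eta_iso[OF q])
  note be = E.comp_in[OF b eta[OF p]]
  let ?h = "\<rho> \<cdot>\<^bsub>E\<^esub> (\<beta> \<cdot>\<^bsub>E\<^esub> \<eta> p)"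
  have h: "?h \<in> hom E p q" using E.comp_in[OF r(1) be] .
  have "on_arr a ?h = \<beta>"
    by (rule a_eq[OF p aL[OF qO] a_hom[OF h] b])
      (simp add: a_nat[OF h] E.assoc[OF eta[OF qO] r(1) be] r(2) E.idl[OF be])
  then show ?thesis using h by blast
qed

text \<open>Objects of the level are orthogonal to the counits: \<open>a\<close> inverts
  \<open>eps p\<close>, and arrows into the level depend only on their images under
  \<open>a\<close>. This is the injective half, \<open>eps_factor\<close> the surjective
  one.\<close>

lemma eps_cancel:
  assumes q: "q \<in> L" and h: "h \<in> hom E p q" "h' \<in> hom E p q" and eq: "h \<cdot>\<^bsub>E\<^esub> eps p = h' \<cdot>\<^bsub>E\<^esub> eps p"
  shows "h = h'"
proof (rule a_faithful[OF q h])
  have p: "p \<in> Ob E" using E.dom_ob[OF h(1)] .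
  show "on_arr a h = on_arr a h'" using a_eps[OF p h(1)] a_eps[OF p h(2)] eq by simp
qed

lemma eps_factor:
  assumes p: "p \<in> Ob E" and q: "q \<in> L" and f: "f \<in> hom E (T p) q"
  shows "\<exists>h \<in> hom E p q. h \<cdot>\<^bsub>E\<^esub> eps p = f"
proof -
  obtain h where h: "h \<in> hom E p q" "on_arr a h = on_arr a f \<cdot>\<^bsub>E\<^esub> u (on_ob a p)"
    using a_full[OF p q E.comp_in[OF a_hom[OF f] uT[OF p]]] by blast
  have "h \<cdot>\<^bsub>E\<^esub> eps p = f"
    by (rule l_eq[OF aL[OF p] E.comp_in[OF h(1) eps[OF p], unfolded T_def] f[unfolded T_def]])
      (simp add: a_eps[OF p h(1)] h(2))
  then show ?thesis using h(1) by blast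
qed

lemma eps_nat:
  assumes f: "f \<in> hom E p q"
  shows "\<exists>g \<in> hom E (T p) (T q). eps q \<cdot>\<^bsub>E\<^esub> g = f \<cdot>\<^bsub>E\<^esub> eps p"
proof -
  have p: "p \<in> Ob E" and q: "q \<in> Ob E" using E.dom_ob[OF f] E.cod_ob[OF f] by auto
  obtain g where g: "g \<in> hom E (T p) (T q)" "on_arr a g \<cdot>\<^bsub>E\<^esub> u (on_ob a p) = u (on_ob a q) \<cdot>\<^bsub>E\<^esub> on_arr a f"
    using l_univ[OF aL[OF p] T_Ob[OF q] E.comp_in[OF uT[OF q] a_hom[OF f]]] unfolding T_def by blast
  have "eps q \<cdot>\<^bsub>E\<^esub> g = f \<cdot>\<^bsub>E\<^esub> eps p"
  proof (rule l_eq[OF aL[OF p] E.comp_in[OF eps[OF q] g(1), unfolded T_def] E.comp_in[OF f eps[OF p], unfolded T_def]])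
    have "on_arr a (eps q \<cdot>\<^bsub>E\<^esub> g) \<cdot>\<^bsub>E\<^esub> u (on_ob a p) = on_arr a (eps q) \<cdot>\<^bsub>E\<^esub> (u (on_ob a q) \<cdot>\<^bsub>E\<^esub> on_arr a f)"
      using a_comp[OF eps[OF q] g(1)] E.assoc[OF a_hom[OF eps[OF q]] a_hom[OF g(1)] uT[OF p]] g(2) by simp
    also have "\<dots> = on_arr a f"
      using E.assoc[OF a_hom[OF eps[OF q]] uT[OF q] a_hom[OF f]] eps_u[OF q] E.idl[OF a_hom[OF f]] by simp
    finally show "on_arr a (eps q \<cdot>\<^bsub>E\<^esub> g) \<cdot>\<^bsub>E\<^esub> u (on_ob a p) = on_arr a (f \<cdot>\<^bsub>E\<^esub> eps p) \<cdot>\<^bsub>E\<^esub> u (on_ob a p)"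
      using a_eps[OF p f] by simp
  qed
  then show ?thesis using g(1) by blast
qed

text \<open>Arrows identified by the unit have the same reflection, and what happens after composing
  with the counit is determined by the reflection.\<close>

lemma T_faithful:
  assumes h: "h \<in> hom E p s" "h' \<in> hom E p s" and eq: "\<eta> s \<cdot>\<^bsub>E\<^esub> h = \<eta> s \<cdot>\<^bsub>E\<^esub> h'"
  shows "h \<cdot>\<^bsub>E\<^esub> eps p = h' \<cdot>\<^bsub>E\<^esub> eps p"
proof -
  have p: "p \<in> Ob E" and s: "s \<in> Ob E" using E.dom_ob[OF h(1)] E.cod_ob[OF h(1)] by auto
  have "on_arr a h = on_arr a h'"
    by (rule a_eq[OF p aL[OF s] a_hom[OF h(1)] a_hom[OF h(2)]]) (simp add: a_nat[OF h(1)] a_nat[OF h(2)] eq)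
  then show ?thesis
    by (intro l_eq[OF aL[OF p] E.comp_in[OF h(1) eps[OF p], unfolded T_def] E.comp_in[OF h(2) eps[OF p], unfolded T_def]])
      (simp add: a_eps[OF p h(1)] a_eps[OF p h(2)])
qed

text \<open>An object in the image of the left adjoint has no proper subobject that is dense for the level.\<close>

lemma T_dense_split:
  assumes p: "p \<in> Ob E" and i: "i \<in> hom E W (T p)"
    and dense: "\<And>q f. q \<in> L \<Longrightarrow> f \<in> hom E W q \<Longrightarrow> \<exists>!h. h \<in> hom E (T p) q \<and> h \<cdot>\<^bsub>E\<^esub> i = f"
  shows "\<exists>g \<in> hom E (T p) W. i \<cdot>\<^bsub>E\<^esub> g = Idt E (T p)"
proof -
  have W: "W \<in> Ob E" using E.dom_ob[OF i] .
  note Tp = T_Ob[OF p]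
  obtain h where h: "h \<in> hom E (T p) (on_ob a W)" "h \<cdot>\<^bsub>E\<^esub> i = \<eta> W" using dense[OF aL[OF W] eta[OF W]] by blast
  obtain j where j: "j \<in> hom E (on_ob a (T p)) (on_ob a W)" "j \<cdot>\<^bsub>E\<^esub> \<eta> (T p) = h"
    using a_univ[OF Tp aL[OF W] h(1)] by blast
  note ai = a_hom[OF i]
  have aij: "on_arr a i \<cdot>\<^bsub>E\<^esub> h = \<eta> (T p)"
  proof -
    have "(on_arr a i \<cdot>\<^bsub>E\<^esub> h) \<cdot>\<^bsub>E\<^esub> i = \<eta> (T p) \<cdot>\<^bsub>E\<^esub> i"
      using E.assoc[OF ai h(1) i] h(2) a_nat[OF i] by simp
    then show ?thesis
      using dense[OF aL[OF Tp] E.comp_in[OF eta[OF Tp] i]] E.comp_in[OF ai h(1)] eta[OF Tp] by blast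
  qed
  have aj: "on_arr a i \<cdot>\<^bsub>E\<^esub> j = Idt E (on_ob a (T p))"
    by (rule a_eq[OF Tp aL[OF Tp] E.comp_in[OF ai j(1)] E.id_in[OF aE[OF Tp]]])
      (simp add: E.assoc[OF ai j(1) eta[OF Tp], symmetric] j(2) aij E.idl[OF eta[OF Tp]])
  \<comment> \<open>By \<open>aj\<close> the reflection of \<open>i\<close> is split by
    \<open>j\<close>. As \<open>T p\<close> is a value of \<open>l\<close>, composing
    \<open>j\<close> with the unit and transposing yields an arrow out of \<open>T p\<close>, the
    desired section.\<close>
  obtain g where g: "g \<in> hom E (T p) W" "on_arr a g \<cdot>\<^bsub>E\<^esub> u (on_ob a p) = j \<cdot>\<^bsub>E\<^esub> u (on_ob a p)"
    using l_univ[OF aL[OF p] W E.comp_in[OF j(1) uT[OF p]]] unfolding T_def by blast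
  have "i \<cdot>\<^bsub>E\<^esub> g = Idt E (T p)"
  proof (rule l_eq[OF aL[OF p] E.comp_in[OF i g(1), unfolded T_def] E.id_in[OF Tp, unfolded T_def], folded T_def])
    show "on_arr a (i \<cdot>\<^bsub>E\<^esub> g) \<cdot>\<^bsub>E\<^esub> u (on_ob a p) = on_arr a (Idt E (T p)) \<cdot>\<^bsub>E\<^esub> u (on_ob a p)"
      using a_comp[OF i g(1)] E.assoc[OF ai a_hom[OF g(1)] uT[OF p]] g(2) E.assoc[OF ai j(1) uT[OF p]] aj a_id[OF Tp]
      by simp
  qed
  then show ?thesis using g(1) by blast
qed

text \<open>The smallest dense sieve on the element \<open>x\<close>; together these sieves form an ideal of maps.\<close>

definition I :: "nat \<Rightarrow> nat \<Rightarrow> 'u \<Rightarrow> simp_op set" where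
  "I m k x = {f \<in> hom Delta m k. res (Y k x) f (gen k x) \<in> eap (eps (Y k x)) m ` el (T (Y k x)) m}"

lemma I_hom: "f \<in> I m k x \<Longrightarrow> f \<in> hom Delta m k" by (simp add: I_def)

lemma I_comp:
  assumes x: "x \<in> on_ob X k" and f: "f \<in> I m k x" and g: "g \<in> hom Delta j m"
  shows "f \<cdot>\<^bsub>Delta\<^esub> g \<in> I j k x"
proof -
  note Y = Y_Ob[OF x]
  obtain t where t: "t \<in> el (T (Y k x)) m" "res (Y k x) f (gen k x) = eap (eps (Y k x)) m t"
    using f by (auto simp: I_def)
  have "res (Y k x) (f \<cdot>\<^bsub>Delta\<^esub> g) (gen k x) = eap (eps (Y k x)) j (res (T (Y k x)) g t)"
    using res_comp[OF Y I_hom[OF f] g gen_in[OF x]] eap_res[OF eps[OF Y] g t(1)] t(2) by simp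
  then show ?thesis using Delta_comp_in[OF I_hom[OF f] g] res_in[OF T_Ob[OF Y] g t(1)] by (auto simp: I_def)
qed

text \<open>Naturality of the counit along the arrow of representables induced by \<open>h\<close>.
  With \<open>I_comp\<close> the sieves become stable under composition on both sides.\<close>

lemma I_push:
  assumes x': "x' \<in> on_ob X k'" and h: "h \<in> hom Delta k k'" and x: "x = act X h x'" and f: "f \<in> I m k x"
  shows "h \<cdot>\<^bsub>Delta\<^esub> f \<in> I m k' x'"
proof -
  have xX: "x \<in> on_ob X k" using x act_in[OF X h x'] by simp
  note Y = Y_Ob[OF xX] and Y' = Y_Ob[OF x']
  have "res (Y k' x') h (gen k' x') \<in> el (Y k' x') k" "lb (Y k' x') k (res (Y k' x') h (gen k' x')) = x"
    using res_in[OF Y' h gen_in[OF x']] lb_res[OF Y' h gen_in[OF x']] gen_lb[OF x'] x by auto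
  from Y_hom[OF xX Y' this] obtain y where y: "y \<in> hom E (Y k x) (Y k' x')" "eap y k (gen k x) = res (Y k' x') h (gen k' x')"
    by blast
  obtain g where g: "g \<in> hom E (T (Y k x)) (T (Y k' x'))" "eps (Y k' x') \<cdot>\<^bsub>E\<^esub> g = y \<cdot>\<^bsub>E\<^esub> eps (Y k x)"
    using eps_nat[OF y(1)] by blast
  obtain t where t: "t \<in> el (T (Y k x)) m" "res (Y k x) f (gen k x) = eap (eps (Y k x)) m t"
    using f by (auto simp: I_def)
  have "res (Y k' x') (h \<cdot>\<^bsub>Delta\<^esub> f) (gen k' x') = eap y m (eap (eps (Y k x)) m t)"
    using res_comp[OF Y' h I_hom[OF f] gen_in[OF x']] eap_res[OF y(1) I_hom[OF f] gen_in[OF xX]] y(2) t(2) by simp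
  also have "\<dots> = eap (eps (Y k' x')) m (eap g m t)"
    using eap_comp[OF y(1) eps[OF Y] t(1)] eap_comp[OF eps[OF Y'] g(1) t(1)] g(2) by simp
  finally show ?thesis using Delta_comp_in[OF h I_hom[OF f]] eap_in[OF g(1) t(1)] by (auto simp: I_def)
qed

text \<open>A compatible family on the sieve is an arrow on \<open>T (Y k x)\<close> that depends
  only on the image under the counit. Extending it along the counit gives an arrow on the
  representable, that is, an element. Together with \<open>I_sep\<close> this is the sheaf condition
  for the sieves.\<close>

lemma I_dense:
  assumes x: "x \<in> on_ob X k" and q: "q \<in> L"
    and z: "\<And>m f. f \<in> I m k x \<Longrightarrow> \<zeta> m f \<in> el q m \<and> lb q m (\<zeta> m f) = act X f x"
    and zr: "\<And>m f j g. f \<in> I m k x \<Longrightarrow> g \<in> hom Delta j m \<Longrightarrow> \<zeta> j (f \<cdot>\<^bsub>Delta\<^esub> g) = res q g (\<zeta> m f)"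
  shows "\<exists>b \<in> el q k. lb q k b = x \<and> (\<forall>m. \<forall>f \<in> I m k x. res q f b = \<zeta> m f)"
proof -
  note Y = Y_Ob[OF x] and qO = subsetD[OF LE q]
  \<comment> \<open>The operator below an element of \<open>T (Y k x)\<close>; it is unique, as
    distinct operators give distinct elements of a representable.\<close>
  define F where "F m t = (SOME f. f \<in> hom Delta m k \<and> eap (eps (Y k x)) m t = res (Y k x) f (gen k x))" for m t
  have F: "F m t \<in> hom Delta m k \<and> eap (eps (Y k x)) m t = res (Y k x) (F m t) (gen k x)" if "t \<in> el (T (Y k x)) m" for m t
    unfolding F_def by (rule someI_ex) (use Y_surj[OF x eap_in[OF eps[OF Y] that]] in blast)
  have FI: "F m t \<in> I m k x" if "t \<in> el (T (Y k x)) m" for m t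
    using F[OF that] that unfolding I_def by (metis (mono_tags, lifting) imageI mem_Collect_eq)
  have Fr: "F j (res (T (Y k x)) g t) = F m t \<cdot>\<^bsub>Delta\<^esub> g" if t: "t \<in> el (T (Y k x)) m" and g: "g \<in> hom Delta j m" for m t j g
  proof (rule Y_inj[OF x])
    note t' = res_in[OF T_Ob[OF Y] g t]
    show "F j (res (T (Y k x)) g t) \<in> hom Delta j k" using F[OF t'] by blast
    show "F m t \<cdot>\<^bsub>Delta\<^esub> g \<in> hom Delta j k" using Delta_comp_in F[OF t] g by blast
    show "res (Y k x) (F j (res (T (Y k x)) g t)) (gen k x) = res (Y k x) (F m t \<cdot>\<^bsub>Delta\<^esub> g) (gen k x)"
      using F[OF t'] F[OF t] res_comp[OF Y _ g gen_in[OF x], of "F m t"] eap_res[OF eps[OF Y] g t] by simp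
  qed
  have "\<exists>h \<in> hom E (T (Y k x)) q. \<forall>m. \<forall>t \<in> el (T (Y k x)) m. eap h m t = \<zeta> m (F m t)"
  proof (rule hom_ex[OF T_Ob[OF Y] qO])
    fix m t assume t: "t \<in> el (T (Y k x)) m"
    show "\<zeta> m (F m t) \<in> el q m" using z[OF FI[OF t]] by blast
    have "lb (T (Y k x)) m t = act X (F m t) x"
      using eap_lb[OF eps[OF Y] t] F[OF t] lb_res[OF Y _ gen_in[OF x], of "F m t"] gen_lb[OF x] by simp
    then show "lb q m (\<zeta> m (F m t)) = lb (T (Y k x)) m t" using z[OF FI[OF t]] by simp
    fix g j assume g: "g \<in> hom Delta j m"
    show "\<zeta> j (F j (res (T (Y k x)) g t)) = res q g (\<zeta> m (F m t))" using Fr[OF t g] zr[OF FI[OF t] g] by simp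
  qed
  then obtain f where f: "f \<in> hom E (T (Y k x)) q" "\<And>m t. t \<in> el (T (Y k x)) m \<Longrightarrow> eap f m t = \<zeta> m (F m t)" by blast
  obtain h where h: "h \<in> hom E (Y k x) q" "h \<cdot>\<^bsub>E\<^esub> eps (Y k x) = f" using eps_factor[OF Y q f(1)] by blast
  have "res q g (eap h k (gen k x)) = \<zeta> m g" if g: "g \<in> I m k x" for m g
  proof -
    obtain t where t: "t \<in> el (T (Y k x)) m" "res (Y k x) g (gen k x) = eap (eps (Y k x)) m t"
      using g by (auto simp: I_def)
    have "F m t = g" using Y_inj[OF x _ I_hom[OF g]] F[OF t(1)] t(2) by simp
    then show ?thesis
      using eap_res[OF h(1) I_hom[OF g] gen_in[OF x]] t eap_comp[OF h(1) eps[OF Y] t(1)] h(2) f(2)[OF t(1)] by simp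
  qed
  then show ?thesis
    using eap_in[OF h(1) gen_in[OF x]] eap_lb[OF h(1) gen_in[OF x]] gen_lb[OF x]
    by (intro bexI[of _ "eap h k (gen k x)"]) simp_all
qed

lemma I_sep:
  assumes x: "x \<in> on_ob X k" and q: "q \<in> L" and b: "b \<in> el q k" "lb q k b = x" and b': "b' \<in> el q k" "lb q k b' = x"
    and eq: "\<And>m f. f \<in> I m k x \<Longrightarrow> res q f b = res q f b'"
  shows "b = b'"
proof -
  note Y = Y_Ob[OF x] and qO = subsetD[OF LE q]
  obtain h where h: "h \<in> hom E (Y k x) q" "eap h k (gen k x) = b" using Y_hom[OF x qO b] by blast
  obtain h' where h': "h' \<in> hom E (Y k x) q" "eap h' k (gen k x) = b'" using Y_hom[OF x qO b'] by blast
  have "h \<cdot>\<^bsub>E\<^esub> eps (Y k x) = h' \<cdot>\<^bsub>E\<^esub> eps (Y k x)"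
  proof (rule hom_eqI[OF E.comp_in[OF h(1) eps[OF Y]] E.comp_in[OF h'(1) eps[OF Y]]])
    fix m t assume t: "t \<in> el (T (Y k x)) m"
    obtain f where f: "f \<in> hom Delta m k" "eap (eps (Y k x)) m t = res (Y k x) f (gen k x)"
      using Y_surj[OF x eap_in[OF eps[OF Y] t]] by blast
    have "f \<in> I m k x" using f t unfolding I_def by (metis (mono_tags, lifting) imageI mem_Collect_eq)
    then show "eap (h \<cdot>\<^bsub>E\<^esub> eps (Y k x)) m t = eap (h' \<cdot>\<^bsub>E\<^esub> eps (Y k x)) m t"
      using eap_comp[OF h(1) eps[OF Y] t] eap_comp[OF h'(1) eps[OF Y] t] f(2)
        eap_res[OF h(1) f(1) gen_in[OF x]] eap_res[OF h'(1) f(1) gen_in[OF x]] h(2) h'(2) eq by simp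
  qed
  then show ?thesis using eps_cancel[OF q h(1) h'(1)] h(2) h'(2) by simp
qed

text \<open>The ideal is idempotent.\<close>

lemma T_el_factor:
  assumes p: "p \<in> Ob E" and w: "w \<in> el (T p) m"
  shows "\<exists>k. \<exists>w' \<in> el (T p) k. \<exists>f \<in> I m k (lb (T p) k w'). w = res (T p) f w'"
proof -
  note Tp = T_Ob[OF p]
  \<comment> \<open>The part of \<open>T p\<close> reached through the ideal. The sheaf condition
    extends arrows from it uniquely to all of \<open>T p\<close>, so it is dense, and
    \<open>T_dense_split\<close> then makes it everything.\<close>
  define B where "B m = {w \<in> el (T p) m. \<exists>k. \<exists>w' \<in> el (T p) k. \<exists>f \<in> I m k (lb (T p) k w'). w = res (T p) f w'}" for m
  have Bres: "res (T p) f w' \<in> B m" if "w' \<in> el (T p) k" "f \<in> I m k (lb (T p) k w')" for w' k m f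
    using that res_in[OF Tp I_hom[OF that(2)] that(1)] unfolding B_def by blast
  have "\<exists>c. \<exists>i \<in> hom E c (T p). \<forall>k. bij_betw (eap i k) (el c k) (B k)"
  proof (rule subobj_ex[OF Tp])
    show "B k \<subseteq> el (T p) k" for k by (auto simp: B_def)
    fix g j m w assume g: "g \<in> hom Delta j m" and "w \<in> B m"
    then obtain k w' f where w': "w' \<in> el (T p) k" "f \<in> I m k (lb (T p) k w')" "w = res (T p) f w'"
      unfolding B_def by blast
    have "res (T p) g w = res (T p) (f \<cdot>\<^bsub>Delta\<^esub> g) w'"
      using res_comp[OF Tp I_hom[OF w'(2)] g w'(1)] w'(3) by simp
    then show "res (T p) g w \<in> B j" using Bres[OF w'(1) I_comp[OF lb_in[OF Tp w'(1)] w'(2) g]] by simp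
  qed
  then obtain c i where i: "i \<in> hom E c (T p)" and bij: "\<And>k. bij_betw (eap i k) (el c k) (B k)" by blast
  have c: "c \<in> Ob E" using E.dom_ob[OF i] .
  define v where "v k = the_inv_into (el c k) (eap i k)" for k
  have inj: "inj_on (eap i k) (el c k)" for k using bij by (simp add: bij_betw_def)
  have vi: "v k (eap i k d) = d" if "d \<in> el c k" for k d using the_inv_into_f_f[OF inj that] by (simp add: v_def)
  have iv: "v k w \<in> el c k \<and> eap i k (v k w) = w" if "w \<in> B k" for k w
  proof -
    have "w \<in> eap i k ` el c k" using that bij[of k] by (simp add: bij_betw_def)
    then obtain d where "d \<in> el c k" "w = eap i k d" by blast
    then show ?thesis using vi by simp
  qed
  have vres: "v j (res (T p) g w) = res c g (v m w)" if "w \<in> B m" "g \<in> hom Delta j m" for j m g w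
    using vi[OF res_in[OF c that(2), of "v m w"]] iv[OF that(1)] eap_res[OF i that(2), of "v m w"] by simp
  have "\<exists>g \<in> hom E (T p) c. i \<cdot>\<^bsub>E\<^esub> g = Idt E (T p)"
  proof (rule T_dense_split[OF p i])
    fix q \<phi> assume q: "q \<in> L" and phi: "\<phi> \<in> hom E c q"
    have qO: "q \<in> Ob E" using q LE by blast
    \<comment> \<open>\<open>b\<close> is the amalgamation at \<open>w\<close> of the values of
      \<open>\<phi>\<close> along the dense sieve of the label of \<open>w\<close>;
      \<open>I_dense\<close> and \<open>I_sep\<close> make it exist uniquely.\<close>
    define Q where "Q k w b \<longleftrightarrow> b \<in> el q k \<and> lb q k b = lb (T p) k w \<and>
        (\<forall>m. \<forall>f \<in> I m k (lb (T p) k w). res q f b = eap \<phi> m (v m (res (T p) f w)))" for k w b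
    have Qex: "\<exists>b. Q k w b" if w: "w \<in> el (T p) k" for k w
    proof -
      have "\<exists>b \<in> el q k. lb q k b = lb (T p) k w \<and>
        (\<forall>m. \<forall>f \<in> I m k (lb (T p) k w). res q f b = eap \<phi> m (v m (res (T p) f w)))"
      proof (rule I_dense[OF lb_in[OF Tp w] q])
        fix m f assume f: "f \<in> I m k (lb (T p) k w)"
        note b = Bres[OF w f]
        have vc: "v m (res (T p) f w) \<in> el c m" using iv[OF b] by blast
        have "lb c m (v m (res (T p) f w)) = act X f (lb (T p) k w)"
          using eap_lb[OF i vc] iv[OF b] lb_res[OF Tp I_hom[OF f] w] by simp
        then show "eap \<phi> m (v m (res (T p) f w)) \<in> el q m \<and> lb q m (eap \<phi> m (v m (res (T p) f w))) = act X f (lb (T p) k w)"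
          using eap_in[OF phi vc] eap_lb[OF phi vc] by simp
        fix j g assume g: "g \<in> hom Delta j m"
        show "eap \<phi> j (v j (res (T p) (f \<cdot>\<^bsub>Delta\<^esub> g) w)) = res q g (eap \<phi> m (v m (res (T p) f w)))"
          using res_comp[OF Tp I_hom[OF f] g w] vres[OF b g] eap_res[OF phi g vc] by simp
      qed
      then show ?thesis unfolding Q_def by blast
    qed
    have Quniq: "b = b'" if "w \<in> el (T p) k" "Q k w b" "Q k w b'" for k w b b'
      using I_sep[OF lb_in[OF Tp that(1)] q, of b b'] that(2,3) by (simp add: Q_def)
    define A where "A k w = (SOME b. Q k w b)" for k w
    have A: "Q k w (A k w)" if "w \<in> el (T p) k" for k w unfolding A_def using someI_ex[OF Qex[OF that]] .
    have Ares: "A j (res (T p) g w) = res q g (A m w)" if w: "w \<in> el (T p) m" and g: "g \<in> hom Delta j m" for w m g j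
    proof (rule Quniq[OF res_in[OF Tp g w] A[OF res_in[OF Tp g w]]])
      have Aq: "A m w \<in> el q m" "lb q m (A m w) = lb (T p) m w" using A[OF w] by (auto simp: Q_def)
      have lbw: "lb (T p) j (res (T p) g w) = act X g (lb (T p) m w)" using lb_res[OF Tp g w] .
      have "res q f (res q g (A m w)) = eap \<phi> n (v n (res (T p) f (res (T p) g w)))"
        if f: "f \<in> I n j (lb (T p) j (res (T p) g w))" for n f
      proof -
        have gf: "g \<cdot>\<^bsub>Delta\<^esub> f \<in> I n m (lb (T p) m w)" using I_push[OF lb_in[OF Tp w] g lbw f] .
        show ?thesis
          using A[OF w] gf res_comp[OF qO g I_hom[OF f] Aq(1)] res_comp[OF Tp g I_hom[OF f] w] by (simp add: Q_def)
      qed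
      then show "Q j (res (T p) g w) (res q g (A m w))"
        unfolding Q_def using res_in[OF qO g Aq(1)] lb_res[OF qO g Aq(1)] Aq(2) lbw by simp
    qed
    have "\<exists>h \<in> hom E (T p) q. \<forall>k. \<forall>w \<in> el (T p) k. eap h k w = A k w"
      by (rule hom_ex[OF Tp qO]) (use A Ares in \<open>auto simp: Q_def\<close>)
    then obtain h where h: "h \<in> hom E (T p) q" "\<And>k w. w \<in> el (T p) k \<Longrightarrow> eap h k w = A k w" by blast
    show "\<exists>!h. h \<in> hom E (T p) q \<and> h \<cdot>\<^bsub>E\<^esub> i = \<phi>"
    proof (rule ex1I[of _ h])
      have "h \<cdot>\<^bsub>E\<^esub> i = \<phi>"
      proof (rule hom_eqI[OF E.comp_in[OF h(1) i] phi])
        fix m d assume d: "d \<in> el c m"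
        have "eap i m d \<in> B m" using d bij[of m] by (auto simp: bij_betw_def)
        then obtain k w' f where w': "w' \<in> el (T p) k" "f \<in> I m k (lb (T p) k w')" "eap i m d = res (T p) f w'"
          unfolding B_def by blast
        have "eap h m (eap i m d) = res q f (A k w')"
          using eap_res[OF h(1) I_hom[OF w'(2)] w'(1)] w'(3) h(2)[OF w'(1)] by simp
        also have "\<dots> = eap \<phi> m (v m (eap i m d))" using A[OF w'(1)] w'(2,3) by (simp add: Q_def)
        finally show "eap (h \<cdot>\<^bsub>E\<^esub> i) m d = eap \<phi> m d" using eap_comp[OF h(1) i d] vi[OF d] by simp
      qed
      then show "h \<in> hom E (T p) q \<and> h \<cdot>\<^bsub>E\<^esub> i = \<phi>" using h(1) by blast
      fix h' assume "h' \<in> hom E (T p) q \<and> h' \<cdot>\<^bsub>E\<^esub> i = \<phi>"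
      then have h': "h' \<in> hom E (T p) q" "h' \<cdot>\<^bsub>E\<^esub> i = \<phi>" by auto
      show "h' = h"
      proof (rule hom_eqI[OF h'(1) h(1)])
        fix k w assume w: "w \<in> el (T p) k"
        have "res q f (eap h' k w) = eap \<phi> m (v m (res (T p) f w))" if f: "f \<in> I m k (lb (T p) k w)" for m f
          using eap_res[OF h'(1) I_hom[OF f] w] iv[OF Bres[OF w f]] eap_comp[OF h'(1) i, of "v m (res (T p) f w)" m] h'(2) by simp
        then have "Q k w (eap h' k w)" unfolding Q_def using eap_in[OF h'(1) w] eap_lb[OF h'(1) w] by simp
        then show "eap h' k w = eap h k w" using Quniq[OF w _ A[OF w]] h(2)[OF w] by simp
      qed
    qed
  qed
  then obtain g where g: "g \<in> hom E (T p) c" "i \<cdot>\<^bsub>E\<^esub> g = Idt E (T p)" by blast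
  have "w = eap i m (eap g m w)" using eap_comp[OF i g(1) w] g(2) eap_id[OF w] by simp
  moreover have "eap i m (eap g m w) \<in> B m" using bij[of m] eap_in[OF g(1) w] by (auto simp: bij_betw_def)
  ultimately show ?thesis unfolding B_def by auto
qed

text \<open>The simplices at which the smallest dense sieve is the maximal one. They generate the
  level, as \<open>T_element_S\<close> will show.\<close>

definition S :: "nat \<Rightarrow> 'u \<Rightarrow> bool" where
  "S k x \<longleftrightarrow> x \<in> on_ob X k \<and> Idt Delta k \<in> I k k x"

lemma S_in: "S k x \<Longrightarrow> x \<in> on_ob X k" by (simp add: S_def)

text \<open>Among all factorizations of an element of \<open>T y\<close> choose one whose image in \<open>y\<close> is as large
  as possible; by idempotency its image belongs to \<open>S\<close>.\<close>

lemma I_factor: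
  assumes x: "x \<in> on_ob X k" and f: "f \<in> I m k x"
  shows "\<exists>j. \<exists>d \<in> hom Delta j k. \<exists>g \<in> hom Delta m j. f = d \<cdot>\<^bsub>Delta\<^esub> g \<and> S j (act X d x)"
proof -
  let ?y = "Y k x" and ?g = "gen k x"
  note Y = Y_Ob[OF x] and TY = T_Ob[OF Y_Ob[OF x]] and ep = eps[OF Y_Ob[OF x]]
  obtain w where w: "w \<in> el (T ?y) m" "res ?y f ?g = eap (eps ?y) m w" using f by (auto simp: I_def)
  \<comment> \<open>A candidate writes \<open>w\<close> as the restriction of some \<open>w'\<close>
    along \<open>g\<close>, with \<open>f'\<close> the operator below \<open>w'\<close>; its degree
    is the number of vertices that \<open>f'\<close> reaches in \<open>[k]\<close>.\<close>
  define P where "P t \<longleftrightarrow> (case t of (m', w', g, f') \<Rightarrow> w' \<in> el (T ?y) m' \<and> g \<in> hom Delta m m' \<and>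
     w = res (T ?y) g w' \<and> f' \<in> hom Delta m' k \<and> eap (eps ?y) m' w' = res ?y f' ?g)" for t
  define deg where "deg t = (case t of (m', w', g, f') \<Rightarrow> card (ev f' ` {..m'}))" for t :: "nat \<times> 'u \<times> simp_op \<times> simp_op"
  have "P (m, w, Idt Delta m, f)"
    using w I_hom[OF f] Delta_id_in res_id[OF TY w(1)] by (simp add: P_def)
  \<comment> \<open>\<open>[k]\<close> has \<open>k + 1\<close> vertices, so degrees stay strictly
    below \<open>k + 2\<close>.\<close>
  moreover have "\<forall>t. P t \<longrightarrow> deg t < k + 2"
  proof (intro allI impI)
    fix t assume "P t"
    then obtain m' w' g f' where t: "t = (m', w', g, f')" "f' \<in> hom Delta m' k" by (cases t) (auto simp: P_def)
    have "ev f' ` {..m'} \<subseteq> {..k}" using ev_le[OF t(2)] by auto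
    then have "card (ev f' ` {..m'}) \<le> Suc k" using card_mono[of "{..k}"] by fastforce
    then show "deg t < k + 2" using t by (simp add: deg_def)
  qed
  ultimately obtain t where t: "P t" "\<And>t'. P t' \<Longrightarrow> deg t' \<le> deg t"
    using ex_has_greatest_nat[of P "(m, w, Idt Delta m, f)" deg "k + 2"] by blast
  then obtain m' w' g f' where tt: "t = (m', w', g, f')" and w': "w' \<in> el (T ?y) m'" and g: "g \<in> hom Delta m m'"
    and wg: "w = res (T ?y) g w'" and f': "f' \<in> hom Delta m' k" "eap (eps ?y) m' w' = res ?y f' ?g"
    by (cases t) (auto simp: P_def)
  obtain n w2 h where w2: "w2 \<in> el (T ?y) n" "h \<in> I m' n (lb (T ?y) n w2)" "w' = res (T ?y) h w2"
    using T_el_factor[OF Y w'] by blast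
  note hh = I_hom[OF w2(2)]
  obtain f2 where f2: "f2 \<in> hom Delta n k" "eap (eps ?y) n w2 = res ?y f2 ?g" using Y_surj[OF x eap_in[OF ep w2(1)]] by blast
  have f'2: "f' = f2 \<cdot>\<^bsub>Delta\<^esub> h"
    by (rule Y_inj[OF x f'(1) Delta_comp_in[OF f2(1) hh]])
      (use f'(2) w2(3) eap_res[OF ep hh w2(1)] f2(2) res_comp[OF Y f2(1) hh gen_in[OF x]] in simp)
  have "P (n, w2, h \<cdot>\<^bsub>Delta\<^esub> g, f2)"
    using w2 f2 Delta_comp_in[OF hh g] wg res_comp[OF TY hh g w2(1)] by (simp add: P_def)
  from t(2)[OF this] have le: "card (ev f2 ` {..n}) \<le> card (ev f' ` {..m'})" by (simp add: deg_def tt)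
  have sub: "ev f' ` {..m'} \<subseteq> ev f2 ` {..n}" using f'2 ev_comp[OF f2(1) hh] ev_le[OF hh] by auto
  \<comment> \<open>Idempotency produced a further candidate, with \<open>f' = f2 \<cdot> h\<close>.
    Its image contains the old one, and by maximality it is not larger.\<close>
  have im: "ev f' ` {..m'} = ev f2 ` {..n}" using card_seteq[OF _ sub le] by simp
  obtain j e d where e: "e \<in> hom Delta n j" "d \<in> hom Delta j k" "f2 = d \<cdot>\<^bsub>Delta\<^esub> e"
    "inj_on (ev d) {..j}" "ev d ` {..j} = ev f2 ` {..n}" by (rule epi_mono[OF f2(1)])
  have lb2: "lb (T ?y) n w2 = act X e (act X d x)"
    using eap_lb[OF ep w2(1)] f2(2) lb_res[OF Y f2(1) gen_in[OF x]] gen_lb[OF x] act_comp[OF X e(2,1) x] e(3) by simp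
  have dx: "act X d x \<in> on_ob X j" using act_in[OF X e(2) x] .
  have ehI: "e \<cdot>\<^bsub>Delta\<^esub> h \<in> I m' j (act X d x)" using I_push[OF dx e(1) lb2 w2(2)] .
  note eh = I_hom[OF ehI]
  have f'd: "f' = d \<cdot>\<^bsub>Delta\<^esub> (e \<cdot>\<^bsub>Delta\<^esub> h)" using f'2 e(3) Delta.assoc[OF e(2,1) hh] by simp
  \<comment> \<open>With equal images already \<open>e \<cdot> h\<close> covers the vertices of
    \<open>[j]\<close>. It belongs to the ideal, and a section of it then brings the identity of
    \<open>[j]\<close> into the ideal.\<close>
  have surj: "ev (e \<cdot>\<^bsub>Delta\<^esub> h) ` {..m'} = {..j}"
  proof
    show "ev (e \<cdot>\<^bsub>Delta\<^esub> h) ` {..m'} \<subseteq> {..j}" using ev_le[OF eh] by auto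
    show "{..j} \<subseteq> ev (e \<cdot>\<^bsub>Delta\<^esub> h) ` {..m'}"
    proof
      fix i assume i: "i \<in> {..j}"
      then have "ev d i \<in> ev f' ` {..m'}" using e(5) im by auto
      then obtain i' where i': "i' \<le> m'" "ev d i = ev f' i'" by auto
      have "ev d i = ev d (ev (e \<cdot>\<^bsub>Delta\<^esub> h) i')" using i' f'd ev_comp[OF e(2) eh i'(1)] by simp
      then have "i = ev (e \<cdot>\<^bsub>Delta\<^esub> h) i'" using inj_onD[OF e(4)] i ev_le[OF eh i'(1)] by simp
      then show "i \<in> ev (e \<cdot>\<^bsub>Delta\<^esub> h) ` {..m'}" using i'(1) by auto
    qed
  qed
  obtain s where s: "s \<in> hom Delta j m'" "(e \<cdot>\<^bsub>Delta\<^esub> h) \<cdot>\<^bsub>Delta\<^esub> s = Idt Delta j" using section_ex[OF eh surj, of 0] by blast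
  have "S j (act X d x)" using I_comp[OF dx ehI s(1)] s(2) dx by (simp add: S_def)
  moreover have "f = d \<cdot>\<^bsub>Delta\<^esub> ((e \<cdot>\<^bsub>Delta\<^esub> h) \<cdot>\<^bsub>Delta\<^esub> g)"
  proof -
    have "f = f' \<cdot>\<^bsub>Delta\<^esub> g"
      by (rule Y_inj[OF x I_hom[OF f] Delta_comp_in[OF f'(1) g]])
        (use w(2) wg eap_res[OF ep g w'] f'(2) res_comp[OF Y f'(1) g gen_in[OF x]] in simp)
    then show ?thesis using f'd Delta.assoc[OF e(2) eh g] by simp
  qed
  ultimately show ?thesis using e(2) Delta_comp_in[OF eh g] by blast
qed

lemma T_element_S:
  assumes p: "p \<in> Ob E" and v: "v \<in> el (T p) m"
  shows "\<exists>j. \<exists>z \<in> el (T p) j. \<exists>g \<in> hom Delta m j. v = res (T p) g z \<and> S j (lb (T p) j z)"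
proof -
  note Tp = T_Ob[OF p]
  obtain k w f where w: "w \<in> el (T p) k" "f \<in> I m k (lb (T p) k w)" "v = res (T p) f w" using T_el_factor[OF p v] by blast
  obtain j d g where d: "d \<in> hom Delta j k" "g \<in> hom Delta m j" "f = d \<cdot>\<^bsub>Delta\<^esub> g" "S j (act X d (lb (T p) k w))"
    using I_factor[OF lb_in[OF Tp w(1)] w(2)] by blast
  show ?thesis
    using res_in[OF Tp d(1) w(1)] d(2,4) res_comp[OF Tp d(1,2) w(1)] w(3) d(3) lb_res[OF Tp d(1) w(1)]
    by (intro exI[of _ j] bexI[of _ "res (T p) d w"] bexI[of _ g]) simp_all
qed

text \<open>Pushing the identity of \<open>[k]\<close> forward puts \<open>e\<close> into the ideal
  at \<open>y\<close>; a section of \<open>e\<close> turns it into the identity there.\<close>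

lemma S_retract:
  assumes S: "S k (act X e y)" and y: "y \<in> on_ob X j" and e: "e \<in> hom Delta k j" "ev e ` {..k} = {..j}"
  shows "S j y"
proof -
  obtain s where s: "s \<in> hom Delta j k" "e \<cdot>\<^bsub>Delta\<^esub> s = Idt Delta j" using section_ex[OF e, of 0] by blast
  have "e \<cdot>\<^bsub>Delta\<^esub> Idt Delta k \<in> I k j y" using I_push[OF y e(1) refl] S by (simp add: S_def)
  then have "e \<in> I k j y" using Delta.idr[OF e(1)] by simp
  then show ?thesis using I_comp[OF y _ s(1), of e] s(2) y by (simp add: S_def)
qed

text \<open>The generic element lies in the image of the counit, where arrows identified by the unit
  agree.\<close>

lemma S_faithful:
  assumes S: "S k x" and h: "h \<in> hom E (Y k x) s" "h' \<in> hom E (Y k x) s" and eq: "\<eta> s \<cdot>\<^bsub>E\<^esub> h = \<eta> s \<cdot>\<^bsub>E\<^esub> h'"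
  shows "h = h'"
proof (rule Y_eq[OF S_in[OF S] h])
  note x = S_in[OF S]
  obtain t where t: "t \<in> el (T (Y k x)) k" "gen k x = eap (eps (Y k x)) k t"
    using S res_id[OF Y_Ob[OF x] gen_in[OF x]] by (auto simp: S_def I_def)
  show "eap h k (gen k x) = eap h' k (gen k x)"
    using T_faithful[OF h eq] eap_comp[OF h(1) eps[OF Y_Ob[OF x]] t(1)] eap_comp[OF h(2) eps[OF Y_Ob[OF x]] t(1)] t(2) by simp
qed

lemma S_eta_inj:
  assumes p: "p \<in> Ob E" and b: "b \<in> el p k" "b' \<in> el p k" "lb p k b = lb p k b'" and S: "S k (lb p k b)"
    and eq: "eap (\<eta> p) k b = eap (\<eta> p) k b'"
  shows "b = b'"
proof -
  note x = S_in[OF S]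
  obtain h where h: "h \<in> hom E (Y k (lb p k b)) p" "eap h k (gen k (lb p k b)) = b" using Y_hom[OF x p b(1) refl] by blast
  obtain h' where h': "h' \<in> hom E (Y k (lb p k b)) p" "eap h' k (gen k (lb p k b)) = b'" using Y_hom[OF x p b(2)] b(3) by metis
  have "\<eta> p \<cdot>\<^bsub>E\<^esub> h = \<eta> p \<cdot>\<^bsub>E\<^esub> h'"
    by (rule Y_eq[OF x E.comp_in[OF eta[OF p] h(1)] E.comp_in[OF eta[OF p] h'(1)]])
      (simp add: eap_comp[OF eta[OF p] h(1) gen_in[OF x]] eap_comp[OF eta[OF p] h'(1) gen_in[OF x]] h(2) h'(2) eq)
  then show ?thesis using S_faithful[OF S h(1) h'(1)] h(2) h'(2) by simp
qed

text \<open>Compare the two inclusions of \<open>B\<close> into the cokernel pair of the image of \<open>e\<close>.\<close>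

lemma relatively_epic_S_surj:
  assumes e: "e \<in> hom E A B" and B: "B \<in> L"
    and epi: "\<And>q h1 h2 \<rho>. q \<in> L \<Longrightarrow> h1 \<in> hom E B q \<Longrightarrow> h2 \<in> hom E B q \<Longrightarrow> \<rho> \<in> hom E q B \<Longrightarrow>
       \<rho> \<cdot>\<^bsub>E\<^esub> h1 = Idt E B \<Longrightarrow> \<rho> \<cdot>\<^bsub>E\<^esub> h2 = Idt E B \<Longrightarrow> h1 \<cdot>\<^bsub>E\<^esub> e = h2 \<cdot>\<^bsub>E\<^esub> e \<Longrightarrow> h1 = h2"
    and b: "b \<in> el B k" and S: "S k (lb B k b)"
  shows "\<exists>z \<in> el A k. eap e k z = b"
proof -
  have BO: "B \<in> Ob E" and AO: "A \<in> Ob E" using E.cod_ob[OF e] E.dom_ob[OF e] by auto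
  define im where "im k = eap e k ` el A k" for k
  have im: "res B f z \<in> im m" if "z \<in> im k" "f \<in> hom Delta m k" for z k f m
  proof -
    obtain z' where z': "z' \<in> el A k" "z = eap e k z'" using \<open>z \<in> im k\<close> by (auto simp: im_def)
    have "res B f z = eap e m (res A f z')" using eap_res[OF e \<open>f \<in> _\<close> z'(1)] z'(2) by simp
    then show ?thesis using res_in[OF AO \<open>f \<in> _\<close> z'(1)] by (simp add: im_def)
  qed
  \<comment> \<open>Two copies of \<open>B\<close> glued along the image of \<open>e\<close>. The
    flag marks the second copy and occurs only off the image, so the action drops it as soon as a
    restriction enters the image.\<close>
  define D where "D k = {t. fst t \<in> el B k \<and> (snd t \<longrightarrow> fst t \<notin> im k)}" for k
  define ac where "ac f t = (res B f (fst t), snd t \<and> res B f (fst t) \<notin> im (Dom Delta f))" for f t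
  have "\<exists>P e. presents D ac (\<lambda>k t. lb B k (fst t)) e P"
  proof (rule presents_ex)
    show "|D k| <o r" for k
      by (rule small_subset[OF _ small_Sigma[OF el_card[OF BO, of k], of "\<lambda>_. UNIV :: bool set"]])
        (auto simp: D_def small_finite)
    show "ac f t \<in> D m" if "f \<in> hom Delta m k" "t \<in> D k" for f m k t
      using that res_in[OF BO] homD[OF that(1)] by (simp add: D_def ac_def)
    show "ac (Idt Delta k) t = t" if "t \<in> D k" for k t
      using that res_id[OF BO] homD[OF Delta_id_in[of k]] by (auto simp: D_def ac_def prod_eq_iff)
    show "ac g (ac f t) = ac (f \<cdot>\<^bsub>Delta\<^esub> g) t" if "f \<in> hom Delta m k" "g \<in> hom Delta j m" "t \<in> D k" for f g m k j t
      using that res_comp[OF BO that(1,2)] homD[OF that(1)] homD[OF that(2)] homD[OF Delta_comp_in[OF that(1,2)]]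
        im[of "res B f (fst t)" m g j] by (auto simp: D_def ac_def)
    show "lb B k (fst t) \<in> on_ob X k" if "t \<in> D k" for k t using that lb_in[OF BO] by (simp add: D_def)
    show "lb B m (fst (ac f t)) = act X f (lb B k (fst t))" if "f \<in> hom Delta m k" "t \<in> D k" for f m k t
      using that lb_res[OF BO] by (simp add: D_def ac_def)
  qed
  then obtain P c where P: "presents D ac (\<lambda>k t. lb B k (fst t)) c P" by blast
  note PO = presents_Ob[OF P]
  have i_ex: "\<exists>h \<in> hom E B P. \<forall>k. \<forall>b \<in> el B k. eap h k b = c k (b, t \<and> b \<notin> im k)" for t
  proof (rule hom_ex[OF BO PO])
    fix k b assume b: "b \<in> el B k"
    have d: "(b, t \<and> b \<notin> im k) \<in> D k" using b by (simp add: D_def)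
    show "c k (b, t \<and> b \<notin> im k) \<in> el P k" using presents_in[OF P d] .
    show "lb P k (c k (b, t \<and> b \<notin> im k)) = lb B k b" using presents_lb[OF P d] by simp
    fix f m assume f: "f \<in> hom Delta m k"
    have "(res B f b, t \<and> res B f b \<notin> im m) = ac f (b, t \<and> b \<notin> im k)"
      using homD[OF f] im[OF _ f, of b] by (simp add: ac_def) blast
    then show "c m (res B f b, t \<and> res B f b \<notin> im m) = res P f (c k (b, t \<and> b \<notin> im k))"
      using presents_res[OF P d f] by simp
  qed
  obtain i1 where i1: "i1 \<in> hom E B P" "\<And>k b. b \<in> el B k \<Longrightarrow> eap i1 k b = c k (b, False)"
    using i_ex[of False] by auto
  obtain i2 where i2: "i2 \<in> hom E B P" "\<And>k b. b \<in> el B k \<Longrightarrow> eap i2 k b = c k (b, b \<notin> im k)"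
    using i_ex[of True] by auto
  have "\<exists>h \<in> hom E P B. \<forall>k. \<forall>t \<in> D k. eap h k (c k t) = fst t"
    by (rule presents_hom[OF P BO]) (auto simp: D_def ac_def)
  then obtain rt where rt: "rt \<in> hom E P B" "\<And>k t. t \<in> D k \<Longrightarrow> eap rt k (c k t) = fst t" by blast
  \<comment> \<open>Folding the copies gives both inclusions a common retraction. It is kept because
    epimorphisms of a slice cancel only arrows over the base, and the retraction is what supplies
    the structure map.\<close>
  obtain \<rho> where rho: "\<rho> \<in> hom E (on_ob a P) B" "\<rho> \<cdot>\<^bsub>E\<^esub> \<eta> P = rt" using a_univ[OF PO B rt(1)] by blast
  note eP = eta[OF PO]
  have "rt \<cdot>\<^bsub>E\<^esub> i1 = Idt E B"
    by (rule hom_eqI[OF E.comp_in[OF rt(1) i1(1)] E.id_in[OF BO]])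
      (simp add: eap_comp[OF rt(1) i1(1)] i1(2) rt(2) D_def eap_id)
  moreover have "rt \<cdot>\<^bsub>E\<^esub> i2 = Idt E B"
    by (rule hom_eqI[OF E.comp_in[OF rt(1) i2(1)] E.id_in[OF BO]])
      (simp add: eap_comp[OF rt(1) i2(1)] i2(2) rt(2) D_def eap_id)
  ultimately have ret: "\<rho> \<cdot>\<^bsub>E\<^esub> (\<eta> P \<cdot>\<^bsub>E\<^esub> i1) = Idt E B" "\<rho> \<cdot>\<^bsub>E\<^esub> (\<eta> P \<cdot>\<^bsub>E\<^esub> i2) = Idt E B"
    using E.assoc[OF rho(1) eP i1(1)] E.assoc[OF rho(1) eP i2(1)] rho(2) by auto
  have "i1 \<cdot>\<^bsub>E\<^esub> e = i2 \<cdot>\<^bsub>E\<^esub> e"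
    by (rule hom_eqI[OF E.comp_in[OF i1(1) e] E.comp_in[OF i2(1) e]])
      (simp add: eap_comp[OF i1(1) e] eap_comp[OF i2(1) e] i1(2) i2(2) eap_in[OF e] im_def)
  then have "(\<eta> P \<cdot>\<^bsub>E\<^esub> i1) \<cdot>\<^bsub>E\<^esub> e = (\<eta> P \<cdot>\<^bsub>E\<^esub> i2) \<cdot>\<^bsub>E\<^esub> e"
    using E.assoc[OF eP i1(1) e] E.assoc[OF eP i2(1) e] by simp
  from epi[OF aL[OF PO] E.comp_in[OF eP i1(1)] E.comp_in[OF eP i2(1)] rho(1) ret this]
  have eq: "\<eta> P \<cdot>\<^bsub>E\<^esub> i1 = \<eta> P \<cdot>\<^bsub>E\<^esub> i2" .
  have "eap i1 k b = eap i2 k b"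
  proof (rule S_eta_inj[OF PO eap_in[OF i1(1) b] eap_in[OF i2(1) b]])
    show "lb P k (eap i1 k b) = lb P k (eap i2 k b)" "S k (lb P k (eap i1 k b))"
      using eap_lb[OF i1(1) b] eap_lb[OF i2(1) b] S by auto
    show "eap (\<eta> P) k (eap i1 k b) = eap (\<eta> P) k (eap i2 k b)"
      using eap_comp[OF eP i1(1) b] eap_comp[OF eP i2(1) b] eq by simp
  qed
  then have "c k (b, False) = c k (b, b \<notin> im k)" using i1(2)[OF b] i2(2)[OF b] by metis
  moreover have "(b, False) \<in> D k" "(b, b \<notin> im k) \<in> D k" using b by (auto simp: D_def)
  ultimately have "(b, False) = (b, b \<notin> im k)" using presents_inj[OF P] by metis
  then show ?thesis by (auto simp: im_def)
qed

text \<open>Yoneda inside the level: objects of \<open>L\<close> do not distinguish a representable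
  from its reflection. \<open>hat_eq\<close> is the matching uniqueness.\<close>

lemma hat_ex:
  assumes x: "x \<in> on_ob X k" and q: "q \<in> L" and b: "b \<in> el q k" "lb q k b = x"
  shows "\<exists>h \<in> hom E (on_ob a (Y k x)) q. eap h k (eap (\<eta> (Y k x)) k (gen k x)) = b"
proof -
  note Y = Y_Ob[OF x] and qO = subsetD[OF LE q]
  obtain h where h: "h \<in> hom E (Y k x) q" "eap h k (gen k x) = b" using Y_hom[OF x qO b] by blast
  obtain g where g: "g \<in> hom E (on_ob a (Y k x)) q" "g \<cdot>\<^bsub>E\<^esub> \<eta> (Y k x) = h" using a_univ[OF Y q h(1)] by blast
  then show ?thesis using eap_comp[OF g(1) eta[OF Y] gen_in[OF x]] h(2) by auto
qed

lemma hat_eq: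
  assumes x: "x \<in> on_ob X k" and q: "q \<in> L"
    and h: "h \<in> hom E (on_ob a (Y k x)) q" "h' \<in> hom E (on_ob a (Y k x)) q"
    and eq: "eap h k (eap (\<eta> (Y k x)) k (gen k x)) = eap h' k (eap (\<eta> (Y k x)) k (gen k x))"
  shows "h = h'"
proof -
  note Y = Y_Ob[OF x]
  have "h \<cdot>\<^bsub>E\<^esub> \<eta> (Y k x) = h' \<cdot>\<^bsub>E\<^esub> \<eta> (Y k x)"
    by (rule Y_eq[OF x E.comp_in[OF h(1) eta[OF Y]] E.comp_in[OF h(2) eta[OF Y]]])
      (use eq eap_comp[OF h(1) eta[OF Y] gen_in[OF x]] eap_comp[OF h(2) eta[OF Y] gen_in[OF x]] in simp)
  then show ?thesis using a_eq[OF Y q h] by blast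
qed

end

text \<open>If the generators are nondegenerate, \<open>T p\<close> is a core, so the counit at
  \<open>p\<close> factors through the generated part \<open>c\<close>. Orthogonality to the counits
  of \<open>p\<close> and of \<open>c\<close> then extends an arrow from \<open>c\<close> to
  \<open>p\<close> in exactly one way, which is the property defining \<open>L0\<close>.\<close>

lemma (in strongly_regular_over) level_below_L0:
  assumes lv: "essential_level r X L a l \<eta> u" and S: "\<And>k x. essential_level.S r X a l u k x \<Longrightarrow> nd k x"
  shows "L \<subseteq> L0"
proof
  interpret essential_level r X L a l \<eta> u by (rule lv)
  fix q assume q: "q \<in> L"
  have qO: "q \<in> Ob E" using q LE by blast
  have Tcore: "isCore (T p)" if p: "p \<in> Ob E" for p
    unfolding isCore_def
  proof (intro conjI allI ballI T_Ob[OF p])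
    fix k v assume "v \<in> el (T p) k"
    then obtain j z g where "z \<in> el (T p) j" "g \<in> hom Delta k j" "v = res (T p) g z" "S j (lb (T p) j z)"
      using T_element_S[OF p] by blast
    moreover from this have "z \<in> Sel (T p) j" using S by (simp add: Sel_def)
    ultimately show "\<exists>j. \<exists>f\<in>hom Delta k j. \<exists>b\<in>Sel (T p) j. v = res (T p) f b" by blast
  qed
  show "q \<in> L0"
    unfolding L0_def
  proof (intro CollectI conjI qO ballI allI impI)
    fix p \<phi> assume p: "p \<in> Ob E" and N: "Nat p q \<phi>"
    obtain c i where c: "isCore c" and i: "Sbij i c p" and inj: "\<And>k. inj_on (eap i k) (el c k)"
      using core_ex[OF p] by blast
    have cO: "c \<in> Ob E" using c by (simp add: isCore_def)
    note ih = Sbij_hom[OF i]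
    obtain \<psi> where psi: "Nat p c \<psi>" "\<And>k b. b \<in> Sel p k \<Longrightarrow> eap i k (\<psi> k b) = b" using Nat_inv[OF i] by blast
    obtain h0 where h0: "h0 \<in> hom E c q" "\<And>k z. z \<in> Sel c k \<Longrightarrow> eap h0 k z = \<phi> k (eap i k z)"
      using core_ext[OF c qO Nat_comp[OF Nat_eap[OF ih] N]] by blast
    obtain t where t: "t \<in> hom E (T p) c" "\<And>k z. z \<in> Sel (T p) k \<Longrightarrow> eap t k z = \<psi> k (eap (eps p) k z)"
      using core_ext[OF Tcore[OF p] cO Nat_comp[OF Nat_eap[OF eps[OF p]] psi(1)]] by blast
    have it: "i \<cdot>\<^bsub>E\<^esub> t = eps p"
      by (rule core_eq[OF Tcore[OF p] E.comp_in[OF ih t(1)] eps[OF p]])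
        (simp add: eap_comp[OF ih t(1) Sel_el] t(2) psi(2) Sel_eap[OF eps[OF p]])
    obtain h where h: "h \<in> hom E p q" "h \<cdot>\<^bsub>E\<^esub> eps p = h0 \<cdot>\<^bsub>E\<^esub> t"
      using eps_factor[OF p q E.comp_in[OF h0(1) t(1)]] by blast
    obtain Ti where Ti: "Ti \<in> hom E (T c) (T p)" "eps p \<cdot>\<^bsub>E\<^esub> Ti = i \<cdot>\<^bsub>E\<^esub> eps c" using eps_nat[OF ih] by blast
    \<comment> \<open>\<open>i\<close> is injective on elements, so the equation may be checked
      after composing with it.\<close>
    have tTi: "t \<cdot>\<^bsub>E\<^esub> Ti = eps c"
    proof (rule hom_eqI[OF E.comp_in[OF t(1) Ti(1)] eps[OF cO]])
      fix k z assume z: "z \<in> el (T c) k"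
      have "i \<cdot>\<^bsub>E\<^esub> (t \<cdot>\<^bsub>E\<^esub> Ti) = i \<cdot>\<^bsub>E\<^esub> eps c" using E.assoc[OF ih t(1) Ti(1)] it Ti(2) by simp
      then have "eap i k (eap (t \<cdot>\<^bsub>E\<^esub> Ti) k z) = eap i k (eap (eps c) k z)"
        using eap_comp[OF ih E.comp_in[OF t(1) Ti(1)] z] eap_comp[OF ih eps[OF cO] z] by simp
      then show "eap (t \<cdot>\<^bsub>E\<^esub> Ti) k z = eap (eps c) k z"
        using inj_onD[OF inj] eap_in[OF E.comp_in[OF t(1) Ti(1)] z] eap_in[OF eps[OF cO] z] by blast
    qed
    have hi: "h \<cdot>\<^bsub>E\<^esub> i = h0"
    proof (rule eps_cancel[OF q E.comp_in[OF h(1) ih] h0(1)])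
      have "(h \<cdot>\<^bsub>E\<^esub> i) \<cdot>\<^bsub>E\<^esub> eps c = (h \<cdot>\<^bsub>E\<^esub> eps p) \<cdot>\<^bsub>E\<^esub> Ti"
        using E.assoc[OF h(1) ih eps[OF cO]] E.assoc[OF h(1) eps[OF p] Ti(1)] Ti(2) by simp
      also have "\<dots> = h0 \<cdot>\<^bsub>E\<^esub> eps c" using h(2) E.assoc[OF h0(1) t(1) Ti(1)] tTi by simp
      finally show "(h \<cdot>\<^bsub>E\<^esub> i) \<cdot>\<^bsub>E\<^esub> eps c = h0 \<cdot>\<^bsub>E\<^esub> eps c" .
    qed
    show "\<exists>!h. h \<in> hom E p q \<and> (\<forall>k. \<forall>b\<in>Sel p k. eap h k b = \<phi> k b)"
    proof (rule ex1I[of _ h])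
      have "eap h k b = \<phi> k b" if b: "b \<in> Sel p k" for k b
      proof -
        obtain z where z: "z \<in> Sel c k" "b = eap i k z" using Sbij_surj[OF i b] by blast
        show ?thesis using eap_comp[OF h(1) ih Sel_el[OF z(1)]] hi h0(2)[OF z(1)] z(2) by simp
      qed
      then show "h \<in> hom E p q \<and> (\<forall>k. \<forall>b\<in>Sel p k. eap h k b = \<phi> k b)" using h(1) by blast
      fix h' assume "h' \<in> hom E p q \<and> (\<forall>k. \<forall>b\<in>Sel p k. eap h' k b = \<phi> k b)"
      then have h': "h' \<in> hom E p q" "\<And>k b. b \<in> Sel p k \<Longrightarrow> eap h' k b = \<phi> k b" by auto
      have "h' \<cdot>\<^bsub>E\<^esub> i = h0"
        by (rule core_eq[OF c E.comp_in[OF h'(1) ih] h0(1)])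
          (simp add: eap_comp[OF h'(1) ih Sel_el] h'(2) Sel_eap[OF ih] h0(2))
      then have "h' \<cdot>\<^bsub>E\<^esub> eps p = h0 \<cdot>\<^bsub>E\<^esub> t" using E.assoc[OF h'(1) ih t(1)] it by simp
      then show "h' = h" using eps_cancel[OF q h'(1) h(1)] h(2) by simp
    qed
  qed
qed

section \<open>Etendues are supported on nondegenerate simplices\<close>

context simp_over
begin

lemma const_psh_simps:
  "on_ob (on_ob (const_psh r Delta) A) k = A"
  "f \<in> hom Delta m k \<Longrightarrow> b \<in> A \<Longrightarrow> act (on_ob (const_psh r Delta) A) f b = b"
  by (auto simp: const_psh_def Let_def act_def hom_def)

lemma const_psh_Ob:
  assumes "|A| <o r"
  shows "on_ob (const_psh r Delta) A \<in> Ob (simp_sets r)"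
proof -
  have i: "Idt (set_cat r) A \<in> hom (set_cat r) A A" using set_id_in[OF assms] .
  have "Idt Delta k \<in> Arr Delta" for k using homD[OF Delta_id_in] by blast
  moreover have "g \<cdot>\<^bsub>Delta\<^esub> f \<in> Arr Delta" if "f \<in> Arr Delta" "g \<in> Arr Delta" "Cod Delta f = Dom Delta g" for f g
    using Delta_comp_in[of g "Dom Delta g" "Cod Delta g" f "Dom Delta f"] that homI by (auto simp: hom_def)
  ultimately have "is_functor (op_cat Delta) (set_cat r) (on_ob (const_psh r Delta) A)"
    using i assms category.idl[OF category_set i]
    by (simp add: is_functor_def const_psh_def Let_def set_Ob)
  then show ?thesis by (simp add: simp_Ob const_psh_def Let_def)
qed

definition "const_E = comp_func (base_change (simp_sets r) X) (const_psh r Delta)"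

text \<open>The constant object on \<open>A\<close> is known up to the choice of base change only.
  In terms of elements, arrows into it are \<open>A\<close>-valued functions invariant under all
  operators, and \<open>\<epsilon>\<close> reads off the values.\<close>

lemma const_E_universal:
  assumes A: "|A| <o r"
  obtains R \<epsilon> where "on_ob const_E A = R" "R \<in> Ob E"
    "\<And>k c. c \<in> el R k \<Longrightarrow> \<epsilon> k c \<in> A"
    "\<And>f m k c. f \<in> hom Delta m k \<Longrightarrow> c \<in> el R k \<Longrightarrow> \<epsilon> m (res R f c) = \<epsilon> k c"
    "\<forall>s \<in> Ob E. \<forall>g. (\<forall>k. \<forall>c \<in> el s k. g k c \<in> A) \<longrightarrow>
       (\<forall>m k. \<forall>f \<in> hom Delta m k. \<forall>c \<in> el s k. g m (res s f c) = g k c) \<longrightarrow>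
       (\<exists>!h. h \<in> hom E s R \<and> (\<forall>k. \<forall>c \<in> el s k. \<epsilon> k (eap h k c) = g k c))"
proof -
  define K where "K = on_ob (const_psh r Delta) A"
  have K: "K \<in> Ob (simp_sets r)" using const_psh_Ob[OF A] by (simp add: K_def)
  have Kel: "on_ob K k = A" for k by (simp add: K_def const_psh_simps)
  have Kact: "act K f b = b" if "f \<in> hom Delta m k" "b \<in> A" for f m k b
    using const_psh_simps(2)[OF that] by (simp add: K_def)
  define R where "R = on_ob (base_change (simp_sets r) X) K"
  have R: "R \<in> Ob E" unfolding R_def using functorD(1)[OF adjointD(2)[OF base_change_X] K] .
  have fo: "on_ob (forget (simp_sets r)) s = fst s" "on_arr (forget (simp_sets r)) g = fst (snd g)" for s g
    by (simp_all add: forget_def simp_simps case_prod_beta)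
  obtain e where e: "e \<in> hom (simp_sets r) (fst R) K"
    and eu: "\<And>s f. s \<in> Ob E \<Longrightarrow> f \<in> hom (simp_sets r) (fst s) K \<Longrightarrow>
      \<exists>!g. g \<in> hom E s R \<and> e \<cdot>\<^bsub>simp_sets r\<^esub> fst (snd g) = f"
    using adjoint_counit[OF E.category_axioms category_simp base_change_X K] unfolding fo R_def[symmetric] by blast
  interpret S: category "simp_sets r" by (rule category_simp)
  show thesis
  proof (rule that)
    show "on_ob const_E A = R" by (simp add: const_E_def comp_func_def R_def K_def)
    show "R \<in> Ob E" by (rule R)
    show "ap e k c \<in> A" if "c \<in> el R k" for k c using ap_in[OF e, of c k] that Kel by (simp add: el_def)
    show "ap e m (res R f c) = ap e k c" if "f \<in> hom Delta m k" "c \<in> el R k" for f m k c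
      using ap_act[OF e that(1), of c] Kact[OF that(1)] ap_in[OF e, of c k] that(2) Kel by (simp add: el_def res_def)
    show "\<forall>s \<in> Ob E. \<forall>g. (\<forall>k. \<forall>c \<in> el s k. g k c \<in> A) \<longrightarrow>
       (\<forall>m k. \<forall>f \<in> hom Delta m k. \<forall>c \<in> el s k. g m (res s f c) = g k c) \<longrightarrow>
       (\<exists>!h. h \<in> hom E s R \<and> (\<forall>k. \<forall>c \<in> el s k. ap e k (eap h k c) = g k c))"
    proof (intro ballI allI impI)
    fix s g assume s: "s \<in> Ob E" and gA: "\<forall>k. \<forall>c \<in> el s k. g k c \<in> A"
      and gi: "\<forall>m k. \<forall>f \<in> hom Delta m k. \<forall>c \<in> el s k. g m (res s f c) = g k c"
    have "\<exists>\<mu> \<in> hom (simp_sets r) (fst s) K. \<forall>k. \<forall>c \<in> on_ob (fst s) k. ap \<mu> k c = g k c"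
      by (rule simp_hom_ex[OF E_Ob_simp[OF s] K]) (use gA gi Kact Kel in \<open>simp_all add: el_def res_def\<close>)
    then obtain \<mu> where mu: "\<mu> \<in> hom (simp_sets r) (fst s) K" "\<And>k c. c \<in> el s k \<Longrightarrow> ap \<mu> k c = g k c"
      by (auto simp: el_def)
    have "e \<cdot>\<^bsub>simp_sets r\<^esub> fst (snd h) = \<mu> \<longleftrightarrow> (\<forall>k. \<forall>c \<in> el s k. ap e k (eap h k c) = g k c)"
      if h: "h \<in> hom E s R" for h
    proof -
      have h': "fst (snd h) \<in> hom (simp_sets r) (fst s) (fst R)" using h by (auto simp: E_hom)
      have ev: "ap (e \<cdot>\<^bsub>simp_sets r\<^esub> fst (snd h)) k c = ap e k (eap h k c)" if "c \<in> el s k" for k c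
        using ap_comp[OF e h'] that by (simp add: el_def eap_def)
      show ?thesis
      proof
        show "e \<cdot>\<^bsub>simp_sets r\<^esub> fst (snd h) = \<mu>" if "\<forall>k. \<forall>c \<in> el s k. ap e k (eap h k c) = g k c"
          by (rule simp_hom_eqI[OF S.comp_in[OF e h'] mu(1)]) (use that ev mu(2) in \<open>simp add: el_def\<close>)
      qed (use ev mu(2) in auto)
    qed
    then show "\<exists>!h. h \<in> hom E s R \<and> (\<forall>k. \<forall>c \<in> el s k. ap e k (eap h k c) = g k c)"
      using eu[OF s mu(1)] by (metis (no_types, lifting))
    qed
  qed
qed

text \<open>The chosen base change of \<open>Q\<close>, read as a product of \<open>Q\<close> and
  \<open>G\<close> in \<open>E\<close> when tested on objects of \<open>L\<close>.\<close>

lemma base_change_universal: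
  assumes L: "L \<subseteq> Ob E" and adj: "adjoint E (full_subcat E L) a inclusion" and G: "G \<in> L" and Q: "Q \<in> L"
  obtains D W \<epsilon> where "on_ob (base_change (full_subcat E L) G) Q = W" "D \<in> L" "W \<in> hom E D G" "\<epsilon> \<in> hom E D Q"
    "\<And>s f g. s \<in> L \<Longrightarrow> f \<in> hom E s Q \<Longrightarrow> g \<in> hom E s G \<Longrightarrow>
       \<exists>!h. h \<in> hom E s D \<and> W \<cdot>\<^bsub>E\<^esub> h = g \<and> \<epsilon> \<cdot>\<^bsub>E\<^esub> h = f"
proof -
  let ?L = "full_subcat E L"
  have cL: "category ?L" by (rule category_full[OF E.category_axioms L])
  note bc = base_change_L[OF L adj G]
  define W where "W = on_ob (base_change ?L G) Q"
  have W0: "W \<in> Ob (slice ?L G)" unfolding W_def using functorD(1)[OF adjointD(2)[OF bc]] Q by simp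
  define D where "D = Dom E W"
  have W: "W \<in> hom E D G" "D \<in> L" using W0 by (auto simp: slice_Ob hom_full_iff D_def)
  have fo: "on_ob (forget ?L) s = Dom E s" "on_arr (forget ?L) g = fst (snd g)" for s g
    by (simp_all add: forget_def case_prod_beta)
  have "Q \<in> Ob ?L" using Q by simp
  then obtain \<epsilon> where e: "\<epsilon> \<in> hom ?L D Q"
    and eu: "\<And>A f. A \<in> Ob (slice ?L G) \<Longrightarrow> f \<in> hom ?L (Dom E A) Q \<Longrightarrow>
      \<exists>!g. g \<in> hom (slice ?L G) A W \<and> \<epsilon> \<cdot>\<^bsub>E\<^esub> fst (snd g) = f"
    using adjoint_counit[OF category_slice[OF cL] cL bc, of Q] unfolding fo W_def[symmetric] D_def[symmetric] full_simps by blast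
  show thesis
  proof (rule that)
    show "on_ob (base_change ?L G) Q = W" by (simp add: W_def)
    show "D \<in> L" "W \<in> hom E D G" using W by auto
    show "\<epsilon> \<in> hom E D Q" using e by (simp add: hom_full_iff)
    fix s f g assume s: "s \<in> L" and f: "f \<in> hom E s Q" and g: "g \<in> hom E s G"
    have gD: "Dom E g = s" using homD[OF g] by simp
    have g0: "g \<in> Ob (slice ?L G)" using g s G gD by (simp add: slice_Ob hom_full_iff)
    have f0: "f \<in> hom ?L (Dom E g) Q" using f s Q gD by (simp add: hom_full_iff)
    have iff: "(g, h, W) \<in> hom (slice ?L G) g W \<longleftrightarrow> h \<in> hom E s D \<and> W \<cdot>\<^bsub>E\<^esub> h = g" for h
      using g0 W0 s W(2) gD by (simp add: slice_hom hom_full_iff D_def)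
    obtain t where t: "t \<in> hom (slice ?L G) g W" "\<epsilon> \<cdot>\<^bsub>E\<^esub> fst (snd t) = f"
      and tu: "\<And>t'. t' \<in> hom (slice ?L G) g W \<Longrightarrow> \<epsilon> \<cdot>\<^bsub>E\<^esub> fst (snd t') = f \<Longrightarrow> t' = t"
      using eu[OF g0 f0] by blast
    obtain h where h: "t = (g, h, W)" using t(1) by (auto simp: slice_hom)
    show "\<exists>!h. h \<in> hom E s D \<and> W \<cdot>\<^bsub>E\<^esub> h = g \<and> \<epsilon> \<cdot>\<^bsub>E\<^esub> h = f"
    proof (rule ex1I[of _ h])
      show "h \<in> hom E s D \<and> W \<cdot>\<^bsub>E\<^esub> h = g \<and> \<epsilon> \<cdot>\<^bsub>E\<^esub> h = f" using t iff by (simp add: h)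
      fix h' assume "h' \<in> hom E s D \<and> W \<cdot>\<^bsub>E\<^esub> h' = g \<and> \<epsilon> \<cdot>\<^bsub>E\<^esub> h' = f"
      then show "h' = h" using tu[of "(g, h', W)"] iff by (simp add: h)
    qed
  qed
qed

lemma slice_full_hom:
  assumes p: "p \<in> hom E A G" and q: "q \<in> hom E B G" and "A \<in> L" "B \<in> L" "G \<in> L"
  shows "t \<in> hom (slice (full_subcat E L) G) p q \<longleftrightarrow> (\<exists>h \<in> hom E A B. t = (p, h, q) \<and> q \<cdot>\<^bsub>E\<^esub> h = p)"
  using assms homD[OF p] homD[OF q] by (auto simp: slice_hom slice_Ob hom_full_iff)

lemma slice_full_Ob:
  "p \<in> Ob (slice (full_subcat E L) G) \<longleftrightarrow> (\<exists>A \<in> L. p \<in> hom E A G \<and> G \<in> L)"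
  by (simp add: slice_Ob hom_full_iff) (metis homD)

end

text \<open>Localicity is tested on the reflected representable of a degenerate generator
  \<open>x\<close>, placed over \<open>G\<close>. Its generic element lifts through the epimorphism
  to a subobject of a product of \<open>G\<close> with a constant object, where
  \<open>\<tau>\<close> cannot move the lift. So \<open>\<tau>\<close> fixes the generic element,
  and injectivity of the unit over \<open>S\<close> forces \<open>\<tau>\<close> to be the
  identity.\<close>

lemma (in essential_level) etendue_S_nondegenerate:
  assumes adj: "adjoint E (full_subcat E L) a inclusion"
    and et: "etendue (full_subcat E L) (set_cat r) (comp_func a const_E)"
    and S: "S k x"
  shows "nd k x"
proof (rule ccontr)
  let ?L = "full_subcat E L"
  assume "\<not> nd k x"
  note x = S_in[OF S]
  obtain m y0 f where f: "f \<in> hom Delta k m" "y0 \<in> on_ob X m" "x = act X f y0" "\<not> inj_on (ev f) {..k}"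
    using \<open>\<not> nd k x\<close> x unfolding nd_def by blast
  obtain j e d where e: "e \<in> hom Delta k j" and d: "d \<in> hom Delta j m" "f = d \<cdot>\<^bsub>Delta\<^esub> e"
    and esurj: "ev e ` {..k} = {..j}" and "inj_on (ev f) {..k} \<or> j < k" by (rule epi_mono[OF f(1)])
  then have jk: "j < k" using f(4) by blast
  define y where "y = act X d y0"
  have y: "y \<in> on_ob X j" using act_in[OF X d(1) f(2)] by (simp add: y_def)
  have xy: "x = act X e y" using act_comp[OF X d(1) e f(2)] f(3) d(2) by (simp add: y_def)
  have Sy: "S j y" using S_retract[OF S[unfolded xy] y e esurj] .
  obtain s where s: "s \<in> hom Delta j k" "e \<cdot>\<^bsub>Delta\<^esub> s = Idt Delta j" using section_ex[OF e esurj, of 0] by blast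
  \<comment> \<open>An idempotent on \<open>[k]\<close> with \<open>e \<cdot> \<tau> = e\<close>,
    hence an endomorphism of \<open>x\<close>; it is not the identity because \<open>e\<close>
    lowers the dimension.\<close>
  define \<tau> where "\<tau> = s \<cdot>\<^bsub>Delta\<^esub> e"
  have tau: "\<tau> \<in> hom Delta k k" using Delta_comp_in[OF s(1) e] by (simp add: \<tau>_def)
  have etau: "e \<cdot>\<^bsub>Delta\<^esub> \<tau> = e" using Delta.assoc[OF e s(1) e] s(2) Delta.idl[OF e] by (simp add: \<tau>_def)
  have xtau: "act X \<tau> x = x" using act_comp[OF X e tau y] etau xy by simp
  from et obtain G where G: "well_supported ?L G"
    and loc: "localic (slice ?L G) (set_cat r) (comp_func (base_change ?L G) (comp_func a const_E))"
    by (auto simp: etendue_def)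
  have GL: "G \<in> L" and GO: "G \<in> Ob E" using G LE by (auto simp: well_supported_def)
  note Yx = Y_Ob[OF x] and Yy = Y_Ob[OF y]
  \<comment> \<open>The support of \<open>G\<close> is used at \<open>y\<close>, again a generator
    by \<open>S_retract\<close>. The terminal object has an element over \<open>y\<close>, and the
    epimorphism from \<open>G\<close> is surjective over generators.\<close>
  have "\<exists>g0 \<in> el G j. lb G j g0 = y"
  proof -
    obtain e0 where e0: "epic ?L e0" "Dom ?L e0 = G" "terminal ?L (Cod ?L e0)" using G by (auto simp: well_supported_def)
    define Tm where "Tm = Cod E e0"
    have Tm: "Tm \<in> L" "terminal ?L Tm" using e0(3) by (auto simp: Tm_def terminal_def)
    have e0h: "e0 \<in> hom E G Tm" using e0(1,2) by (auto simp: epic_def Tm_def hom_def full_subcat_def)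
    obtain t where t: "t \<in> hom E (on_ob a (Y j y)) Tm" 
      using Tm(2) aL[OF Yy] unfolding terminal_def by (auto simp: hom_full_iff)
    note te = E.comp_in[OF t eta[OF Yy]]
    define b where "b = eap (t \<cdot>\<^bsub>E\<^esub> \<eta> (Y j y)) j (gen j y)"
    have b: "b \<in> el Tm j" "lb Tm j b = y"
      using eap_in[OF te gen_in[OF y]] eap_lb[OF te gen_in[OF y]] gen_lb[OF y] by (auto simp: b_def)
    have "\<exists>z \<in> el G j. eap e0 j z = b"
    proof (rule relatively_epic_S_surj[OF e0h Tm(1) _ b(1)])
      show "S j (lb Tm j b)" using Sy b(2) by simp
      fix q h1 h2 assume q: "q \<in> L" and h: "h1 \<in> hom E Tm q" "h2 \<in> hom E Tm q" "h1 \<cdot>\<^bsub>E\<^esub> e0 = h2 \<cdot>\<^bsub>E\<^esub> e0"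
      show "h1 = h2" using e0(1) q h Tm(1) unfolding epic_def by (simp add: hom_full_iff Tm_def)
    qed
    then show ?thesis using eap_lb[OF e0h] b(2) by metis
  qed
  then obtain g0 where g0: "g0 \<in> el G j" "lb G j g0 = y" by blast
  \<comment> \<open>Being a restriction along \<open>e\<close>, this element is fixed by
    \<open>\<tau>\<close>; other elements of \<open>G\<close> over \<open>x\<close> might not
    be.\<close>
  define g1 where "g1 = res G e g0"
  have g1: "g1 \<in> el G k" "lb G k g1 = x"
    using res_in[OF GO e g0(1)] lb_res[OF GO e g0(1)] g0(2) xy by (auto simp: g1_def)
  have g1tau: "res G \<tau> g1 = g1" using res_comp[OF GO e tau g0(1)] etau by (simp add: g1_def)
  define B where "B = on_ob a (Y k x)"
  have BL: "B \<in> L" using aL[OF Yx] by (simp add: B_def)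
  have BO: "B \<in> Ob E" using BL LE by blast
  define c where "c = eap (\<eta> (Y k x)) k (gen k x)"
  have c: "c \<in> el B k" "lb B k c = x"
    using eap_in[OF eta[OF Yx] gen_in[OF x]] eap_lb[OF eta[OF Yx] gen_in[OF x]] gen_lb[OF x] by (auto simp: c_def B_def)
  obtain \<beta> where beta: "\<beta> \<in> hom E B G" "eap \<beta> k c = g1" using hat_ex[OF x GL g1] by (auto simp: B_def c_def)
  have "\<beta> \<in> Ob (slice ?L G)" using slice_full_Ob beta(1) BL GL by blast
  then obtain A where A: "A \<in> Ob (set_cat r)"
    and sq: "subquotient (slice ?L G) \<beta> (on_ob (comp_func (base_change ?L G) (comp_func a const_E)) A)"
    using loc unfolding localic_def by blast
  have Ar: "|A| <o r" using A by (simp add: set_Ob)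
  obtain R \<epsilon>1 where R: "on_ob const_E A = R" and RO: "R \<in> Ob E"
    and e1A: "\<And>k c. c \<in> el R k \<Longrightarrow> \<epsilon>1 k c \<in> A"
    and e1r: "\<And>f m k c. f \<in> hom Delta m k \<Longrightarrow> c \<in> el R k \<Longrightarrow> \<epsilon>1 m (res R f c) = \<epsilon>1 k c"
    and e1u: "\<forall>s \<in> Ob E. \<forall>g. (\<forall>k. \<forall>c \<in> el s k. g k c \<in> A) \<longrightarrow>
       (\<forall>m k. \<forall>f \<in> hom Delta m k. \<forall>c \<in> el s k. g m (res s f c) = g k c) \<longrightarrow>
       (\<exists>!h. h \<in> hom E s R \<and> (\<forall>k. \<forall>c \<in> el s k. \<epsilon>1 k (eap h k c) = g k c))"
    by (rule const_E_universal[OF Ar]) (rule that)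
  define Q where "Q = on_ob a R"
  have QL: "Q \<in> L" and QO: "Q \<in> Ob E" using aL[OF RO] LE by (auto simp: Q_def)
  obtain D W \<epsilon>2 where W: "on_ob (base_change ?L G) Q = W" and DL: "D \<in> L" and Wh: "W \<in> hom E D G"
    and e2: "\<epsilon>2 \<in> hom E D Q"
    and e2u: "\<And>s f g. s \<in> L \<Longrightarrow> f \<in> hom E s Q \<Longrightarrow> g \<in> hom E s G \<Longrightarrow>
       \<exists>!h. h \<in> hom E s D \<and> W \<cdot>\<^bsub>E\<^esub> h = g \<and> \<epsilon>2 \<cdot>\<^bsub>E\<^esub> h = f"
    by (rule base_change_universal[OF LE adj GL QL]) (rule that)
  have DO: "D \<in> Ob E" using DL LE by blast
  have "on_ob (comp_func (base_change ?L G) (comp_func a const_E)) A = W"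
    by (simp add: comp_func_def R Q_def[symmetric] W)
  with sq obtain mm ee where mono: "monic (slice ?L G) mm" and mc: "snd (snd mm) = W"
    and epi: "epic (slice ?L G) ee" and de: "fst ee = fst mm" and ce: "snd (snd ee) = \<beta>"
    by (auto simp: subquotient_def)
  define P where "P = fst mm"
  have mmh: "mm \<in> hom (slice ?L G) P W" using mono mc by (simp add: monic_def hom_def P_def)
  have eeh: "ee \<in> hom (slice ?L G) P \<beta>" using epi de ce by (simp add: epic_def hom_def P_def)
  have "P \<in> Ob (slice ?L G)" using mmh by (simp add: slice_hom)
  then obtain P0 where P0L: "P0 \<in> L" and Ph: "P \<in> hom E P0 G" using slice_full_Ob by blast
  have P0O: "P0 \<in> Ob E" using P0L LE by blast
  obtain m1 where m1: "m1 \<in> hom E P0 D" "mm = (P, m1, W)" "W \<cdot>\<^bsub>E\<^esub> m1 = P"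
    using mmh slice_full_hom[OF Ph Wh P0L DL GL] by blast
  obtain e1 where e1: "e1 \<in> hom E P0 B" "ee = (P, e1, \<beta>)" "\<beta> \<cdot>\<^bsub>E\<^esub> e1 = P"
    using eeh slice_full_hom[OF Ph beta(1) P0L BL GL] by blast
  \<comment> \<open>Arrows from \<open>B\<close> with a common retraction \<open>\<rho>\<close> are
    arrows over \<open>G\<close> for the structure map \<open>\<beta> \<cdot> \<rho>\<close>. The
    slice epimorphism cancels them, as surjectivity over generators requires.\<close>
  have "\<exists>z \<in> el P0 k. eap e1 k z = c"
  proof (rule relatively_epic_S_surj[OF e1(1) BL _ c(1)])
    show "S k (lb B k c)" using S c(2) by simp
    fix q h1 h2 \<rho> assume q: "q \<in> L" and h: "h1 \<in> hom E B q" "h2 \<in> hom E B q" and rho: "\<rho> \<in> hom E q B"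
      "\<rho> \<cdot>\<^bsub>E\<^esub> h1 = Idt E B" "\<rho> \<cdot>\<^bsub>E\<^esub> h2 = Idt E B" and eq: "h1 \<cdot>\<^bsub>E\<^esub> e1 = h2 \<cdot>\<^bsub>E\<^esub> e1"
    let ?q = "\<beta> \<cdot>\<^bsub>E\<^esub> \<rho>"
    have qh: "?q \<in> hom E q G" using E.comp_in[OF beta(1) rho(1)] .
    have "?q \<cdot>\<^bsub>E\<^esub> h1 = \<beta>" "?q \<cdot>\<^bsub>E\<^esub> h2 = \<beta>"
      using E.assoc[OF beta(1) rho(1) h(1)] E.assoc[OF beta(1) rho(1) h(2)] rho E.idr[OF beta(1)] by simp_all
    then have t: "(\<beta>, h1, ?q) \<in> hom (slice ?L G) \<beta> ?q" "(\<beta>, h2, ?q) \<in> hom (slice ?L G) \<beta> ?q"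
      using slice_full_hom[OF beta(1) qh BL q GL] h by blast+
    have "?q \<in> Ob (slice ?L G)" using slice_full_Ob qh q GL by blast
    then have "(\<beta>, h1, ?q) = (\<beta>, h2, ?q)"
      using epi[unfolded epic_def, THEN conjunct2, rule_format, of ?q "(\<beta>, h1, ?q)" "(\<beta>, h2, ?q)"] t eq ce
      by (simp add: e1(2))
    then show "h1 = h2" by simp
  qed
  then obtain z where z: "z \<in> el P0 k" "eap e1 k z = c" by blast
  have zx: "lb P0 k z = x" using eap_lb[OF e1(1) z(1)] z(2) c(2) by simp
  define z' where "z' = res P0 \<tau> z"
  have z': "z' \<in> el P0 k" "lb P0 k z' = x" using res_in[OF P0O tau z(1)] lb_res[OF P0O tau z(1)] zx xtau by (auto simp: z'_def)
  have Pz: "eap P k z = g1" using eap_comp[OF beta(1) e1(1) z(1)] e1(3) z(2) beta(2) by simp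
  have Pz': "eap P k z' = g1" using eap_res[OF Ph tau z(1)] Pz g1tau by (simp add: z'_def)
  \<comment> \<open>In \<open>R\<close> an element over \<open>x\<close> is determined by its label
    and its value in \<open>A\<close>, and \<open>\<tau>\<close> preserves both. Over generators
    each element of the reflection \<open>Q\<close> comes from \<open>R\<close>.\<close>
  have Qtau: "res Q \<tau> w = w" if w: "w \<in> el Q k" "lb Q k w = x" for w
  proof -
    have "\<exists>w0 \<in> el R k. eap (\<eta> R) k w0 = w"
    proof (rule relatively_epic_S_surj[OF _ QL _ w(1)])
      show "\<eta> R \<in> hom E R Q" using eta[OF RO] by (simp add: Q_def)
      show "S k (lb Q k w)" using S w(2) by simp
      show "h1 = h2" if "q \<in> L" "h1 \<in> hom E Q q" "h2 \<in> hom E Q q" "h1 \<cdot>\<^bsub>E\<^esub> \<eta> R = h2 \<cdot>\<^bsub>E\<^esub> \<eta> R" for q h1 h2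
        using a_eq[OF RO that(1)] that(2-) by (simp add: Q_def)
    qed
    then obtain w0 where w0: "w0 \<in> el R k" "eap (\<eta> R) k w0 = w" by blast
    have w0x: "lb R k w0 = x" using eap_lb[OF eta[OF RO] w0(1)] w0(2) w(2) by (simp add: Q_def)
    have w0': "res R \<tau> w0 \<in> el R k" "lb R k (res R \<tau> w0) = x"
      using res_in[OF RO tau w0(1)] lb_res[OF RO tau w0(1)] w0x xtau by auto
    obtain h where h: "h \<in> hom E (Y k x) R" "eap h k (gen k x) = w0" using Y_hom[OF x RO w0(1) w0x] by blast
    obtain h' where h': "h' \<in> hom E (Y k x) R" "eap h' k (gen k x) = res R \<tau> w0" using Y_hom[OF x RO w0'] by blast
    have val: "\<epsilon>1 n (eap g n v) = \<epsilon>1 k w0"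
      if g: "g \<in> hom E (Y k x) R" "eap g k (gen k x) = w0 \<or> eap g k (gen k x) = res R \<tau> w0" and v: "v \<in> el (Y k x) n" for g n v
    proof -
      obtain f where f: "f \<in> hom Delta n k" "v = res (Y k x) f (gen k x)" using Y_surj[OF x v] by blast
      show ?thesis using eap_res[OF g(1) f(1) gen_in[OF x]] e1r[OF f(1) w0(1)] e1r[OF f(1) w0'(1)] e1r[OF tau w0(1)] f(2) g(2) by auto
    qed
    have "\<exists>!h. h \<in> hom E (Y k x) R \<and> (\<forall>n. \<forall>v \<in> el (Y k x) n. \<epsilon>1 n (eap h n v) = \<epsilon>1 k w0)"
      using e1u Yx e1A[OF w0(1)] by simp
    then have "h = h'" using h h' val by blast
    then have "res R \<tau> w0 = w0" using h(2) h'(2) by simp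
    then show ?thesis using eap_res[OF eta[OF RO] tau w0(1)] w0(2) by (simp add: Q_def)
  qed
  \<comment> \<open>\<open>D\<close> is a product, and the images of \<open>z\<close> and
    \<open>z'\<close> have equal components: in \<open>G\<close> by the choice of \<open>g1\<close>,
    in \<open>Q\<close> by \<open>Qtau\<close>. Reflected representables translate this into an
    equality of arrows.\<close>
  have m1z: "eap m1 k z = eap m1 k z'"
  proof -
    define w w' where "w = eap m1 k z" and "w' = eap m1 k z'"
    have w: "w \<in> el D k" "lb D k w = x" and w': "w' \<in> el D k" "lb D k w' = x"
      using eap_in[OF m1(1)] eap_lb[OF m1(1)] z(1) zx z' by (auto simp: w_def w'_def)
    obtain h where h: "h \<in> hom E B D" "eap h k c = w" using hat_ex[OF x DL w] by (auto simp: B_def c_def)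
    obtain h' where h': "h' \<in> hom E B D" "eap h' k c = w'" using hat_ex[OF x DL w'] by (auto simp: B_def c_def)
    have "W \<cdot>\<^bsub>E\<^esub> h = W \<cdot>\<^bsub>E\<^esub> h'"
    proof (rule hat_eq[OF x GL, folded B_def, folded c_def])
      show "W \<cdot>\<^bsub>E\<^esub> h \<in> hom E B G" "W \<cdot>\<^bsub>E\<^esub> h' \<in> hom E B G" using E.comp_in[OF Wh] h h' by auto
      show "eap (W \<cdot>\<^bsub>E\<^esub> h) k c = eap (W \<cdot>\<^bsub>E\<^esub> h') k c"
        using eap_comp[OF Wh h(1) c(1)] eap_comp[OF Wh h'(1) c(1)] h(2) h'(2)
          eap_comp[OF Wh m1(1) z(1)] eap_comp[OF Wh m1(1) z'(1)] m1(3) Pz Pz' by (simp add: w_def w'_def)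
    qed
    moreover have "\<epsilon>2 \<cdot>\<^bsub>E\<^esub> h = \<epsilon>2 \<cdot>\<^bsub>E\<^esub> h'"
    proof (rule hat_eq[OF x QL, folded B_def, folded c_def])
      show "\<epsilon>2 \<cdot>\<^bsub>E\<^esub> h \<in> hom E B Q" "\<epsilon>2 \<cdot>\<^bsub>E\<^esub> h' \<in> hom E B Q" using E.comp_in[OF e2] h h' by auto
      have "w' = res D \<tau> w" using eap_res[OF m1(1) tau z(1)] by (simp add: w_def w'_def z'_def)
      then have "eap \<epsilon>2 k w' = eap \<epsilon>2 k w"
        using eap_res[OF e2 tau w(1)] Qtau[OF eap_in[OF e2 w(1)]] eap_lb[OF e2 w(1)] w(2) by simp
      then show "eap (\<epsilon>2 \<cdot>\<^bsub>E\<^esub> h) k c = eap (\<epsilon>2 \<cdot>\<^bsub>E\<^esub> h') k c"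
        using eap_comp[OF e2 h(1) c(1)] eap_comp[OF e2 h'(1) c(1)] h(2) h'(2) by simp
    qed
    ultimately have "h = h'"
      using e2u[OF BL E.comp_in[OF e2 h(1)] E.comp_in[OF Wh h(1)]] h(1) h'(1) by metis
    then show ?thesis using h(2) h'(2) by (simp add: w_def w'_def)
  qed
  \<comment> \<open>Monicity is known against arrows over \<open>G\<close> only, so \<open>z\<close>
    and \<open>z'\<close> are regarded as arrows from \<open>B\<close>, with the common structure
    map \<open>P \<cdot> h\<close>.\<close>
  have "z = z'"
  proof -
    obtain h where h: "h \<in> hom E B P0" "eap h k c = z" using hat_ex[OF x P0L z(1) zx] by (auto simp: B_def c_def)
    obtain h' where h': "h' \<in> hom E B P0" "eap h' k c = z'" using hat_ex[OF x P0L z'] by (auto simp: B_def c_def)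
    note Ph1 = E.comp_in[OF Ph h(1)] and Ph2 = E.comp_in[OF Ph h'(1)]
    have PP: "P \<cdot>\<^bsub>E\<^esub> h = P \<cdot>\<^bsub>E\<^esub> h'"
      by (rule hat_eq[OF x GL, folded B_def, folded c_def, OF Ph1 Ph2])
        (use eap_comp[OF Ph h(1) c(1)] eap_comp[OF Ph h'(1) c(1)] h(2) h'(2) Pz Pz' in simp)
    have mm1: "m1 \<cdot>\<^bsub>E\<^esub> h = m1 \<cdot>\<^bsub>E\<^esub> h'"
      by (rule hat_eq[OF x DL, folded B_def, folded c_def, OF E.comp_in[OF m1(1) h(1)] E.comp_in[OF m1(1) h'(1)]])
        (use eap_comp[OF m1(1) h(1) c(1)] eap_comp[OF m1(1) h'(1) c(1)] h(2) h'(2) m1z in simp)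
    let ?p = "P \<cdot>\<^bsub>E\<^esub> h"
    have t: "(?p, h, P) \<in> hom (slice ?L G) ?p P" "(?p, h', P) \<in> hom (slice ?L G) ?p P"
      using slice_full_hom[OF Ph1 Ph BL P0L GL] h h' PP by auto
    have "?p \<in> Ob (slice ?L G)" using slice_full_Ob Ph1 BL GL by blast
    then have "(?p, h, P) = (?p, h', P)"
      using mono[unfolded monic_def, THEN conjunct2, rule_format, of ?p "(?p, h, P)" "(?p, h', P)"] t mm1
      by (simp add: m1(2))
    then show ?thesis using h(2) h'(2) by simp
  qed
  then have "c = res B \<tau> c" using eap_res[OF e1(1) tau z(1)] z(2) by (simp add: z'_def)
  then have "eap (\<eta> (Y k x)) k (gen k x) = eap (\<eta> (Y k x)) k (res (Y k x) \<tau> (gen k x))"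
    using eap_res[OF eta[OF Yx] tau gen_in[OF x]] by (simp add: c_def B_def)
  then have "gen k x = res (Y k x) \<tau> (gen k x)"
    using S_eta_inj[OF Yx gen_in[OF x] res_in[OF Yx tau gen_in[OF x]]] lb_res[OF Yx tau gen_in[OF x]] gen_lb[OF x] xtau S
    by simp
  then have "Idt Delta k = \<tau>"
    using Y_inj[OF x Delta_id_in tau] res_id[OF Yx gen_in[OF x]] by simp
  then have "inj_on (ev (s \<cdot>\<^bsub>Delta\<^esub> e)) {..k}" by (auto simp: \<tau>_def[symmetric] inj_on_def)
  then have "inj_on (ev e) {..k}" using inj_comp_right[OF e s(1)] by blast
  then show False using inj_dim[OF e] jk by simp
qed

section \<open>The level of the minimal objects is an etendue\<close>

context simp_over
begin

definition One :: "'u simp_map" where "One = Idt (simp_sets r) X"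

lemma One_Ob: "One \<in> Ob E"
  using category.id_in[OF category_simp X] homD by (fastforce simp: E_Ob One_def simp_simps)

lemma One_el [simp]: "el One k = on_ob X k"
  using homD[OF category.id_in[OF category_simp X]] by (simp add: el_def One_def simp_simps)

lemma One_lb: "x \<in> on_ob X k \<Longrightarrow> lb One k x = x"
  by (simp add: lb_def One_def ap_id)

lemma One_eap: "h \<in> hom E p One \<Longrightarrow> c \<in> el p k \<Longrightarrow> eap h k c = lb p k c"
  using eap_lb[of h p One c k] eap_in[of h p One c k] One_lb by simp

lemma One_eq: "h \<in> hom E p One \<Longrightarrow> h' \<in> hom E p One \<Longrightarrow> h = h'"
  by (rule hom_eqI, assumption+) (metis One_eap)

lemma One_ex:
  assumes p: "p \<in> Ob E"
  shows "\<exists>h. h \<in> hom E p One"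
proof -
  have "\<exists>h \<in> hom E p One. \<forall>k. \<forall>c \<in> el p k. eap h k c = lb p k c"
  proof (rule hom_ex[OF p One_Ob])
    fix k c assume c: "c \<in> el p k"
    then show "lb p k c \<in> el One k" "lb One k (lb p k c) = lb p k c" using lb_in[OF p] One_lb by auto
    fix f m assume f: "f \<in> hom Delta m k"
    have x: "lb p k c \<in> el One k" using lb_in[OF p c] by simp
    have "lb One m (res One f (lb p k c)) = act X f (lb p k c)"
      using lb_res[OF One_Ob f x] One_lb[OF lb_in[OF p c]] by simp
    then show "lb p m (res p f c) = res One f (lb p k c)"
      using One_lb[of "res One f (lb p k c)" m] res_in[OF One_Ob f x] lb_res[OF p f c] by simp
  qed
  then show ?thesis by blast
qed

end

context strongly_regular_over
begin

lemma One_L0: "One \<in> L0"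
  unfolding L0_def
proof (intro CollectI conjI One_Ob ballI allI impI)
  fix p \<phi> assume p: "p \<in> Ob E" and N: "Nat p One \<phi>"
  obtain h where h: "h \<in> hom E p One" using One_ex[OF p] by blast
  have "eap h k b = \<phi> k b" if "b \<in> Sel p k" for k b
    using One_eap[OF h Sel_el[OF that]] Nat_lb[OF N that] One_lb[of "\<phi> k b" k] Nat_Sel[OF N that, THEN Sel_el] by simp
  then show "\<exists>!h. h \<in> hom E p One \<and> (\<forall>k. \<forall>b\<in>Sel p k. eap h k b = \<phi> k b)" using h One_eq by blast
qed

lemma One_terminal: "terminal (full_subcat E L0) One"
  using One_L0 One_ex One_eq L0_Ob by (auto simp: terminal_def hom_full_iff)

text \<open>The witness is the presheaf of injective monotone maps from \<open>[k]\<close> to the natural numbers: its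
  category of elements is a preorder.\<close>

lemma rigid_object:
  assumes lv: "essential_level r X L0 a l \<eta> u"
  obtains G where "G \<in> L0" "\<And>k x. nd k x \<Longrightarrow> \<exists>b \<in> Sel G k. lb G k b = x"
    "\<And>k j f f' v. v \<in> Sel G j \<Longrightarrow> f \<in> hom Delta k j \<Longrightarrow> f' \<in> hom Delta k j \<Longrightarrow>
       res G f v \<in> Sel G k \<Longrightarrow> res G f v = res G f' v \<Longrightarrow> f = f'"
proof -
  interpret essential_level r X L0 a l \<eta> u by (rule lv)
  \<comment> \<open>Injectivity is required only after restriction to nondegenerate simplices, so
    degeneracies act as well; a function on the vertices of a degenerate simplex need not be
    injective.\<close>
  define B :: "nat \<Rightarrow> ('u \<times> (nat \<Rightarrow> nat)) set" where
    "B k = {b. fst b \<in> on_ob X k \<and> snd b \<in> {..k} \<rightarrow>\<^sub>E UNIV \<and> mono_on {..k} (snd b) \<and>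
      (\<forall>m. \<forall>f \<in> hom Delta m k. nd m (act X f (fst b)) \<longrightarrow> inj_on (\<lambda>i. snd b (ev f i)) {..m})}" for k
  define ac where "ac f b = (act X f (fst b), restrict (\<lambda>i. snd b (ev f i)) {..Dom Delta f})"
    for f and b :: "'u \<times> (nat \<Rightarrow> nat)"
  have BD: "fst b \<in> on_ob X k" "snd b \<in> {..k} \<rightarrow>\<^sub>E UNIV" "mono_on {..k} (snd b)" if "b \<in> B k" for b k
    using that by (auto simp: B_def)
  have BI: "inj_on (\<lambda>i. snd b (ev f i)) {..m}" if "b \<in> B k" "f \<in> hom Delta m k" "nd m (act X f (fst b))" for b k f m
    using that unfolding B_def by blast
  have acv: "snd (ac f b) i = snd b (ev f i)" if "f \<in> hom Delta m k" "i \<le> m" for f m k b i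
    using that homD[OF that(1)] by (simp add: ac_def)
  have "\<exists>p e. presents B ac (\<lambda>k. fst) e p"
  proof (rule presents_ex)
    show "|B k| <o r" for k
    proof (rule small_subset)
      show "B k \<subseteq> on_ob X k \<times> ({..k} \<rightarrow>\<^sub>E UNIV)" by (auto simp: B_def)
      show "|on_ob X k \<times> ({..k} \<rightarrow>\<^sub>E (UNIV :: nat set))| <o r"
        by (intro small_Sigma simp_card[OF X] small_PiE small_nat) simp
    qed
  next
    fix f m k b assume f: "f \<in> hom Delta m k" and b: "b \<in> B k"
    have "inj_on (\<lambda>i. snd (ac f b) (ev g i)) {..n}" if g: "g \<in> hom Delta n m" and n: "nd n (act X g (fst (ac f b)))" for n g
    proof -
      have "nd n (act X (f \<cdot>\<^bsub>Delta\<^esub> g) (fst b))" using n act_comp[OF X f g BD(1)[OF b]] by (simp add: ac_def)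
      from BI[OF b Delta_comp_in[OF f g] this] show ?thesis
        using ev_comp[OF f g] acv[OF f ev_le[OF g]] by (simp add: inj_on_def)
    qed
    moreover have "mono_on {..m} (snd (ac f b))"
      unfolding mono_on_def
    proof (intro allI impI)
      fix i i' assume i: "i \<in> {..m} \<and> i' \<in> {..m} \<and> i \<le> i'"
      then have "ev f i \<le> ev f i'" "ev f i' \<le> k" using ev_mono[OF f] ev_le[OF f] by auto
      then show "snd (ac f b) i \<le> snd (ac f b) i'"
        using i acv[OF f] BD(3)[OF b] by (simp add: mono_on_def)
    qed
    moreover have "fst (ac f b) \<in> on_ob X m" using act_in[OF X f BD(1)[OF b]] by (simp add: ac_def)
    moreover have "snd (ac f b) \<in> {..m} \<rightarrow>\<^sub>E UNIV" using homD[OF f] by (simp add: ac_def)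
    ultimately show "ac f b \<in> B m" unfolding B_def by blast
    show "fst (ac f b) = act X f (fst b)" by (simp add: ac_def)
  next
    fix k b assume b: "b \<in> B k"
    have "restrict (\<lambda>i. snd b (ev (Idt Delta k) i)) {..k} = snd b"
      using BD(2)[OF b] by (auto simp: fun_eq_iff PiE_def extensional_def)
    then show "ac (Idt Delta k) b = b"
      using act_id[OF X BD(1)[OF b]] homD[OF Delta_id_in[of k]] by (simp add: ac_def prod_eq_iff)
    show "fst b \<in> on_ob X k" using BD(1)[OF b] .
  next
    fix f g m k j b assume f: "f \<in> hom Delta m k" and g: "g \<in> hom Delta j m" and b: "b \<in> B k"
    have "restrict (\<lambda>i. snd (ac f b) (ev g i)) {..j} = restrict (\<lambda>i. snd b (ev (f \<cdot>\<^bsub>Delta\<^esub> g) i)) {..j}"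
      using ev_comp[OF f g] acv[OF f ev_le[OF g]] by (auto simp: fun_eq_iff)
    then show "ac g (ac f b) = ac (f \<cdot>\<^bsub>Delta\<^esub> g) b"
      using act_comp[OF X f g BD(1)[OF b]] homD[OF g] homD[OF Delta_comp_in[OF f g]]
      unfolding ac_def[of g] ac_def[of "f \<cdot>\<^bsub>Delta\<^esub> g"] by (simp add: ac_def)
  qed
  then obtain G0 e where P: "presents B ac (\<lambda>k. fst) e G0" by blast
  note G0 = presents_Ob[OF P]
  have sb: "Sbij (\<eta> G0) G0 (on_ob a G0)" by (rule unit_Sbij[OF G0 aL[OF G0] eta[OF G0] a_univ[OF G0]])
  note e0 = eta[OF G0]
  show thesis
  proof (rule that)
    show "on_ob a G0 \<in> L0" using aL[OF G0] .
  next
    fix k x assume n: "nd k x"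
    \<comment> \<open>The inclusion of the vertices into the natural numbers gives an element over
      each nondegenerate simplex, which is the support that \<open>G\<close> needs.\<close>
    have b: "(x, restrict id {..k}) \<in> B k"
    proof -
      have "inj_on (\<lambda>i. restrict id {..k} (ev f i)) {..m}" if f: "f \<in> hom Delta m k" "nd m (act X f x)" for f m
        using nd_inj[OF f(2) nd_in[OF n] f(1)] ev_le[OF f(1)] by (simp add: inj_on_def)
      then show ?thesis using nd_in[OF n] by (simp add: B_def mono_on_def)
    qed
    have "e k (x, restrict id {..k}) \<in> Sel G0 k"
      using presents_in[OF P b] presents_lb[OF P b] n by (simp add: Sel_def)
    then show "\<exists>b\<in>Sel (on_ob a G0) k. lb (on_ob a G0) k b = x"
      using Sel_eap[OF e0] eap_lb[OF e0 presents_in[OF P b]] presents_lb[OF P b]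
      by (intro bexI[of _ "eap (\<eta> G0) k (e k (x, restrict id {..k}))"]) simp_all
  next
    fix k j f f' v assume v: "v \<in> Sel (on_ob a G0) j" and f: "f \<in> hom Delta k j" and f': "f' \<in> hom Delta k j"
      and S: "res (on_ob a G0) f v \<in> Sel (on_ob a G0) k" and eq: "res (on_ob a G0) f v = res (on_ob a G0) f' v"
    obtain z where z: "z \<in> Sel G0 j" "v = eap (\<eta> G0) j z" using Sbij_surj[OF sb v] by blast
    obtain b where b: "b \<in> B j" "z = e j b" using presents_surj[OF P Sel_el[OF z(1)]] by blast
    have r: "eap (\<eta> G0) k (res G0 g z) = res (on_ob a G0) g v" if "g \<in> hom Delta k j" for g
      using eap_res[OF e0 that Sel_el[OF z(1)]] z(2) by simp
    have "res G0 f z \<in> Sel G0 k" "res G0 f' z \<in> Sel G0 k"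
      using Sel_eapD[OF e0 res_in[OF G0 f Sel_el[OF z(1)]]] Sel_eapD[OF e0 res_in[OF G0 f' Sel_el[OF z(1)]]]
        r[OF f] r[OF f'] S eq by simp_all
    then have "res G0 f z = res G0 f' z" using Sbij_inj[OF sb] r[OF f] r[OF f'] eq by simp
    then have "ac f b = ac f' b"
      using presents_res[OF P b(1) f] presents_res[OF P b(1) f'] b(2)
        presents_inj[OF P presents_ac[OF P b(1) f] presents_ac[OF P b(1) f']] by simp
    then have ge: "snd b (ev f i) = snd b (ev f' i)" if "i \<le> k" for i using acv[OF f that, of b] acv[OF f' that, of b] by simp
    have "nd j (fst b)" using z(1) presents_lb[OF P b(1)] b(2) by (simp add: Sel_def)
    then have "inj_on (\<lambda>i. snd b (ev (Idt Delta j) i)) {..j}"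
      using BI[OF b(1) Delta_id_in] act_id[OF X BD(1)[OF b(1)]] by simp
    then have "ev f i = ev f' i" if "i \<le> k" for i
      using inj_onD[of "\<lambda>i. snd b (ev (Idt Delta j) i)" "{..j}" "ev f i" "ev f' i"] ge[OF that] ev_le[OF f that] ev_le[OF f' that] by simp
    then show "f = f'" by (rule Delta_eqI[OF f f'])
  qed
qed

text \<open>Given \<open>b\<close> over \<open>G\<close>, each nondegenerate element of
  \<open>B\<close> contributes a copy of the part of \<open>G\<close> generated by its image.
  Rigidity gives every copy an arrow to \<open>B\<close> that hits the element, and remembering the
  index embeds the whole in the product of \<open>G\<close> with a constant object.\<close>

lemma L0_etendue: "etendue (full_subcat E L0) (set_cat r) (comp_func (inverse_image E L0) const_E)"
proof -
  let ?L = "full_subcat E L0"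
  define a where "a = inverse_image E L0"
  obtain l \<eta> u where lv: "essential_level r X L0 a l \<eta> u" using level_essential_level(1)[OF L0_level] by (auto simp: a_def)
  have adj: "adjoint E ?L a inclusion" using L0_inverse_image by (simp add: a_def)
  interpret essential_level r X L0 a l \<eta> u by (rule lv)
  have sb: "Sbij (\<eta> p) p (on_ob a p)" if "p \<in> Ob E" for p
    by (rule unit_Sbij[OF that aL[OF that] eta[OF that] a_univ[OF that]])
  obtain G where G: "G \<in> L0" and Gs: "\<And>k x. nd k x \<Longrightarrow> \<exists>b \<in> Sel G k. lb G k b = x"
    and rigid: "\<And>k j f f' v. v \<in> Sel G j \<Longrightarrow> f \<in> hom Delta k j \<Longrightarrow> f' \<in> hom Delta k j \<Longrightarrow>
       res G f v \<in> Sel G k \<Longrightarrow> res G f v = res G f' v \<Longrightarrow> f = f'"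
    by (rule rigid_object[OF lv]) (rule that)
  have GO: "G \<in> Ob E" using L0_Ob[OF G] .
  have "well_supported ?L G"
  proof -
    obtain e where e: "e \<in> hom E G One" using One_ex[OF GO] by blast
    have eL: "e \<in> Arr ?L" "Dom ?L e = G" "Cod ?L e = One" using e G One_L0 by (auto simp: hom_def full_subcat_def)
    have "epic ?L e"
      unfolding epic_def
    proof (intro conjI ballI impI eL(1))
      fix q h1 h2 assume "q \<in> Ob ?L" and h: "h1 \<in> hom ?L (Cod ?L e) q" "h2 \<in> hom ?L (Cod ?L e) q"
        and eq: "h1 \<cdot>\<^bsub>?L\<^esub> e = h2 \<cdot>\<^bsub>?L\<^esub> e"
      then have q: "q \<in> L0" and h: "h1 \<in> hom E One q" "h2 \<in> hom E One q" and eq: "h1 \<cdot>\<^bsub>E\<^esub> e = h2 \<cdot>\<^bsub>E\<^esub> e"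
        using eL(3) by (auto simp: hom_full_iff)
      show "h1 = h2"
      proof (rule L0_eq[OF q h])
        fix k x assume "x \<in> Sel One k"
        then have x: "nd k x" using One_lb by (auto simp: Sel_def)
        then obtain b where b: "b \<in> Sel G k" "lb G k b = x" using Gs by blast
        have "eap e k b = x" using One_eap[OF e Sel_el[OF b(1)]] b(2) by simp
        then show "eap h1 k x = eap h2 k x"
          using eap_comp[OF h(1) e Sel_el[OF b(1)]] eap_comp[OF h(2) e Sel_el[OF b(1)]] eq by simp
      qed
    qed
    then show ?thesis using G eL One_terminal by (auto simp: well_supported_def)
  qed
  moreover have "localic (slice ?L G) (set_cat r) (comp_func (base_change ?L G) (comp_func a const_E))"
    unfolding localic_def
  proof
    fix b assume "b \<in> Ob (slice ?L G)"
    then obtain B where BL: "B \<in> L0" and b: "b \<in> hom E B G" using slice_full_Ob by blast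
    have BO: "B \<in> Ob E" using L0_Ob[OF BL] .
    define Z where "Z = (SIGMA j : (UNIV :: nat set). Sel B j)"
    have Zs: "|Z| <o r"
      unfolding Z_def by (intro small_Sigma small_nat) (rule small_subset[OF _ el_card[OF BO]], auto simp: Sel_def)
    obtain enc :: "nat \<times> 'u \<Rightarrow> 'u" where enc: "inj_on enc Z" using card_inj[OF Zs] by blast
    define A where "A = enc ` Z"
    have As: "|A| <o r" unfolding A_def by (rule small_image[OF Zs])
    have ZD: "snd t \<in> Sel B (fst t)" if "t \<in> Z" for t using that by (auto simp: Z_def)
    define bz where "bz t = eap b (fst t) (snd t)" for t
    have bz: "bz t \<in> Sel G (fst t)" if "t \<in> Z" for t using Sel_eap[OF b ZD[OF that]] by (simp add: bz_def)
    \<comment> \<open>An index paired with an element of \<open>G\<close>. Recording the element of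
      \<open>G\<close> rather than the operator makes the embedding into the product immediate; the
      operator is recovered by rigidity over nondegenerate simplices.\<close>
    define D where "D k = {t. fst t \<in> Z \<and> (\<exists>f \<in> hom Delta k (fst (fst t)). snd t = res G f (bz (fst t)))}" for k
    define ac where "ac f t = (fst t, res G f (snd t))" for f and t :: "(nat \<times> 'u) \<times> 'u"
    have Del: "snd t \<in> el G k" if tD: "t \<in> D k" for t k
    proof -
      obtain f where f: "f \<in> hom Delta k (fst (fst t))" "snd t = res G f (bz (fst t))" and z: "fst t \<in> Z"
        using tD unfolding D_def by blast
      show ?thesis using res_in[OF GO f(1) Sel_el[OF bz[OF z]]] f(2) by simp
    qed
    have "\<exists>p e. presents D ac (\<lambda>k t. lb G k (snd t)) e p"
    proof (rule presents_ex)
      show "|D k| <o r" for k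
      proof (rule small_subset)
        show "D k \<subseteq> Z \<times> el G k"
        proof
          fix t assume t: "t \<in> D k"
          then have "fst t \<in> Z" by (simp add: D_def)
          then show "t \<in> Z \<times> el G k" using Del[OF t] by (simp add: mem_Times_iff)
        qed
        show "|Z \<times> el G k| <o r" by (intro small_Sigma Zs el_card[OF GO])
      qed
    next
      fix f m k t assume f: "f \<in> hom Delta m k" and t: "t \<in> D k"
      then obtain g where g: "g \<in> hom Delta k (fst (fst t))" "snd t = res G g (bz (fst t))" "fst t \<in> Z" by (auto simp: D_def)
      have "res G f (snd t) = res G (g \<cdot>\<^bsub>Delta\<^esub> f) (bz (fst t))" using res_comp[OF GO g(1) f Sel_el[OF bz[OF g(3)]]] g(2) by simp
      then show "ac f t \<in> D m" using g(3) Delta_comp_in[OF g(1) f] by (auto simp: D_def ac_def)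
      show "lb G m (snd (ac f t)) = act X f (lb G k (snd t))" using lb_res[OF GO f Del[OF t]] by (simp add: ac_def)
    next
      fix k t assume t: "t \<in> D k"
      show "ac (Idt Delta k) t = t" using res_id[OF GO Del[OF t]] by (simp add: ac_def)
      show "lb G k (snd t) \<in> on_ob X k" using lb_in[OF GO Del[OF t]] .
    next
      fix f g m k j t assume "f \<in> hom Delta m k" "g \<in> hom Delta j m" "t \<in> D k"
      then show "ac g (ac f t) = ac (f \<cdot>\<^bsub>Delta\<^esub> g) t" using res_comp[OF GO _ _ Del] by (simp add: ac_def)
    qed
    then obtain P0 e where P: "presents D ac (\<lambda>k t. lb G k (snd t)) e P0" by blast
    note P0 = presents_Ob[OF P]
    define un where "un k c = the_inv_into (D k) (e k) c" for k c
    have inj: "inj_on (e k) (D k)" for k using presents_inj[OF P] by (auto simp: inj_on_def)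
    have un: "un k (e k t) = t" if "t \<in> D k" for k t using the_inv_into_f_f[OF inj that] by (simp add: un_def)
    have unD: "un k c \<in> D k \<and> e k (un k c) = c" if "c \<in> el P0 k" for k c
      using presents_surj[OF P that] un by auto
    have unac: "un m (res P0 f c) = ac f (un k c)" if "c \<in> el P0 k" "f \<in> hom Delta m k" for m k f c
      using presents_res[OF P _ that(2), of "un k c"] unD[OF that(1)] un[OF presents_ac[OF P _ that(2), of "un k c"]] by simp
    define p where "p = on_ob a P0"
    have pL: "p \<in> L0" and pO: "p \<in> Ob E" using aL[OF P0] L0_Ob by (auto simp: p_def)
    define \<pi> where "\<pi> = \<eta> P0"
    have pi: "\<pi> \<in> hom E P0 p" and pS: "Sbij \<pi> P0 p" using eta[OF P0] sb[OF P0] by (auto simp: \<pi>_def p_def)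
    have pu: "\<exists>g. g \<in> hom E p q \<and> g \<cdot>\<^bsub>E\<^esub> \<pi> = f" if "q \<in> L0" "f \<in> hom E P0 q" for q f
      using a_univ[OF P0 that] unfolding p_def \<pi>_def by blast
    have "\<exists>h \<in> hom E P0 G. \<forall>k. \<forall>t \<in> D k. eap h k (e k t) = snd t"
      by (rule presents_hom[OF P GO]) (use Del in \<open>simp_all add: ac_def\<close>)
    then obtain g0 where g0: "g0 \<in> hom E P0 G" "\<And>k t. t \<in> D k \<Longrightarrow> eap g0 k (e k t) = snd t" by blast
    obtain pG where pG: "pG \<in> hom E p G" "pG \<cdot>\<^bsub>E\<^esub> \<pi> = g0" using pu[OF G g0(1)] by blast
    \<comment> \<open>By rigidity the map \<open>F k t\<close> witnessing membership in \<open>D k\<close> is unique on nondegenerate elements.\<close>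
    define F where "F k t = (SOME f. f \<in> hom Delta k (fst (fst t)) \<and> snd t = res G f (bz (fst t)))" for k t
    have F: "F k t \<in> hom Delta k (fst (fst t)) \<and> snd t = res G (F k t) (bz (fst t))" if "t \<in> D k" for k t
      unfolding F_def by (rule someI_ex) (use that in \<open>auto simp: D_def\<close>)
    have Fu: "F k t = f"
      if "t \<in> D k" "snd t \<in> Sel G k" "f \<in> hom Delta k (fst (fst t))" "snd t = res G f (bz (fst t))" for k t f
    proof -
      have z: "fst t \<in> Z" using that(1) by (simp add: D_def)
      show ?thesis using rigid[OF bz[OF z] _ that(3)] F[OF that(1)] that(2,4) by metis
    qed
    have SelD: "snd (un k c) \<in> Sel G k" if "c \<in> Sel P0 k" for k c
      using unD[OF Sel_el[OF that]] Del presents_lb[OF P] that by (metis (mono_tags, lifting) Sel_def mem_Collect_eq)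
    define \<phi> where "\<phi> k c = res B (F k (un k c)) (snd (fst (un k c)))" for k c
    have ZB: "snd (fst t) \<in> el B (fst (fst t))" if "t \<in> D k" for k t
      using that ZD[of "fst t"] Sel_el by (simp add: D_def)
    have N: "Nat P0 B \<phi>"
      unfolding Nat_def
    proof (intro conjI allI ballI impI)
      fix k c assume c: "c \<in> Sel P0 k"
      have t: "un k c \<in> D k" "e k (un k c) = c" using unD[OF Sel_el[OF c]] by auto
      note f = F[OF t(1)]
      show "\<phi> k c \<in> el B k" using res_in[OF BO _ ZB[OF t(1)]] f by (simp add: \<phi>_def)
      have "lb P0 k c = lb G k (res G (F k (un k c)) (bz (fst (un k c))))" using presents_lb[OF P t(1)] t(2) f by simp
      also have "\<dots> = act X (F k (un k c)) (lb B (fst (fst (un k c))) (snd (fst (un k c))))"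
        using lb_res[OF GO _ Sel_el[OF bz]] f t(1) eap_lb[OF b ZB[OF t(1)]] by (simp add: D_def bz_def)
      finally show "lb B k (\<phi> k c) = lb P0 k c" using lb_res[OF BO _ ZB[OF t(1)]] f by (simp add: \<phi>_def)
    next
      fix k m f c assume c: "c \<in> Sel P0 k" and f: "f \<in> hom Delta m k" "inj_on (ev f) {..m}"
      have t: "un k c \<in> D k" using unD[OF Sel_el[OF c]] by auto
      have c': "res P0 f c \<in> Sel P0 m" using Sel_res[OF P0 c f] .
      have t': "un m (res P0 f c) \<in> D m" using unD[OF Sel_el[OF c']] by auto
      have u: "un m (res P0 f c) = ac f (un k c)" using unac[OF Sel_el[OF c] f(1)] .
      have z: "fst (un k c) \<in> Z" using t by (simp add: D_def)
      note Fk = F[OF t]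
      have "F m (un m (res P0 f c)) = F k (un k c) \<cdot>\<^bsub>Delta\<^esub> f"
      proof (rule Fu[OF t' SelD[OF c']])
        show "F k (un k c) \<cdot>\<^bsub>Delta\<^esub> f \<in> hom Delta m (fst (fst (un m (res P0 f c))))"
          using Delta_comp_in[OF conjunct1[OF Fk] f(1)] by (simp add: u ac_def)
        show "snd (un m (res P0 f c)) = res G (F k (un k c) \<cdot>\<^bsub>Delta\<^esub> f) (bz (fst (un m (res P0 f c))))"
          using res_comp[OF GO _ f(1) Sel_el[OF bz[OF z]], of "F k (un k c)"] Fk by (simp add: u ac_def)
      qed
      then show "\<phi> m (res P0 f c) = res B f (\<phi> k c)"
        using res_comp[OF BO _ f(1) ZB[OF t], of "F k (un k c)"] Fk by (simp add: \<phi>_def u ac_def)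
    qed
    obtain e0 where e0: "e0 \<in> hom E P0 B" "\<And>k c. c \<in> Sel P0 k \<Longrightarrow> eap e0 k c = \<phi> k c"
      using L0_ext[OF BL P0 N] by blast
    obtain e1 where e1: "e1 \<in> hom E p B" "e1 \<cdot>\<^bsub>E\<^esub> \<pi> = e0" using pu[OF BL e0(1)] by blast
    have be1: "b \<cdot>\<^bsub>E\<^esub> e1 = pG"
    proof -
      have "b \<cdot>\<^bsub>E\<^esub> e0 = g0"
      proof (rule L0_eq[OF G E.comp_in[OF b e0(1)] g0(1)])
        fix k c assume c: "c \<in> Sel P0 k"
        have t: "un k c \<in> D k" "e k (un k c) = c" using unD[OF Sel_el[OF c]] by auto
        have "eap b k (\<phi> k c) = snd (un k c)"
          using eap_res[OF b _ ZB[OF t(1)], of "F k (un k c)"] F[OF t(1)] by (simp add: \<phi>_def bz_def)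
        then show "eap (b \<cdot>\<^bsub>E\<^esub> e0) k c = eap g0 k c"
          using eap_comp[OF b e0(1) Sel_el[OF c]] e0(2)[OF c] g0(2)[OF t(1)] t(2) by simp
      qed
      then have "(b \<cdot>\<^bsub>E\<^esub> e1) \<cdot>\<^bsub>E\<^esub> \<pi> = pG \<cdot>\<^bsub>E\<^esub> \<pi>" using E.assoc[OF b e1(1) pi] e1(2) pG(2) by simp
      then show ?thesis using a_eq[OF P0 G] E.comp_in[OF b e1(1)] pG(1) unfolding p_def \<pi>_def by blast
    qed
    \<comment> \<open>\<open>z\<close> is reached from its own copy by the identity
      operator.\<close>
    have e1s: "\<exists>c \<in> Sel p j. eap e1 j c = z" if z: "z \<in> Sel B j" for j z
    proof -
      define t where "t = ((j, z), eap b j z)"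
      have zZ: "(j, z) \<in> Z" using z by (simp add: Z_def)
      have w: "eap b j z \<in> Sel G j" using Sel_eap[OF b z] .
      have idj: "eap b j z = res G (Idt Delta j) (bz (j, z))" using res_id[OF GO Sel_el[OF w]] by (simp add: bz_def)
      have t: "t \<in> D j" using zZ idj Delta_id_in[of j] by (auto simp: D_def t_def)
      have c: "e j t \<in> Sel P0 j"
        using presents_in[OF P t] presents_lb[OF P t] w by (simp add: Sel_def t_def)
      have "F j t = Idt Delta j" by (rule Fu[OF t]) (use w idj Delta_id_in in \<open>simp_all add: t_def\<close>)
      then have "eap e0 j (e j t) = z"
        using e0(2)[OF c] un[OF t] res_id[OF BO Sel_el[OF z]] by (simp add: \<phi>_def t_def)
      then have "eap e1 j (eap \<pi> j (e j t)) = z" using eap_comp[OF e1(1) pi Sel_el[OF c]] e1(2) by simp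
      then show ?thesis using Sel_eap[OF pi c] by blast
    qed
    obtain R \<epsilon>1 where R: "on_ob const_E A = R" and RO: "R \<in> Ob E"
      and e1A: "\<And>k c. c \<in> el R k \<Longrightarrow> \<epsilon>1 k c \<in> A"
      and e1r: "\<And>f m k c. f \<in> hom Delta m k \<Longrightarrow> c \<in> el R k \<Longrightarrow> \<epsilon>1 m (res R f c) = \<epsilon>1 k c"
      and e1u: "\<forall>s \<in> Ob E. \<forall>g. (\<forall>k. \<forall>c \<in> el s k. g k c \<in> A) \<longrightarrow>
       (\<forall>m k. \<forall>f \<in> hom Delta m k. \<forall>c \<in> el s k. g m (res s f c) = g k c) \<longrightarrow>
       (\<exists>!h. h \<in> hom E s R \<and> (\<forall>k. \<forall>c \<in> el s k. \<epsilon>1 k (eap h k c) = g k c))"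
      by (rule const_E_universal[OF As]) (rule that)
    define Q where "Q = on_ob a R"
    have QL: "Q \<in> L0" using aL[OF RO] by (simp add: Q_def)
    obtain W0 W \<epsilon>2 where W: "on_ob (base_change ?L G) Q = W" and W0L: "W0 \<in> L0" and Wh: "W \<in> hom E W0 G"
      and e2: "\<epsilon>2 \<in> hom E W0 Q"
      and e2u: "\<And>s f g. s \<in> L0 \<Longrightarrow> f \<in> hom E s Q \<Longrightarrow> g \<in> hom E s G \<Longrightarrow>
         \<exists>!h. h \<in> hom E s W0 \<and> W \<cdot>\<^bsub>E\<^esub> h = g \<and> \<epsilon>2 \<cdot>\<^bsub>E\<^esub> h = f"
      by (rule base_change_universal[OF LE adj G QL]) (rule that)
    have iA: "on_ob (comp_func (base_change ?L G) (comp_func a const_E)) A = W"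
      by (simp add: comp_func_def R Q_def[symmetric] W)
    \<comment> \<open>The index does not change under restriction, so it is an arrow to the constant
      object.\<close>
    have "\<exists>h. h \<in> hom E P0 R \<and> (\<forall>k. \<forall>c \<in> el P0 k. \<epsilon>1 k (eap h k c) = enc (fst (un k c)))"
    proof -
      have "enc (fst (un k c)) \<in> A" if "c \<in> el P0 k" for k c using unD[OF that] by (simp add: D_def A_def)
      moreover have "enc (fst (un m (res P0 f c))) = enc (fst (un k c))" if "f \<in> hom Delta m k" "c \<in> el P0 k" for f m k c
        using unac[OF that(2,1)] by (simp add: ac_def)
      ultimately show ?thesis using e1u[rule_format, OF P0, of "\<lambda>k c. enc (fst (un k c))"] by blast
    qed
    then obtain r0 where r0: "r0 \<in> hom E P0 R" "\<And>k c. c \<in> el P0 k \<Longrightarrow> \<epsilon>1 k (eap r0 k c) = enc (fst (un k c))" by blast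
    have eR: "\<eta> R \<in> hom E R Q" using eta[OF RO] by (simp add: Q_def)
    obtain m1 where m1: "m1 \<in> hom E p Q" "m1 \<cdot>\<^bsub>E\<^esub> \<pi> = \<eta> R \<cdot>\<^bsub>E\<^esub> r0" using pu[OF QL E.comp_in[OF eR r0(1)]] by blast
    obtain h where h: "h \<in> hom E p W0" "W \<cdot>\<^bsub>E\<^esub> h = pG" "\<epsilon>2 \<cdot>\<^bsub>E\<^esub> h = m1" using e2u[OF pL m1(1) pG(1)] by blast
    define mm where "mm = (pG, h, W)"
    define ee where "ee = (pG, e1, b)"
    have mmh: "mm \<in> hom (slice ?L G) pG W" using slice_full_hom[OF pG(1) Wh pL W0L G] h by (auto simp: mm_def)
    have eeh: "ee \<in> hom (slice ?L G) pG b" using slice_full_hom[OF pG(1) b pL BL G] e1 be1 by (auto simp: ee_def)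
    \<comment> \<open>The component in \<open>G\<close> gives the element and the component in the
      constant object the index. Injectivity on nondegenerate elements is all that monicity into an
      object of \<open>L0\<close> calls for.\<close>
    have key: "s1 = s2" if s: "s1 \<in> Sel p k" "s2 \<in> Sel p k" and eq: "eap h k s1 = eap h k s2" for k s1 s2
    proof -
      obtain c1 where c1: "c1 \<in> Sel P0 k" "s1 = eap \<pi> k c1" using Sbij_surj[OF pS s(1)] by blast
      obtain c2 where c2: "c2 \<in> Sel P0 k" "s2 = eap \<pi> k c2" using Sbij_surj[OF pS s(2)] by blast
      have "eap pG k s1 = eap pG k s2" "eap m1 k s1 = eap m1 k s2"
        using eap_comp[OF Wh h(1) Sel_el] eap_comp[OF e2 h(1) Sel_el] h(2,3) s eq by metis+
      then have g: "eap g0 k c1 = eap g0 k c2" and q: "eap (\<eta> R) k (eap r0 k c1) = eap (\<eta> R) k (eap r0 k c2)"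
        using eap_comp[OF pG(1) pi Sel_el[OF c1(1)]] eap_comp[OF pG(1) pi Sel_el[OF c2(1)]] pG(2)
          eap_comp[OF m1(1) pi Sel_el[OF c1(1)]] eap_comp[OF m1(1) pi Sel_el[OF c2(1)]] m1(2)
          eap_comp[OF eR r0(1) Sel_el[OF c1(1)]] eap_comp[OF eR r0(1) Sel_el[OF c2(1)]] c1(2) c2(2) by simp_all
      have t1: "un k c1 \<in> D k" "e k (un k c1) = c1" using unD[OF Sel_el[OF c1(1)]] by auto
      have t2: "un k c2 \<in> D k" "e k (un k c2) = c2" using unD[OF Sel_el[OF c2(1)]] by auto
      have "snd (un k c1) = snd (un k c2)" using g g0(2)[OF t1(1)] g0(2)[OF t2(1)] t1(2) t2(2) by simp
      moreover have "eap r0 k c1 = eap r0 k c2"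
        using Sbij_inj[OF sb[OF RO] Sel_eap[OF r0(1) c1(1)] Sel_eap[OF r0(1) c2(1)] q] .
      then have "enc (fst (un k c1)) = enc (fst (un k c2))"
        using r0(2)[OF Sel_el[OF c1(1)]] r0(2)[OF Sel_el[OF c2(1)]] by simp
      then have "fst (un k c1) = fst (un k c2)" using inj_onD[OF enc] t1(1) t2(1) by (simp add: D_def)
      ultimately have "un k c1 = un k c2" by (simp add: prod_eq_iff)
      then show ?thesis using t1(2) t2(2) c1(2) c2(2) by metis
    qed
    have "monic (slice ?L G) mm"
      unfolding monic_def
    proof (intro conjI ballI impI)
      show "mm \<in> Arr (slice ?L G)" using homD[OF mmh] by simp
      fix s t1 t2 assume s: "s \<in> Ob (slice ?L G)" and t: "t1 \<in> hom (slice ?L G) s (Dom (slice ?L G) mm)"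
        "t2 \<in> hom (slice ?L G) s (Dom (slice ?L G) mm)" "mm \<cdot>\<^bsub>slice ?L G\<^esub> t1 = mm \<cdot>\<^bsub>slice ?L G\<^esub> t2"
      obtain S0 where S0: "S0 \<in> L0" "s \<in> hom E S0 G" using s slice_full_Ob by blast
      obtain u1 where u1: "u1 \<in> hom E S0 p" "t1 = (s, u1, pG)"
        using t(1) slice_full_hom[OF S0(2) pG(1) S0(1) pL G] by (auto simp: mm_def)
      obtain u2 where u2: "u2 \<in> hom E S0 p" "t2 = (s, u2, pG)"
        using t(2) slice_full_hom[OF S0(2) pG(1) S0(1) pL G] by (auto simp: mm_def)
      have hu: "h \<cdot>\<^bsub>E\<^esub> u1 = h \<cdot>\<^bsub>E\<^esub> u2" using t(3) by (simp add: u1(2) u2(2) mm_def)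
      have "u1 = u2"
      proof (rule L0_eq[OF pL u1(1) u2(1)])
        fix k c assume c: "c \<in> Sel S0 k"
        have "eap h k (eap u1 k c) = eap h k (eap u2 k c)"
          using eap_comp[OF h(1) u1(1) Sel_el[OF c]] eap_comp[OF h(1) u2(1) Sel_el[OF c]] hu by simp
        then show "eap u1 k c = eap u2 k c" using key Sel_eap[OF u1(1) c] Sel_eap[OF u2(1) c] by blast
      qed
      then show "t1 = t2" using u1 u2 by simp
    qed
    moreover have "epic (slice ?L G) ee"
      unfolding epic_def
    proof (intro conjI ballI impI)
      show "ee \<in> Arr (slice ?L G)" using homD[OF eeh] by simp
      fix s t1 t2 assume s: "s \<in> Ob (slice ?L G)" and t: "t1 \<in> hom (slice ?L G) (Cod (slice ?L G) ee) s"
        "t2 \<in> hom (slice ?L G) (Cod (slice ?L G) ee) s" "t1 \<cdot>\<^bsub>slice ?L G\<^esub> ee = t2 \<cdot>\<^bsub>slice ?L G\<^esub> ee"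
      obtain S0 where S0: "S0 \<in> L0" "s \<in> hom E S0 G" using s slice_full_Ob by blast
      obtain u1 where u1: "u1 \<in> hom E B S0" "t1 = (b, u1, s)"
        using t(1) slice_full_hom[OF b S0(2) BL S0(1) G] by (auto simp: ee_def)
      obtain u2 where u2: "u2 \<in> hom E B S0" "t2 = (b, u2, s)"
        using t(2) slice_full_hom[OF b S0(2) BL S0(1) G] by (auto simp: ee_def)
      have ue: "u1 \<cdot>\<^bsub>E\<^esub> e1 = u2 \<cdot>\<^bsub>E\<^esub> e1" using t(3) by (simp add: u1(2) u2(2) ee_def)
      have "u1 = u2"
      proof (rule L0_eq[OF S0(1) u1(1) u2(1)])
        fix k z assume "z \<in> Sel B k"
        then obtain c where c: "c \<in> Sel p k" "eap e1 k c = z" using e1s by blast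
        show "eap u1 k z = eap u2 k z"
          using eap_comp[OF u1(1) e1(1) Sel_el[OF c(1)]] eap_comp[OF u2(1) e1(1) Sel_el[OF c(1)]] ue c(2) by simp
      qed
      then show "t1 = t2" using u1 u2 by simp
    qed
    ultimately have "subquotient (slice ?L G) b W"
      unfolding subquotient_def by (intro exI[of _ mm] exI[of _ ee]) (simp add: mm_def ee_def)
    then show "\<exists>A\<in>Ob (set_cat r). subquotient (slice ?L G) b
        (on_ob (comp_func (base_change ?L G) (comp_func a const_E)) A)"
      using iA As by (metis set_Ob)
  qed
  ultimately show ?thesis unfolding etendue_def a_def by blast
qed

text \<open>A greatest set of objects is unique, which justifies the definite description in
  \<open>level_e\<close>.\<close>

lemma level_e_L0: "level_e E (set_cat r) const_E = L0"
proof -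
  have 1: "etendue_level E (set_cat r) const_E L0"
    unfolding etendue_level_def using L0_level L0_etendue by blast
  have 2: "L \<subseteq> L0" if "etendue_level E (set_cat r) const_E L" for L
  proof -
    have lv: "level E L" and et: "etendue (full_subcat E L) (set_cat r) (comp_func (inverse_image E L) const_E)"
      using that by (auto simp: etendue_level_def)
    obtain l \<eta> u where essential_level: "essential_level r X L (inverse_image E L) l \<eta> u" using level_essential_level(1)[OF lv] by blast
    show ?thesis
      by (rule level_below_L0[OF essential_level]) (rule essential_level.etendue_S_nondegenerate[OF essential_level level_essential_level(2)[OF lv] et])
  qed
  show ?thesis
    unfolding level_e_def by (rule the_equality) (use 1 2 in blast)+
qed

end

section \<open>Subobjects in the topos of minimal objects\<close>

locale e_acute_topos = strongly_regular_over r X + essential_level r X "simp_over.L0 r X" a l \<eta> u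
  for r :: "'u rel" and X :: "'u simp_set" and a l \<eta> u
begin

abbreviation C where "C \<equiv> full_subcat E L0"

definition img where "img m k = eap m k ` Sel (Dom E m) k"

definition closed_in :: "'u simp_map \<Rightarrow> (nat \<Rightarrow> 'u set) \<Rightarrow> bool" where
  "closed_in A R \<longleftrightarrow> (\<forall>k. R k \<subseteq> Sel A k) \<and>
     (\<forall>k m. \<forall>f \<in> hom Delta m k. \<forall>b \<in> R k. inj_on (ev f) {..m} \<longrightarrow> res A f b \<in> R m)"

text \<open>With \<open>aY\<close>, the generic element of a reflected representable: the test
  object for the elements over \<open>x\<close> inside the topos.\<close>

definition "pt k x = eap (\<eta> (Y k x)) k (gen k x)"

definition "aY k x = on_ob a (Y k x)"

lemma closed_inD:
  assumes "closed_in A R"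
  shows "b \<in> R k \<Longrightarrow> b \<in> Sel A k"
    and "b \<in> R k \<Longrightarrow> f \<in> hom Delta m k \<Longrightarrow> inj_on (ev f) {..m} \<Longrightarrow> res A f b \<in> R m"
  using assms unfolding closed_in_def by blast+

lemma unitS: "p \<in> Ob E \<Longrightarrow> Sbij (\<eta> p) p (on_ob a p)"
  using unit_Sbij[OF _ aL eta a_univ] by blast

lemma pt:
  assumes n: "nd k x"
  shows "aY k x \<in> L0" "pt k x \<in> Sel (aY k x) k" "lb (aY k x) k (pt k x) = x"
proof -
  note x = nd_in[OF n]
  note Y = Y_Ob[OF x]
  show "aY k x \<in> L0" using aL[OF Y] by (simp add: aY_def)
  show "lb (aY k x) k (pt k x) = x" using eap_lb[OF eta[OF Y] gen_in[OF x]] gen_lb[OF x] by (simp add: pt_def aY_def)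
  then show "pt k x \<in> Sel (aY k x) k"
    using eap_in[OF eta[OF Y] gen_in[OF x]] n by (simp add: Sel_def pt_def aY_def)
qed

lemma pt_hom:
  assumes "b \<in> Sel q k" "q \<in> L0"
  shows "\<exists>h \<in> hom E (aY k (lb q k b)) q. eap h k (pt k (lb q k b)) = b"
  using hat_ex[OF _ assms(2) Sel_el[OF assms(1)] refl] lb_in[OF L0_Ob[OF assms(2)] Sel_el[OF assms(1)]]
  by (simp add: aY_def pt_def)

lemma pt_eq:
  assumes "nd k x" "q \<in> L0" "h \<in> hom E (aY k x) q" "h' \<in> hom E (aY k x) q" "eap h k (pt k x) = eap h' k (pt k x)"
  shows "h = h'"
  using hat_eq[OF nd_in[OF assms(1)] assms(2)] assms(3-5) by (simp add: aY_def pt_def)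

text \<open>Nondegenerate elements with equal images have the same label, so they are parallel
  arrows from one test object.\<close>

lemma monic_iff:
  assumes m: "m \<in> hom E M A" and M: "M \<in> L0" and A: "A \<in> L0"
  shows "monic C m \<longleftrightarrow> (\<forall>k. inj_on (eap m k) (Sel M k))"
proof
  have arr: "m \<in> Arr C" "Dom C m = M" using m M A by (auto simp: hom_def full_subcat_def)
  { assume mono: "monic C m"
    show "\<forall>k. inj_on (eap m k) (Sel M k)"
    proof (intro allI inj_onI)
      fix k b b' assume b: "b \<in> Sel M k" and b': "b' \<in> Sel M k" and eq: "eap m k b = eap m k b'"
      have lbb: "lb M k b' = lb M k b" using eap_lb[OF m Sel_el[OF b]] eap_lb[OF m Sel_el[OF b']] eq by simp
      define x where "x = lb M k b"
      have n: "nd k x" using b by (simp add: Sel_def x_def)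
      note ptx = pt[OF n]
      obtain h where h: "h \<in> hom E (aY k x) M" "eap h k (pt k x) = b" using pt_hom[OF b M] by (auto simp: x_def)
      obtain h' where h': "h' \<in> hom E (aY k x) M" "eap h' k (pt k x) = b'" using pt_hom[OF b' M] lbb by (auto simp: x_def)
      have "m \<cdot>\<^bsub>E\<^esub> h = m \<cdot>\<^bsub>E\<^esub> h'"
        by (rule pt_eq[OF n A E.comp_in[OF m h(1)] E.comp_in[OF m h'(1)]])
          (simp add: eap_comp[OF m h(1) Sel_el[OF ptx(2)]] eap_comp[OF m h'(1) Sel_el[OF ptx(2)]] h(2) h'(2) eq)
      then have "h = h'"
        using mono arr(2) h(1) h'(1) M ptx(1) unfolding monic_def by (simp add: hom_full_iff)
      then show "b = b'" using h(2) h'(2) by simp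
    qed }
  assume inj: "\<forall>k. inj_on (eap m k) (Sel M k)"
  show "monic C m"
    unfolding monic_def
  proof (intro conjI arr(1) ballI impI)
    fix s f g assume "s \<in> Ob C" and f0: "f \<in> hom C s (Dom C m)" and g0: "g \<in> hom C s (Dom C m)" and eq: "m \<cdot>\<^bsub>C\<^esub> f = m \<cdot>\<^bsub>C\<^esub> g"
    have f: "f \<in> hom E s M" and g: "g \<in> hom E s M" using f0 g0 arr(2) by (auto simp: hom_full_iff)
    show "f = g"
    proof (rule L0_eq[OF M f g])
      fix k c assume c: "c \<in> Sel s k"
      have "eap m k (eap f k c) = eap m k (eap g k c)"
        using eap_comp[OF m f Sel_el[OF c]] eap_comp[OF m g Sel_el[OF c]] eq by simp
      then show "eap f k c = eap g k c" using inj Sel_eap[OF f c] Sel_eap[OF g c] by (auto simp: inj_on_def)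
    qed
  qed
qed

lemma sub_iff: "m \<in> sub C A \<longleftrightarrow> Dom E m \<in> L0 \<and> A \<in> L0 \<and> m \<in> hom E (Dom E m) A \<and>
    (\<forall>k. inj_on (eap m k) (Sel (Dom E m) k))"
proof
  assume m: "m \<in> sub C A"
  then have "m \<in> Arr C" "Cod E m = A" by (auto simp: sub_def monic_def)
  then have *: "Dom E m \<in> L0" "A \<in> L0" "m \<in> hom E (Dom E m) A" by (auto simp: full_subcat_def hom_def)
  then show "Dom E m \<in> L0 \<and> A \<in> L0 \<and> m \<in> hom E (Dom E m) A \<and> (\<forall>k. inj_on (eap m k) (Sel (Dom E m) k))"
    using monic_iff[of m "Dom E m" A] m by (simp add: sub_def)
next
  assume "Dom E m \<in> L0 \<and> A \<in> L0 \<and> m \<in> hom E (Dom E m) A \<and> (\<forall>k. inj_on (eap m k) (Sel (Dom E m) k))"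
  then show "m \<in> sub C A" using monic_iff[of m "Dom E m" A] homD[of m E "Dom E m" A] by (simp add: sub_def)
qed

lemma
  assumes "m \<in> sub C A"
  shows sub_hom: "m \<in> hom E (Dom E m) A" and sub_dom: "Dom E m \<in> L0" and sub_cod: "A \<in> L0"
    and sub_inj: "b \<in> Sel (Dom E m) k \<Longrightarrow> b' \<in> Sel (Dom E m) k \<Longrightarrow> eap m k b = eap m k b' \<Longrightarrow> b = b'"
  using assms unfolding sub_iff inj_on_def by blast+

lemma img_closed:
  assumes m: "m \<in> sub C A"
  shows "closed_in A (img m)"
  unfolding closed_in_def
proof (intro conjI allI ballI impI)
  note mh = sub_hom[OF m]
  show "img m k \<subseteq> Sel A k" for k using Sel_eap[OF mh] by (auto simp: img_def)
  fix k j f b assume f: "f \<in> hom Delta j k" "inj_on (ev f) {..j}" and "b \<in> img m k"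
  then obtain c where c: "c \<in> Sel (Dom E m) k" "b = eap m k c" by (auto simp: img_def)
  have "res A f b = eap m j (res (Dom E m) f c)" using eap_res[OF mh f(1) Sel_el[OF c(1)]] c(2) by simp
  then show "res A f b \<in> img m j" using Sel_res[OF E.dom_ob[OF mh] c(1) f] by (simp add: img_def)
qed

lemma img_Sel: "m \<in> sub C A \<Longrightarrow> b \<in> img m k \<Longrightarrow> b \<in> Sel A k"
  using closed_inD(1)[OF img_closed] by blast

text \<open>Preimages under \<open>m\<close> are unique on nondegenerate elements, hence natural,
  and the domain of \<open>m\<close> extends natural families.\<close>

lemma sub_factor:
  assumes m: "m \<in> sub C A" and f: "f \<in> hom E s A" and im: "\<And>k c. c \<in> Sel s k \<Longrightarrow> eap f k c \<in> img m k"
  shows "\<exists>g \<in> hom E s (Dom E m). m \<cdot>\<^bsub>E\<^esub> g = f"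
proof -
  let ?M = "Dom E m"
  note mh = sub_hom[OF m] and M = sub_dom[OF m] and A = sub_cod[OF m]
  have s: "s \<in> Ob E" and MO: "?M \<in> Ob E" using E.dom_ob[OF f] E.dom_ob[OF mh] by auto
  define \<phi> where "\<phi> k c = (SOME b. b \<in> Sel ?M k \<and> eap m k b = eap f k c)" for k c
  have phi: "\<phi> k c \<in> Sel ?M k \<and> eap m k (\<phi> k c) = eap f k c" if "c \<in> Sel s k" for k c
    unfolding \<phi>_def by (rule someI_ex) (use im[OF that] in \<open>auto simp: img_def\<close>)
  have "Nat s ?M \<phi>"
    unfolding Nat_def
  proof (intro conjI allI ballI impI)
    fix k c assume c: "c \<in> Sel s k"
    show "\<phi> k c \<in> el ?M k" using phi[OF c] Sel_el by blast
    show "lb ?M k (\<phi> k c) = lb s k c"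
      using eap_lb[OF mh, of "\<phi> k c" k] eap_lb[OF f Sel_el[OF c]] phi[OF c] Sel_el by simp
  next
    fix k j g c assume c: "c \<in> Sel s k" and g: "g \<in> hom Delta j k" "inj_on (ev g) {..j}"
    have p: "\<phi> k c \<in> Sel ?M k" using phi[OF c] by blast
    show "\<phi> j (res s g c) = res ?M g (\<phi> k c)"
    proof (rule sub_inj[OF m])
      show "\<phi> j (res s g c) \<in> Sel ?M j" using phi[OF Sel_res[OF s c g]] by blast
      show "res ?M g (\<phi> k c) \<in> Sel ?M j" using Sel_res[OF MO p g] .
      show "eap m j (\<phi> j (res s g c)) = eap m j (res ?M g (\<phi> k c))"
        using phi[OF Sel_res[OF s c g]] eap_res[OF f g(1) Sel_el[OF c]] eap_res[OF mh g(1) Sel_el[OF p]] phi[OF c] by simp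
    qed
  qed
  then obtain g where g: "g \<in> hom E s ?M" "\<And>k c. c \<in> Sel s k \<Longrightarrow> eap g k c = \<phi> k c" using L0_ext[OF M s] by blast
  have "m \<cdot>\<^bsub>E\<^esub> g = f"
    by (rule L0_eq[OF A E.comp_in[OF mh g(1)] f]) (use eap_comp[OF mh g(1) Sel_el] g(2) phi in simp)
  then show ?thesis using g(1) by blast
qed

lemma sub_le_iff:
  assumes m: "m \<in> sub C A" and m': "m' \<in> sub C A"
  shows "sub_le C m m' \<longleftrightarrow> (\<forall>k. img m k \<subseteq> img m' k)"
proof
  note mh = sub_hom[OF m] and mh' = sub_hom[OF m']
  { assume "sub_le C m m'"
    then obtain g where g: "g \<in> hom E (Dom E m) (Dom E m')" "m' \<cdot>\<^bsub>E\<^esub> g = m" by (auto simp: sub_le_def hom_full_iff)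
    show "\<forall>k. img m k \<subseteq> img m' k"
    proof (intro allI subsetI)
      fix k b assume "b \<in> img m k"
      then obtain c where c: "c \<in> Sel (Dom E m) k" "b = eap m k c" by (auto simp: img_def)
      have "b = eap m' k (eap g k c)" using eap_comp[OF mh' g(1) Sel_el[OF c(1)]] g(2) c(2) by simp
      then show "b \<in> img m' k" using Sel_eap[OF g(1) c(1)] by (simp add: img_def)
    qed }
  assume "\<forall>k. img m k \<subseteq> img m' k"
  then have "\<And>k c. c \<in> Sel (Dom E m) k \<Longrightarrow> eap m k c \<in> img m' k" by (auto simp: img_def)
  from sub_factor[OF m' mh this] show "sub_le C m m'"
    using sub_dom[OF m] sub_dom[OF m'] by (auto simp: sub_le_def hom_full_iff)
qed

text \<open>The subpresheaf of \<open>A\<close> generated by \<open>R\<close> is reflected into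
  \<open>L0\<close>. No nondegenerate element is added: an operator that restricts an element to a
  nondegenerate one is injective, and \<open>R\<close> is closed under such operators.\<close>

lemma sub_ex:
  assumes A: "A \<in> L0" and R: "closed_in A R"
  shows "\<exists>m \<in> sub C A. img m = R"
proof -
  have AO: "A \<in> Ob E" using L0_Ob[OF A] .
  define B where "B k = {c \<in> el A k. \<exists>j. \<exists>f \<in> hom Delta k j. \<exists>b \<in> R j. c = res A f b}" for k
  have "\<exists>c. \<exists>i \<in> hom E c A. \<forall>k. bij_betw (eap i k) (el c k) (B k)"
  proof (rule subobj_ex[OF AO])
    show "B k \<subseteq> el A k" for k by (auto simp: B_def)
    fix g m k c assume g: "g \<in> hom Delta m k" and "c \<in> B k"
    then obtain j f b where f: "f \<in> hom Delta k j" "b \<in> R j" "c = res A f b" and c: "c \<in> el A k" unfolding B_def by blast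
    have "res A g c = res A (f \<cdot>\<^bsub>Delta\<^esub> g) b" using res_comp[OF AO f(1) g Sel_el[OF closed_inD(1)[OF R f(2)]]] f(3) by simp
    then show "res A g c \<in> B m" using res_in[OF AO g c] Delta_comp_in[OF f(1) g] f(2) unfolding B_def by blast
  qed
  then obtain c i where i: "i \<in> hom E c A" and bij: "\<And>k. bij_betw (eap i k) (el c k) (B k)" by blast
  have c: "c \<in> Ob E" using E.dom_ob[OF i] .
  obtain m where m: "m \<in> hom E (on_ob a c) A" "m \<cdot>\<^bsub>E\<^esub> \<eta> c = i" using a_univ[OF c A i] by blast
  have ev: "eap m k (eap (\<eta> c) k z) = eap i k z" if "z \<in> el c k" for k z
    using eap_comp[OF m(1) eta[OF c] that] m(2) by simp
  note uS = unitS[OF c]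
  have D: "Dom E m = on_ob a c" using homD[OF m(1)] by simp
  have "m \<in> sub C A"
    unfolding sub_iff D
  proof (intro conjI aL[OF c] A m(1) allI inj_onI)
    fix k b b' assume b: "b \<in> Sel (on_ob a c) k" "b' \<in> Sel (on_ob a c) k" and eq: "eap m k b = eap m k b'"
    obtain z where z: "z \<in> Sel c k" "b = eap (\<eta> c) k z" using Sbij_surj[OF uS b(1)] by blast
    obtain z' where z': "z' \<in> Sel c k" "b' = eap (\<eta> c) k z'" using Sbij_surj[OF uS b(2)] by blast
    have "eap i k z = eap i k z'" using eq z(2) z'(2) ev[OF Sel_el[OF z(1)]] ev[OF Sel_el[OF z'(1)]] by simp
    then have "z = z'"
      using inj_onD[OF bij_betw_imp_inj_on[OF bij] _ Sel_el[OF z(1)] Sel_el[OF z'(1)]] by blast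
    then show "b = b'" using z(2) z'(2) by simp
  qed
  moreover have "img m k = R k" for k
  proof
    show "img m k \<subseteq> R k"
    proof
      fix b assume "b \<in> img m k"
      then obtain s where s: "s \<in> Sel (on_ob a c) k" "b = eap m k s" by (auto simp: img_def D)
      then have bS: "b \<in> Sel A k" using Sel_eap[OF m(1)] by blast
      obtain z where z: "z \<in> Sel c k" "s = eap (\<eta> c) k z" using Sbij_surj[OF uS s(1)] by blast
      have "b = eap i k z" using s(2) z(2) ev[OF Sel_el[OF z(1)]] by simp
      then have "b \<in> B k" using bij[of k] Sel_el[OF z(1)] by (auto simp: bij_betw_def)
      then obtain j f b' where f: "f \<in> hom Delta k j" "b' \<in> R j" "b = res A f b'" unfolding B_def by blast
      have "inj_on (ev f) {..k}" using Sel_inj[OF AO Sel_el[OF closed_inD(1)[OF R f(2)]] f(1)] bS f(3) by simp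
      then show "b \<in> R k" using closed_inD(2)[OF R f(2,1)] f(3) by simp
    qed
    show "R k \<subseteq> img m k"
    proof
      fix b assume b: "b \<in> R k"
      note bS = closed_inD(1)[OF R b]
      have "b \<in> B k" unfolding B_def using Sel_el[OF bS] res_id[OF AO Sel_el[OF bS]] Delta_id_in b
        by (intro CollectI conjI exI[of _ k] bexI[of _ "Idt Delta k"] bexI[of _ b]) simp_all
      then have "b \<in> eap i k ` el c k" using bij[of k] by (simp add: bij_betw_def)
      then obtain z where z: "z \<in> el c k" "b = eap i k z" by blast
      have "z \<in> Sel c k" using Sel_eapD[OF i z(1)] bS z(2) by simp
      then have "eap (\<eta> c) k z \<in> Sel (on_ob a c) k" using Sel_eap[OF eta[OF c]] by blast
      then show "b \<in> img m k" using ev[OF z(1)] z(2) by (metis D img_def imageI)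
    qed
  qed
  ultimately show ?thesis by blast
qed

text \<open>Logical operations are specified by the subobjects below them. Comparison with the
  subobject whose image is \<open>R\<close> then computes the image, as in Yoneda for a
  preorder.\<close>

lemma img_char:
  assumes v: "v \<in> sub C A" and R: "closed_in A R"
    and ch: "\<And>h. h \<in> sub C A \<Longrightarrow> sub_le C h v \<longleftrightarrow> (\<forall>k. img h k \<subseteq> R k)"
  shows "img v = R"
proof -
  obtain m where m: "m \<in> sub C A" "img m = R" using sub_ex[OF sub_cod[OF v] R] by blast
  have "sub_le C m v" using ch[OF m(1)] m(2) by simp
  then have 1: "\<forall>k. R k \<subseteq> img v k" using sub_le_iff[OF m(1) v] m(2) by simp
  have "sub_le C v v" using sub_le_iff[OF v v] by simp
  then have "\<forall>k. img v k \<subseteq> R k" using ch[OF v] by simp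
  then show ?thesis using 1 by (intro ext) blast
qed

section \<open>The logical operations on subobjects\<close>

lemma closed_empty: "closed_in A (\<lambda>k. {})" by (simp add: closed_in_def)

lemma closed_Int: "closed_in A R \<Longrightarrow> closed_in A R' \<Longrightarrow> closed_in A (\<lambda>k. R k \<inter> R' k)"
  unfolding closed_in_def by blast

lemma closed_Un: "closed_in A R \<Longrightarrow> closed_in A R' \<Longrightarrow> closed_in A (\<lambda>k. R k \<union> R' k)"
  unfolding closed_in_def by blast

lemma sub_bot_iff: "A \<in> L0 \<Longrightarrow> sub_bot C A b \<longleftrightarrow> b \<in> sub C A \<and> img b = (\<lambda>k. {})"
proof -
  assume A: "A \<in> L0"
  obtain m where m: "m \<in> sub C A" "img m = (\<lambda>k. {})" using sub_ex[OF A closed_empty] by blast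
  show ?thesis
  proof
    assume b: "sub_bot C A b"
    then have "b \<in> sub C A" "sub_le C b m" using m(1) by (auto simp: sub_bot_def)
    then show "b \<in> sub C A \<and> img b = (\<lambda>k. {})" using sub_le_iff[OF _ m(1)] m(2) by (auto simp: fun_eq_iff)
  next
    assume b: "b \<in> sub C A \<and> img b = (\<lambda>k. {})"
    then have "sub_le C b m" if "m \<in> sub C A" for m using sub_le_iff[OF _ that] by simp
    then show "sub_bot C A b" using b by (simp add: sub_bot_def)
  qed
qed

lemma sub_meet_iff:
  assumes m: "m \<in> sub C A" and m': "m' \<in> sub C A"
  shows "sub_meet C A m m' k \<longleftrightarrow> k \<in> sub C A \<and> img k = (\<lambda>j. img m j \<inter> img m' j)"
proof
  assume k: "sub_meet C A m m' k"
  then have kS: "k \<in> sub C A" by (simp add: sub_meet_def)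
  have "img k = (\<lambda>j. img m j \<inter> img m' j)"
  proof (rule img_char[OF kS closed_Int[OF img_closed[OF m] img_closed[OF m']]])
    fix h assume h: "h \<in> sub C A"
    then have "sub_le C h k \<longleftrightarrow> sub_le C h m \<and> sub_le C h m'" using k by (simp add: sub_meet_def)
    then show "sub_le C h k \<longleftrightarrow> (\<forall>j. img h j \<subseteq> img m j \<inter> img m' j)"
      using sub_le_iff[OF h m] sub_le_iff[OF h m'] by auto
  qed
  then show "k \<in> sub C A \<and> img k = (\<lambda>j. img m j \<inter> img m' j)" using kS by simp
next
  assume "k \<in> sub C A \<and> img k = (\<lambda>j. img m j \<inter> img m' j)"
  then show "sub_meet C A m m' k" using sub_le_iff m m' by (auto simp: sub_meet_def)
qed

text \<open>A join is specified by the subobjects above it, so \<open>img_char\<close> does not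
  apply; it is compared directly with the subobject whose image is the union, which is already
  closed under faces.\<close>

lemma sub_join_iff:
  assumes m: "m \<in> sub C A" and m': "m' \<in> sub C A"
  shows "sub_join C A m m' k \<longleftrightarrow> k \<in> sub C A \<and> img k = (\<lambda>j. img m j \<union> img m' j)"
proof
  assume k: "sub_join C A m m' k"
  then have kS: "k \<in> sub C A" by (simp add: sub_join_def)
  obtain n where n: "n \<in> sub C A" "img n = (\<lambda>j. img m j \<union> img m' j)"
    using sub_ex[OF sub_cod[OF m] closed_Un[OF img_closed[OF m] img_closed[OF m']]] by blast
  have "sub_le C m n" "sub_le C m' n" using sub_le_iff[OF m n(1)] sub_le_iff[OF m' n(1)] n(2) by auto
  then have "sub_le C k n" using k n(1) by (simp add: sub_join_def)
  then have 1: "img k j \<subseteq> img m j \<union> img m' j" for j using sub_le_iff[OF kS n(1)] n(2) by auto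
  have "sub_le C k k" using sub_le_iff[OF kS kS] by simp
  then have "sub_le C m k" "sub_le C m' k" using k kS by (auto simp: sub_join_def)
  then have "img m j \<union> img m' j \<subseteq> img k j" for j using sub_le_iff[OF m kS] sub_le_iff[OF m' kS] by auto
  then have "img k j = img m j \<union> img m' j" for j using 1[of j] by blast
  then show "k \<in> sub C A \<and> img k = (\<lambda>j. img m j \<union> img m' j)" using kS by (simp add: fun_eq_iff)
next
  assume k: "k \<in> sub C A \<and> img k = (\<lambda>j. img m j \<union> img m' j)"
  then have "sub_le C k h \<longleftrightarrow> sub_le C m h \<and> sub_le C m' h" if "h \<in> sub C A" for h
    using sub_le_iff[OF _ that] sub_le_iff[OF m that] sub_le_iff[OF m' that] by auto
  then show "sub_join C A m m' k" using k by (simp add: sub_join_def)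
qed

text \<open>The Kripke clause for implication, with nondegenerate faces as later stages.\<close>

definition imp_set where
  "imp_set A R R' k = {b \<in> Sel A k. \<forall>j. \<forall>f \<in> hom Delta j k. inj_on (ev f) {..j} \<longrightarrow> res A f b \<in> R j \<longrightarrow> res A f b \<in> R' j}"

lemma closed_imp:
  assumes A: "A \<in> L0"
  shows "closed_in A (imp_set A R R')"
  unfolding closed_in_def
proof (intro conjI allI ballI impI)
  have AO: "A \<in> Ob E" using L0_Ob[OF A] .
  show "imp_set A R R' k \<subseteq> Sel A k" for k by (auto simp: imp_set_def)
  fix k m f b assume f: "f \<in> hom Delta m k" "inj_on (ev f) {..m}" and b: "b \<in> imp_set A R R' k"
  have bS: "b \<in> Sel A k" using b by (simp add: imp_set_def)
  have "res A g (res A f b) \<in> R' j" if g: "g \<in> hom Delta j m" "inj_on (ev g) {..j}" "res A g (res A f b) \<in> R j" for j g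
    using that res_comp[OF AO f(1) g(1) Sel_el[OF bS]] b Delta_comp_in[OF f(1) g(1)] inj_comp[OF g(1) f(1) g(2) f(2)]
    by (simp add: imp_set_def)
  then show "res A f b \<in> imp_set A R R' m" using Sel_res[OF AO bS f] by (simp add: imp_set_def)
qed

lemma imp_set_adj:
  assumes A: "A \<in> L0" and H: "closed_in A H"
  shows "(\<forall>k. H k \<inter> R k \<subseteq> R' k) \<longleftrightarrow> (\<forall>k. H k \<subseteq> imp_set A R R' k)"
proof
  assume *: "\<forall>k. H k \<inter> R k \<subseteq> R' k"
  show "\<forall>k. H k \<subseteq> imp_set A R R' k"
    using * closed_inD[OF H] unfolding imp_set_def by blast
next
  assume *: "\<forall>k. H k \<subseteq> imp_set A R R' k"
  show "\<forall>k. H k \<inter> R k \<subseteq> R' k"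
  proof (intro allI subsetI)
    fix k b assume b: "b \<in> H k \<inter> R k"
    then have "b \<in> imp_set A R R' k" using * by blast
    moreover have "inj_on (ev (Idt Delta k)) {..k}" by (simp add: inj_on_def)
    moreover have "res A (Idt Delta k) b = b" using res_id[OF L0_Ob[OF A] Sel_el[OF closed_inD(1)[OF H]]] b by blast
    ultimately have "res A (Idt Delta k) b \<in> R' k" using Delta_id_in[of k] b unfolding imp_set_def by force
    then show "b \<in> R' k" using \<open>res A (Idt Delta k) b = b\<close> by simp
  qed
qed

text \<open>\<open>sub_imp\<close> quantifies over all meets; one exists and all have the same
  image, so the condition is one on images.\<close>

lemma sub_imp_iff:
  assumes m: "m \<in> sub C A" and m': "m' \<in> sub C A"
  shows "sub_imp C A m m' i \<longleftrightarrow> i \<in> sub C A \<and> img i = imp_set A (img m) (img m')"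
proof -
  note A = sub_cod[OF m]
  have le: "(\<forall>k. sub_meet C A h m k \<longrightarrow> sub_le C k m') \<longleftrightarrow> (\<forall>k. img h k \<subseteq> imp_set A (img m) (img m') k)"
    if h: "h \<in> sub C A" for h
  proof -
    obtain n where n: "n \<in> sub C A" "img n = (\<lambda>j. img h j \<inter> img m j)"
      using sub_ex[OF A closed_Int[OF img_closed[OF h] img_closed[OF m]]] by blast
    have "(\<forall>k. sub_meet C A h m k \<longrightarrow> sub_le C k m') \<longleftrightarrow> (\<forall>k. img h k \<inter> img m k \<subseteq> img m' k)"
    proof
      assume "\<forall>k. sub_meet C A h m k \<longrightarrow> sub_le C k m'"
      then have "sub_le C n m'" using n sub_meet_iff[OF h m] by blast
      then show "\<forall>k. img h k \<inter> img m k \<subseteq> img m' k" using sub_le_iff[OF n(1) m'] n(2) by simp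
    next
      assume *: "\<forall>k. img h k \<inter> img m k \<subseteq> img m' k"
      show "\<forall>k. sub_meet C A h m k \<longrightarrow> sub_le C k m'"
      proof (intro allI impI)
        fix k assume "sub_meet C A h m k"
        then have k: "k \<in> sub C A" "img k = (\<lambda>j. img h j \<inter> img m j)" using sub_meet_iff[OF h m] by auto
        then show "sub_le C k m'" using sub_le_iff[OF k(1) m'] * by simp
      qed
    qed
    then show ?thesis using imp_set_adj[OF A img_closed[OF h]] by simp
  qed
  show ?thesis
  proof
    assume i: "sub_imp C A m m' i"
    then have iS: "i \<in> sub C A" by (simp add: sub_imp_def)
    have "img i = imp_set A (img m) (img m')"
      by (rule img_char[OF iS closed_imp[OF A]]) (use i le in \<open>simp add: sub_imp_def\<close>)
    then show "i \<in> sub C A \<and> img i = imp_set A (img m) (img m')" using iS by simp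
  next
    assume "i \<in> sub C A \<and> img i = imp_set A (img m) (img m')"
    then show "sub_imp C A m m' i" using le sub_le_iff by (simp add: sub_imp_def)
  qed
qed

definition pull_set where "pull_set A f R k = {b \<in> Sel A k. eap f k b \<in> R k}"

lemma closed_pull:
  assumes f: "f \<in> hom E A B" and R: "closed_in B R"
  shows "closed_in A (pull_set A f R)"
  unfolding closed_in_def pull_set_def
proof (intro conjI allI ballI impI)
  fix k m g b assume g: "g \<in> hom Delta m k" "inj_on (ev g) {..m}" and "b \<in> {b \<in> Sel A k. eap f k b \<in> R k}"
  then have b: "b \<in> Sel A k" "eap f k b \<in> R k" by auto
  show "res A g b \<in> {b \<in> Sel A m. eap f m b \<in> R m}"
    using Sel_res[OF E.dom_ob[OF f] b(1) g] eap_res[OF f g(1) Sel_el[OF b(1)]] closed_inD(2)[OF R b(2) g] by simp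
qed auto

text \<open>Two elements over \<open>x\<close> that agree in \<open>B\<close> are a cone with vertex
  the test object \<open>aY k x\<close>. So the universal property determines the nondegenerate
  elements of any pullback.\<close>

lemma pullback_img:
  assumes m: "m \<in> sub C B" and f: "f \<in> hom E A B" and A: "A \<in> L0" and pb: "is_pullback C f m p q"
  shows "p \<in> sub C A" "img p = pull_set A f (img m)"
proof -
  define P where "P = Dom E p"
  note mh = sub_hom[OF m] and M = sub_dom[OF m] and B = sub_cod[OF m]
  have Df: "Dom E f = A" using homD[OF f] by simp
  have p: "p \<in> hom E P A" and q: "q \<in> hom E P (Dom E m)" and PL: "P \<in> L0" and eq: "f \<cdot>\<^bsub>E\<^esub> p = m \<cdot>\<^bsub>E\<^esub> q"
    using pb Df unfolding is_pullback_def P_def by (auto simp: hom_full_iff)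
  have U: "\<exists>!h. h \<in> hom E s P \<and> p \<cdot>\<^bsub>E\<^esub> h = \<alpha> \<and> q \<cdot>\<^bsub>E\<^esub> h = \<beta>"
    if "s \<in> L0" "\<alpha> \<in> hom E s A" "\<beta> \<in> hom E s (Dom E m)" "f \<cdot>\<^bsub>E\<^esub> \<alpha> = m \<cdot>\<^bsub>E\<^esub> \<beta>" for s \<alpha> \<beta>
    using pb that Df M A PL unfolding is_pullback_def P_def[symmetric] full_simps by (simp add: hom_full_iff)
  have key: "\<exists>!s. s \<in> Sel P k \<and> eap p k s = b" if b: "b \<in> Sel A k" "eap f k b \<in> img m k" for k b
  proof -
    obtain z where z: "z \<in> Sel (Dom E m) k" "eap m k z = eap f k b" using b(2) by (auto simp: img_def)
    define x where "x = lb A k b"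
    have n: "nd k x" using b(1) by (simp add: Sel_def x_def)
    note ptx = pt[OF n]
    have zx: "lb (Dom E m) k z = x" using eap_lb[OF mh Sel_el[OF z(1)]] eap_lb[OF f Sel_el[OF b(1)]] z(2) by (simp add: x_def)
    obtain h1 where h1: "h1 \<in> hom E (aY k x) A" "eap h1 k (pt k x) = b" using pt_hom[OF b(1) A] by (auto simp: x_def)
    obtain h2 where h2: "h2 \<in> hom E (aY k x) (Dom E m)" "eap h2 k (pt k x) = z" using pt_hom[OF z(1) M] zx by auto
    note pe = Sel_el[OF ptx(2)]
    have sq: "f \<cdot>\<^bsub>E\<^esub> h1 = m \<cdot>\<^bsub>E\<^esub> h2"
      by (rule pt_eq[OF n B E.comp_in[OF f h1(1)] E.comp_in[OF mh h2(1)]])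
        (simp add: eap_comp[OF f h1(1) pe] eap_comp[OF mh h2(1) pe] h1(2) h2(2) z(2))
    obtain h where h: "h \<in> hom E (aY k x) P" "p \<cdot>\<^bsub>E\<^esub> h = h1" "q \<cdot>\<^bsub>E\<^esub> h = h2"
      and hu: "\<And>h'. h' \<in> hom E (aY k x) P \<Longrightarrow> p \<cdot>\<^bsub>E\<^esub> h' = h1 \<Longrightarrow> q \<cdot>\<^bsub>E\<^esub> h' = h2 \<Longrightarrow> h' = h"
      using U[OF ptx(1) h1(1) h2(1) sq] by blast
    show ?thesis
    proof (rule ex1I[of _ "eap h k (pt k x)"])
      show "eap h k (pt k x) \<in> Sel P k \<and> eap p k (eap h k (pt k x)) = b"
        using Sel_eap[OF h(1) ptx(2)] eap_comp[OF p h(1) pe] h(2) h1(2) by simp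
      fix s assume s: "s \<in> Sel P k \<and> eap p k s = b"
      then have sS: "s \<in> Sel P k" by blast
      have "lb P k s = x" using eap_lb[OF p Sel_el[OF sS]] s by (simp add: x_def)
      then obtain h' where h': "h' \<in> hom E (aY k x) P" "eap h' k (pt k x) = s" using pt_hom[OF sS PL] by auto
      have p1: "p \<cdot>\<^bsub>E\<^esub> h' = h1"
        by (rule pt_eq[OF n A E.comp_in[OF p h'(1)] h1(1)]) (simp add: eap_comp[OF p h'(1) pe] h'(2) h1(2) s)
      have "eap m k (eap q k s) = eap m k z"
        using eap_comp[OF mh q Sel_el[OF sS]] eap_comp[OF f p Sel_el[OF sS]] eq s z(2) by simp
      then have "eap q k s = z" using sub_inj[OF m Sel_eap[OF q sS] z(1)] by blast
      then have "q \<cdot>\<^bsub>E\<^esub> h' = h2"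
        by (intro pt_eq[OF n M E.comp_in[OF q h'(1)] h2(1)]) (simp add: eap_comp[OF q h'(1) pe] h'(2) h2(2))
      then show "s = eap h k (pt k x)" using hu[OF h'(1) p1] h'(2) by simp
    qed
  qed
  have im: "eap f k (eap p k s) \<in> img m k" if "s \<in> Sel P k" for k s
  proof -
    have "eap f k (eap p k s) = eap m k (eap q k s)"
      using eap_comp[OF f p Sel_el[OF that]] eap_comp[OF mh q Sel_el[OF that]] eq by simp
    then show ?thesis using Sel_eap[OF q that] unfolding img_def by blast
  qed
  show "p \<in> sub C A"
    unfolding sub_iff P_def[symmetric]
  proof (intro conjI PL A p allI inj_onI)
    fix k s s' assume "s \<in> Sel P k" "s' \<in> Sel P k" "eap p k s = eap p k s'"
    then show "s = s'" using key[OF Sel_eap[OF p] im] by blast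
  qed
  show "img p = pull_set A f (img m)"
  proof (intro ext equalityI subsetI)
    fix k b assume "b \<in> img p k"
    then show "b \<in> pull_set A f (img m) k" using Sel_eap[OF p] im by (auto simp: img_def pull_set_def P_def[symmetric])
  next
    fix k b assume "b \<in> pull_set A f (img m) k"
    then have "\<exists>s. s \<in> Sel P k \<and> eap p k s = b" using key[of b k] by (auto simp: pull_set_def)
    then show "b \<in> img p k" by (auto simp: img_def P_def)
  qed
qed

lemma pullback_ex:
  assumes m: "m \<in> sub C B" and f: "f \<in> hom E A B" and p: "p \<in> sub C A" and im: "img p = pull_set A f (img m)"
  shows "\<exists>q. is_pullback C f m p q"
proof -
  note mh = sub_hom[OF m] and M = sub_dom[OF m] and B = sub_cod[OF m]
  note ph = sub_hom[OF p] and P = sub_dom[OF p] and A = sub_cod[OF p]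
  have "eap (f \<cdot>\<^bsub>E\<^esub> p) k c \<in> img m k" if "c \<in> Sel (Dom E p) k" for k c
  proof -
    have "eap p k c \<in> img p k" using that by (simp add: img_def)
    then show ?thesis using eap_comp[OF f ph Sel_el[OF that]] by (simp add: im pull_set_def)
  qed
  from sub_factor[OF m E.comp_in[OF f ph] this]
  obtain q where q: "q \<in> hom E (Dom E p) (Dom E m)" "m \<cdot>\<^bsub>E\<^esub> q = f \<cdot>\<^bsub>E\<^esub> p" by blast
  have "\<exists>!h. h \<in> hom E s (Dom E p) \<and> p \<cdot>\<^bsub>E\<^esub> h = \<alpha> \<and> q \<cdot>\<^bsub>E\<^esub> h = \<beta>"
    if al: "\<alpha> \<in> hom E s A" and be: "\<beta> \<in> hom E s (Dom E m)" and eq: "f \<cdot>\<^bsub>E\<^esub> \<alpha> = m \<cdot>\<^bsub>E\<^esub> \<beta>" for s \<alpha> \<beta>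
  proof -
    have "eap \<alpha> k c \<in> img p k" if "c \<in> Sel s k" for k c
    proof -
      have "eap f k (eap \<alpha> k c) = eap m k (eap \<beta> k c)"
        using eap_comp[OF f al Sel_el[OF that]] eap_comp[OF mh be Sel_el[OF that]] eq by simp
      then show ?thesis using Sel_eap[OF al that] Sel_eap[OF be that] by (simp add: im pull_set_def img_def)
    qed
    from sub_factor[OF p al this] obtain h where h: "h \<in> hom E s (Dom E p)" "p \<cdot>\<^bsub>E\<^esub> h = \<alpha>" by blast
    have qh: "q \<cdot>\<^bsub>E\<^esub> h = \<beta>"
    proof (rule L0_eq[OF M E.comp_in[OF q(1) h(1)] be])
      fix k c assume c: "c \<in> Sel s k"
      have "m \<cdot>\<^bsub>E\<^esub> (q \<cdot>\<^bsub>E\<^esub> h) = m \<cdot>\<^bsub>E\<^esub> \<beta>" using E.assoc[OF mh q(1) h(1)] E.assoc[OF f ph h(1)] q(2) h(2) eq by simp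
      then have "eap m k (eap (q \<cdot>\<^bsub>E\<^esub> h) k c) = eap m k (eap \<beta> k c)"
        using eap_comp[OF mh E.comp_in[OF q(1) h(1)] Sel_el[OF c]] eap_comp[OF mh be Sel_el[OF c]] by simp
      then show "eap (q \<cdot>\<^bsub>E\<^esub> h) k c = eap \<beta> k c"
        using sub_inj[OF m] Sel_eap[OF E.comp_in[OF q(1) h(1)] c] Sel_eap[OF be c] by blast
    qed
    show ?thesis
    proof (rule ex1I[of _ h])
      show "h \<in> hom E s (Dom E p) \<and> p \<cdot>\<^bsub>E\<^esub> h = \<alpha> \<and> q \<cdot>\<^bsub>E\<^esub> h = \<beta>" using h qh by simp
      fix h' assume "h' \<in> hom E s (Dom E p) \<and> p \<cdot>\<^bsub>E\<^esub> h' = \<alpha> \<and> q \<cdot>\<^bsub>E\<^esub> h' = \<beta>"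
      then have h': "h' \<in> hom E s (Dom E p)" "p \<cdot>\<^bsub>E\<^esub> h' = p \<cdot>\<^bsub>E\<^esub> h" using h(2) by auto
      show "h' = h"
      proof (rule L0_eq[OF P h'(1) h(1)])
        fix k c assume c: "c \<in> Sel s k"
        have "eap p k (eap h' k c) = eap p k (eap h k c)"
          using eap_comp[OF ph h'(1) Sel_el[OF c]] eap_comp[OF ph h(1) Sel_el[OF c]] h'(2) by simp
        then show "eap h' k c = eap h k c" using sub_inj[OF p] Sel_eap[OF h'(1) c] Sel_eap[OF h(1) c] by blast
      qed
    qed
  qed
  then have "is_pullback C f m p q"
    unfolding is_pullback_def
    using f mh ph q A B M P homD[OF f] homD[OF mh] homD[OF ph] homD[OF q(1)]
    by (simp add: hom_full_iff) (simp add: full_subcat_def)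
  then show ?thesis by blast
qed

lemma sub_pull_iff:
  assumes "m \<in> sub C B" "f \<in> hom E A B" "A \<in> L0"
  shows "sub_pull C f m p \<longleftrightarrow> p \<in> sub C A \<and> img p = pull_set A f (img m)"
  using pullback_img[OF assms] pullback_ex[OF assms(1,2)] unfolding sub_pull_def by blast

text \<open>The Kripke-Joyal clause: all elements above all faces of \<open>b\<close> are tested,
  not just those above \<open>b\<close>.\<close>

definition forall_set where
  "forall_set A B f R k = {b \<in> Sel B k. \<forall>j. \<forall>g \<in> hom Delta j k. inj_on (ev g) {..j} \<longrightarrow>
     (\<forall>c \<in> Sel A j. eap f j c = res B g b \<longrightarrow> c \<in> R j)}"

lemma closed_forall:
  assumes f: "f \<in> hom E A B"
  shows "closed_in B (forall_set A B f R)"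
  unfolding closed_in_def
proof (intro conjI allI ballI impI)
  have B: "B \<in> Ob E" using E.cod_ob[OF f] .
  show "forall_set A B f R k \<subseteq> Sel B k" for k by (auto simp: forall_set_def)
  fix k m g b assume g: "g \<in> hom Delta m k" "inj_on (ev g) {..m}" and b: "b \<in> forall_set A B f R k"
  have bS: "b \<in> Sel B k" using b by (simp add: forall_set_def)
  have "c \<in> R j" if h: "h \<in> hom Delta j m" "inj_on (ev h) {..j}" and c: "c \<in> Sel A j" "eap f j c = res B h (res B g b)" for j h c
    using b c res_comp[OF B g(1) h(1) Sel_el[OF bS]] Delta_comp_in[OF g(1) h(1)] inj_comp[OF h(1) g(1) h(2) g(2)]
    unfolding forall_set_def by auto
  then show "res B g b \<in> forall_set A B f R m" using Sel_res[OF B bS g] by (simp add: forall_set_def)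
qed

lemma sub_forall_iff:
  assumes m: "m \<in> sub C A" and f: "f \<in> hom E A B" and B: "B \<in> L0"
  shows "sub_forall C f m v \<longleftrightarrow> v \<in> sub C B \<and> img v = forall_set A B f (img m)"
proof -
  note A = sub_cod[OF m]
  have BO: "B \<in> Ob E" and AO: "A \<in> Ob E" using L0_Ob A B by auto
  have Cf: "Cod E f = B" using homD[OF f] by simp
  have le: "(\<forall>p. sub_pull C f h p \<longrightarrow> sub_le C p m) \<longleftrightarrow> (\<forall>k. img h k \<subseteq> forall_set A B f (img m) k)"
    if h: "h \<in> sub C B" for h
  proof -
    obtain n where n: "n \<in> sub C A" "img n = pull_set A f (img h)"
      using sub_ex[OF A closed_pull[OF f img_closed[OF h]]] by blast
    have "(\<forall>p. sub_pull C f h p \<longrightarrow> sub_le C p m) \<longleftrightarrow> (\<forall>k. pull_set A f (img h) k \<subseteq> img m k)"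
    proof
      assume "\<forall>p. sub_pull C f h p \<longrightarrow> sub_le C p m"
      then have "sub_le C n m" using n sub_pull_iff[OF h f A] by blast
      then show "\<forall>k. pull_set A f (img h) k \<subseteq> img m k" using sub_le_iff[OF n(1) m] n(2) by simp
    next
      assume *: "\<forall>k. pull_set A f (img h) k \<subseteq> img m k"
      show "\<forall>p. sub_pull C f h p \<longrightarrow> sub_le C p m"
      proof (intro allI impI)
        fix p assume "sub_pull C f h p"
        then have p: "p \<in> sub C A" "img p = pull_set A f (img h)" using sub_pull_iff[OF h f A] by auto
        then show "sub_le C p m" using sub_le_iff[OF p(1) m] * by simp
      qed
    qed
    also have "\<dots> \<longleftrightarrow> (\<forall>k. img h k \<subseteq> forall_set A B f (img m) k)"
    proof
      assume *: "\<forall>k. pull_set A f (img h) k \<subseteq> img m k"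
      show "\<forall>k. img h k \<subseteq> forall_set A B f (img m) k"
      proof (intro allI subsetI)
        fix k b assume b: "b \<in> img h k"
        have "c \<in> img m j" if "g \<in> hom Delta j k" "inj_on (ev g) {..j}" "c \<in> Sel A j" "eap f j c = res B g b" for j g c
        proof -
          have "c \<in> pull_set A f (img h) j"
            using that closed_inD(2)[OF img_closed[OF h] b that(1,2)] by (simp add: pull_set_def)
          then show ?thesis using * by blast
        qed
        then show "b \<in> forall_set A B f (img m) k" using img_Sel[OF h b] unfolding forall_set_def by blast
      qed
    next
      assume *: "\<forall>k. img h k \<subseteq> forall_set A B f (img m) k"
      show "\<forall>k. pull_set A f (img h) k \<subseteq> img m k"
      proof (intro allI subsetI)
        fix k c assume "c \<in> pull_set A f (img h) k"
        then have c: "c \<in> Sel A k" "eap f k c \<in> img h k" by (auto simp: pull_set_def)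
        have "eap f k c \<in> forall_set A B f (img m) k" using * c(2) by blast
        moreover have "eap f k c = res B (Idt Delta k) (eap f k c)" using res_id[OF BO eap_in[OF f Sel_el[OF c(1)]]] by simp
        moreover have "inj_on (ev (Idt Delta k)) {..k}" by (simp add: inj_on_def)
        ultimately show "c \<in> img m k" using c(1) Delta_id_in unfolding forall_set_def by blast
      qed
    qed
    finally show ?thesis .
  qed
  show ?thesis
  proof
    assume v: "sub_forall C f m v"
    then have vS: "v \<in> sub C B" by (simp add: sub_forall_def Cf)
    have "img v = forall_set A B f (img m)"
      by (rule img_char[OF vS closed_forall[OF f]]) (use v le Cf in \<open>simp add: sub_forall_def\<close>)
    then show "v \<in> sub C B \<and> img v = forall_set A B f (img m)" using vS by simp
  next
    assume "v \<in> sub C B \<and> img v = forall_set A B f (img m)"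
    then show "sub_forall C f m v" using le sub_le_iff Cf by (simp add: sub_forall_def)
  qed
qed

end

section \<open>Truth values and the formulas IBD\<close>

context e_acute_topos
begin

text \<open>A classifier may use any terminal object, not just \<open>One\<close>; each has exactly
  the nondegenerate simplices as its nondegenerate elements.\<close>

lemma terminal_element:
  assumes T: "terminal C Tm" and n: "nd k x"
  shows "\<exists>!c. c \<in> Sel Tm k \<and> lb Tm k c = x"
proof -
  have TL: "Tm \<in> L0" using T by (simp add: terminal_def)
  note ptx = pt[OF n]
  obtain h where "h \<in> hom C (aY k x) Tm" using T ptx(1) by (auto simp: terminal_def)
  then have h: "h \<in> hom E (aY k x) Tm" by (simp add: hom_full_iff)
  have u: "c = eap h k (pt k x)" if c: "c \<in> Sel Tm k" "lb Tm k c = x" for c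
  proof -
    obtain g where g: "g \<in> hom E (aY k x) Tm" "eap g k (pt k x) = c" using pt_hom[OF c(1) TL] c(2) by auto
    have "g = h" using terminal_hom[OF T, of "aY k x" g h] ptx(1) g(1) h TL by (simp add: hom_full_iff)
    then show ?thesis using g(2) by simp
  qed
  have "lb Tm k (eap h k (pt k x)) = x" using eap_lb[OF h Sel_el[OF ptx(2)]] ptx(3) by simp
  then show ?thesis using u Sel_eap[OF h ptx(2)] by blast
qed

lemma inj_id: "inj_on (ev (Idt Delta k)) {..k}" by (simp add: inj_on_def)

text \<open>The nondegenerate elements of the subobject classifier are the sieves of nondegenerate faces.\<close>

lemma truth_ex:
  obtains t \<Omega> where "\<Omega> \<in> L0" "t \<in> hom E One \<Omega>"
    "\<And>k w w'. w \<in> Sel \<Omega> k \<Longrightarrow> w' \<in> Sel \<Omega> k \<Longrightarrow> lb \<Omega> k w = lb \<Omega> k w' \<Longrightarrow>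
       (\<forall>m. \<forall>f \<in> hom Delta m k. inj_on (ev f) {..m} \<longrightarrow> (res \<Omega> f w \<in> img t m \<longleftrightarrow> res \<Omega> f w' \<in> img t m)) \<Longrightarrow> w = w'"
    "\<And>k x R. nd k x \<Longrightarrow> (\<forall>m j. \<forall>f \<in> hom Delta m k. \<forall>g \<in> hom Delta j m. f \<in> R \<longrightarrow> inj_on (ev g) {..j} \<longrightarrow>
         f \<cdot>\<^bsub>Delta\<^esub> g \<in> R) \<Longrightarrow>
       \<exists>w \<in> Sel \<Omega> k. lb \<Omega> k w = x \<and>
         (\<forall>m. \<forall>f \<in> hom Delta m k. inj_on (ev f) {..m} \<longrightarrow> (res \<Omega> f w \<in> img t m \<longleftrightarrow> f \<in> R))"
proof -
  \<comment> \<open>The maximal sieve at \<open>x\<close>, later the truth value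
    \<open>true\<close>.\<close>
  define Mx where "Mx k x = {f. \<exists>m. f \<in> hom Delta m k \<and> nd m (act X f x)}" for k x
  have Mx: "f \<in> Mx k x \<longleftrightarrow> nd m (act X f x)" if "f \<in> hom Delta m k" for f m k x
    using that homD[OF that] unfolding Mx_def by (auto dest: homD)
  have Mx_hom: "\<exists>m. f \<in> hom Delta m k \<and> nd m (act X f x)" if "f \<in> Mx k x" for f k x
    using that by (simp add: Mx_def)
  \<comment> \<open>Sieves are taken at degenerate simplices too, so as to have a presheaf on all of
    them; the classifier is its reflection, with unchanged nondegenerate elements.\<close>
  define B where "B k = {b. fst b \<in> on_ob X k \<and> snd b \<subseteq> Mx k (fst b) \<and>
     (\<forall>m j. \<forall>f \<in> hom Delta m k. \<forall>g \<in> hom Delta j m. f \<in> snd b \<longrightarrow> inj_on (ev g) {..j} \<longrightarrow> f \<cdot>\<^bsub>Delta\<^esub> g \<in> snd b)}" for k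
  define ac :: "simp_op \<Rightarrow> 'u \<times> simp_op set \<Rightarrow> 'u \<times> simp_op set" where
    "ac h b = (act X h (fst b), {f \<in> Mx (Dom Delta h) (act X h (fst b)). h \<cdot>\<^bsub>Delta\<^esub> f \<in> snd b})" for h b
  have BD: "fst b \<in> on_ob X k" "snd b \<subseteq> Mx k (fst b)"
    "\<And>m j f g. f \<in> hom Delta m k \<Longrightarrow> g \<in> hom Delta j m \<Longrightarrow> f \<in> snd b \<Longrightarrow> inj_on (ev g) {..j} \<Longrightarrow> f \<cdot>\<^bsub>Delta\<^esub> g \<in> snd b"
    if "b \<in> B k" for b k using that unfolding B_def by blast+
  have acs: "f \<in> snd (ac h b) \<longleftrightarrow> f \<in> Mx m (act X h (fst b)) \<and> h \<cdot>\<^bsub>Delta\<^esub> f \<in> snd b" if "h \<in> hom Delta m k" for h m k f b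
    using homD[OF that] by (simp add: ac_def)
  have acf: "fst (ac h b) = act X h (fst b)" for h b by (simp add: ac_def)
  have acB: "ac h b \<in> B m" if h: "h \<in> hom Delta m k" and b: "b \<in> B k" for h m k b
  proof -
    have "f \<cdot>\<^bsub>Delta\<^esub> g \<in> snd (ac h b)"
      if f: "f \<in> hom Delta n m" "f \<in> snd (ac h b)" and g: "g \<in> hom Delta j n" "inj_on (ev g) {..j}" for n j f g
    proof -
      have hx: "act X h (fst b) \<in> on_ob X m" using act_in[OF X h BD(1)[OF b]] .
      have n: "nd n (act X f (act X h (fst b)))" and hf: "h \<cdot>\<^bsub>Delta\<^esub> f \<in> snd b"
        using f acs[OF h] Mx[OF f(1)] by auto
      have "nd j (act X (f \<cdot>\<^bsub>Delta\<^esub> g) (act X h (fst b)))" "h \<cdot>\<^bsub>Delta\<^esub> (f \<cdot>\<^bsub>Delta\<^esub> g) \<in> snd b"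
        using nd_face[OF n g] act_comp[OF X f(1) g(1) hx] BD(3)[OF b Delta_comp_in[OF h f(1)] g(1) hf g(2)]
          Delta.assoc[OF h f(1) g(1)] by simp_all
      then show ?thesis using acs[OF h] Mx[OF Delta_comp_in[OF f(1) g(1)]] by blast
    qed
    moreover have "fst (ac h b) \<in> on_ob X m" using act_in[OF X h BD(1)[OF b]] by (simp add: acf)
    moreover have "snd (ac h b) \<subseteq> Mx m (fst (ac h b))" using acs[OF h, of _ b] unfolding acf by blast
    ultimately show ?thesis unfolding B_def by blast
  qed
  have "\<exists>p e. presents B ac (\<lambda>k. fst) e p"
  proof (rule presents_ex)
    fix k
    define I where "I = {f \<in> Arr Delta. Cod Delta f = k \<and> Dom Delta f \<le> k}"
    show "|B k| <o r"
    proof (rule small_subset)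
      show "B k \<subseteq> on_ob X k \<times> Pow I"
      proof
        fix b assume b: "b \<in> B k"
        have "f \<in> I" if fb: "f \<in> snd b" for f
        proof -
          obtain m where m: "f \<in> hom Delta m k" "nd m (act X f (fst b))" using fb BD(2)[OF b] Mx_hom by blast
          then show ?thesis using inj_dim[OF m(1) nd_inj[OF m(2) BD(1)[OF b] m(1)]] homD[OF m(1)] by (simp add: I_def)
        qed
        then show "b \<in> on_ob X k \<times> Pow I" using BD(1)[OF b] by (auto simp: mem_Times_iff)
      qed
      show "|on_ob X k \<times> Pow I| <o r"
        by (intro small_Sigma simp_card[OF X] small_finite) (simp add: I_def finite_Delta)
    qed
  next
    fix f m k b assume f: "f \<in> hom Delta m k" and b: "b \<in> B k"
    show "ac f b \<in> B m" using acB[OF f b] .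
    show "fst (ac f b) = act X f (fst b)" by (rule acf)
  next
    fix k b assume b: "b \<in> B k"
    note i = Delta_id_in[of k]
    have "f \<in> snd (ac (Idt Delta k) b) \<longleftrightarrow> f \<in> snd b" for f
    proof (cases "f \<in> Mx k (fst b)")
      case True
      then obtain m where "f \<in> hom Delta m k" using Mx_hom by blast
      then show ?thesis using acs[OF i, of f b] act_id[OF X BD(1)[OF b]] Delta.idl[of f] True by simp
    qed (use acs[OF i, of f b] act_id[OF X BD(1)[OF b]] BD(2)[OF b] in auto)
    then show "ac (Idt Delta k) b = b" using act_id[OF X BD(1)[OF b]] by (simp add: prod_eq_iff acf set_eq_iff)
    show "fst b \<in> on_ob X k" using BD(1)[OF b] .
  next
    fix f g m k j b assume f: "f \<in> hom Delta m k" and g: "g \<in> hom Delta j m" and b: "b \<in> B k"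
    have fx: "act X f (fst b) \<in> on_ob X m" using act_in[OF X f BD(1)[OF b]] .
    have eq: "act X g (act X f (fst b)) = act X (f \<cdot>\<^bsub>Delta\<^esub> g) (fst b)" using act_comp[OF X f g BD(1)[OF b]] .
    have "h \<in> snd (ac g (ac f b)) \<longleftrightarrow> h \<in> snd (ac (f \<cdot>\<^bsub>Delta\<^esub> g) b)" for h
    proof (cases "h \<in> Mx j (act X g (act X f (fst b)))")
      case True
      then obtain n where n: "h \<in> hom Delta n j" "nd n (act X h (act X g (act X f (fst b))))" using Mx_hom by blast
      have "g \<cdot>\<^bsub>Delta\<^esub> h \<in> Mx m (act X f (fst b))"
        using Mx[OF Delta_comp_in[OF g n(1)]] n(2) act_comp[OF X g n(1) fx] by simp
      then show ?thesis
        using True acs[OF g, of h "ac f b"] acs[OF f, of "g \<cdot>\<^bsub>Delta\<^esub> h" b] acs[OF Delta_comp_in[OF f g], of h b]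
          Delta.assoc[OF f g n(1)] eq by (simp add: acf)
    next
      case False
      then show ?thesis using acs[OF g, of h "ac f b"] acs[OF Delta_comp_in[OF f g], of h b] eq by (simp add: acf)
    qed
    then show "ac g (ac f b) = ac (f \<cdot>\<^bsub>Delta\<^esub> g) b" using eq by (simp add: prod_eq_iff acf set_eq_iff)
  qed
  then obtain W e where P: "presents B ac (\<lambda>k. fst) e W" by blast
  note W = presents_Ob[OF P]
  have MB: "(x, Mx k x) \<in> B k" if x: "x \<in> on_ob X k" for k x
  proof -
    have "f \<cdot>\<^bsub>Delta\<^esub> g \<in> Mx k x" if f: "f \<in> hom Delta m k" "f \<in> Mx k x" and g: "g \<in> hom Delta j m" "inj_on (ev g) {..j}" for f m g j
      using Mx[OF f(1)] f(2) nd_face[OF _ g, of "act X f x"] act_comp[OF X f(1) g(1) x]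
        Mx[OF Delta_comp_in[OF f(1) g(1)]] by metis
    then show ?thesis using x unfolding B_def by auto
  qed
  have "\<exists>h \<in> hom E One W. \<forall>k. \<forall>x \<in> el One k. eap h k x = e k (x, Mx k x)"
  proof (rule hom_ex[OF One_Ob W])
    fix k x assume "x \<in> el One k"
    then have x: "x \<in> on_ob X k" by simp
    show "e k (x, Mx k x) \<in> el W k" using presents_in[OF P MB[OF x]] .
    show "lb W k (e k (x, Mx k x)) = lb One k x" using presents_lb[OF P MB[OF x]] One_lb[OF x] by simp
    fix f m assume f: "f \<in> hom Delta m k"
    have rx: "res One f x = act X f x"
      using lb_res[OF One_Ob f] res_in[OF One_Ob f] x One_lb[OF x] One_lb[of "res One f x" m] by simp
    have "h \<in> Mx m (act X f x) \<longleftrightarrow> h \<in> snd (ac f (x, Mx k x))" for h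
    proof (cases "h \<in> Mx m (act X f x)")
      case True
      then obtain n where n: "h \<in> hom Delta n m" "nd n (act X h (act X f x))" using Mx_hom by blast
      then show ?thesis using acs[OF f] Mx[OF Delta_comp_in[OF f n(1)]] act_comp[OF X f n(1) x] True by simp
    qed (use acs[OF f] in simp)
    then have "(act X f x, Mx m (act X f x)) = ac f (x, Mx k x)" by (simp add: prod_eq_iff acf set_eq_iff)
    then show "e m (res One f x, Mx m (res One f x)) = res W f (e k (x, Mx k x))"
      using presents_res[OF P MB[OF x] f] rx by simp
  qed
  then obtain t0 where t0: "t0 \<in> hom E One W" "\<And>k x. x \<in> on_ob X k \<Longrightarrow> eap t0 k x = e k (x, Mx k x)" by auto
  define \<Omega> where "\<Omega> = on_ob a W"
  define \<sigma> where "\<sigma> = \<eta> W"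
  have Om: "\<Omega> \<in> L0" and sg: "\<sigma> \<in> hom E W \<Omega>" and sS: "Sbij \<sigma> W \<Omega>"
    using aL[OF W] eta[OF W] unitS[OF W] by (auto simp: \<Omega>_def \<sigma>_def)
  define t where "t = \<sigma> \<cdot>\<^bsub>E\<^esub> t0"
  have t: "t \<in> hom E One \<Omega>" using E.comp_in[OF sg t0(1)] by (simp add: t_def)
  have tD: "Dom E t = One" using homD[OF t] by simp
  have tv: "eap t k x = eap \<sigma> k (e k (x, Mx k x))" if "x \<in> on_ob X k" for k x
    using eap_comp[OF sg t0(1), of x k] t0(2)[OF that] that by (simp add: t_def)
  have eS: "e k b \<in> Sel W k" if "b \<in> B k" "nd k (fst b)" for k b
    using presents_in[OF P that(1)] presents_lb[OF P that(1)] that(2) by (simp add: Sel_def)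
  have in_t: "eap \<sigma> k (e k b) \<in> img t k \<longleftrightarrow> snd b = Mx k (fst b)" if b: "b \<in> B k" "nd k (fst b)" for k b
  proof
    assume "eap \<sigma> k (e k b) \<in> img t k"
    then obtain x where x: "x \<in> Sel One k" "eap \<sigma> k (e k b) = eap t k x" by (auto simp: img_def tD)
    have xX: "x \<in> on_ob X k" "nd k x" using x(1) One_lb by (auto simp: Sel_def)
    have "e k b = e k (x, Mx k x)"
      using Sbij_inj[OF sS eS[OF b] eS[OF MB[OF xX(1)]]] x(2) tv[OF xX(1)] xX(2) by simp
    then have "b = (x, Mx k x)" using presents_inj[OF P b(1) MB[OF xX(1)]] by blast
    then show "snd b = Mx k (fst b)" by simp
  next
    assume "snd b = Mx k (fst b)"
    then have "b = (fst b, Mx k (fst b))" by (simp add: prod_eq_iff)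
    then have "eap \<sigma> k (e k b) = eap t k (fst b)" using tv[OF BD(1)[OF b(1)]] by simp
    moreover have "fst b \<in> Sel One k" using BD(1)[OF b(1)] b(2) One_lb by (simp add: Sel_def)
    ultimately show "eap \<sigma> k (e k b) \<in> img t k" unfolding img_def tD by blast
  qed
  \<comment> \<open>A restricted sieve is maximal exactly when it contains the identity, that is,
    when the original sieve contains \<open>f\<close>.\<close>
  have face: "res \<Omega> f (eap \<sigma> k (e k b)) \<in> img t m \<longleftrightarrow> f \<in> snd b"
    if b: "b \<in> B k" "nd k (fst b)" and f: "f \<in> hom Delta m k" "inj_on (ev f) {..m}" for k b f m
  proof -
    have n: "nd m (act X f (fst b))" using nd_face[OF b(2) f] .
    have "res \<Omega> f (eap \<sigma> k (e k b)) = eap \<sigma> m (e m (ac f b))"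
      using eap_res[OF sg f(1) presents_in[OF P b(1)]] presents_res[OF P b(1) f(1)] by simp
    then have "res \<Omega> f (eap \<sigma> k (e k b)) \<in> img t m \<longleftrightarrow> snd (ac f b) = Mx m (act X f (fst b))"
      using in_t[OF acB[OF f(1) b(1)]] n by (simp add: acf)
    also have "\<dots> \<longleftrightarrow> f \<in> snd b"
    proof
      assume eq: "snd (ac f b) = Mx m (act X f (fst b))"
      have "Idt Delta m \<in> Mx m (act X f (fst b))"
        using Mx[OF Delta_id_in] act_id[OF X nd_in[OF n]] n by simp
      then have "f \<cdot>\<^bsub>Delta\<^esub> Idt Delta m \<in> snd b" using acs[OF f(1)] eq by blast
      then show "f \<in> snd b" using Delta.idr[OF f(1)] by simp
    next
      assume fb: "f \<in> snd b"
      have "g \<in> snd (ac f b)" if g: "g \<in> Mx m (act X f (fst b))" for g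
      proof -
        obtain j where j: "g \<in> hom Delta j m" "nd j (act X g (act X f (fst b)))" using Mx_hom[OF g] by blast
        show ?thesis using acs[OF f(1)] g BD(3)[OF b(1) f(1) j(1) fb nd_inj[OF j(2) nd_in[OF n] j(1)]] by blast
      qed
      then show "snd (ac f b) = Mx m (act X f (fst b))" using acs[OF f(1)] by blast
    qed
    finally show ?thesis .
  qed
  show thesis
  proof (rule that[OF Om t])
    fix k w w' assume w: "w \<in> Sel \<Omega> k" and w': "w' \<in> Sel \<Omega> k" and l: "lb \<Omega> k w = lb \<Omega> k w'"
      and eq: "\<forall>m. \<forall>f \<in> hom Delta m k. inj_on (ev f) {..m} \<longrightarrow> (res \<Omega> f w \<in> img t m \<longleftrightarrow> res \<Omega> f w' \<in> img t m)"
    have rep: "\<exists>b \<in> B k. w = eap \<sigma> k (e k b) \<and> nd k (fst b) \<and> lb \<Omega> k w = fst b" if w: "w \<in> Sel \<Omega> k" for w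
    proof -
      obtain c where c: "c \<in> Sel W k" "w = eap \<sigma> k c" using Sbij_surj[OF sS w] by blast
      obtain b where b: "b \<in> B k" "c = e k b" using presents_surj[OF P Sel_el[OF c(1)]] by blast
      have "lb \<Omega> k w = fst b" using eap_lb[OF sg Sel_el[OF c(1)]] presents_lb[OF P b(1)] c(2) b(2) by simp
      then show ?thesis using w b c(2) by (auto simp: Sel_def)
    qed
    obtain b where b: "b \<in> B k" "w = eap \<sigma> k (e k b)" "nd k (fst b)" "lb \<Omega> k w = fst b" using rep[OF w] by blast
    obtain b' where b': "b' \<in> B k" "w' = eap \<sigma> k (e k b')" "nd k (fst b')" "lb \<Omega> k w' = fst b'" using rep[OF w'] by blast
    have fb: "fst b = fst b'" using l b(4) b'(4) by simp
    have "f \<in> snd b \<longleftrightarrow> f \<in> snd b'" for f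
    proof (cases "f \<in> Mx k (fst b)")
      case True
      then obtain m where m: "f \<in> hom Delta m k" "nd m (act X f (fst b))" using Mx_hom by blast
      have i: "inj_on (ev f) {..m}" using nd_inj[OF m(2) BD(1)[OF b(1)] m(1)] .
      show ?thesis using face[OF b(1,3) m(1) i] face[OF b'(1,3) m(1) i] eq m(1) i b(2) b'(2) by simp
    qed (use BD(2)[OF b(1)] BD(2)[OF b'(1)] fb in auto)
    then have "b = b'" using fb by (simp add: prod_eq_iff set_eq_iff)
    then show "w = w'" using b(2) b'(2) by simp
  next
    fix k x R assume n: "nd k x" and R: "\<forall>m j. \<forall>f \<in> hom Delta m k. \<forall>g \<in> hom Delta j m. f \<in> R \<longrightarrow> inj_on (ev g) {..j} \<longrightarrow>
         f \<cdot>\<^bsub>Delta\<^esub> g \<in> R"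
    \<comment> \<open>\<open>R\<close> is an arbitrary set of operators closed under faces; the
      intersection leaves those which a sieve at \<open>x\<close> may contain.\<close>
    define b where "b = (x, R \<inter> Mx k x)"
    have b: "b \<in> B k"
      using R MB[OF nd_in[OF n]] nd_in[OF n] unfolding B_def b_def by simp
    have nb: "nd k (fst b)" using n by (simp add: b_def)
    have "eap \<sigma> k (e k b) \<in> Sel \<Omega> k" using Sel_eap[OF sg eS[OF b nb]] .
    moreover have "lb \<Omega> k (eap \<sigma> k (e k b)) = x"
      using eap_lb[OF sg presents_in[OF P b]] presents_lb[OF P b] by (simp add: b_def)
    moreover have "res \<Omega> f (eap \<sigma> k (e k b)) \<in> img t m \<longleftrightarrow> f \<in> R" if f: "f \<in> hom Delta m k" "inj_on (ev f) {..m}" for f m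
      using face[OF b nb f] nd_face[OF n f] Mx[OF f(1)] by (simp add: b_def)
    ultimately show "\<exists>w \<in> Sel \<Omega> k. lb \<Omega> k w = x \<and>
         (\<forall>m. \<forall>f \<in> hom Delta m k. inj_on (ev f) {..m} \<longrightarrow> (res \<Omega> f w \<in> img t m \<longleftrightarrow> f \<in> R))" by blast
  qed
qed

text \<open>Arrows keep labels, and a terminal object has one nondegenerate element for each
  label.\<close>

lemma terminal_sub:
  assumes t: "t \<in> hom E Tm \<Omega>" and T: "terminal C Tm" and Om: "\<Omega> \<in> L0"
  shows "t \<in> sub C \<Omega>"
proof -
  have TL: "Tm \<in> L0" using T by (simp add: terminal_def)
  have D: "Dom E t = Tm" using homD[OF t] by simp
  show ?thesis
    unfolding sub_iff D
  proof (intro conjI TL Om t allI inj_onI)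
    fix k b b' assume b: "b \<in> Sel Tm k" "b' \<in> Sel Tm k" "eap t k b = eap t k b'"
    have "lb Tm k b = lb Tm k b'" using eap_lb[OF t Sel_el[OF b(1)]] eap_lb[OF t Sel_el[OF b(2)]] b(3) by simp
    moreover have "nd k (lb Tm k b)" using b(1) by (simp add: Sel_def)
    ultimately show "b = b'" using terminal_element[OF T] b(1,2) by metis
  qed
qed

text \<open>The classifying arrow sends an element to the sieve of its faces that lie in the
  subobject. A pullback square determines these sieves, hence the arrow.\<close>

lemma classifier_ex: "\<exists>t. subobject_classifier C t"
proof -
  obtain t \<Omega> where Om: "\<Omega> \<in> L0" and t: "t \<in> hom E One \<Omega>"
    and Oeq: "\<And>k w w'. w \<in> Sel \<Omega> k \<Longrightarrow> w' \<in> Sel \<Omega> k \<Longrightarrow> lb \<Omega> k w = lb \<Omega> k w' \<Longrightarrow>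
       (\<forall>m. \<forall>f \<in> hom Delta m k. inj_on (ev f) {..m} \<longrightarrow> (res \<Omega> f w \<in> img t m \<longleftrightarrow> res \<Omega> f w' \<in> img t m)) \<Longrightarrow> w = w'"
    and Oex: "\<And>k x R. nd k x \<Longrightarrow> (\<forall>m j. \<forall>f \<in> hom Delta m k. \<forall>g \<in> hom Delta j m. f \<in> R \<longrightarrow> inj_on (ev g) {..j} \<longrightarrow>
         f \<cdot>\<^bsub>Delta\<^esub> g \<in> R) \<Longrightarrow>
       \<exists>w \<in> Sel \<Omega> k. lb \<Omega> k w = x \<and>
         (\<forall>m. \<forall>f \<in> hom Delta m k. inj_on (ev f) {..m} \<longrightarrow> (res \<Omega> f w \<in> img t m \<longleftrightarrow> f \<in> R))"
    by (rule truth_ex) (rule that)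
  have OmO: "\<Omega> \<in> Ob E" using L0_Ob[OF Om] .
  have tS: "t \<in> sub C \<Omega>" by (rule terminal_sub[OF t One_terminal Om])
  have tC: "t \<in> Arr C" "Dom C t = One" "Cod C t = \<Omega>" using t Om One_L0 by (auto simp: hom_def full_subcat_def)
  have "\<exists>!\<chi>. \<chi> \<in> hom C (Cod C m) (Cod C t) \<and> (\<exists>u. is_pullback C \<chi> t m u)" if m0: "monic C m" for m
  proof -
    define A where "A = Cod E m"
    have m: "m \<in> sub C A" using m0 by (simp add: sub_def A_def)
    have A: "A \<in> L0" and AO: "A \<in> Ob E" using sub_cod[OF m] L0_Ob by auto
    note mcl = closed_inD[OF img_closed[OF m]]
    define Q where "Q k \<alpha> w \<longleftrightarrow> w \<in> Sel \<Omega> k \<and> lb \<Omega> k w = lb A k \<alpha> \<and>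
      (\<forall>j. \<forall>f \<in> hom Delta j k. inj_on (ev f) {..j} \<longrightarrow> (res \<Omega> f w \<in> img t j \<longleftrightarrow> res A f \<alpha> \<in> img m j))" for k \<alpha> w
    have Qex: "\<exists>w. Q k \<alpha> w" if al: "\<alpha> \<in> Sel A k" for k \<alpha>
    proof -
      have "nd k (lb A k \<alpha>)" using al by (simp add: Sel_def)
      moreover have "f \<cdot>\<^bsub>Delta\<^esub> g \<in> {f. \<exists>n. f \<in> hom Delta n k \<and> res A f \<alpha> \<in> img m n}"
        if f: "f \<in> hom Delta i k" "f \<in> {f. \<exists>n. f \<in> hom Delta n k \<and> res A f \<alpha> \<in> img m n}"
          and g: "g \<in> hom Delta j i" "inj_on (ev g) {..j}" for i j f g
      proof -
        have "res A f \<alpha> \<in> img m i" using f by (auto dest: homD)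
        then show ?thesis
          using mcl(2)[OF _ g, of "res A f \<alpha>"] res_comp[OF AO f(1) g(1) Sel_el[OF al]] Delta_comp_in[OF f(1) g(1)]
          by (intro CollectI exI[of _ j]) simp
      qed
      ultimately obtain w where w: "w \<in> Sel \<Omega> k" "lb \<Omega> k w = lb A k \<alpha>"
        "\<forall>j. \<forall>f \<in> hom Delta j k. inj_on (ev f) {..j} \<longrightarrow>
           (res \<Omega> f w \<in> img t j \<longleftrightarrow> f \<in> {f. \<exists>n. f \<in> hom Delta n k \<and> res A f \<alpha> \<in> img m n})"
        using Oex[of k "lb A k \<alpha>" "{f. \<exists>n. f \<in> hom Delta n k \<and> res A f \<alpha> \<in> img m n}"] by blast
      have "f \<in> {f. \<exists>n. f \<in> hom Delta n k \<and> res A f \<alpha> \<in> img m n} \<longleftrightarrow> res A f \<alpha> \<in> img m j" if "f \<in> hom Delta j k" for j f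
        using that by (auto dest: homD)
      then have "Q k \<alpha> w" using w unfolding Q_def by blast
      then show ?thesis by blast
    qed
    have Quniq: "w = w'" if "Q k \<alpha> w" "Q k \<alpha> w'" for k \<alpha> w w'
      using Oeq[of w k w'] that unfolding Q_def by metis
    define \<phi> where "\<phi> k \<alpha> = (SOME w. Q k \<alpha> w)" for k \<alpha>
    have phi: "Q k \<alpha> (\<phi> k \<alpha>)" if "\<alpha> \<in> Sel A k" for k \<alpha> unfolding \<phi>_def by (rule someI_ex[OF Qex[OF that]])
    have "Nat A \<Omega> \<phi>"
      unfolding Nat_def
    proof (intro conjI allI ballI impI)
      fix k \<alpha> assume al: "\<alpha> \<in> Sel A k"
      show "\<phi> k \<alpha> \<in> el \<Omega> k" "lb \<Omega> k (\<phi> k \<alpha>) = lb A k \<alpha>" using phi[OF al] Sel_el unfolding Q_def by blast+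
    next
      fix k j f \<alpha> assume al: "\<alpha> \<in> Sel A k" and f: "f \<in> hom Delta j k" "inj_on (ev f) {..j}"
      have w: "\<phi> k \<alpha> \<in> Sel \<Omega> k" using phi[OF al] by (simp add: Q_def)
      show "\<phi> j (res A f \<alpha>) = res \<Omega> f (\<phi> k \<alpha>)"
      proof (rule Quniq[OF phi[OF Sel_res[OF AO al f]]])
        have "lb \<Omega> j (res \<Omega> f (\<phi> k \<alpha>)) = lb A j (res A f \<alpha>)"
          using lb_res[OF OmO f(1) Sel_el[OF w]] lb_res[OF AO f(1) Sel_el[OF al]] phi[OF al] by (simp add: Q_def)
        moreover have "res \<Omega> g (res \<Omega> f (\<phi> k \<alpha>)) \<in> img t i \<longleftrightarrow> res A g (res A f \<alpha>) \<in> img m i"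
          if g: "g \<in> hom Delta i j" "inj_on (ev g) {..i}" for i g
          using res_comp[OF OmO f(1) g(1) Sel_el[OF w]] res_comp[OF AO f(1) g(1) Sel_el[OF al]] phi[OF al]
            Delta_comp_in[OF f(1) g(1)] inj_comp[OF g(1) f(1) g(2) f(2)] by (simp add: Q_def)
        ultimately show "Q j (res A f \<alpha>) (res \<Omega> f (\<phi> k \<alpha>))"
          using Sel_res[OF OmO w f] unfolding Q_def by blast
      qed
    qed
    then obtain \<chi> where chi: "\<chi> \<in> hom E A \<Omega>" "\<And>k \<alpha>. \<alpha> \<in> Sel A k \<Longrightarrow> eap \<chi> k \<alpha> = \<phi> k \<alpha>"
      using L0_ext[OF Om AO] by blast
    have "img m k = pull_set A \<chi> (img t) k" for k
    proof -
      have "\<alpha> \<in> img m k \<longleftrightarrow> eap \<chi> k \<alpha> \<in> img t k" if al: "\<alpha> \<in> Sel A k" for \<alpha>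
      proof -
        have w: "\<phi> k \<alpha> \<in> Sel \<Omega> k" using phi[OF al] by (simp add: Q_def)
        have "res \<Omega> (Idt Delta k) (\<phi> k \<alpha>) \<in> img t k \<longleftrightarrow> res A (Idt Delta k) \<alpha> \<in> img m k"
          using phi[OF al] Delta_id_in[of k] inj_id[of k] unfolding Q_def by blast
        then show ?thesis using res_id[OF OmO Sel_el[OF w]] res_id[OF AO Sel_el[OF al]] chi(2)[OF al] by simp
      qed
      then show ?thesis using img_Sel[OF m] by (auto simp: pull_set_def)
    qed
    then have "\<exists>u. is_pullback C \<chi> t m u" using pullback_ex[OF tS chi(1) m] by (simp add: fun_eq_iff)
    moreover have "\<chi>' = \<chi>" if h: "\<chi>' \<in> hom E A \<Omega>" and pb: "is_pullback C \<chi>' t m u" for \<chi>' u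
    proof (rule L0_eq[OF Om h chi(1)])
      fix k \<alpha> assume al: "\<alpha> \<in> Sel A k"
      have im: "img m = pull_set A \<chi>' (img t)" using pullback_img(2)[OF tS h A pb] .
      have "res \<Omega> f (eap \<chi>' k \<alpha>) \<in> img t j \<longleftrightarrow> res A f \<alpha> \<in> img m j" if f: "f \<in> hom Delta j k" "inj_on (ev f) {..j}" for j f
        using eap_res[OF h f(1) Sel_el[OF al]] Sel_res[OF AO al f] by (simp add: im pull_set_def)
      then have "Q k \<alpha> (eap \<chi>' k \<alpha>)" using Sel_eap[OF h al] eap_lb[OF h Sel_el[OF al]] by (simp add: Q_def)
      then show "eap \<chi>' k \<alpha> = eap \<chi> k \<alpha>" using Quniq phi[OF al] chi(2)[OF al] by simp
    qed
    ultimately show ?thesis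
      using chi(1) A Om tC(3) by (intro ex1I[of _ \<chi>]) (auto simp: hom_full_iff A_def[symmetric])
  qed
  then have "subobject_classifier C t"
    unfolding subobject_classifier_def using tC One_terminal by simp
  then show ?thesis by blast
qed

text \<open>The evaluation of \<open>IBD\<close> must not depend on the classifier, so what it uses
  is extracted for an arbitrary one.\<close>

lemma classifierD:
  assumes t: "subobject_classifier C t"
  shows "terminal C (Dom E t)" "Dom E t \<in> L0" "Cod E t \<in> L0" "t \<in> sub C (Cod E t)"
    "m \<in> sub C A \<Longrightarrow> \<exists>\<chi> \<in> hom E A (Cod E t). img m = pull_set A \<chi> (img t)"
    "\<exists>b. b \<in> hom E (Cod E t) (Dom E t)"
proof -
  show T: "terminal C (Dom E t)" using t by (simp add: subobject_classifier_def)
  then show D: "Dom E t \<in> L0" by (simp add: terminal_def)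
  have th: "t \<in> hom E (Dom E t) (Cod E t)" and Om: "Cod E t \<in> L0"
    using t by (auto simp: subobject_classifier_def full_subcat_def hom_def)
  then show "Cod E t \<in> L0" by simp
  show tS: "t \<in> sub C (Cod E t)" by (rule terminal_sub[OF th T Om])
  show "\<exists>b. b \<in> hom E (Cod E t) (Dom E t)" using T Om unfolding terminal_def by (auto simp: hom_full_iff)
  assume m: "m \<in> sub C A"
  have "monic C m" "Cod C m = A" using m by (auto simp: sub_def)
  then obtain \<chi> u where chi: "\<chi> \<in> hom C A (Cod C t)" "is_pullback C \<chi> t m u"
    using t unfolding subobject_classifier_def by blast
  have ch: "\<chi> \<in> hom E A (Cod E t)" using chi(1) by (simp add: hom_full_iff)
  show "\<exists>\<chi> \<in> hom E A (Cod E t). img m = pull_set A \<chi> (img t)"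
    using pullback_img(2)[OF tS ch sub_cod[OF m] chi(2)] ch by blast
qed

text \<open>The arrow \<open>b\<close> is unique because its target is terminal, and every other
  ingredient is determined by its image, so the existential quantifiers of \<open>ibd_step\<close>
  collapse to one computation.\<close>

lemma ibd_step_iff:
  assumes t: "subobject_classifier C t" and z: "z \<in> sub C (Dom E t)" and b: "b \<in> hom E (Cod E t) (Dom E t)"
  shows "ibd_step C t z v \<longleftrightarrow> v \<in> sub C (Dom E t) \<and>
    img v = forall_set (Cod E t) (Dom E t) b
      (\<lambda>k. img t k \<union> imp_set (Cod E t) (img t) (pull_set (Cod E t) b (img z)) k)"
    (is "_ \<longleftrightarrow> ?R")
proof -
  define \<Omega> Tm where "\<Omega> = Cod E t" and "Tm = Dom E t"
  note D = classifierD[OF t, folded \<Omega>_def Tm_def] and z = z[folded Tm_def] and b = b[folded \<Omega>_def Tm_def]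
  have bu: "b' = b" if "b' \<in> hom C \<Omega> Tm" for b'
    using terminal_hom[OF D(1), of \<Omega> b' b] that D(2,3) b by (simp add: hom_full_iff)
  show ?thesis
    unfolding \<Omega>_def[symmetric] Tm_def[symmetric]
  proof
    assume "ibd_step C t z v"
    then obtain b' w i j where "b' \<in> hom C \<Omega> Tm" and w0: "sub_pull C b' z w" and i0: "sub_imp C \<Omega> t w i"
      and j0: "sub_join C \<Omega> t i j" and v0: "sub_forall C b' j v"
      unfolding ibd_step_def full_simps \<Omega>_def[symmetric] Tm_def[symmetric] by blast
    then have b': "b' = b" using bu by blast
    have w: "w \<in> sub C \<Omega>" "img w = pull_set \<Omega> b (img z)" using w0 sub_pull_iff[OF z b D(3)] b' by auto
    have i: "i \<in> sub C \<Omega>" "img i = imp_set \<Omega> (img t) (img w)" using i0 sub_imp_iff[OF D(4) w(1)] by auto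
    have j: "j \<in> sub C \<Omega>" "img j = (\<lambda>k. img t k \<union> img i k)" using j0 sub_join_iff[OF D(4) i(1)] by auto
    show "v \<in> sub C Tm \<and> img v = forall_set \<Omega> Tm b (\<lambda>k. img t k \<union> imp_set \<Omega> (img t) (pull_set \<Omega> b (img z)) k)"
      using v0 sub_forall_iff[OF j(1) b D(2)] b' j(2) i(2) w(2) by simp
  next
    assume R: "v \<in> sub C Tm \<and> img v = forall_set \<Omega> Tm b (\<lambda>k. img t k \<union> imp_set \<Omega> (img t) (pull_set \<Omega> b (img z)) k)"
    obtain w where w: "w \<in> sub C \<Omega>" "img w = pull_set \<Omega> b (img z)"
      using sub_ex[OF D(3) closed_pull[OF b img_closed[OF z]]] by blast
    obtain i where i: "i \<in> sub C \<Omega>" "img i = imp_set \<Omega> (img t) (img w)" using sub_ex[OF D(3) closed_imp[OF D(3)]] by blast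
    obtain j where j: "j \<in> sub C \<Omega>" "img j = (\<lambda>k. img t k \<union> img i k)"
      using sub_ex[OF D(3) closed_Un[OF img_closed[OF D(4)] img_closed[OF i(1)]]] by blast
    have "sub_forall C b j v" using R sub_forall_iff[OF j(1) b D(2)] j(2) i(2) w(2) by simp
    moreover have "sub_pull C b z w" "sub_imp C \<Omega> t w i" "sub_join C \<Omega> t i j"
      using sub_pull_iff[OF z b D(3)] w sub_imp_iff[OF D(4) w(1)] i sub_join_iff[OF D(4) i(1)] j by auto
    moreover have "b \<in> hom C \<Omega> Tm" using b D(2,3) by (simp add: hom_full_iff)
    ultimately show "ibd_step C t z v"
      unfolding ibd_step_def full_simps \<Omega>_def[symmetric] Tm_def[symmetric] by blast
  qed
qed

lemma ibd_step_ex: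
  assumes t: "subobject_classifier C t" and z: "z \<in> sub C (Dom E t)"
  shows "\<exists>v. ibd_step C t z v"
proof -
  obtain b where b: "b \<in> hom E (Cod E t) (Dom E t)" using classifierD(6)[OF t] by blast
  show ?thesis using ibd_step_iff[OF t z b] sub_ex[OF classifierD(2)[OF t] closed_forall[OF b]] by blast
qed

text \<open>A simplex of dimension larger than \<open>N\<close> is excluded from \<open>v\<close> by the truth value given by the sieve
  of its proper faces.\<close>

lemma ibd_step_img:
  assumes t: "subobject_classifier C t" and z: "z \<in> sub C (Dom E t)"
    and iu: "\<And>k. img z k = {c \<in> Sel (Dom E t) k. k < N}" and st: "ibd_step C t z v"
  shows "v \<in> sub C (Dom E t) \<and> (\<forall>k. img v k = {c \<in> Sel (Dom E t) k. k < Suc N})"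
proof -
  define \<Omega> Tm where "\<Omega> = Cod E t" and "Tm = Dom E t"
  note D = classifierD[OF t, folded \<Omega>_def Tm_def]
  obtain b where b0: "b \<in> hom E (Cod E t) (Dom E t)" using classifierD(6)[OF t] by blast
  note b = b0[folded \<Omega>_def Tm_def]
  have v: "v \<in> sub C Tm"
    and iv: "img v = forall_set \<Omega> Tm b (\<lambda>k. img t k \<union> imp_set \<Omega> (img t) (pull_set \<Omega> b (img z)) k)"
    using st ibd_step_iff[OF t z b0] by (auto simp: \<Omega>_def Tm_def)
  have iu': "img z k = {c \<in> Sel Tm k. k < N}" for k using iu by (simp add: Tm_def)
  have OmO: "\<Omega> \<in> Ob E" and TO: "Tm \<in> Ob E" using D L0_Ob by auto
  \<comment> \<open>A truth value that is not true at a simplex of dimension at most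
    \<open>N\<close> can become true only at proper faces. Those have dimension below
    \<open>N\<close> and lie in the interpretation of the inner formula.\<close>
  have up: "c \<in> img v k" if c: "c \<in> Sel Tm k" and k: "k < Suc N" for k c
  proof -
    have "w \<in> img t j \<union> imp_set \<Omega> (img t) (pull_set \<Omega> b (img z)) j"
      if g: "g \<in> hom Delta j k" "inj_on (ev g) {..j}" and w: "w \<in> Sel \<Omega> j" for j g w
    proof (cases "w \<in> img t j")
      case False
      have "res \<Omega> f w \<in> pull_set \<Omega> b (img z) i"
        if f: "f \<in> hom Delta i j" "inj_on (ev f) {..i}" and ft: "res \<Omega> f w \<in> img t i" for i f
      proof -
        have ij: "i \<le> j" "j \<le> k" using inj_dim[OF f] inj_dim[OF g] by auto
        have "i \<noteq> j"
        proof
          assume "i = j"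
          then have "f = Idt Delta j" using inj_endo f by blast
          then show False using ft False res_id[OF OmO Sel_el[OF w]] \<open>i = j\<close> by simp
        qed
        then have "i < N" using ij k by simp
        moreover have "res \<Omega> f w \<in> Sel \<Omega> i" using Sel_res[OF OmO w f] .
        ultimately show ?thesis using Sel_eap[OF b] by (simp add: pull_set_def iu')
      qed
      then show ?thesis using w by (simp add: imp_set_def)
    qed simp
    then show ?thesis using c by (simp add: iv forall_set_def)
  qed
  have down: "k < Suc N" if c: "c \<in> img v k" for k c
  proof (rule ccontr)
    assume k: "\<not> k < Suc N"
    have cS: "c \<in> Sel Tm k" using img_Sel[OF v c] .
    define x where "x = lb Tm k c"
    have n: "nd k x" using cS by (simp add: Sel_def x_def)
    note ptx = pt[OF n]
    have aYO: "aY k x \<in> Ob E" using L0_Ob[OF ptx(1)] .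
    \<comment> \<open>The proper faces of the generic simplex; a map between nondegenerate simplices
      of equal dimension is an identity, so only dimensions are compared.\<close>
    define R where "R i = {s \<in> Sel (aY k x) i. i < k}" for i
    have "closed_in (aY k x) R"
      unfolding closed_in_def
    proof (intro conjI allI ballI impI)
      show "R i \<subseteq> Sel (aY k x) i" for i by (auto simp: R_def)
      fix i m f s assume f: "f \<in> hom Delta m i" "inj_on (ev f) {..m}" and "s \<in> R i"
      then show "res (aY k x) f s \<in> R m" using Sel_res[OF aYO _ f] inj_dim[OF f] by (auto simp: R_def)
    qed
    then obtain m where m: "m \<in> sub C (aY k x)" "img m = R" using sub_ex[OF ptx(1)] by blast
    obtain \<chi> where chi: "\<chi> \<in> hom E (aY k x) \<Omega>" "R = pull_set (aY k x) \<chi> (img t)" using D(5)[OF m(1)] m(2) by auto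
    define w where "w = eap \<chi> k (pt k x)"
    have w: "w \<in> Sel \<Omega> k" "lb \<Omega> k w = x"
      using Sel_eap[OF chi(1) ptx(2)] eap_lb[OF chi(1) Sel_el[OF ptx(2)]] ptx(3) by (auto simp: w_def)
    have "eap b k w \<in> Sel Tm k" "lb Tm k (eap b k w) = x"
      using Sel_eap[OF b w(1)] eap_lb[OF b Sel_el[OF w(1)]] w(2) by auto
    then have "eap b k w = c" using terminal_element[OF D(1) n] cS by (auto simp: x_def)
    moreover have "res Tm (Idt Delta k) c = c" using res_id[OF TO Sel_el[OF cS]] .
    ultimately have w2: "w \<in> img t k \<or> w \<in> imp_set \<Omega> (img t) (pull_set \<Omega> b (img z)) k"
      using c w(1) Delta_id_in[of k] inj_id[of k] unfolding iv forall_set_def by fastforce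
    have inR: "s \<in> R i \<longleftrightarrow> eap \<chi> i s \<in> img t i" if "s \<in> Sel (aY k x) i" for i s
      using that fun_cong[OF chi(2), of i] by (simp add: pull_set_def)
    have "w \<notin> img t k" using inR[OF ptx(2)] by (simp add: w_def R_def)
    then have wi: "w \<in> imp_set \<Omega> (img t) (pull_set \<Omega> b (img z)) k" using w2 by blast
    \<comment> \<open>The face omitting the last vertex. Here \<open>k\<close> is at least
      \<open>Suc N\<close>, so the face exists and has dimension at least \<open>N\<close>, outside
      the inner formula; yet the chosen truth value holds on it.\<close>
    define f where "f = mkD (k - 1) id k"
    have f: "f \<in> hom Delta (k - 1) k" unfolding f_def by (rule mkD_in) (auto simp: mono_on_def)
    have fi: "inj_on (ev f) {..k - 1}" by (simp add: f_def inj_on_def)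
    have s: "res (aY k x) f (pt k x) \<in> Sel (aY k x) (k - 1)" using Sel_res[OF aYO ptx(2) f fi] .
    then have "res (aY k x) f (pt k x) \<in> R (k - 1)" using k by (simp add: R_def)
    then have "res \<Omega> f w \<in> img t (k - 1)"
      using inR[OF s] eap_res[OF chi(1) f Sel_el[OF ptx(2)]] by (simp add: w_def)
    then have "res \<Omega> f w \<in> pull_set \<Omega> b (img z) (k - 1)" using wi f fi by (simp add: imp_set_def)
    then have "k - 1 < N" by (simp add: pull_set_def iu')
    then show False using k by simp
  qed
  have "img v k = {c \<in> Sel Tm k. k < Suc N}" for k using up down img_Sel[OF v] by blast
  then show ?thesis using v by (simp add: Tm_def)
qed

text \<open>Falsity contains the simplices of dimension below \<open>0\<close>, and each step raises
  the strict bound by one; index \<open>0\<close> already includes one step, hence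
  \<open>Suc n\<close>.\<close>

lemma ibd_img:
  assumes t: "subobject_classifier C t"
  shows "ibd C t n v \<Longrightarrow> v \<in> sub C (Dom E t) \<and> (\<forall>k. img v k = {c \<in> Sel (Dom E t) k. k < Suc n})"
proof (induction n arbitrary: v)
  case 0
  then obtain z where z: "sub_bot C (Dom E t) z" "ibd_step C t z v" by auto
  then have "z \<in> sub C (Dom E t)" "img z = (\<lambda>k. {})" using sub_bot_iff[OF classifierD(2)[OF t]] by auto
  then show ?case using ibd_step_img[OF t, of z 0 v] z(2) by simp
next
  case (Suc n)
  then obtain z where z: "ibd C t n z" "ibd_step C t z v" by auto
  then show ?case using ibd_step_img[OF t, of z "Suc n" v] Suc.IH[OF z(1)] by simp
qed

text \<open>\<open>ibd\<close> is a relation, so that an interpretation exists has to be shown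
  before \<open>IBD_holds\<close> can be derived from the dimension bound.\<close>

lemma ibd_ex:
  assumes t: "subobject_classifier C t"
  shows "\<exists>v. ibd C t n v"
proof (induction n)
  case 0
  obtain z where z: "z \<in> sub C (Dom E t)" "img z = (\<lambda>k. {})" using sub_ex[OF classifierD(2)[OF t] closed_empty] by blast
  then have "sub_bot C (Dom E t) z" using sub_bot_iff[OF classifierD(2)[OF t]] by blast
  then show ?case using ibd_step_ex[OF t z(1)] by auto
next
  case (Suc n)
  then show ?case using ibd_step_ex[OF t] ibd_img[OF t] by fastforce
qed

lemma sub_iso_iff:
  assumes v: "v \<in> sub C A"
  shows "is_iso C v \<longleftrightarrow> (\<forall>k. img v k = Sel A k)"
proof
  define V where "V = Dom E v"
  note vh = sub_hom[OF v, folded V_def] and V = sub_dom[OF v, folded V_def] and A = sub_cod[OF v]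
  have vC: "v \<in> Arr C" "Dom C v = V" "Cod C v = A" using vh V A by (auto simp: hom_def full_subcat_def)
  { assume "is_iso C v"
    then obtain g where "g \<in> hom C A V" "v \<cdot>\<^bsub>C\<^esub> g = Idt C A" unfolding is_iso_def using vC by auto
    then have g: "g \<in> hom E A V" "v \<cdot>\<^bsub>E\<^esub> g = Idt E A" by (auto simp: hom_full_iff)
    have "c \<in> img v k" if c: "c \<in> Sel A k" for k c
    proof -
      have "c = eap v k (eap g k c)" using eap_comp[OF vh g(1) Sel_el[OF c]] g(2) eap_id[OF Sel_el[OF c]] by simp
      then show ?thesis using Sel_eap[OF g(1) c] unfolding img_def V_def[symmetric] by blast
    qed
    then show "\<forall>k. img v k = Sel A k" using img_Sel[OF v] by blast }
  assume im: "\<forall>k. img v k = Sel A k"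
  have AO: "A \<in> Ob E" and VO: "V \<in> Ob E" using A V L0_Ob by auto
  have "eap (Idt E A) k c \<in> img v k" if "c \<in> Sel A k" for k c using im that eap_id[OF Sel_el[OF that]] by simp
  from sub_factor[OF v E.id_in[OF AO] this] obtain g where g: "g \<in> hom E A V" "v \<cdot>\<^bsub>E\<^esub> g = Idt E A"
    unfolding V_def by blast
  have "g \<cdot>\<^bsub>E\<^esub> v = Idt E V"
  proof (rule L0_eq[OF V E.comp_in[OF g(1) vh] E.id_in[OF VO]])
    fix k c assume c: "c \<in> Sel V k"
    have "v \<cdot>\<^bsub>E\<^esub> (g \<cdot>\<^bsub>E\<^esub> v) = v" using E.assoc[OF vh g(1) vh] g(2) E.idl[OF vh] by simp
    then have "eap v k (eap (g \<cdot>\<^bsub>E\<^esub> v) k c) = eap v k c"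
      using eap_comp[OF vh E.comp_in[OF g(1) vh] Sel_el[OF c]] by simp
    then have "eap (g \<cdot>\<^bsub>E\<^esub> v) k c = c"
      using sub_inj[OF v, folded V_def] Sel_eap[OF E.comp_in[OF g(1) vh] c] c by blast
    then show "eap (g \<cdot>\<^bsub>E\<^esub> v) k c = eap (Idt E V) k c" using eap_id[OF Sel_el[OF c]] by simp
  qed
  moreover have "g \<in> hom C A V" using g(1) A V by (simp add: hom_full_iff)
  ultimately show "is_iso C v" unfolding is_iso_def using vC g(2) by auto
qed

text \<open>Every classifier and every interpretation lead to the same condition, so the existential
  quantifiers in \<open>IBD_holds\<close> leave no ambiguity.\<close>

lemma IBD_holds_iff: "IBD_holds C n \<longleftrightarrow> (\<forall>k x. nd k x \<longrightarrow> k \<le> n)"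
proof -
  have key: "is_iso C v \<longleftrightarrow> (\<forall>k x. nd k x \<longrightarrow> k \<le> n)" if t: "subobject_classifier C t" and v: "ibd C t n v" for t v
  proof -
    note D = classifierD[OF t]
    have "is_iso C v \<longleftrightarrow> (\<forall>k. \<forall>c \<in> Sel (Dom E t) k. k < Suc n)"
      using sub_iso_iff[of v "Dom E t"] ibd_img[OF t v] by auto
    also have "\<dots> \<longleftrightarrow> (\<forall>k x. nd k x \<longrightarrow> k \<le> n)"
    proof
      assume *: "\<forall>k. \<forall>c \<in> Sel (Dom E t) k. k < Suc n"
      show "\<forall>k x. nd k x \<longrightarrow> k \<le> n"
      proof (intro allI impI)
        fix k x assume "nd k x"
        then obtain c where "c \<in> Sel (Dom E t) k" using terminal_element[OF D(1)] by blast
        then show "k \<le> n" using * by auto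
      qed
    qed (auto simp: Sel_def)
    finally show ?thesis .
  qed
  show ?thesis unfolding IBD_holds_def using key classifier_ex ibd_ex by blast
qed

end

theorem corollary8p5:
  fixes r :: "'u rel" and X :: "'u simp_set" and n :: nat
  assumes "universe r"
    and "X \<in> Ob (simp_sets r)"
    and "strongly_regular X"
  shows "dim_le r X n \<longleftrightarrow> IBD_holds (E_topos r X) n"
proof -
  interpret strongly_regular_over r X using assms by unfold_locales
  have E: "E_topos r X = full_subcat E L0"
    using level_e_L0 by (simp add: E_topos_def E_def const_E_def)
  obtain l \<eta> u where lv: "essential_level r X L0 (inverse_image E L0) l \<eta> u" using level_essential_level(1)[OF L0_level] by blast
  interpret e_acute_topos r X "inverse_image E L0" l \<eta> u
    by (intro e_acute_topos.intro strongly_regular_over_axioms lv)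
  show ?thesis using dim_le_iff IBD_holds_iff E by simp
qed

end
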